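(* The following statements are equivalent: (1) $(\Sigma_{P_0})$ is exactly controllable; (2) $(\Sigma_{P_0})$ is approximately controllable; (3) $\operatorname{rank}\begin{bmatrix}B&AB&A^2B&\cdots&A^{n-1}B\end{bmatrix}=n$; (4) $\operatorname{rank}\begin{bmatrix}\lambda-A&B\end{bmatrix}=n$ for every $\lambda\in\mathbb{C}$; (5) $\operatorname{rank}\begin{bmatrix}\lambda-A&B\end{bmatrix}=n$ for every $\lambda\in\sigma(A)$. Moreover, the following statements are equivalent: (1') $(\Sigma_{P_0})$ is exactly observable; (2') $(\Sigma_{P_0})$ is approximately observable; (3') $\operatorname{rank}\begin{bmatrix}C\\ CA\\ \vdots\\ CA^{n-1}\end{bmatrix}=n$; (4') $\operatorname{rank}\begin{bmatrix}\lambda-A\\ C\end{bmatrix}=n$ for every $\lambda\in\mathbb{C}$; (5') $\operatorname{rank}\begin{bmatrix}\lambda-A\\ C\end{bmatrix}=n$ for every $\lambda\in\sigma(A)$.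
   Context: Setting. Let $\mathbb{K}=\mathbb{R}$ or $\mathbb{K}=\mathbb{C}$, let $n,m,k$ be positive integers with $m\le n$, let $\lambda_0,\lambda_0^{-1}\in L^\infty([0,1];(0,\infty))$, $P_0\in L^\infty([0,1];\mathbb{K}^{n\times n})$, $K,L\in\mathbb{K}^{n\times n}$ with $K$ invertible, and $K_y,L_y\in\mathbb{K}^{k\times n}$. Put $E=\begin{bmatrix}0\\ I\end{bmatrix}\in\mathbb{K}^{n\times m}$ with $I$ the $m\times m$ identity. Let $P:[0,1]\to\mathbb{K}^{n\times n}$ be the absolutely continuous (Carathéodory) solution of $P'(\xi)=P_0(\xi)P(\xi)$, $P(0)=I$, and define $$A=-K^{-1}LP(1),\quad B=-K^{-1}E,\quad C=(K_yK^{-1}L-L_y)P(1),\quad D=K_yK^{-1}E.$$ $\sigma(A)$ is the set of (complex) eigenvalues of $A$; ranks involving complex $\lambda$ are ranks of complex matrices. System. $(\Sigma_{P_0})$ is the boundary controlled and observed system $$\frac{\partial x}{\partial t}=-\frac{\partial}{\partial\xi}(\lambda_0x)+P_0\lambda_0x,\quad Eu(t)=-K\lambda_0(0)x(0,t)-L\lambda_0(1)x(1,t),\quad y(t)=-K_y\lambda_0(0)x(0,t)-L_y\lambda_0(1)x(1,t),$$ with $x(\cdot,0)=x_0\in L^2([0,1];\mathbb{K}^n)$, input $u(t)\in\mathbb{K}^m$, output $y(t)\in\mathbb{K}^k$. Since $K$ is invertible the system is well-posed: for every $x_0\in L^2([0,1];\mathbb{K}^n)$ and $u\in L^2_{\mathrm{loc}}([0,\infty);\mathbb{K}^m)$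 there is a unique (mild) solution $x\in C([0,\infty);L^2([0,1];\mathbb{K}^n))$ and output $y\in L^2_{\mathrm{loc}}([0,\infty);\mathbb{K}^k)$, depending continuously on $x_0$ and $u$ (the continuous extension of the map from smooth compatible data to classical solutions). Controllability. $(\Sigma_{P_0})$ is exactly controllable if there is $t\in[0,\infty)$ such that for all $x_0,x_1\in L^2([0,1];\mathbb{K}^n)$ there is $u\in L^2([0,t];\mathbb{K}^m)$ with $x(\cdot,t)=x_1$; it is approximately controllable if there is $t\in[0,\infty)$ such that for all $x_0,x_1\in L^2([0,1];\mathbb{K}^n)$ and every $\varepsilon>0$ there is $u\in L^2([0,t];\mathbb{K}^m)$ with $\|x(\cdot,t)-x_1\|_{L^2}<\varepsilon$. Observability. $(\Sigma_{P_0})$ is approximately observable if there is $t\in[0,\infty)$ such that the initial condition $x_0$ can be constructed from the output $y$ on $[0,t]$, i.e. the map $x_0\mapsto y|_{[0,t]}$ with $u=0$ is injective; it is exactly observable if there is $t\in[0,\infty)$ such that $x_0$ can be constructed continuously from $y$ on $[0,t]$, i.e. there is $c>0$ with $\int_0^t\|y(s)\|^2ds\ge c\|x_0\|_{L^2}^2$ for all $x_0\in L^2([0,1];\mathbb{K}^n)$ when $u=0$. *)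

theory Defs
  imports "HOL-Analysis.Analysis"
begin

section \<open>The scalar field\<close>

text \<open>
  A type of this class is a copy of the reals or of the complex numbers (see
  \<open>range_to_complex\<close> below); the map \<open>to_complex\<close> is the inclusion into the complex numbers.
\<close>

class real_or_complex = real_normed_field + euclidean_space +
  fixes to_complex :: "'a \<Rightarrow> complex"
  assumes to_complex_add: "to_complex (a + b) = to_complex a + to_complex b"
    and to_complex_mult: "to_complex (a * b) = to_complex a * to_complex b"
    and to_complex_one: "to_complex 1 = 1"
    and to_complex_scaleR: "to_complex (r *\<^sub>R a) = r *\<^sub>R to_complex a"
    and norm_to_complex: "norm (to_complex a) = norm a"

instantiation real :: real_or_complex
begin
definition to_complex_real :: "real \<Rightarrow> complex" where "to_complex_real = complex_of_real"
instance by standard (simp_all add: to_complex_real_def scaleR_conv_of_real)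
end

instantiation complex :: real_or_complex
begin
definition to_complex_complex :: "complex \<Rightarrow> complex" where "to_complex_complex = id"
instance by standard (simp_all add: to_complex_complex_def)
end

lemma to_complex_of_real: "to_complex (of_real r) = complex_of_real r"
  by (simp add: of_real_def to_complex_scaleR to_complex_one)

lemma range_to_complex:
  "range (to_complex :: 'k::real_or_complex \<Rightarrow> complex) = \<real> \<or>
   range (to_complex :: 'k \<Rightarrow> complex) = UNIV"
proof (cases "range (to_complex :: 'k \<Rightarrow> complex) \<subseteq> \<real>")
  case True
  have "complex_of_real r \<in> range (to_complex :: 'k \<Rightarrow> complex)" for r
    using to_complex_of_real[where 'a='k, of r] by (metis rangeI)
  then show ?thesis
    using True by (auto simp: Reals_def)
next
  case False
  then obtain a :: 'k where a: "to_complex a \<notin> \<real>" by auto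
  define w where "w = to_complex a"
  have im: "Im w \<noteq> 0" using a by (simp add: w_def complex_is_Real_iff)
  have "z \<in> range (to_complex :: 'k \<Rightarrow> complex)" for z
  proof -
    define s where "s = Im z / Im w"
    define r where "r = Re z - s * Re w"
    have "to_complex (of_real r + of_real s * a) = of_real r + of_real s * w"
      by (simp add: to_complex_add to_complex_mult to_complex_of_real w_def)
    also have "\<dots> = z"
      using im by (simp add: complex_eq_iff r_def s_def)
    finally show ?thesis by (metis rangeI)
  qed
  then show ?thesis by auto
qed


section \<open>Matrices\<close>

text \<open>
  Row and column indices range over finite linearly ordered types. The order identifies the
  index type with \<open>0, \<dots>, N - 1\<close>.
\<close>

definition index_pos :: "'i::{finite,linorder} \<Rightarrow> nat" where
  "index_pos i = card {..<i}"

text \<open>The block column with a zero block on top of the identity of the size of \<open>'m\<close>.\<close>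

definition zero_over_id :: "'k::zero_neq_one ^ 'm::{finite,linorder} ^ 'n::{finite,linorder}" where
  "zero_over_id =
     (\<chi> i j. if index_pos i + CARD('m) = CARD('n) + index_pos j then 1 else 0)"

definition beside :: "'k ^ 'a ^ 'n \<Rightarrow> 'k ^ 'b ^ 'n \<Rightarrow> 'k ^ ('a + 'b) ^ 'n" where
  "beside M N = (\<chi> i j. case j of Inl a \<Rightarrow> M $ i $ a | Inr b \<Rightarrow> N $ i $ b)"

definition stacked :: "'k ^ 'n ^ 'a \<Rightarrow> 'k ^ 'n ^ 'b \<Rightarrow> 'k ^ 'n ^ ('a + 'b)" where
  "stacked M N = (\<chi> i. case i of Inl a \<Rightarrow> M $ a | Inr b \<Rightarrow> N $ b)"

primrec matrix_power :: "'k::semiring_1 ^ 'n ^ 'n \<Rightarrow> nat \<Rightarrow> 'k ^ 'n ^ 'n" where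
  "matrix_power A 0 = mat 1"
| "matrix_power A (Suc i) = A ** matrix_power A i"

text \<open>
  The columns (rows) of the two block matrices are indexed by pairs consisting of the block
  number, which is encoded by an element of \<open>'n\<close>, and the position within the block.
\<close>

definition controllability_matrix ::
  "'k::semiring_1 ^ 'n::{finite,linorder} ^ 'n::{finite,linorder} \<Rightarrow>
   'k ^ 'm::finite ^ 'n::{finite,linorder} \<Rightarrow> 'k ^ ('n::{finite,linorder} \<times> 'm::finite) ^ 'n::{finite,linorder}" where
  "controllability_matrix A B =
     (\<chi> i c. (matrix_power A (index_pos (fst c)) ** B) $ i $ snd c)"

definition observability_matrix ::
  "'k::semiring_1 ^ 'n::{finite,linorder} ^ 'n::{finite,linorder} \<Rightarrow>
   'k ^ 'n::{finite,linorder} ^ 'p::finite \<Rightarrow> 'k ^ 'n::{finite,linorder} ^ ('n::{finite,linorder} \<times> 'p::finite)" where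
  "observability_matrix A C =
     (\<chi> r. (C ** matrix_power A (index_pos (fst r))) $ snd r)"

abbreviation complexify :: "'k::real_or_complex ^ 'a ^ 'b \<Rightarrow> complex ^ 'a ^ 'b" where
  "complexify \<equiv> map_matrix to_complex"

definition eigenvalues :: "complex ^ 'n ^ 'n \<Rightarrow> complex set" where
  "eigenvalues A = {\<mu>. \<exists>v. v \<noteq> 0 \<and> A *v v = \<mu> *s v}"


section \<open>Function spaces\<close>

text \<open>
  Elements of \<open>L\<^sup>2\<close> and \<open>L\<^sup>\<infinity>\<close> are represented by functions; equality of such elements is
  equality almost everywhere.
\<close>

definition L2_on :: "real set \<Rightarrow> (real \<Rightarrow> 'v::{real_normed_vector}) \<Rightarrow> bool" where
  "L2_on S f \<longleftrightarrow> f \<in> borel_measurable (lebesgue_on S) \<and>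
     integrable (lebesgue_on S) (\<lambda>s. (norm (f s))\<^sup>2)"

definition L2_norm_on :: "real set \<Rightarrow> (real \<Rightarrow> 'v::{real_normed_vector}) \<Rightarrow> real" where
  "L2_norm_on S f = sqrt (LINT s|lebesgue_on S. (norm (f s))\<^sup>2)"

definition L2_loc :: "(real \<Rightarrow> 'v::{real_normed_vector}) \<Rightarrow> bool" where
  "L2_loc f \<longleftrightarrow> (\<forall>T\<ge>0. L2_on {0..T} f)"

definition Linf_on :: "real set \<Rightarrow> (real \<Rightarrow> 'v::{real_normed_vector}) \<Rightarrow> bool" where
  "Linf_on S f \<longleftrightarrow> f \<in> borel_measurable (lebesgue_on S) \<and>
     (\<exists>M. AE s in lebesgue_on S. norm (f s) \<le> M)"

text \<open>\<open>f\<close> is absolutely continuous on \<open>[0,1]\<close> with derivative \<open>f'\<close> almost everywhere.\<close>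

definition AC_deriv :: "(real \<Rightarrow> 'v::euclidean_space) \<Rightarrow> (real \<Rightarrow> 'v) \<Rightarrow> bool" where
  "AC_deriv f f' \<longleftrightarrow> f' absolutely_integrable_on {0..1} \<and>
     (\<forall>\<xi>\<in>{0..1}. f \<xi> = f 0 + integral {0..\<xi>} f')"

definition smooth_on_nonneg :: "(real \<Rightarrow> 'v::real_normed_vector) \<Rightarrow> bool" where
  "smooth_on_nonneg u \<longleftrightarrow> (\<exists>D. D 0 = u \<and>
     (\<forall>i. \<forall>t\<ge>0. (D i has_vector_derivative D (Suc i) t) (at t within {0..})))"

text \<open>
  \<open>x\<close> lies in \<open>C\<^sup>1([0,\<infinity>); L\<^sup>2([0,1]))\<close> with derivative \<open>x'\<close>. The first argument of \<open>x\<close> is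
  the time, the second one the spatial variable.
\<close>

definition C1_L2 ::
  "(real \<Rightarrow> real \<Rightarrow> 'v::real_normed_vector) \<Rightarrow> (real \<Rightarrow> real \<Rightarrow> 'v) \<Rightarrow> bool" where
  "C1_L2 x x' \<longleftrightarrow> (\<forall>t\<ge>0. L2_on {0..1} (x t) \<and> L2_on {0..1} (x' t) \<and>
     ((\<lambda>s. L2_norm_on {0..1} (\<lambda>\<xi>. (x s \<xi> - x t \<xi>) /\<^sub>R (s - t) - x' t \<xi>)) \<longlongrightarrow> 0)
       (at t within {0..}) \<and>
     ((\<lambda>s. L2_norm_on {0..1} (\<lambda>\<xi>. x' s \<xi> - x' t \<xi>)) \<longlongrightarrow> 0) (at t within {0..}))"


section \<open>The boundary controlled and observed system\<close>

definition caratheodory_solution ::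
  "(real \<Rightarrow> 'k::real_or_complex ^ 'n ^ 'n) \<Rightarrow> (real \<Rightarrow> 'k ^ 'n ^ 'n) \<Rightarrow> bool" where
  "caratheodory_solution P0 P \<longleftrightarrow> P 0 = mat 1 \<and> AC_deriv P (\<lambda>\<xi>. P0 \<xi> ** P \<xi>)"

text \<open>
  Classical solutions for smooth inputs. For each time \<open>t\<close>, the function \<open>z t\<close> is the absolutely
  continuous representative of \<open>\<lambda>\<^sub>0 x(\<cdot>,t) \<in> H\<^sup>1\<close>, through which the boundary values are
  defined, and \<open>z'\<close> is its spatial derivative. Compatibility of the initial state with \<open>u 0\<close> is
  the boundary condition at \<open>t = 0\<close>.
\<close>

definition classical_solution ::
  "(real \<Rightarrow> real) \<Rightarrow> (real \<Rightarrow> 'k::real_or_complex ^ 'n ^ 'n) \<Rightarrow> 'k ^ 'm ^ 'n \<Rightarrow>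
   'k ^ 'n ^ 'n \<Rightarrow> 'k ^ 'n ^ 'n \<Rightarrow> 'k ^ 'n ^ 'p \<Rightarrow> 'k ^ 'n ^ 'p \<Rightarrow>
   (real \<Rightarrow> 'k ^ 'm) \<Rightarrow> (real \<Rightarrow> real \<Rightarrow> 'k ^ 'n) \<Rightarrow> (real \<Rightarrow> 'k ^ 'p) \<Rightarrow> bool" where
  "classical_solution l0 P0 E K L Ky Ly u x y \<longleftrightarrow>
     smooth_on_nonneg u \<and>
     (\<exists>x' z. C1_L2 x x' \<and>
       (\<forall>t\<ge>0.
         (AE \<xi> in lebesgue_on {0..1}. z t \<xi> = l0 \<xi> *\<^sub>R x t \<xi>) \<and>
         (\<exists>z'. AC_deriv (z t) z' \<and> L2_on {0..1} z' \<and>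
            (AE \<xi> in lebesgue_on {0..1}. x' t \<xi> = - z' \<xi> + P0 \<xi> *v z t \<xi>)) \<and>
         E *v u t = - (K *v z t 0) - L *v z t 1 \<and>
         y t = - (Ky *v z t 0) - Ly *v z t 1))"

text \<open>
  The graph of the continuous extension of the map from the data \<open>(x0, u)\<close> of classical solutions
  to \<open>(x, y)\<close>, with respect to convergence of \<open>x0\<close> in \<open>L\<^sup>2([0,1])\<close>, of \<open>u\<close> and \<open>y\<close> in
  \<open>L\<^sup>2\<^sub>l\<^sub>o\<^sub>c([0,\<infinity>))\<close>, and of \<open>x\<close> in \<open>C([0,\<infinity>); L\<^sup>2([0,1]))\<close> (uniformly on bounded intervals).
\<close>

definition mild_solution ::
  "(real \<Rightarrow> real) \<Rightarrow> (real \<Rightarrow> 'k::real_or_complex ^ 'n ^ 'n) \<Rightarrow> 'k ^ 'm ^ 'n \<Rightarrow>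
   'k ^ 'n ^ 'n \<Rightarrow> 'k ^ 'n ^ 'n \<Rightarrow> 'k ^ 'n ^ 'p \<Rightarrow> 'k ^ 'n ^ 'p \<Rightarrow>
   (real \<Rightarrow> 'k ^ 'n) \<Rightarrow> (real \<Rightarrow> 'k ^ 'm) \<Rightarrow>
   (real \<Rightarrow> real \<Rightarrow> 'k ^ 'n) \<Rightarrow> (real \<Rightarrow> 'k ^ 'p) \<Rightarrow> bool" where
  "mild_solution l0 P0 E K L Ky Ly x0 u x y \<longleftrightarrow>
     L2_on {0..1} x0 \<and> L2_loc u \<and> (\<forall>t\<ge>0. L2_on {0..1} (x t)) \<and> L2_loc y \<and>
     (\<exists>uu xx yy.
       (\<forall>j::nat. classical_solution l0 P0 E K L Ky Ly (uu j) (xx j) (yy j)) \<and>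
       (\<lambda>j. L2_norm_on {0..1} (\<lambda>\<xi>. xx j 0 \<xi> - x0 \<xi>)) \<longlonglongrightarrow> 0 \<and>
       (\<forall>T\<ge>0.
         (\<lambda>j. L2_norm_on {0..T} (\<lambda>s. uu j s - u s)) \<longlonglongrightarrow> 0 \<and>
         uniform_limit {0..T} (\<lambda>j t. L2_norm_on {0..1} (\<lambda>\<xi>. xx j t \<xi> - x t \<xi>)) (\<lambda>_. 0)
           sequentially \<and>
         (\<lambda>j. L2_norm_on {0..T} (\<lambda>s. yy j s - y s)) \<longlonglongrightarrow> 0))"

text \<open>
  An input on \<open>[0,t]\<close> is extended by zero; the state at time \<open>t\<close> does not depend on the extension.
\<close>

definition zero_ext :: "real \<Rightarrow> (real \<Rightarrow> 'v::zero) \<Rightarrow> real \<Rightarrow> 'v" where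
  "zero_ext t u = (\<lambda>s. if s \<in> {0..t} then u s else 0)"

definition exactly_controllable ::
  "(real \<Rightarrow> real) \<Rightarrow> (real \<Rightarrow> 'k::real_or_complex ^ 'n ^ 'n) \<Rightarrow> 'k ^ 'm ^ 'n \<Rightarrow>
   'k ^ 'n ^ 'n \<Rightarrow> 'k ^ 'n ^ 'n \<Rightarrow> 'k ^ 'n ^ 'p \<Rightarrow> 'k ^ 'n ^ 'p \<Rightarrow> bool" where
  "exactly_controllable l0 P0 E K L Ky Ly \<longleftrightarrow>
     (\<exists>t\<ge>0. \<forall>x0 x1. L2_on {0..1} x0 \<longrightarrow> L2_on {0..1} x1 \<longrightarrow>
       (\<exists>u. L2_on {0..t} u \<and>
         (\<exists>x y. mild_solution l0 P0 E K L Ky Ly x0 (zero_ext t u) x y \<and>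
            (AE \<xi> in lebesgue_on {0..1}. x t \<xi> = x1 \<xi>))))"

definition approximately_controllable ::
  "(real \<Rightarrow> real) \<Rightarrow> (real \<Rightarrow> 'k::real_or_complex ^ 'n ^ 'n) \<Rightarrow> 'k ^ 'm ^ 'n \<Rightarrow>
   'k ^ 'n ^ 'n \<Rightarrow> 'k ^ 'n ^ 'n \<Rightarrow> 'k ^ 'n ^ 'p \<Rightarrow> 'k ^ 'n ^ 'p \<Rightarrow> bool" where
  "approximately_controllable l0 P0 E K L Ky Ly \<longleftrightarrow>
     (\<exists>t\<ge>0. \<forall>x0 x1. L2_on {0..1} x0 \<longrightarrow> L2_on {0..1} x1 \<longrightarrow> (\<forall>\<epsilon>>0.
       (\<exists>u. L2_on {0..t} u \<and>
         (\<exists>x y. mild_solution l0 P0 E K L Ky Ly x0 (zero_ext t u) x y \<and>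
            L2_norm_on {0..1} (\<lambda>\<xi>. x t \<xi> - x1 \<xi>) < \<epsilon>))))"

definition exactly_observable ::
  "(real \<Rightarrow> real) \<Rightarrow> (real \<Rightarrow> 'k::real_or_complex ^ 'n ^ 'n) \<Rightarrow> 'k ^ 'm ^ 'n \<Rightarrow>
   'k ^ 'n ^ 'n \<Rightarrow> 'k ^ 'n ^ 'n \<Rightarrow> 'k ^ 'n ^ 'p \<Rightarrow> 'k ^ 'n ^ 'p \<Rightarrow> bool" where
  "exactly_observable l0 P0 E K L Ky Ly \<longleftrightarrow>
     (\<exists>t\<ge>0. \<exists>c>0. \<forall>x0 x y. mild_solution l0 P0 E K L Ky Ly x0 (\<lambda>_. 0) x y \<longrightarrow>
       (LINT s|lebesgue_on {0..t}. (norm (y s))\<^sup>2) \<ge> c * (L2_norm_on {0..1} x0)\<^sup>2)"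

definition approximately_observable ::
  "(real \<Rightarrow> real) \<Rightarrow> (real \<Rightarrow> 'k::real_or_complex ^ 'n ^ 'n) \<Rightarrow> 'k ^ 'm ^ 'n \<Rightarrow>
   'k ^ 'n ^ 'n \<Rightarrow> 'k ^ 'n ^ 'n \<Rightarrow> 'k ^ 'n ^ 'p \<Rightarrow> 'k ^ 'n ^ 'p \<Rightarrow> bool" where
  "approximately_observable l0 P0 E K L Ky Ly \<longleftrightarrow>
     (\<exists>t\<ge>0. \<forall>x0 x y x0' x' y'.
       mild_solution l0 P0 E K L Ky Ly x0 (\<lambda>_. 0) x y \<longrightarrow>
       mild_solution l0 P0 E K L Ky Ly x0' (\<lambda>_. 0) x' y' \<longrightarrow>
       (AE s in lebesgue_on {0..t}. y s = y' s) \<longrightarrow>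
       (AE \<xi> in lebesgue_on {0..1}. x0 \<xi> = x0' \<xi>))"

end

theory Submission
  imports Defs "HOL-Computational_Algebra.Fundamental_Theorem_Algebra"
begin

text \<open>
  Put \<open>w(\<xi>,t) = P(\<xi>)\<^sup>-\<^sup>1 \<lambda>\<^sub>0(\<xi>) x(\<xi>,t)\<close>. This removes \<open>P0\<close>: the quantity \<open>w\<close> satisfies
  \<open>\<partial>w/\<partial>t = - \<lambda>\<^sub>0 \<partial>w/\<partial>\<xi>\<close>, so its values travel unchanged from \<open>\<xi> = 0\<close> to \<open>\<xi> = 1\<close>, and
  \<open>w(\<xi>,t) = g(t - \<tau>(\<xi>))\<close> with the travel time \<open>\<tau>(\<xi>) = \<integral>\<^sub>0\<^sup>\<xi> 1/\<lambda>\<^sub>0\<close> and the signal \<open>g\<close> entering at the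
  left end. With the period \<open>p = \<tau>(1)\<close>, the boundary condition and the output become

    \<open>g(t) = A g(t - p) + B u(t)\<close>  and  \<open>y(t) = C g(t - p) + D u(t)\<close>.

  So the system is a family of uncoupled copies, one for each phase in \<open>(0,p)\<close>, of the
  discrete-time system \<open>(A,B,C,D)\<close>, and it is controllable or observable iff that system is.
  The rank conditions are the tests of Kalman and Hautus for the latter
  (\<open>krylov_stabilises\<close>, \<open>Hautus_observability\<close> and its transposed version).

  Two tools connect this picture with mild solutions. The first one produces solutions:
  if input and signal in the \<open>k\<close>-th period are fixed linear images of data that are a
  function of the phase, then smooth data that are flat at the ends of the period give classical
  solutions, and as such data are dense in \<open>L\<^sup>2\<close>, all square integrable data give mild solutions
  (\<open>flat_jets_dense\<close>, \<open>mild_solution_stair\<close>). The second one constrains an arbitrary solution: tested with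
  a function travelling along the characteristics, a classical solution changes only by what passes the two
  ends (\<open>classical_solution_weak\<close>), and such an identity is stable under the limits
  that define mild solutions.

  Controllability. If the ranges of the \<open>A\<^sup>k B\<close> span the space, then inputs for the first \<open>N\<close> periods
  that are linear in the initial and the final state steer one into the other
  (\<open>exactly_controllable_if\<close>). If they do not, then some \<open>v \<noteq> 0\<close> is orthogonal to them, and running the
  adjoint loop backwards from \<open>v\<close> yields a test function that never sees the input, so that no
  reachable state is close to the state \<open>P v\<close> (\<open>approximately_controllable_imp\<close>).

  Observability. A vector \<open>v \<noteq> 0\<close> in the kernel of all \<open>C A\<^sup>k\<close> gives a wave in the direction of \<open>v\<close> whose
  output is zero (\<open>unobservable_solutions\<close>). If there is none, then every vector is a sum of images of
  the adjoints of the \<open>C A\<^sup>k\<close>; the corresponding test function expresses the inner products of the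
  initial state with arbitrary profiles by the output, and choosing a profile close to the
  initial state bounds the latter by the output (\<open>observability_estimate\<close>).
\<close>

section \<open>Rank tests for controllability and observability of matrix pairs\<close>

lemma full_column_rank_iff_left_inverse:
  fixes M :: "'k::field ^ 'n ^ 'r"
  shows "rank M = CARD('n) \<longleftrightarrow> (\<exists>N. N ** M = mat 1)"
  by (metis row_rank_def_gen matrix_left_invertible_span_rows_gen vec.dim_eq_full vec.span_UNIV vec_dim_card)

text \<open>
  One-sided inverses are the form in which full rank survives an extension of the scalars and can
  be used in real inner products. Full row rank means that the rows, as a family indexed by
  \<open>'n\<close>, are independent, so repeated rows have to be excluded separately.
\<close>

lemma full_row_rank_iff_right_inverse:
  fixes M :: "'k::field ^ 'c ^ 'n"
  shows "rank M = CARD('n) \<longleftrightarrow> (\<exists>N. M ** N = mat 1)"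
proof -
  have rows: "rows M = range (\<lambda>i. row i M)"
    by (auto simp: rows_def)
  have "rank M = CARD('n) \<longleftrightarrow> inj (\<lambda>i. row i M) \<and> vec.independent (rows M)"
  proof
    assume r: "rank M = CARD('n)"
    have "vec.dim (rows M) \<le> card (rows M)"
      by (rule vec.dim_le_card') (simp add: rows)
    moreover have "card (rows M) \<le> CARD('n)"
      unfolding rows by (rule card_image_le) simp
    ultimately have c: "card (rows M) = CARD('n)" "card (rows M) = vec.dim (rows M)"
      using r by (auto simp: row_rank_def_gen)
    have "inj (\<lambda>i. row i M)"
      using c(1) unfolding rows by (simp add: eq_card_imp_inj_on)
    moreover have "vec.independent (rows M)"
      using c(2) by (intro vec.card_le_dim_spanning[where V="vec.span (rows M)"])
        (auto simp: rows vec.span_superset)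
    ultimately show "inj (\<lambda>i. row i M) \<and> vec.independent (rows M)" by simp
  next
    assume "inj (\<lambda>i. row i M) \<and> vec.independent (rows M)"
    then show "rank M = CARD('n)"
      by (simp add: row_rank_def_gen vec.dim_eq_card_independent rows card_image)
  qed
  also have "\<dots> \<longleftrightarrow> (\<forall>c. sum (\<lambda>i::'n. c i *s row i M) UNIV = 0 \<longrightarrow> (\<forall>i. c i = 0))"
  proof safe
    fix c i
    assume inj: "inj (\<lambda>i. row i M)" and ind: "vec.independent (rows M)"
      and s: "sum (\<lambda>i::'n. c i *s row i M) UNIV = 0"
    define c' where "c' v = c (inv (\<lambda>i. row i M) v)" for v
    have "(\<Sum>v\<in>rows M. c' v *s v) = 0"
      unfolding rows using inj by (subst sum.reindex) (auto simp: c'_def s inv_f_f[OF inj])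
    moreover have "finite (rows M)" by (simp add: rows)
    ultimately have "c' (row i M) = 0"
      using ind vec.dependent_finite[of "rows M"] by (force simp: rows)
    then show "c i = 0" by (simp add: c'_def inv_f_f[OF inj])
  next
    assume h: "\<forall>c. sum (\<lambda>i::'n. c i *s row i M) UNIV = 0 \<longrightarrow> (\<forall>i. c i = 0)"
    show inj: "inj (\<lambda>i. row i M)"
    proof (rule injI, rule ccontr)
      fix i j assume e: "row i M = row j M" and ne: "i \<noteq> j"
      have "sum (\<lambda>l. (if l = i then 1 else if l = j then - 1 else 0) *s row l M) UNIV
          = sum (\<lambda>l. (if l = i then row l M else 0) - (if l = j then row l M else 0)) UNIV"
        using ne by (intro sum.cong) auto
      also have "\<dots> = 0" using e by (simp add: sum_subtractf)
      finally have "(if i = i then 1 else if i = j then - 1 else 0::'k) = 0"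
        using h[rule_format, of "\<lambda>l. if l = i then 1 else if l = j then - 1 else 0" i] by auto
      then show False by simp
    qed
    show "vec.dependent (rows M) \<Longrightarrow> False"
    proof -
      assume "vec.dependent (rows M)"
      then obtain c v where c: "v \<in> rows M" "c v \<noteq> 0" "(\<Sum>v\<in>rows M. c v *s v) = 0"
        using vec.dependent_finite[of "rows M"] by (auto simp: rows)
      have "(\<Sum>i\<in>UNIV. c (row i M) *s row i M) = 0"
        using c(3) inj unfolding rows by (subst (asm) sum.reindex) auto
      then have "\<forall>i. c (row i M) = 0" using h[rule_format, of "\<lambda>i. c (row i M)"] by blast
      then show False using c(1,2) by (auto simp: rows)
    qed
  qed
  also have "\<dots> \<longleftrightarrow> (\<exists>N. M ** N = mat 1)"
    by (simp add: matrix_right_invertible_independent_rows)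
  finally show ?thesis .
qed

lemma full_column_rank_iff_kernel:
  fixes M :: "'k::field ^ 'n ^ 'r"
  shows "rank M = CARD('n) \<longleftrightarrow> (\<forall>v. M *v v = 0 \<longrightarrow> v = 0)"
  by (simp add: full_column_rank_iff_left_inverse matrix_left_invertible_ker)

lemma full_row_rank_iff_transpose_kernel:
  fixes M :: "'k::field ^ 'c ^ 'n"
  shows "rank M = CARD('n) \<longleftrightarrow> (\<forall>v. transpose M *v v = 0 \<longrightarrow> v = 0)"
  by (simp only: full_row_rank_iff_right_inverse left_invertible_transpose[symmetric] matrix_left_invertible_ker)

lemma bij_index_pos: "bij_betw (index_pos :: 'i::{finite,linorder} \<Rightarrow> nat) UNIV {..<CARD('i)}"
proof -
  have inj: "inj (index_pos :: 'i \<Rightarrow> nat)"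
  proof (rule linorder_injI)
    fix x y :: 'i assume "x < y"
    then have "{..<x} \<subset> {..<y}" by auto
    then have "index_pos x < index_pos y"
      unfolding index_pos_def by (intro psubset_card_mono) auto
    then show "index_pos x \<noteq> index_pos y" by simp
  qed
  have "index_pos ` (UNIV :: 'i set) \<subseteq> {..<CARD('i)}"
    unfolding index_pos_def by (auto intro!: psubset_card_mono)
  then have "index_pos ` (UNIV :: 'i set) = {..<CARD('i)}"
    by (intro card_subset_eq) (auto simp: card_image[OF inj])
  then show ?thesis using inj by (simp add: bij_betw_def)
qed

text \<open>
  As soon as one vector \<open>A\<^sup>d v\<close> depends on the earlier ones, their span is invariant under
  \<open>A\<close>, and this has to happen at the latest for \<open>d\<close> equal to the dimension. This gives the part of
  the Cayley-Hamilton theorem by which the exponents below the dimension decide about all exponents.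
\<close>

lemma krylov_stabilises:
  fixes A :: "'k::field ^ 'n ^ 'n" and v :: "'k ^ 'n"
  defines "K \<equiv> \<lambda>i. matrix_power A i *v v"
  obtains d where "d \<le> CARD('n)" "\<And>i. i < d \<Longrightarrow> K i \<notin> vec.span (K ` {..<i})"
    "\<And>j. K j \<in> vec.span (K ` {..<d})"
proof -
  define d where "d = (LEAST d. K d \<in> vec.span (K ` {..<d}))"
  have "\<exists>d\<le>CARD('n). K d \<in> vec.span (K ` {..<d})"
  proof (rule ccontr)
    assume "\<not> ?thesis"
    then have h: "d \<le> CARD('n) \<Longrightarrow> K d \<notin> vec.span (K ` {..<d})" for d by auto
    have "m \<le> Suc CARD('n) \<Longrightarrow> vec.independent (K ` {..<m}) \<and> card (K ` {..<m}) = m" for m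
    proof (induction m)
      case (Suc m)
      have *: "K m \<notin> vec.span (K ` {..<m})" using h[of m] Suc.prems by simp
      then have "K m \<notin> K ` {..<m}" using vec.span_superset[of "K ` {..<m}"] by (meson subsetD)
      then show ?case
        using Suc * by (simp add: lessThan_Suc vec.independent_insert)
    qed (simp add: vec.independent_empty)
    from this[of "Suc CARD('n)"] have i: "vec.independent (K ` {..<Suc CARD('n)})"
      "card (K ` {..<Suc CARD('n)}) = Suc CARD('n)" by auto
    have "card (K ` {..<Suc CARD('n)}) \<le> vec.dim (UNIV :: ('k ^ 'n) set)"
      by (rule vec.independent_card_le_dim) (use i in auto)
    then show False using i(2) by (simp add: card_cart_basis)
  qed
  then obtain d0 where d0: "d0 \<le> CARD('n)" "K d0 \<in> vec.span (K ` {..<d0})" by auto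
  have Kd: "K d \<in> vec.span (K ` {..<d})" unfolding d_def by (rule LeastI) (rule d0(2))
  have le: "d \<le> CARD('n)" using Least_le[of "\<lambda>d. K d \<in> vec.span (K ` {..<d})", OF d0(2)] d0(1)
    by (simp add: d_def)
  have step: "A *v K i = K (Suc i)" for i by (simp add: K_def matrix_vector_mul_assoc)
  have "K j \<in> vec.span (K ` {..<d})" for j
  proof (induction j)
    case 0
    show ?case using Kd by (cases "d = 0") (auto intro!: vec.span_base)
  next
    case (Suc j)
    have "K (Suc j) \<in> (*v) A ` vec.span (K ` {..<d})" using Suc step[of j] by force
    also have "\<dots> = vec.span ((*v) A ` K ` {..<d})" by (simp add: vec.span_image)
    also have "\<dots> \<subseteq> vec.span (K ` {..<d})"
    proof (rule vec.span_minimal)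
      show "(*v) A ` K ` {..<d} \<subseteq> vec.span (K ` {..<d})"
      proof clarify
        fix i assume "i < d"
        then show "A *v K i \<in> vec.span (K ` {..<d})"
          using Kd step[of i] by (cases "Suc i = d") (auto intro!: vec.span_base)
      qed
    qed simp
    finally show ?case .
  qed
  moreover have "i < d \<Longrightarrow> K i \<notin> vec.span (K ` {..<i})" for i
    unfolding d_def by (rule not_less_Least)
  ultimately show ?thesis using that le by blast
qed

lemma unobservable_iff_all_powers:
  fixes A :: "'k::field ^ 'n ^ 'n" and C :: "'k ^ 'n ^ 'p"
  shows "(\<forall>i<CARD('n). C *v (matrix_power A i *v v) = 0) \<longleftrightarrow> (\<forall>i. C *v (matrix_power A i *v v) = 0)"
proof
  assume h: "\<forall>i<CARD('n). C *v (matrix_power A i *v v) = 0"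
  obtain d where d: "d \<le> CARD('n)"
    "\<And>j. matrix_power A j *v v \<in> vec.span ((\<lambda>i. matrix_power A i *v v) ` {..<d})"
    using krylov_stabilises[of A v] by metis
  show "\<forall>i. C *v (matrix_power A i *v v) = 0"
  proof
    fix j
    have "vec.span ((\<lambda>i. matrix_power A i *v v) ` {..<d}) \<subseteq> {w. C *v w = 0}"
      by (rule vec.span_minimal)
        (use h d(1) in \<open>auto simp: vec.subspace_def matrix_vector_right_distrib vec.scale\<close>)
    then show "C *v (matrix_power A j *v v) = 0" using d(2)[of j] by blast
  qed
qed simp

lemma observability_matrix_kernel:
  "observability_matrix A C *v v = 0 \<longleftrightarrow> (\<forall>i. C *v (matrix_power A i *v v) = 0)"
  for A :: "'k::field ^ 'n::{finite,linorder} ^ 'n::{finite,linorder}" and C :: "'k ^ 'n::{finite,linorder} ^ 'p::finite"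
proof -
  have "observability_matrix A C *v v = 0 \<longleftrightarrow>
      (\<forall>a::'n. (C ** matrix_power A (index_pos a)) *v v = 0)"
    by (simp add: vec_eq_iff observability_matrix_def matrix_vector_mult_def)
  also have "\<dots> \<longleftrightarrow> (\<forall>i\<in>index_pos ` (UNIV :: 'n set). (C ** matrix_power A i) *v v = 0)" by blast
  also have "\<dots> \<longleftrightarrow> (\<forall>i<CARD('n). (C ** matrix_power A i) *v v = 0)"
    using bij_betw_imp_surj_on[OF bij_index_pos[where 'i='n]] by auto
  finally show ?thesis
    by (simp add: unobservable_iff_all_powers flip: matrix_vector_mul_assoc)
qed

lemma matrix_power_commute: "matrix_power A i ** A = A ** matrix_power A i"
  by (induction i) (simp_all flip: matrix_mul_assoc)

lemma transpose_matrix_power: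
  "transpose (matrix_power A i) = matrix_power (transpose A) i"
  for A :: "'k::comm_semiring_1 ^ 'n ^ 'n"
  by (induction i) (simp_all add: matrix_transpose_mul matrix_power_commute)

lemma transpose_controllability_matrix:
  "transpose (controllability_matrix A B) = observability_matrix (transpose A) (transpose B)"
  for A :: "'k::comm_semiring_1 ^ 'n::{finite,linorder} ^ 'n::{finite,linorder}"
proof -
  have "transpose B ** matrix_power (transpose A) i = transpose (matrix_power A i ** B)" for i
    by (simp add: matrix_transpose_mul transpose_matrix_power)
  then show ?thesis
    by (simp add: vec_eq_iff controllability_matrix_def observability_matrix_def transpose_def)
qed

lemma transpose_beside: "transpose (beside M N) = stacked (transpose M) (transpose N)"
  by (simp add: vec_eq_iff beside_def stacked_def transpose_def split: sum.split)

lemma stacked_kernel: "stacked M N *v v = 0 \<longleftrightarrow> M *v v = 0 \<and> N *v v = 0"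
  by (auto simp: vec_eq_iff stacked_def matrix_vector_mult_def split: sum.splits)

lemma observability_rank_iff:
  fixes A :: "'k::field ^ 'n::{finite,linorder} ^ 'n::{finite,linorder}" and C :: "'k ^ 'n::{finite,linorder} ^ 'p::finite"
  shows "rank (observability_matrix A C) = CARD('n) \<longleftrightarrow>
    (\<forall>v. (\<forall>i. C *v (matrix_power A i *v v) = 0) \<longrightarrow> v = 0)"
  by (simp add: full_column_rank_iff_kernel observability_matrix_kernel)

lemma controllability_rank_iff:
  fixes A :: "'k::field ^ 'n::{finite,linorder} ^ 'n::{finite,linorder}" and B :: "'k ^ 'm::finite ^ 'n::{finite,linorder}"
  shows "rank (controllability_matrix A B) = CARD('n) \<longleftrightarrow>
    (\<forall>v. (\<forall>i. transpose B *v (matrix_power (transpose A) i *v v) = 0) \<longrightarrow> v = 0)"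
  by (simp add: full_row_rank_iff_transpose_kernel transpose_controllability_matrix observability_matrix_kernel)

lemma mat_diff_kernel: "(mat \<mu> - A) *v v = 0 \<longleftrightarrow> A *v v = \<mu> *s v"
  for A :: "'k::field ^ 'n ^ 'n"
  by (auto simp: vec_eq_iff mat_def matrix_vector_mult_def if_distrib[where f="\<lambda>x. x * _"]
      left_diff_distrib sum_subtractf cong: if_cong)

text \<open>
  The vectors that no \<open>C A\<^sup>i\<close> detects form an invariant subspace of \<open>A\<close>. Over the complex
  numbers it contains an eigenvector if it is nonzero. The eigenvector is constructed inside the
  Krylov space of \<open>v\<close>, where the minimal polynomial of \<open>v\<close> has a root.
\<close>

lemma unobservable_eigenvector:
  fixes A :: "complex ^ 'n ^ 'n" and C :: "complex ^ 'n ^ 'p"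
  assumes v: "v \<noteq> 0" and Cv: "\<And>i. C *v (matrix_power A i *v v) = 0"
  obtains w \<mu> where "w \<noteq> 0" "A *v w = \<mu> *s w" "C *v w = 0"
proof -
  define K where "K i = matrix_power A i *v v" for i
  obtain d where d: "\<And>i. i < d \<Longrightarrow> K i \<notin> vec.span (K ` {..<i})" "\<And>j. K j \<in> vec.span (K ` {..<d})"
    unfolding K_def using krylov_stabilises[of A v] by metis
  have step: "A *v K i = K (Suc i)" for i by (simp add: K_def matrix_vector_mul_assoc)
  have "K 0 = v" by (simp add: K_def)
  then have "d \<noteq> 0" using d(2)[of 0] v by (cases "d = 0") auto
  then obtain e where e: "d = Suc e" by (cases d) auto
  have inj: "inj_on K {..<d}"
  proof (rule linorder_inj_onI)
    fix i j assume "i < j" "j \<in> {..<d}"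
    then show "K i \<noteq> K j" using d(1)[of j] vec.span_base[of "K i" "K ` {..<j}"] by auto
  qed auto
  obtain c where c: "K d = (\<Sum>i<d. c i *s K i)"
  proof -
    have "K d \<in> range (\<lambda>u. \<Sum>w\<in>K ` {..<d}. u w *s w)"
      using d(2)[of d] by (simp add: vec.span_finite)
    then obtain u where "K d = (\<Sum>w\<in>K ` {..<d}. u w *s w)" by auto
    also have "\<dots> = (\<Sum>i<d. u (K i) *s K i)" using inj by (simp add: sum.reindex)
    finally show ?thesis using that[of "\<lambda>i. u (K i)"] by blast
  qed
  (* The minimal polynomial of v: p applied to A annihilates v, because K d is the
     combination of the earlier vectors with the coefficients c. *)
  define p where "p = monom 1 d - (\<Sum>i<d. monom (c i) i)"
  have cp: "coeff p i = (if i = d then 1 else if i < d then - c i else 0)" for i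
    by (auto simp: p_def coeff_sum)
  have dp: "degree p = d"
    by (rule antisym) (auto intro!: degree_le le_degree simp: cp)
  obtain \<mu> where "poly p \<mu> = 0"
    using fundamental_theorem_of_algebra[of p] constant_degree[of p] dp e by auto
  then obtain q where q: "p = [:- \<mu>, 1:] * q" by (auto simp: poly_eq_0_iff_dvd elim: dvdE)
  have "p \<noteq> 0" using dp e by auto
  then have "q \<noteq> 0" using q by auto
  then have "degree p = 1 + degree q"
    unfolding q by (subst degree_mult_eq) auto
  then have dq: "degree q = e"
    using dp e by simp
  have lq: "coeff q e = 1"
    using cp[of d] dq e unfolding q by (simp add: coeff_pCons coeff_eq_0)
  (* For p = (X - \<mu>) q the vector w is q applied to A and v. It is annihilated by A - \<mu>,
     and it is nonzero because q has a smaller degree than the minimal polynomial. *)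
  define w where "w = (\<Sum>i<d. coeff q i *s K i)"
  have w0: "w \<noteq> 0"
  proof
    assume "w = 0"
    then have "K e = (\<Sum>i<e. (- coeff q i) *s K i)"
      unfolding w_def e by (simp add: lq sum_negf add_eq_0_iff2)
    also have "\<dots> \<in> vec.span (K ` {..<e})"
      by (intro vec.span_sum vec.span_scale vec.span_base) auto
    finally show False using d(1)[of e] e by simp
  qed
  have "A *v w - \<mu> *s w = (\<Sum>i<d. coeff q i *s K (Suc i)) - (\<Sum>i<d. (\<mu> * coeff q i) *s K i)"
    by (simp add: w_def vec.linear_sum vec.sum vec.scale step vec.scale_sum_right)
  also have "(\<Sum>i<d. coeff q i *s K (Suc i)) = (\<Sum>i<Suc d. coeff (pCons 0 q) i *s K i)"
    by (simp only: sum.lessThan_Suc_shift coeff_pCons_0 coeff_pCons_Suc vec.scale_zero_left add_0)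
  also have "(\<Sum>i<d. (\<mu> * coeff q i) *s K i) = (\<Sum>i<Suc d. (\<mu> * coeff q i) *s K i)"
    using dq e by (simp add: coeff_eq_0)
  also have "(\<Sum>i<Suc d. coeff (pCons 0 q) i *s K i) - \<dots> = (\<Sum>i<Suc d. coeff p i *s K i)"
    unfolding q by (simp add: sum_subtractf[symmetric] vec.scale_left_diff_distrib coeff_pCons split: nat.split)
  also have "\<dots> = 0"
    by (simp add: cp c sum_negf)
  finally have "A *v w = \<mu> *s w" by simp
  moreover have "C *v w = 0"
    using Cv by (simp add: w_def vec.sum vec.scale K_def)
  ultimately show ?thesis using that w0 by blast
qed

text \<open>
  Failure of the Hautus test at \<open>\<mu>\<close> means an eigenvector for \<open>\<mu>\<close> in the kernel of \<open>C\<close>. Such a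
  vector is invisible for all \<open>C A\<^sup>i\<close>, and conversely invisible vectors yield an invisible
  eigenvector. At a \<open>\<mu>\<close> outside the spectrum the test cannot fail.
\<close>

theorem Hautus_observability:
  fixes A :: "complex ^ 'n::{finite,linorder} ^ 'n::{finite,linorder}" and C :: "complex ^ 'n::{finite,linorder} ^ 'p::finite"
  shows "rank (observability_matrix A C) = CARD('n) \<longleftrightarrow>
      (\<forall>\<mu>. rank (stacked (mat \<mu> - A) C) = CARD('n))"
    and "(\<forall>\<mu>. rank (stacked (mat \<mu> - A) C) = CARD('n)) \<longleftrightarrow>
      (\<forall>\<mu>\<in>eigenvalues A. rank (stacked (mat \<mu> - A) C) = CARD('n))"
proof -
  have st: "rank (stacked (mat \<mu> - A) C) = CARD('n) \<longleftrightarrow> (\<forall>v. A *v v = \<mu> *s v \<and> C *v v = 0 \<longrightarrow> v = 0)" for \<mu>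
    by (simp add: full_column_rank_iff_kernel stacked_kernel mat_diff_kernel)
  show "(\<forall>\<mu>. rank (stacked (mat \<mu> - A) C) = CARD('n)) \<longleftrightarrow>
      (\<forall>\<mu>\<in>eigenvalues A. rank (stacked (mat \<mu> - A) C) = CARD('n))"
    unfolding st eigenvalues_def by blast
  show "rank (observability_matrix A C) = CARD('n) \<longleftrightarrow>
      (\<forall>\<mu>. rank (stacked (mat \<mu> - A) C) = CARD('n))"
    unfolding st observability_rank_iff
  proof safe
    fix \<mu> v
    assume h: "\<forall>v. (\<forall>i. C *v (matrix_power A i *v v) = 0) \<longrightarrow> v = 0"
      and ev: "A *v v = \<mu> *s v" and Cv: "C *v v = 0"
    have "matrix_power A i *v v = \<mu> ^ i *s v" for i
      by (induction i) (simp_all add: ev vec.scale mult.commute flip: matrix_vector_mul_assoc)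
    then show "v = 0" using h Cv by (simp add: vec.scale)
  next
    fix v
    assume h: "\<forall>\<mu> v. A *v v = \<mu> *s v \<and> C *v v = 0 \<longrightarrow> v = 0"
      and "\<forall>i. C *v (matrix_power A i *v v) = 0"
    then show "v = 0" using unobservable_eigenvector[of v C A] by metis
  qed
qed

lemma to_complex_0: "to_complex 0 = 0"
  by (metis add_cancel_right_right to_complex_add)

lemma to_complex_eq_0: "to_complex a = 0 \<longleftrightarrow> a = 0"
  by (metis norm_eq_zero norm_to_complex)

lemma to_complex_sum: "to_complex (sum f S) = (\<Sum>i\<in>S. to_complex (f i))"
  by (induction S rule: infinite_finite_induct) (simp_all add: to_complex_0 to_complex_add)

lemma complexify_mult: "complexify (M ** N) = complexify M ** complexify N"
  by (simp add: vec_eq_iff matrix_matrix_mult_def to_complex_sum to_complex_mult)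

lemma complexify_mat: "complexify (mat c) = mat (to_complex c)"
  by (simp add: vec_eq_iff mat_def to_complex_0)

lemma complexify_transpose: "complexify (transpose M) = transpose (complexify M)"
  by (simp add: vec_eq_iff transpose_def)

text \<open>
  A left inverse can be complexified, and a kernel vector can be complexified; each proves one
  direction. So real systems may be tested with complex eigenvalues.
\<close>

lemma complexify_full_column_rank:
  fixes M :: "'k::real_or_complex ^ 'n ^ 'r"
  shows "rank (complexify M) = CARD('n) \<longleftrightarrow> rank M = CARD('n)"
proof
  assume "rank M = CARD('n)"
  then obtain N where "N ** M = mat 1" by (auto simp: full_column_rank_iff_left_inverse)
  then have "complexify N ** complexify M = mat 1"
    by (metis complexify_mult complexify_mat to_complex_one)
  then show "rank (complexify M) = CARD('n)" by (auto simp: full_column_rank_iff_left_inverse)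
next
  assume r: "rank (complexify M) = CARD('n)"
  show "rank M = CARD('n)"
    unfolding full_column_rank_iff_kernel
  proof (intro allI impI)
    fix v assume "M *v v = 0"
    then have "complexify M *v (\<chi> i. to_complex (v $ i)) = 0"
      by (simp add: vec_eq_iff matrix_vector_mult_def flip: to_complex_mult to_complex_sum)
         (simp add: to_complex_0)
    then have "(\<chi> i. to_complex (v $ i)) = 0"
      using r by (simp add: full_column_rank_iff_kernel)
    then show "v = 0" by (simp add: vec_eq_iff to_complex_eq_0)
  qed
qed

lemma complexify_power: "complexify (matrix_power A i) = matrix_power (complexify A) i"
  by (induction i) (simp_all add: complexify_mult complexify_mat to_complex_one)

lemma complexify_observability_matrix:
  "complexify (observability_matrix A C) = observability_matrix (complexify A) (complexify C)"
proof -
  have "complexify (C ** matrix_power A i) = complexify C ** matrix_power (complexify A) i" for i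
    by (simp add: complexify_mult complexify_power)
  then show ?thesis
    by (simp add: observability_matrix_def vec_eq_iff)
qed

lemma observability_rank_tests:
  fixes A :: "'k::real_or_complex ^ 'n::{finite,linorder} ^ 'n::{finite,linorder}" and C :: "'k ^ 'n::{finite,linorder} ^ 'p::finite"
  shows "rank (observability_matrix A C) = CARD('n) \<longleftrightarrow>
      (\<forall>\<mu>. rank (stacked (mat \<mu> - complexify A) (complexify C)) = CARD('n))"
  by (metis complexify_full_column_rank complexify_observability_matrix Hautus_observability(1))

lemma full_row_rank_transpose:
  fixes M :: "'k::field ^ 'c ^ 'n"
  shows "rank M = CARD('n) \<longleftrightarrow> rank (transpose M) = CARD('n)"
  by (simp add: full_row_rank_iff_transpose_kernel full_column_rank_iff_kernel)

lemma eigenvalues_transpose: "eigenvalues (transpose A) = eigenvalues A"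
proof -
  have "\<mu> \<in> eigenvalues A \<longleftrightarrow> rank (mat \<mu> - A) \<noteq> CARD('a)" for \<mu> and A :: "complex ^ 'a ^ 'a"
    by (auto simp: eigenvalues_def full_column_rank_iff_kernel mat_diff_kernel)
  moreover have "mat \<mu> - transpose A = transpose (mat \<mu> - A)" for \<mu>
    by (auto simp: vec_eq_iff transpose_def mat_def)
  ultimately show ?thesis by (auto simp: full_row_rank_transpose[symmetric])
qed

text \<open>
  The transposed statements: a row rank condition for a pair is a column rank condition for its transpose.
\<close>

lemma controllability_rank_tests:
  fixes A :: "'k::real_or_complex ^ 'n::{finite,linorder} ^ 'n::{finite,linorder}" and B :: "'k ^ 'm::finite ^ 'n::{finite,linorder}"
  shows "rank (controllability_matrix A B) = CARD('n) \<longleftrightarrow>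
      (\<forall>\<mu>. rank (beside (mat \<mu> - complexify A) (complexify B)) = CARD('n))"
    and "(\<forall>\<mu>. rank (beside (mat \<mu> - complexify A) (complexify B)) = CARD('n)) \<longleftrightarrow>
      (\<forall>\<mu>\<in>eigenvalues (complexify A). rank (beside (mat \<mu> - complexify A) (complexify B)) = CARD('n))"
proof -
  have b: "rank (beside (mat \<mu> - complexify A) (complexify B)) = CARD('n) \<longleftrightarrow>
      rank (stacked (mat \<mu> - complexify (transpose A)) (complexify (transpose B))) = CARD('n)" for \<mu>
  proof -
    have "transpose (mat \<mu> - complexify A) = mat \<mu> - complexify (transpose A)"
      by (auto simp: vec_eq_iff transpose_def mat_def)
    then show ?thesis
      by (simp add: full_row_rank_transpose transpose_beside complexify_transpose)
  qed
  show "rank (controllability_matrix A B) = CARD('n) \<longleftrightarrow>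
      (\<forall>\<mu>. rank (beside (mat \<mu> - complexify A) (complexify B)) = CARD('n))"
    unfolding b by (simp add: full_row_rank_transpose transpose_controllability_matrix
        flip: observability_rank_tests)
  show "(\<forall>\<mu>. rank (beside (mat \<mu> - complexify A) (complexify B)) = CARD('n)) \<longleftrightarrow>
      (\<forall>\<mu>\<in>eigenvalues (complexify A). rank (beside (mat \<mu> - complexify A) (complexify B)) = CARD('n))"
    unfolding b Hautus_observability(2) by (simp add: complexify_transpose eigenvalues_transpose)
qed

lemma controllability_matrix_mult_vector:
  fixes A :: "'k::field ^ 'n::{finite,linorder} ^ 'n::{finite,linorder}" and B :: "'k ^ 'm::finite ^ 'n::{finite,linorder}"
  shows "controllability_matrix A B *v w =
    (\<Sum>a\<in>UNIV. matrix_power A (index_pos (a::'n)) *v (B *v (\<chi> j. w $ (a, j))))"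
proof -
  have "(controllability_matrix A B *v w) $ i =
      (\<Sum>a\<in>UNIV. (matrix_power A (index_pos (a::'n)) *v (B *v (\<chi> j. w $ (a, j)))) $ i)" for i
    by (simp add: controllability_matrix_def matrix_vector_mul_assoc sum.cartesian_product
        matrix_vector_mult_def[of "_ ** _"] case_prod_unfold)
       (simp add: matrix_vector_mult_def)
  then show ?thesis by (simp add: vec_eq_iff)
qed

text \<open>
  The reachable space is the whole space iff its orthogonal complement in the real inner product
  is trivial. The transposed kernel uses the bilinear pairing \<open>\<Sum>i. v\<^sub>i x\<^sub>i\<close> instead, which for
  complex scalars is not an inner product, so an adjoint translates between the two.
\<close>

lemma controllability_rank_iff_inner:
  fixes A :: "'k::real_or_complex ^ 'n::{finite,linorder} ^ 'n::{finite,linorder}" and B :: "'k ^ 'm::finite ^ 'n::{finite,linorder}"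
  shows "rank (controllability_matrix A B) = CARD('n) \<longleftrightarrow>
    (\<forall>v. (\<forall>i u. v \<bullet> (matrix_power A i *v (B *v u)) = 0) \<longrightarrow> v = 0)"
proof
  assume "rank (controllability_matrix A B) = CARD('n)"
  then obtain N where N: "controllability_matrix A B ** N = mat 1"
    by (auto simp: full_row_rank_iff_right_inverse)
  show "\<forall>v. (\<forall>i u. v \<bullet> (matrix_power A i *v (B *v u)) = 0) \<longrightarrow> v = 0"
  proof (intro allI impI)
    fix v assume h: "\<forall>i u. v \<bullet> (matrix_power A i *v (B *v u)) = 0"
    have "v \<bullet> v = v \<bullet> (controllability_matrix A B *v (N *v v))"
      by (simp add: matrix_vector_mul_assoc N)
    also have "\<dots> = 0"
      unfolding controllability_matrix_mult_vector by (simp add: inner_sum_right h)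
    finally show "v = 0" by simp
  qed
next
  assume h: "\<forall>v. (\<forall>i u. v \<bullet> (matrix_power A i *v (B *v u)) = 0) \<longrightarrow> v = 0"
  show "rank (controllability_matrix A B) = CARD('n)"
    unfolding controllability_rank_iff
  proof (intro allI impI, rule ccontr)
    fix v
    assume ker: "\<forall>i. transpose B *v (matrix_power (transpose A) i *v v) = 0" and v: "v \<noteq> 0"
    (* The bilinear pairing with v vanishes on the reachable space. Its adjoint at 1 represents
       its real part by a vector for the real inner product. *)
    define f where "f x = (\<Sum>i\<in>UNIV. v $ i * x $ i)" for x
    have lin: "linear f"
      by (rule linearI) (simp_all add: f_def algebra_simps sum.distrib scaleR_sum_right)
    have f_mult: "f (M *v x) = (\<Sum>j\<in>UNIV. (transpose M *v v) $ j * x $ j)"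
      for M :: "'k ^ 'c ^ 'n::{finite,linorder}" and x
    proof -
      have "f (M *v x) = (\<Sum>i\<in>UNIV. \<Sum>j\<in>UNIV. v $ i * (M $ i $ j * x $ j))"
        by (simp add: f_def matrix_vector_mult_def sum_distrib_left)
      also have "\<dots> = (\<Sum>j\<in>UNIV. \<Sum>i\<in>UNIV. v $ i * (M $ i $ j * x $ j))"
        by (rule sum.swap)
      also have "\<dots> = (\<Sum>j\<in>UNIV. (transpose M *v v) $ j * x $ j)"
        by (simp add: matrix_vector_mult_def transpose_def sum_distrib_right sum_distrib_left mult_ac)
      finally show ?thesis .
    qed
    have "transpose (matrix_power A i ** B) *v v = 0" for i
      using ker by (simp add: matrix_transpose_mul transpose_matrix_power flip: matrix_vector_mul_assoc)
    then have "f (matrix_power A i *v (B *v u)) = 0" for i u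
      using f_mult[of "matrix_power A i ** B" u] by (simp add: matrix_vector_mul_assoc)
    then have "adjoint f 1 \<bullet> (matrix_power A i *v (B *v u)) = 0" for i u
      by (subst inner_commute) (simp add: adjoint_works[OF lin])
    then have 0: "adjoint f 1 = 0" using h by blast
    obtain j where j: "v $ j \<noteq> 0" using v by (auto simp: vec_eq_iff)
    have "f (axis j (1 / v $ j)) = 1"
      using j by (simp add: f_def axis_def if_distrib[where f="\<lambda>x. _ * x"] cong: if_cong)
    then have "adjoint f 1 \<bullet> axis j (1 / v $ j) = (1::'k) \<bullet> 1"
      using adjoint_works[OF lin, of "axis j (1 / v $ j)" 1] by (simp add: inner_commute)
    then show False using 0 by simp
  qed
qed

text \<open>
  A family of linear maps whose ranges together have a trivial orthogonal complement spans
  the space by finitely many members, and a linear right inverse is obtained from a basis. Applied to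
  \<open>A\<^sup>k B\<close> it gives inputs that depend linearly on the target; applied to the adjoints of
  \<open>C A\<^sup>k\<close> it gives weights that recover a state from its outputs.
\<close>

lemma linear_right_inverse_of_family:
  fixes f :: "nat \<Rightarrow> 'u::euclidean_space \<Rightarrow> 'v::euclidean_space"
  assumes lin: "\<And>k. linear (f k)"
    and total: "\<And>v. (\<And>k u. v \<bullet> f k u = 0) \<Longrightarrow> v = 0"
  obtains N H where "\<And>k. linear (H k :: 'v \<Rightarrow> 'u)" "\<And>v. (\<Sum>k<N. f k (H k v)) = v"
proof -
  define T where "T N = {v. \<exists>u. v = (\<Sum>k<N. f k (u k))}" for N
  have mono: "T N \<subseteq> T M" if "N \<le> M" for N M
  proof
    fix v assume "v \<in> T N"
    then obtain u where u: "v = (\<Sum>k<N. f k (u k))" by (auto simp: T_def)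
    have "(\<Sum>k<M. f k (if k < N then u k else 0)) = (\<Sum>k<N. f k (u k))"
      using that by (intro sum.mono_neutral_cong_right) (auto simp: linear_0[OF lin])
    then have "v = (\<Sum>k<M. f k (if k < N then u k else 0))" by (simp add: u)
    then show "v \<in> T M" unfolding T_def mem_Collect_eq
      by (rule exI[of _ "\<lambda>k. if k < N then u k else 0"])
  qed
  have sub: "subspace (\<Union>N. T N)"
  proof (rule subspaceI)
    show "0 \<in> (\<Union>N. T N)" unfolding T_def by (auto intro!: exI[of _ 0])
  next
    fix x y assume "x \<in> (\<Union>N. T N)" "y \<in> (\<Union>N. T N)"
    then obtain N M where "x \<in> T N" "y \<in> T M" by blast
    then have "x \<in> T (max N M)" "y \<in> T (max N M)" using mono[of N "max N M"] mono[of M "max N M"] by auto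
    then obtain u w where "x = (\<Sum>k<max N M. f k (u k))" "y = (\<Sum>k<max N M. f k (w k))"
      unfolding T_def by blast
    then have "x + y = (\<Sum>k<max N M. f k (u k + w k))" by (simp add: linear_add[OF lin] sum.distrib)
    then show "x + y \<in> (\<Union>N. T N)" unfolding T_def by (intro UN_I[of "max N M"]) (auto intro: exI[of _ "\<lambda>k. u k + w k"])
  next
    fix c x assume "x \<in> (\<Union>N. T N)"
    then obtain N u where "x = (\<Sum>k<N. f k (u k))" by (auto simp: T_def)
    then have "c *\<^sub>R x = (\<Sum>k<N. f k (c *\<^sub>R u k))" by (simp add: linear_scale[OF lin] scaleR_sum_right)
    then show "c *\<^sub>R x \<in> (\<Union>N. T N)" unfolding T_def by (intro UN_I[of N]) (auto intro: exI[of _ "\<lambda>k. c *\<^sub>R u k"])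
  qed
  have range: "f k u \<in> (\<Union>N. T N)" for k u
  proof -
    have "f k u = (\<Sum>i<Suc k. f i (if i = k then u else 0))"
      by (simp add: linear_0[OF lin])
    then show ?thesis unfolding T_def
      by (intro UN_I[of "Suc k"]) (auto intro: exI[of _ "\<lambda>i. if i = k then u else 0"])
  qed
  have "span (\<Union>N. T N) = UNIV"
  proof (rule ccontr)
    assume "span (\<Union>N. T N) \<noteq> UNIV"
    then obtain v where "v \<noteq> 0" "\<forall>x\<in>span (\<Union>N. T N). v \<bullet> x = 0"
      using span_not_UNIV_orthogonal by blast
    then show False using total[of v] range by (meson span_base)
  qed
  then have all: "(\<Union>N. T N) = UNIV" by (metis sub span_eq_iff)
  obtain n where n: "\<And>b. b \<in> Basis \<Longrightarrow> (b::'v) \<in> T (n b)"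
    using all by (metis UNIV_I UN_E)
  define N where "N = Max (n ` Basis)"
  have "\<exists>u. b = (\<Sum>k<N. f k (u k))" if "b \<in> Basis" for b
    using n[OF that] mono[of "n b" N] that by (auto simp: T_def N_def)
  then obtain u where u: "\<And>b. b \<in> Basis \<Longrightarrow> b = (\<Sum>k<N. f k (u b k))" by metis
  (* On the basis vectors H returns the chosen preimages; it is extended linearly. *)
  define H where "H k v = (\<Sum>b\<in>Basis. (v \<bullet> b) *\<^sub>R u b k)" for k v
  have "linear (H k)" for k
    by (rule linearI) (simp_all add: H_def inner_left_distrib scaleR_left_distrib sum.distrib scaleR_sum_right)
  moreover have "(\<Sum>k<N. f k (H k v)) = v" for v
  proof -
    have "(\<Sum>k<N. f k (H k v)) = (\<Sum>k<N. \<Sum>b\<in>Basis. (v \<bullet> b) *\<^sub>R f k (u b k))"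
      by (simp add: H_def linear_sum[OF lin] linear_scale[OF lin])
    also have "\<dots> = (\<Sum>b\<in>Basis. (v \<bullet> b) *\<^sub>R (\<Sum>k<N. f k (u b k)))"
      by (subst sum.swap) (simp add: scaleR_sum_right)
    also have "\<dots> = v" using u by (simp add: euclidean_representation)
    finally show ?thesis .
  qed
  ultimately show ?thesis using that by blast
qed

section \<open>Square integrable functions\<close>

lemma L2_norm_on_nonneg: "0 \<le> L2_norm_on S f"
  by (simp add: L2_norm_on_def)

lemma L2_norm_on_power2: "(L2_norm_on S f)\<^sup>2 = (LINT s|lebesgue_on S. (norm (f s))\<^sup>2)"
  by (simp add: L2_norm_on_def)

lemma L2_on_measurable: "L2_on S f \<Longrightarrow> f \<in> borel_measurable (lebesgue_on S)"
  by (simp add: L2_on_def)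

text \<open>
  The quadratic polynomial \<open>t \<mapsto> \<integral> (\<bar>f\<bar> - t \<bar>g\<bar>)\<^sup>2\<close> is nonnegative, so its discriminant is not
  positive.
\<close>

lemma L2_Cauchy_Schwarz_norm:
  fixes f :: "real \<Rightarrow> 'v::euclidean_space" and g :: "real \<Rightarrow> 'w::euclidean_space"
  assumes f: "L2_on S f" and g: "L2_on S g"
  shows "integrable (lebesgue_on S) (\<lambda>s. norm (f s) * norm (g s))"
    and "(LINT s|lebesgue_on S. norm (f s) * norm (g s)) \<le> L2_norm_on S f * L2_norm_on S g"
proof -
  let ?M = "lebesgue_on S"
  note [measurable] = L2_on_measurable[OF f] L2_on_measurable[OF g]
  have if2: "integrable ?M (\<lambda>s. (norm (f s))\<^sup>2)" and ig2: "integrable ?M (\<lambda>s. (norm (g s))\<^sup>2)"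
    using f g by (auto simp: L2_on_def)
  show ifg: "integrable ?M (\<lambda>s. norm (f s) * norm (g s))"
  proof (rule Bochner_Integration.integrable_bound)
    show "integrable ?M (\<lambda>s. (norm (f s))\<^sup>2 + (norm (g s))\<^sup>2)" using if2 ig2 by simp
    show "AE s in ?M. norm (norm (f s) * norm (g s)) \<le> norm ((norm (f s))\<^sup>2 + (norm (g s))\<^sup>2)"
    proof (rule AE_I2)
      fix s
      have "2 * (norm (f s) * norm (g s)) \<le> (norm (f s))\<^sup>2 + (norm (g s))\<^sup>2"
        using sum_squares_bound[of "norm (f s)" "norm (g s)"] by (simp add: mult.assoc)
      moreover have "0 \<le> norm (f s) * norm (g s)" by simp
      ultimately show "norm (norm (f s) * norm (g s)) \<le> norm ((norm (f s))\<^sup>2 + (norm (g s))\<^sup>2)"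
        unfolding real_norm_def by linarith
    qed
  qed measurable
  define a b c where "a = (LINT s|?M. (norm (f s))\<^sup>2)" and "b = (LINT s|?M. (norm (g s))\<^sup>2)"
    and "c = (LINT s|?M. norm (f s) * norm (g s))"
  have ab: "a \<ge> 0" "b \<ge> 0" "c \<ge> 0" by (simp_all add: a_def b_def c_def)
  have quad: "a - 2 * t * c + t\<^sup>2 * b \<ge> 0" for t
  proof -
    have "0 \<le> (LINT s|?M. (norm (f s) - t * norm (g s))\<^sup>2)" by simp
    also have "\<dots> = (LINT s|?M. (norm (f s))\<^sup>2 - (2 * t) * (norm (f s) * norm (g s)) + t\<^sup>2 * (norm (g s))\<^sup>2)"
      by (intro Bochner_Integration.integral_cong) (auto simp: power2_eq_square algebra_simps)
    also have "\<dots> = a - 2 * t * c + t\<^sup>2 * b"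
      using if2 ig2 ifg by (simp add: a_def b_def c_def)
    finally show ?thesis .
  qed
  have "c\<^sup>2 \<le> a * b"
  proof (cases "b = 0")
    case True
    have "c = 0"
    proof (rule ccontr)
      assume "c \<noteq> 0"
      then show False using quad[of "(a + 1) / c"] True ab by simp
    qed
    then show ?thesis using ab by simp
  next
    case False
    then show ?thesis
      using quad[of "c / b"] ab by (simp add: power2_eq_square field_simps)
  qed
  then have "sqrt (c\<^sup>2) \<le> sqrt (a * b)" by (rule real_sqrt_le_mono)
  then show "c \<le> L2_norm_on S f * L2_norm_on S g"
    using ab by (simp add: L2_norm_on_def a_def b_def real_sqrt_mult)
qed

lemma L2_inner:
  fixes f g :: "real \<Rightarrow> 'v::euclidean_space"
  assumes f: "L2_on S f" and g: "L2_on S g"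
  shows L2_inner_integrable: "integrable (lebesgue_on S) (\<lambda>s. f s \<bullet> g s)"
    and L2_Cauchy_Schwarz: "\<bar>LINT s|lebesgue_on S. f s \<bullet> g s\<bar> \<le> L2_norm_on S f * L2_norm_on S g"
proof -
  note [measurable] = L2_on_measurable[OF f] L2_on_measurable[OF g]
  show i: "integrable (lebesgue_on S) (\<lambda>s. f s \<bullet> g s)"
    by (rule Bochner_Integration.integrable_bound[OF L2_Cauchy_Schwarz_norm(1)[OF f g]])
      (measurable, simp add: Cauchy_Schwarz_ineq2)
  have "\<bar>LINT s|lebesgue_on S. f s \<bullet> g s\<bar> \<le> (LINT s|lebesgue_on S. \<bar>f s \<bullet> g s\<bar>)"
    by (rule integral_abs_bound)
  also have "\<dots> \<le> (LINT s|lebesgue_on S. norm (f s) * norm (g s))"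
    using i L2_Cauchy_Schwarz_norm(1)[OF f g] by (intro integral_mono) (auto simp: Cauchy_Schwarz_ineq2)
  also have "\<dots> \<le> L2_norm_on S f * L2_norm_on S g" by (rule L2_Cauchy_Schwarz_norm(2)[OF f g])
  finally show "\<bar>LINT s|lebesgue_on S. f s \<bullet> g s\<bar> \<le> L2_norm_on S f * L2_norm_on S g" .
qed

text \<open>
  Pointwise domination yields square integrability and the norm estimate at once. The two
  functions may take values in different spaces, as for a matrix applied to a vector.
\<close>

lemma L2_bound:
  fixes f :: "real \<Rightarrow> 'v::euclidean_space" and g :: "real \<Rightarrow> 'w::euclidean_space"
  assumes g: "L2_on S g" and f[measurable]: "f \<in> borel_measurable (lebesgue_on S)"
    and le: "AE s in lebesgue_on S. norm (f s) \<le> c * norm (g s)" and c: "c \<ge> 0"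
  shows L2_on_bound: "L2_on S f" and L2_norm_on_bound: "L2_norm_on S f \<le> c * L2_norm_on S g"
proof -
  have le2: "AE s in lebesgue_on S. (norm (f s))\<^sup>2 \<le> c\<^sup>2 * (norm (g s))\<^sup>2"
    using le by eventually_elim (metis norm_ge_zero power_mono power_mult_distrib)
  have ig: "integrable (lebesgue_on S) (\<lambda>s. c\<^sup>2 * (norm (g s))\<^sup>2)" using g by (simp add: L2_on_def)
  have i: "integrable (lebesgue_on S) (\<lambda>s. (norm (f s))\<^sup>2)"
    by (rule Bochner_Integration.integrable_bound[OF ig]) (use le2 in \<open>auto simp: abs_mult\<close>)
  then show "L2_on S f" by (simp add: L2_on_def f)
  have "(LINT s|lebesgue_on S. (norm (f s))\<^sup>2) \<le> (LINT s|lebesgue_on S. c\<^sup>2 * (norm (g s))\<^sup>2)"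
    by (rule integral_mono_AE[OF i ig le2])
  then have "L2_norm_on S f \<le> sqrt (c\<^sup>2 * (LINT s|lebesgue_on S. (norm (g s))\<^sup>2))"
    unfolding L2_norm_on_def by (intro real_sqrt_le_mono) simp
  then show "L2_norm_on S f \<le> c * L2_norm_on S g"
    using c by (simp add: L2_norm_on_def real_sqrt_mult)
qed

lemma L2_norm_on_cong_AE:
  fixes f g :: "real \<Rightarrow> 'v::euclidean_space"
  assumes [measurable]: "f \<in> borel_measurable (lebesgue_on S)" "g \<in> borel_measurable (lebesgue_on S)"
    and "AE s in lebesgue_on S. f s = g s"
  shows "L2_norm_on S f = L2_norm_on S g"
  unfolding L2_norm_on_def using assms(3) by (intro arg_cong[where f=sqrt] integral_cong_AE) auto

lemma L2_norm_on_cong: "(\<And>s. s \<in> S \<Longrightarrow> f s = g s) \<Longrightarrow> L2_norm_on S f = L2_norm_on S g"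
  unfolding L2_norm_on_def by (intro arg_cong[where f=sqrt] Bochner_Integration.integral_cong) auto

lemma L2_on_cong: "(\<And>s. s \<in> S \<Longrightarrow> f s = g s) \<Longrightarrow> L2_on S f \<longleftrightarrow> L2_on S g"
  unfolding L2_on_def by (intro conj_cong measurable_cong Bochner_Integration.integrable_cong) auto

lemma L2_norm_on_zero: "L2_norm_on S (\<lambda>_. 0) = 0"
  by (simp add: L2_norm_on_def)

lemma L2_on_zero: "L2_on S (\<lambda>_. 0)"
  by (simp add: L2_on_def)

lemma L2_add:
  fixes f g :: "real \<Rightarrow> 'v::euclidean_space"
  assumes f: "L2_on S f" and g: "L2_on S g"
  shows L2_on_add: "L2_on S (\<lambda>s. f s + g s)"
    and L2_norm_on_triangle: "L2_norm_on S (\<lambda>s. f s + g s) \<le> L2_norm_on S f + L2_norm_on S g"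
proof -
  let ?M = "lebesgue_on S"
  note [measurable] = L2_on_measurable[OF f] L2_on_measurable[OF g]
  have if2: "integrable ?M (\<lambda>s. (norm (f s))\<^sup>2)" and ig2: "integrable ?M (\<lambda>s. (norm (g s))\<^sup>2)"
    using f g by (auto simp: L2_on_def)
  note ifg = L2_Cauchy_Schwarz_norm[OF f g]
  have le: "(norm (f s + g s))\<^sup>2 \<le> (norm (f s))\<^sup>2 + 2 * (norm (f s) * norm (g s)) + (norm (g s))\<^sup>2" for s
  proof -
    have "(norm (f s + g s))\<^sup>2 \<le> (norm (f s) + norm (g s))\<^sup>2"
      by (intro power_mono norm_triangle_ineq) simp
    then show ?thesis by (simp add: power2_sum algebra_simps)
  qed
  have ib: "integrable ?M (\<lambda>s. (norm (f s))\<^sup>2 + 2 * (norm (f s) * norm (g s)) + (norm (g s))\<^sup>2)"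
    using if2 ig2 ifg(1) by simp
  have i: "integrable ?M (\<lambda>s. (norm (f s + g s))\<^sup>2)"
    by (rule Bochner_Integration.integrable_bound[OF ib]) (use le in \<open>auto intro!: AE_I2 order_trans[OF le]\<close>)
  then show "L2_on S (\<lambda>s. f s + g s)" by (simp add: L2_on_def)
  have "(LINT s|?M. (norm (f s + g s))\<^sup>2) \<le>
      (LINT s|?M. (norm (f s))\<^sup>2 + 2 * (norm (f s) * norm (g s)) + (norm (g s))\<^sup>2)"
    by (rule integral_mono[OF i ib le])
  also have "\<dots> = (L2_norm_on S f)\<^sup>2 + 2 * (LINT s|?M. norm (f s) * norm (g s)) + (L2_norm_on S g)\<^sup>2"
    using if2 ig2 ifg(1) by (simp add: L2_norm_on_power2)
  also have "\<dots> \<le> (L2_norm_on S f + L2_norm_on S g)\<^sup>2"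
    using ifg(2) by (simp add: power2_sum algebra_simps)
  finally have "(L2_norm_on S (\<lambda>s. f s + g s))\<^sup>2 \<le> (L2_norm_on S f + L2_norm_on S g)\<^sup>2"
    by (simp add: L2_norm_on_power2)
  then show "L2_norm_on S (\<lambda>s. f s + g s) \<le> L2_norm_on S f + L2_norm_on S g"
    by (rule power2_le_imp_le) (simp add: L2_norm_on_nonneg)
qed

lemma L2_scaleR:
  fixes f :: "real \<Rightarrow> 'v::euclidean_space"
  assumes f: "L2_on S f"
  shows L2_on_scaleR: "L2_on S (\<lambda>s. c *\<^sub>R f s)"
    and L2_norm_on_scaleR: "L2_norm_on S (\<lambda>s. c *\<^sub>R f s) = \<bar>c\<bar> * L2_norm_on S f"
  using f by (auto simp: L2_on_def L2_norm_on_def power_mult_distrib real_sqrt_mult)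

lemma L2_diff:
  fixes f g :: "real \<Rightarrow> 'v::euclidean_space"
  assumes f: "L2_on S f" and g: "L2_on S g"
  shows L2_on_diff: "L2_on S (\<lambda>s. f s - g s)"
    and L2_norm_on_triangle_diff: "L2_norm_on S (\<lambda>s. f s - g s) \<le> L2_norm_on S f + L2_norm_on S g"
  using L2_add[OF f L2_on_scaleR[OF g, of "-1"]] L2_norm_on_scaleR[OF g, of "-1"] by auto

lemma L2_on_const: "T \<ge> 0 \<Longrightarrow> L2_on {0..T} (\<lambda>_. c)"
  by (simp add: L2_on_def finite_measure.integrable_const finite_measure_lebesgue_on)

lemma L2_norm_on_const: "T \<ge> 0 \<Longrightarrow> L2_norm_on {0..T} (\<lambda>_. c) = sqrt T * norm c"
  by (simp add: L2_norm_on_def real_sqrt_mult measure_restrict_space)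

lemma L2_imp_L1:
  fixes f :: "real \<Rightarrow> 'v::euclidean_space"
  assumes f: "L2_on {0..T} f" and T: "T \<ge> 0"
  shows L2_imp_integrable: "integrable (lebesgue_on {0..T}) f"
    and L1_le_L2: "(LINT s|lebesgue_on {0..T}. norm (f s)) \<le> sqrt T * L2_norm_on {0..T} f"
proof -
  note [measurable] = L2_on_measurable[OF f]
  note c = L2_Cauchy_Schwarz_norm[OF f L2_on_const[OF T, of "1::real"]]
  show "integrable (lebesgue_on {0..T}) f"
    using c(1) by (simp add: integrable_norm_iff)
  show "(LINT s|lebesgue_on {0..T}. norm (f s)) \<le> sqrt T * L2_norm_on {0..T} f"
    using c(2) T by (simp add: L2_norm_on_const mult.commute)
qed

lemma continuous_imp_L2_on:
  fixes f :: "real \<Rightarrow> 'v::euclidean_space"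
  assumes f: "continuous_on {0..T} f"
  shows "L2_on {0..T} f"
proof -
  have [measurable]: "f \<in> borel_measurable (lebesgue_on {0..T})"
    using f by (intro continuous_imp_measurable_on_sets_lebesgue) auto
  have "bounded (f ` {0..T})"
    using f by (intro compact_imp_bounded compact_continuous_image) auto
  then obtain B where "\<forall>x\<in>f ` {0..T}. norm x \<le> B" unfolding bounded_iff by blast
  then have B: "\<And>s. s \<in> {0..T} \<Longrightarrow> norm (f s) \<le> B" by blast
  have "integrable (lebesgue_on {0..T}) (\<lambda>s. (norm (f s))\<^sup>2)"
    by (rule finite_measure.integrable_const_bound[where B="B\<^sup>2"])
      (use B in \<open>auto simp: finite_measure_lebesgue_on intro!: AE_I2 power_mono\<close>)
  then show ?thesis by (simp add: L2_on_def)
qed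

section \<open>Absolutely continuous functions and linear differential equations\<close>

text \<open>
  Rewriting the indefinite integral as a Lebesgue integral over the fixed interval \<open>[0,1]\<close> makes
  Fubini's theorem applicable.
\<close>

lemma AC_deriv_iff:
  fixes f :: "real \<Rightarrow> 'v::euclidean_space"
  shows "AC_deriv f f' \<longleftrightarrow> integrable (lebesgue_on {0..1}) f' \<and>
    (\<forall>\<xi>\<in>{0..1}. f \<xi> = f 0 + (LINT s|lebesgue_on {0..1}. indicator {0..\<xi>} s *\<^sub>R f' s))"
proof -
  have i: "f' absolutely_integrable_on {0..1} \<longleftrightarrow> integrable (lebesgue_on {0..1}) f'"
    by (simp add: set_integrable_def integrable_restrict_space)
  have "(LINT s|lebesgue_on {0..1}. indicator {0..\<xi>} s *\<^sub>R f' s) = integral {0..\<xi>} f'"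
    if f': "integrable (lebesgue_on {0..1}) f'" and \<xi>: "\<xi> \<in> {0..1}" for \<xi>
  proof -
    have "integrable (lebesgue_on {0..1}) (\<lambda>s. indicator {0..\<xi>} s *\<^sub>R f' s)"
      using f' \<xi> by (intro integrable_mult_indicator) (auto simp: sets_restrict_space_iff)
    then have "((\<lambda>s. indicator {0..\<xi>} s *\<^sub>R f' s) has_integral
        (LINT s|lebesgue_on {0..1}. indicator {0..\<xi>} s *\<^sub>R f' s)) {0..1}"
      by (rule has_integral_integral_lebesgue_on) simp
    then have "((\<lambda>s. if s \<in> {0..\<xi>} then f' s else 0) has_integral
        (LINT s|lebesgue_on {0..1}. indicator {0..\<xi>} s *\<^sub>R f' s)) {0..1}"
      by (simp add: indicator_scaleR_eq_if)
    then have "(f' has_integral (LINT s|lebesgue_on {0..1}. indicator {0..\<xi>} s *\<^sub>R f' s)) {0..\<xi>}"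
      using \<xi> by (subst (asm) has_integral_restrict) auto
    then show ?thesis by (simp add: integral_unique)
  qed
  then show ?thesis unfolding AC_deriv_def i by auto
qed

lemma AC_deriv_integrable: "AC_deriv f f' \<Longrightarrow> integrable (lebesgue_on {0..1}) f'"
  for f :: "real \<Rightarrow> 'v::euclidean_space"
  by (simp add: AC_deriv_iff)

lemma AC_deriv_eq:
  fixes f :: "real \<Rightarrow> 'v::euclidean_space"
  assumes "AC_deriv f f'" "\<xi> \<in> {0..1}"
  shows "f \<xi> = f 0 + (LINT s|lebesgue_on {0..1}. indicator {0..\<xi>} s *\<^sub>R f' s)"
  using assms unfolding AC_deriv_iff by blast

lemma AC_deriv_continuous:
  fixes f :: "real \<Rightarrow> 'v::euclidean_space"
  assumes "AC_deriv f f'"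
  shows "continuous_on {0..1} f"
proof -
  have "continuous_on {0..1} (\<lambda>\<xi>. f 0 + integral {0..\<xi>} f')"
    using assms by (intro continuous_intros indefinite_integral_continuous_1)
      (auto simp: AC_deriv_def absolutely_integrable_on_def)
  then show ?thesis
    by (rule continuous_on_eq) (use assms in \<open>unfold AC_deriv_def, metis\<close>)
qed

lemma AC_deriv_cong_AE:
  fixes f :: "real \<Rightarrow> 'v::euclidean_space"
  assumes "AC_deriv f f'" "f'' \<in> borel_measurable (lebesgue_on {0..1})"
    "AE \<xi> in lebesgue_on {0..1}. f' \<xi> = f'' \<xi>"
  shows "AC_deriv f f''"
proof -
  have [measurable]: "f' \<in> borel_measurable (lebesgue_on {0..1})" "f'' \<in> borel_measurable (lebesgue_on {0..1})"
    using assms by (auto simp: AC_deriv_iff)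
  have "integrable (lebesgue_on {0..1}) f''"
    by (rule integrable_cong_AE_imp[OF AC_deriv_integrable[OF assms(1)]]) (use assms(3) in auto)
  moreover have "(LINT s|lebesgue_on {0..1}. indicator {0..\<xi>} s *\<^sub>R f' s) =
      (LINT s|lebesgue_on {0..1}. indicator {0..\<xi>} s *\<^sub>R f'' s)" if "\<xi> \<in> {0..1}" for \<xi>
  proof (rule integral_cong_AE)
    have [measurable]: "{0..\<xi>} \<in> sets (lebesgue_on {0..1})" using that by (auto simp: sets_restrict_space_iff)
    show "(\<lambda>s. indicator {0..\<xi>} s *\<^sub>R f' s) \<in> borel_measurable (lebesgue_on {0..1})" by measurable
    show "(\<lambda>s. indicator {0..\<xi>} s *\<^sub>R f'' s) \<in> borel_measurable (lebesgue_on {0..1})" by measurable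
  qed (use assms(3) in auto)
  ultimately show ?thesis unfolding AC_deriv_iff using AC_deriv_eq[OF assms(1)] by metis
qed

lemma AC_deriv_diff:
  fixes f :: "real \<Rightarrow> 'v::euclidean_space"
  assumes "AC_deriv f f'" "AC_deriv g g'"
  shows "AC_deriv (\<lambda>\<xi>. f \<xi> - g \<xi>) (\<lambda>\<xi>. f' \<xi> - g' \<xi>)"
  unfolding AC_deriv_iff
proof (intro conjI ballI)
  fix \<xi> :: real assume \<xi>: "\<xi> \<in> {0..1}"
  have "integrable (lebesgue_on {0..1}) (\<lambda>s. indicator {0..\<xi>} s *\<^sub>R f' s)"
    "integrable (lebesgue_on {0..1}) (\<lambda>s. indicator {0..\<xi>} s *\<^sub>R g' s)"
    using assms \<xi> by (auto intro!: integrable_mult_indicator simp: sets_restrict_space_iff AC_deriv_iff)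
  then show "f \<xi> - g \<xi> = f 0 - g 0 + (LINT s|lebesgue_on {0..1}. indicator {0..\<xi>} s *\<^sub>R (f' s - g' s))"
    unfolding AC_deriv_eq[OF assms(1) \<xi>] AC_deriv_eq[OF assms(2) \<xi>] by (simp add: scaleR_diff_right)
qed (use assms in \<open>auto simp: AC_deriv_iff\<close>)

text \<open>
  The product rule holds because \<open>\<integral>\<integral> f'(s) g'(r)\<close> over a square is the sum of the integrals over
  the two triangles \<open>r \<le> s\<close> and \<open>s \<le> r\<close>, in which the inner integral is an increment of \<open>g\<close> and of
  \<open>f\<close>. It is stated for bounded bilinear products, to cover inner products, matrix products and
  matrices applied to vectors.
\<close>

lemma AC_deriv_product:
  fixes f :: "real \<Rightarrow> 'a::euclidean_space" and g :: "real \<Rightarrow> 'b::euclidean_space"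
    and prod :: "'a \<Rightarrow> 'b \<Rightarrow> 'c::euclidean_space"
  assumes bil: "bounded_bilinear prod" and f: "AC_deriv f f'" and g: "AC_deriv g g'"
  shows "AC_deriv (\<lambda>\<xi>. prod (f \<xi>) (g \<xi>)) (\<lambda>\<xi>. prod (f' \<xi>) (g \<xi>) + prod (f \<xi>) (g' \<xi>))"
proof -
  interpret bounded_bilinear prod by (rule bil)
  let ?M = "lebesgue_on {0..1::real}"
  interpret M: finite_measure ?M by (rule finite_measure_lebesgue_on) simp
  interpret pair_sigma_finite ?M ?M ..
  have cont: "continuous_on {0..1} f" "continuous_on {0..1} g"
    using f g by (auto intro: AC_deriv_continuous)
  have if': "integrable ?M f'" and ig': "integrable ?M g'" using f g by (auto simp: AC_deriv_iff)
  have [measurable]: "f \<in> borel_measurable ?M" "g \<in> borel_measurable ?M"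
    "f' \<in> borel_measurable ?M" "g' \<in> borel_measurable ?M"
    using cont if' ig' by (auto intro: continuous_imp_measurable_on_sets_lebesgue)
  have [measurable]: "(\<lambda>x. prod (a x) (b x)) \<in> borel_measurable N"
    if [measurable]: "a \<in> borel_measurable N" "b \<in> borel_measurable N" for a b and N :: "'z measure"
  proof -
    have "(\<lambda>p. prod (fst p) (snd p)) \<in> borel_measurable borel"
      by (intro borel_measurable_continuous_onI continuous_intros continuous_on)
    then have "(\<lambda>p. prod (fst p) (snd p)) \<circ> (\<lambda>x. (a x, b x)) \<in> borel_measurable N"
      by (intro measurable_comp[where N=borel]) measurable
    then show ?thesis by (simp add: o_def)
  qed
  obtain K where K: "K > 0" "\<And>a b. norm (prod a b) \<le> norm a * norm b * K" using pos_bounded by blast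
  have bound: "\<exists>B\<ge>0. \<forall>x\<in>{0..1}. norm (h x) \<le> B" if "continuous_on {0..1} h" for h :: "real \<Rightarrow> 'z::real_normed_vector"
  proof -
    have "bounded (h ` {0..1})" using that by (intro compact_imp_bounded compact_continuous_image) auto
    then obtain B where "\<forall>x\<in>h ` {0..1}. norm x \<le> B" unfolding bounded_iff by blast
    then show ?thesis by (intro exI[of _ "max B 0"]) (auto simp: max.coboundedI1)
  qed
  obtain Bf Bg where Bf: "Bf \<ge> 0" "\<And>x. x \<in> {0..1} \<Longrightarrow> norm (f x) \<le> Bf"
    and Bg: "Bg \<ge> 0" "\<And>x. x \<in> {0..1} \<Longrightarrow> norm (g x) \<le> Bg"
    using bound[OF cont(1)] bound[OF cont(2)] by blast
  have i1: "integrable ?M (\<lambda>x. prod (f' x) (g x))"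
  proof (rule Bochner_Integration.integrable_bound)
    show "integrable ?M (\<lambda>x. norm (f' x) * (Bg * K))" using if' by simp
    show "AE x in ?M. norm (prod (f' x) (g x)) \<le> norm (norm (f' x) * (Bg * K))"
    proof (rule AE_I2)
      fix x assume "x \<in> space ?M"
      then have "norm (f' x) * norm (g x) * K \<le> norm (f' x) * (Bg * K)"
        using Bg K by (auto simp: mult.assoc intro!: mult_left_mono mult_right_mono)
      then show "norm (prod (f' x) (g x)) \<le> norm (norm (f' x) * (Bg * K))"
        using K(2)[of "f' x" "g x"] by (smt (verit) real_norm_def)
    qed
  qed measurable
  have i2: "integrable ?M (\<lambda>x. prod (f x) (g' x))"
  proof (rule Bochner_Integration.integrable_bound)
    show "integrable ?M (\<lambda>x. norm (g' x) * (Bf * K))" using ig' by simp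
    show "AE x in ?M. norm (prod (f x) (g' x)) \<le> norm (norm (g' x) * (Bf * K))"
    proof (rule AE_I2)
      fix x assume "x \<in> space ?M"
      then have "norm (f x) * norm (g' x) * K \<le> Bf * norm (g' x) * K"
        using Bf K by (auto intro!: mult_right_mono)
      then show "norm (prod (f x) (g' x)) \<le> norm (norm (g' x) * (Bf * K))"
        using K(2)[of "f x" "g' x"] by (smt (verit) real_norm_def mult.assoc mult.commute)
    qed
  qed measurable
  have eq: "prod (f \<xi>) (g \<xi>) = prod (f 0) (g 0) +
      (LINT s|?M. indicator {0..\<xi>} s *\<^sub>R (prod (f' s) (g s) + prod (f s) (g' s)))" if \<xi>: "\<xi> \<in> {0..1}" for \<xi>
  proof -
    (* The derivatives are cut off at \<xi>, so that the square [0,\<xi>] x [0,\<xi>] may be replaced by the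
       unit square. *)
    define \<phi> \<gamma> where "\<phi> s = indicator {0..\<xi>} s *\<^sub>R f' s" and "\<gamma> s = indicator {0..\<xi>} s *\<^sub>R g' s" for s
    have [measurable]: "{0..\<xi>} \<in> sets ?M" using \<xi> by (auto simp: sets_restrict_space_iff)
    have i\<phi>: "integrable ?M \<phi>" and i\<gamma>: "integrable ?M \<gamma>"
      unfolding \<phi>_def \<gamma>_def by (auto intro!: integrable_mult_indicator if' ig')
    have [measurable]: "\<phi> \<in> borel_measurable ?M" "\<gamma> \<in> borel_measurable ?M"
      using i\<phi> i\<gamma> by auto
    have [measurable]: "(\<lambda>x. x) \<in> borel_measurable ?M" using id_borel_measurable_lebesgue_on by (simp add: id_def)
    have ind: "integrable ?M (\<lambda>r. indicator X r *\<^sub>R k r)"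
      if "integrable ?M k" and [measurable]: "X \<in> sets borel" for k :: "real \<Rightarrow> 'z::{banach,second_countable_topology}" and X :: "real set"
    proof (rule Bochner_Integration.integrable_bound[OF that(1)])
      have [measurable]: "(\<lambda>r. indicator X r :: real) \<in> borel_measurable ?M"
        by (rule measurable_compose[of "\<lambda>x. x" ?M borel "indicator X"]) measurable
      have [measurable]: "k \<in> borel_measurable ?M" using that by auto
      show "(\<lambda>r. indicator X r *\<^sub>R k r) \<in> borel_measurable ?M" by measurable
    qed (auto simp: indicator_def)
    have F: "f s = f 0 + (LINT r|?M. indicator {..s} r *\<^sub>R \<phi> r)" if "s \<in> {0..\<xi>}" for s
    proof -
      have "f s = f 0 + (LINT r|?M. indicator {0..s} r *\<^sub>R f' r)"
        using that \<xi> by (intro AC_deriv_eq[OF f]) auto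
      also have "(LINT r|?M. indicator {0..s} r *\<^sub>R f' r) = (LINT r|?M. indicator {..s} r *\<^sub>R \<phi> r)"
        using that by (intro Bochner_Integration.integral_cong) (auto simp: \<phi>_def indicator_def)
      finally show ?thesis .
    qed
    have G: "g s = g 0 + (LINT r|?M. indicator {..s} r *\<^sub>R \<gamma> r)" if "s \<in> {0..\<xi>}" for s
    proof -
      have "g s = g 0 + (LINT r|?M. indicator {0..s} r *\<^sub>R g' r)"
        using that \<xi> by (intro AC_deriv_eq[OF g]) auto
      also have "(LINT r|?M. indicator {0..s} r *\<^sub>R g' r) = (LINT r|?M. indicator {..s} r *\<^sub>R \<gamma> r)"
        using that by (intro Bochner_Integration.integral_cong) (auto simp: \<gamma>_def indicator_def)
      finally show ?thesis .
    qed
    have F1: "f \<xi> = f 0 + (LINT r|?M. \<phi> r)"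
    proof -
      have "(LINT r|?M. indicator {..\<xi>} r *\<^sub>R \<phi> r) = (LINT r|?M. \<phi> r)"
        by (intro Bochner_Integration.integral_cong) (auto simp: \<phi>_def indicator_def)
      then show ?thesis using F[of \<xi>] \<xi> by simp
    qed
    have G1: "g \<xi> = g 0 + (LINT r|?M. \<gamma> r)"
    proof -
      have "(LINT r|?M. indicator {..\<xi>} r *\<^sub>R \<gamma> r) = (LINT r|?M. \<gamma> r)"
        by (intro Bochner_Integration.integral_cong) (auto simp: \<gamma>_def indicator_def)
      then show ?thesis using G[of \<xi>] \<xi> by simp
    qed
    define p where "p s r = prod (\<phi> s) (\<gamma> r)" for s r
    have ip: "integrable (?M \<Otimes>\<^sub>M ?M) (\<lambda>(s, r). p s r)"
    proof (rule Bochner_Integration.integrable_bound)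
      show "integrable (?M \<Otimes>\<^sub>M ?M) (\<lambda>(s, r). norm (\<phi> s) * norm (\<gamma> r) * K)"
      proof (rule Fubini_integrable)
        show "integrable ?M (\<lambda>s. LINT r|?M. norm (case (s, r) of (s, r) \<Rightarrow> norm (\<phi> s) * norm (\<gamma> r) * K))"
          using i\<phi> i\<gamma> by (simp add: abs_mult)
        show "AE s in ?M. integrable ?M (\<lambda>r. case (s, r) of (s, r) \<Rightarrow> norm (\<phi> s) * norm (\<gamma> r) * K)"
          using i\<gamma> by simp
      qed measurable
      show "AE x in ?M \<Otimes>\<^sub>M ?M. norm (case x of (s, r) \<Rightarrow> p s r)
          \<le> norm (case x of (s, r) \<Rightarrow> norm (\<phi> s) * norm (\<gamma> r) * K)"
        using K by (intro AE_I2) (auto simp: p_def abs_mult)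
    qed (unfold p_def, measurable)
    have ip1: "integrable (?M \<Otimes>\<^sub>M ?M) (\<lambda>(s, r). indicator {..s} r *\<^sub>R p s r)"
      by (rule Bochner_Integration.integrable_bound[OF ip])
        (unfold p_def, measurable, auto simp: indicator_def)
    have ip2: "integrable (?M \<Otimes>\<^sub>M ?M) (\<lambda>(s, r). indicator {s..} r *\<^sub>R p s r)"
      by (rule Bochner_Integration.integrable_bound[OF ip])
        (unfold p_def, measurable, auto simp: indicator_def)
    (* Lower triangle: the integral over r is the increment of g from 0 to s. *)
    have eq1: "(LINT s|?M. indicator {0..\<xi>} s *\<^sub>R prod (f' s) (g s)) =
        prod (LINT s|?M. \<phi> s) (g 0) + (LINT s|?M. LINT r|?M. indicator {..s} r *\<^sub>R p s r)"
    proof -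
      have "(LINT s|?M. indicator {0..\<xi>} s *\<^sub>R prod (f' s) (g s)) =
          (LINT s|?M. prod (\<phi> s) (g 0) + (LINT r|?M. indicator {..s} r *\<^sub>R p s r))"
      proof (rule Bochner_Integration.integral_cong[OF refl])
        fix s
        have "indicator {0..\<xi>} s *\<^sub>R prod (f' s) (g s) = prod (\<phi> s) (g 0 + (LINT r|?M. indicator {..s} r *\<^sub>R \<gamma> r))"
          using G[of s] by (cases "s \<in> {0..\<xi>}") (simp_all add: \<phi>_def zero_left)
        also have "\<dots> = prod (\<phi> s) (g 0) + prod (\<phi> s) (LINT r|?M. indicator {..s} r *\<^sub>R \<gamma> r)"
          by (rule add_right)
        also have "prod (\<phi> s) (LINT r|?M. indicator {..s} r *\<^sub>R \<gamma> r) =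
            (LINT r|?M. prod (\<phi> s) (indicator {..s} r *\<^sub>R \<gamma> r))"
          by (intro integral_bounded_linear[symmetric] bounded_linear_right ind i\<gamma>) simp
        finally show "indicator {0..\<xi>} s *\<^sub>R prod (f' s) (g s) =
            prod (\<phi> s) (g 0) + (LINT r|?M. indicator {..s} r *\<^sub>R p s r)"
          by (simp add: p_def scaleR_right)
      qed
      also have "\<dots> = (LINT s|?M. prod (\<phi> s) (g 0)) + (LINT s|?M. LINT r|?M. indicator {..s} r *\<^sub>R p s r)"
        by (intro Bochner_Integration.integral_add integrable_bounded_linear[OF bounded_linear_left] i\<phi>)
          (use integrable_fst'[OF ip1] in simp)
      also have "(LINT s|?M. prod (\<phi> s) (g 0)) = prod (LINT s|?M. \<phi> s) (g 0)"
        by (intro integral_bounded_linear bounded_linear_left i\<phi>)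
      finally show ?thesis .
    qed
    (* Upper triangle: the integral over s is the increment of f from 0 to r; then the integrals are
       exchanged. *)
    have eq2: "(LINT r|?M. indicator {0..\<xi>} r *\<^sub>R prod (f r) (g' r)) =
        prod (f 0) (LINT r|?M. \<gamma> r) + (LINT s|?M. LINT r|?M. indicator {s..} r *\<^sub>R p s r)"
    proof -
      have "(LINT r|?M. indicator {0..\<xi>} r *\<^sub>R prod (f r) (g' r)) =
          (LINT r|?M. prod (f 0) (\<gamma> r) + (LINT s|?M. indicator {s..} r *\<^sub>R p s r))"
      proof (rule Bochner_Integration.integral_cong[OF refl])
        fix r
        have "indicator {0..\<xi>} r *\<^sub>R prod (f r) (g' r) = prod (f 0 + (LINT s|?M. indicator {..r} s *\<^sub>R \<phi> s)) (\<gamma> r)"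
          using F[of r] by (cases "r \<in> {0..\<xi>}") (simp_all add: \<gamma>_def zero_right)
        also have "\<dots> = prod (f 0) (\<gamma> r) + prod (LINT s|?M. indicator {..r} s *\<^sub>R \<phi> s) (\<gamma> r)"
          by (rule add_left)
        also have "prod (LINT s|?M. indicator {..r} s *\<^sub>R \<phi> s) (\<gamma> r) =
            (LINT s|?M. prod (indicator {..r} s *\<^sub>R \<phi> s) (\<gamma> r))"
          by (intro integral_bounded_linear[symmetric] bounded_linear_left ind i\<phi>) simp
        also have "\<dots> = (LINT s|?M. indicator {s..} r *\<^sub>R p s r)"
          by (intro Bochner_Integration.integral_cong) (auto simp: p_def scaleR_left indicator_def zero_left)
        finally show "indicator {0..\<xi>} r *\<^sub>R prod (f r) (g' r) =
            prod (f 0) (\<gamma> r) + (LINT s|?M. indicator {s..} r *\<^sub>R p s r)" .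
      qed
      also have "\<dots> = (LINT r|?M. prod (f 0) (\<gamma> r)) + (LINT r|?M. LINT s|?M. indicator {s..} r *\<^sub>R p s r)"
        by (intro Bochner_Integration.integral_add integrable_bounded_linear[OF bounded_linear_right] i\<gamma>)
          (rule integrable_snd[OF ip2])
      also have "(LINT r|?M. prod (f 0) (\<gamma> r)) = prod (f 0) (LINT r|?M. \<gamma> r)"
        by (intro integral_bounded_linear bounded_linear_right i\<gamma>)
      also have "(LINT r|?M. LINT s|?M. indicator {s..} r *\<^sub>R p s r) = (LINT s|?M. LINT r|?M. indicator {s..} r *\<^sub>R p s r)"
        by (rule Fubini_integral[OF ip2])
      finally show ?thesis .
    qed
    have "(LINT s|?M. LINT r|?M. indicator {..s} r *\<^sub>R p s r) + (LINT s|?M. LINT r|?M. indicator {s..} r *\<^sub>R p s r)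
        = (LINT s|?M. (LINT r|?M. indicator {..s} r *\<^sub>R p s r) + (LINT r|?M. indicator {s..} r *\<^sub>R p s r))"
      using integrable_fst'[OF ip1] integrable_fst'[OF ip2] by (intro Bochner_Integration.integral_add[symmetric]) auto
    also have "\<dots> = (LINT s|?M. prod (\<phi> s) (LINT r|?M. \<gamma> r))"
    proof (rule Bochner_Integration.integral_cong[OF refl])
      fix s assume s: "s \<in> space ?M"
      have ipr: "integrable ?M (p s)"
        unfolding p_def by (intro integrable_bounded_linear[OF bounded_linear_right] i\<gamma>)
      have "(LINT r|?M. indicator {..s} r *\<^sub>R p s r) + (LINT r|?M. indicator {s..} r *\<^sub>R p s r) =
          (LINT r|?M. indicator {..s} r *\<^sub>R p s r + indicator {s..} r *\<^sub>R p s r)"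
        using ipr by (intro Bochner_Integration.integral_add[symmetric] ind) auto
      also have "\<dots> = (LINT r|?M. p s r)"
      proof (rule integral_cong_AE)
        have "AE r in lebesgue. r \<noteq> s"
          by (metis AE_completion AE_lborel_singleton)
        then have "AE r in ?M. r \<noteq> s" by (auto simp: AE_restrict_space_iff elim: eventually_mono)
        then show "AE r in ?M. indicator {..s} r *\<^sub>R p s r + indicator {s..} r *\<^sub>R p s r = p s r"
          by eventually_elim (auto simp: indicator_def)
      qed (unfold p_def, measurable)
      also have "\<dots> = prod (\<phi> s) (LINT r|?M. \<gamma> r)"
        unfolding p_def by (intro integral_bounded_linear bounded_linear_right i\<gamma>)
      finally show "(LINT r|?M. indicator {..s} r *\<^sub>R p s r) + (LINT r|?M. indicator {s..} r *\<^sub>R p s r) =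
        prod (\<phi> s) (LINT r|?M. \<gamma> r)" .
    qed
    also have "\<dots> = prod (LINT s|?M. \<phi> s) (LINT r|?M. \<gamma> r)"
      by (intro integral_bounded_linear bounded_linear_left i\<phi>)
    finally have eq3: "(LINT s|?M. LINT r|?M. indicator {..s} r *\<^sub>R p s r) +
        (LINT s|?M. LINT r|?M. indicator {s..} r *\<^sub>R p s r) = prod (LINT s|?M. \<phi> s) (LINT r|?M. \<gamma> r)" .
    have "(LINT s|?M. indicator {0..\<xi>} s *\<^sub>R (prod (f' s) (g s) + prod (f s) (g' s))) =
        (LINT s|?M. indicator {0..\<xi>} s *\<^sub>R prod (f' s) (g s)) + (LINT s|?M. indicator {0..\<xi>} s *\<^sub>R prod (f s) (g' s))"
      unfolding scaleR_add_right
      by (intro Bochner_Integration.integral_add integrable_mult_indicator i1 i2) measurable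
    also have "\<dots> = prod (LINT s|?M. \<phi> s) (g 0) + prod (f 0) (LINT r|?M. \<gamma> r) + prod (LINT s|?M. \<phi> s) (LINT r|?M. \<gamma> r)"
      unfolding eq1 eq2 eq3[symmetric] by simp
    finally show ?thesis by (simp add: F1 G1 add_left add_right)
  qed
  show ?thesis
    unfolding AC_deriv_iff by (intro conjI ballI Bochner_Integration.integrable_add i1 i2 eq)
qed

text \<open>
  The product of \<open>exp (- M x)\<close> and \<open>\<integral>\<^sub>0\<^sup>x h\<close> is decreasing. The conclusion \<open>h \<le> 0\<close> rather than an
  exponential bound suffices, since it is applied to norms of differences of solutions.
\<close>

lemma Gronwall_forward:
  fixes h :: "real \<Rightarrow> real"
  assumes h: "continuous_on {0..b} h" and M: "M \<ge> 0"
    and le: "\<And>x. x \<in> {0..b} \<Longrightarrow> h x \<le> M * integral {0..x} h" and x: "x \<in> {0..b}"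
  shows "h x \<le> 0"
proof -
  define H where "H x = exp (- M * x) * integral {0..x} h" for x
  have "H x \<le> H 0"
  proof (rule DERIV_nonpos_imp_decreasing_open[of 0 x])
    show "0 \<le> x" using x by simp
  next
    fix y assume y: "0 < y" "y < x"
    have "((\<lambda>x. integral {0..x} h) has_vector_derivative h y) (at y within {0..b})"
      using y x by (intro integral_has_vector_derivative h) auto
    then have d: "((\<lambda>x. integral {0..x} h) has_real_derivative h y) (at y)"
      using y x by (simp add: has_real_derivative_iff_has_vector_derivative at_within_Icc_at)
    have "(H has_real_derivative exp (- M * y) * (h y - M * integral {0..y} h)) (at y)"
      unfolding H_def by (auto intro!: derivative_eq_intros d simp: algebra_simps)
    moreover have "exp (- M * y) * (h y - M * integral {0..y} h) \<le> 0"
      using le[of y] y x by (simp add: mult_le_0_iff)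
    ultimately show "\<exists>z. (H has_real_derivative z) (at y) \<and> z \<le> 0" by blast
  next
    have "continuous_on {0..b} H"
      unfolding H_def using h by (intro continuous_intros indefinite_integral_continuous_1 integrable_continuous_real)
    then show "continuous_on {0..x} H" by (rule continuous_on_subset) (use x in auto)
  qed
  then have "integral {0..x} h \<le> 0" by (simp add: H_def mult_le_0_iff)
  then have "M * integral {0..x} h \<le> 0" using M by (simp add: mult_le_0_iff)
  then show ?thesis using le[OF x] by linarith
qed

lemma Gronwall_backward:
  fixes h :: "real \<Rightarrow> real"
  assumes h: "continuous_on {0..b} h" and M: "M \<ge> 0"
    and le: "\<And>x. x \<in> {0..b} \<Longrightarrow> h x \<le> M * integral {x..b} h" and x: "x \<in> {0..b}"
  shows "h x \<le> 0"
proof -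
  have "((\<lambda>s. h (b - s)) has_integral integral {b - y..b} h) {0..y}" if "y \<in> {0..b}" for y
  proof -
    have "(h has_integral integral {b - y..b} h) {b - y..b}"
      using that by (intro integrable_integral integrable_continuous_real continuous_on_subset[OF h]) auto
    then have "((\<lambda>s. h (- 1 *\<^sub>R s + b)) has_integral (1 / \<bar>- 1\<bar>) *\<^sub>R integral {b - y..b} h) ((\<lambda>s. (1 / - 1) *\<^sub>R s + - ((1 / - 1) *\<^sub>R b)) ` {b - y..b})"
      using has_integral_affinity[of h "integral {b - y..b} h" "b - y" b "-1" b] that by auto
    moreover have "(\<lambda>s. (1 / - 1) *\<^sub>R s + - ((1 / - 1) *\<^sub>R b)) ` {b - y..b} = {0..y}"
    proof -
      have "(\<lambda>s. b - s) ` {b - y..b} = {0..y}"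
        using image_minus_const_atLeastAtMost'[of b "b - y" b] by simp
      then show ?thesis by simp
    qed
    ultimately show ?thesis by simp
  qed
  then have *: "integral {0..y} (\<lambda>s. h (b - s)) = integral {b - y..b} h" if "y \<in> {0..b}" for y
    using that by (simp add: integral_unique)
  have "h (b - (b - x)) \<le> 0"
  proof (rule Gronwall_forward[of b "\<lambda>s. h (b - s)" M])
    show "continuous_on {0..b} (\<lambda>s. h (b - s))"
      by (intro continuous_on_compose2[OF h] continuous_intros) auto
    fix y assume y: "y \<in> {0..b}"
    then show "h (b - y) \<le> M * integral {0..y} (\<lambda>s. h (b - s))" using le[of "b - y"] by (simp add: *)
  qed (use M x in auto)
  then show ?thesis by simp
qed

lemma bounded_bilinear_matrix_vector_mult:
  "bounded_bilinear ((*v) :: 'k::real_or_complex ^ 'n ^ 'm \<Rightarrow> 'k ^ 'n \<Rightarrow> 'k ^ 'm)"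
  unfolding bilinear_conv_bounded_bilinear[symmetric]
  unfolding bilinear_def
  by (intro allI conjI linearI)
    (simp_all add: vec_eq_iff matrix_vector_mult_def algebra_simps sum.distrib scaleR_sum_right)

lemma bounded_bilinear_matrix_matrix_mult:
  "bounded_bilinear ((**) :: 'k::real_or_complex ^ 'n ^ 'm \<Rightarrow> 'k ^ 'p ^ 'n \<Rightarrow> 'k ^ 'p ^ 'm)"
  unfolding bilinear_conv_bounded_bilinear[symmetric]
  unfolding bilinear_def
  by (intro allI conjI linearI)
    (simp_all add: vec_eq_iff matrix_matrix_mult_def algebra_simps sum.distrib scaleR_sum_right)

lemma AC_deriv_const: "AC_deriv (\<lambda>_. c) (\<lambda>_. 0)"
  by (simp add: AC_deriv_iff)

lemma AC_deriv_cong: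
  fixes f g :: "real \<Rightarrow> 'v::euclidean_space"
  assumes "AC_deriv f f'" and "\<And>\<xi>. \<xi> \<in> {0..1} \<Longrightarrow> f \<xi> = g \<xi>"
  shows "AC_deriv g f'"
proof -
  have "g \<xi> = g 0 + (LINT s|lebesgue_on {0..1}. indicator {0..\<xi>} s *\<^sub>R f' s)" if "\<xi> \<in> {0..1}" for \<xi>
    using AC_deriv_eq[OF assms(1) that] assms(2)[of \<xi>] assms(2)[of 0] that by simp
  then show ?thesis unfolding AC_deriv_iff using AC_deriv_integrable[OF assms(1)] by blast
qed

lemma AC_deriv_integral:
  fixes f :: "real \<Rightarrow> 'v::euclidean_space"
  assumes f: "AC_deriv f f'" and "0 \<le> x" "x \<le> y" "y \<le> 1"
  shows "f' integrable_on {x..y}" and "f y - f x = integral {x..y} f'"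
proof -
  have i: "f' integrable_on {0..1}"
    using f by (auto simp: AC_deriv_def absolutely_integrable_on_def)
  show "f' integrable_on {x..y}"
    by (rule integrable_on_subinterval[OF i]) (use assms in auto)
  have "integral {0..x} f' + integral {x..y} f' = integral {0..y} f'"
    by (rule Henstock_Kurzweil_Integration.integral_combine)
      (use assms in \<open>auto intro: integrable_on_subinterval[OF i]\<close>)
  moreover have "f x = f 0 + integral {0..x} f'"
    by (rule bspec[OF conjunct2[OF f[unfolded AC_deriv_def]]]) (use assms in auto)
  moreover have "f y = f 0 + integral {0..y} f'"
    by (rule bspec[OF conjunct2[OF f[unfolded AC_deriv_def]]]) (use assms in auto)
  ultimately show "f y - f x = integral {x..y} f'" by (simp add: algebra_simps)
qed

lemma matrix_inv_cancel:
  assumes "invertible A"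
  shows matrix_inv_right: "A ** matrix_inv A = mat 1" and matrix_inv_left: "matrix_inv A ** A = mat 1"
  unfolding matrix_inv_def using someI_ex[OF assms[unfolded invertible_def]] by auto

text \<open>Cramer's rule expresses each entry as a quotient of determinants.\<close>

lemma continuous_on_matrix_inv:
  fixes P :: "'t::topological_space \<Rightarrow> 'k::real_normed_field ^ 'n ^ 'n"
  assumes P: "continuous_on S P" and inv: "\<And>t. t \<in> S \<Longrightarrow> invertible (P t)"
  shows "continuous_on S (\<lambda>t. matrix_inv (P t))"
proof -
  have cdet: "continuous_on S (\<lambda>t. det (X t :: 'k ^ 'n ^ 'n))"
    if "\<And>i j. continuous_on S (\<lambda>t. X t $ i $ j)" for X
    unfolding det_def by (intro continuous_intros that)
  have cP: "continuous_on S (\<lambda>t. P t $ i $ j)" for i j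
    by (intro continuous_intros P)
  have entry: "matrix_inv (P t) $ k $ i = det (\<chi> r c. if c = k then axis i 1 $ r else P t $ r $ c) / det (P t)"
    if "t \<in> S" for t k i
  proof -
    have "P t ** matrix_inv (P t) = mat 1" using inv[OF that] by (simp add: matrix_inv_right)
    then have "P t *v (matrix_inv (P t) *v axis i 1) = axis i 1"
      by (simp add: matrix_vector_mul_assoc)
    moreover have "det (P t) \<noteq> 0" using inv[OF that] by (simp add: invertible_det_nz)
    ultimately have "matrix_inv (P t) *v axis i 1 =
        (\<chi> k. det (\<chi> r c. if c = k then axis i 1 $ r else P t $ r $ c) / det (P t))"
      by (simp add: cramer)
    moreover have "(matrix_inv (P t) *v axis i 1) $ k = matrix_inv (P t) $ k $ i"
      by (simp add: matrix_vector_mul_component inner_vec_def matrix_vector_mult_def axis_def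
          if_distrib[where f="\<lambda>x. _ * x"] cong: if_cong)
    ultimately show ?thesis by simp
  qed
  have quot: "continuous_on S (\<lambda>t. det (\<chi> r c. if c = k then axis i 1 $ r else P t $ r $ c) / det (P t))" for k i
  proof (rule continuous_on_divide)
    show "continuous_on S (\<lambda>t. det (\<chi> r c. if c = k then axis i 1 $ r else P t $ r $ c))"
    proof (rule cdet)
      fix i' j
      show "continuous_on S (\<lambda>t. (\<chi> r c. if c = k then axis i 1 $ r else P t $ r $ c) $ i' $ j)"
        by (cases "j = k") (simp_all add: cP)
    qed
  qed (use inv in \<open>auto intro!: cdet cP simp: invertible_det_nz\<close>)
  have "continuous_on S (\<lambda>t. matrix_inv (P t) $ k $ i)" for k i
    by (rule continuous_on_eq[OF quot[of k i]]) (simp add: entry)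
  then have "continuous_on S (\<lambda>t. \<chi> k i. matrix_inv (P t) $ k $ i)"
    by (intro continuous_on_vec_lambda)
  then show ?thesis by (simp add: vec_lambda_eta)
qed

text \<open>
  A vector in the kernel of \<open>P \<xi>\<close> starts a solution \<open>P v\<close> that vanishes at \<open>\<xi>\<close>. By uniqueness
  backwards in \<open>\<xi>\<close> it vanishes at \<open>0\<close>, where \<open>P\<close> is the identity.
\<close>

lemma linear_ode_invertible:
  fixes P0 P :: "real \<Rightarrow> 'k::real_or_complex ^ 'n ^ 'n"
  assumes P: "P 0 = mat 1" "AC_deriv P (\<lambda>\<xi>. P0 \<xi> ** P \<xi>)"
    and M: "\<And>\<xi>. norm (P0 \<xi>) \<le> M" and \<xi>: "\<xi> \<in> {0..1}"
  shows "invertible (P \<xi>)"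
proof -
  obtain K where K: "K > 0" "\<And>(A::'k^'n^'n) v. norm (A *v v) \<le> norm A * norm v * K"
    using bounded_bilinear.pos_bounded[OF bounded_bilinear_matrix_vector_mult] by blast
  have M0: "M \<ge> 0" using M[of 0] norm_ge_zero order_trans by blast
  have "v = 0" if v: "P \<xi> *v v = 0" for v
  proof -
    define p where "p \<eta> = P \<eta> *v v" for \<eta>
    have "AC_deriv p (\<lambda>\<eta>. (P0 \<eta> ** P \<eta>) *v v + P \<eta> *v 0)"
      unfolding p_def by (intro AC_deriv_product[OF bounded_bilinear_matrix_vector_mult] P AC_deriv_const)
    then have p: "AC_deriv p (\<lambda>\<eta>. P0 \<eta> *v p \<eta>)"
      by (simp add: p_def matrix_vector_mul_assoc)
    have cp: "continuous_on {0..1} p" by (rule AC_deriv_continuous[OF p])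
    have "norm (p 0) \<le> 0"
    proof (rule Gronwall_backward[of \<xi> "\<lambda>\<eta>. norm (p \<eta>)" "M * K"])
      show "continuous_on {0..\<xi>} (\<lambda>\<eta>. norm (p \<eta>))"
        using \<xi> by (intro continuous_intros continuous_on_subset[OF cp]) auto
      fix \<eta> assume \<eta>: "\<eta> \<in> {0..\<xi>}"
      have i: "(\<lambda>s. norm (p s)) integrable_on {\<eta>..\<xi>}"
        using \<xi> \<eta> by (intro integrable_continuous_real continuous_intros continuous_on_subset[OF cp]) auto
      have "norm (p \<eta>) = norm (p \<xi> - p \<eta>)" using v by (simp add: p_def)
      also have "\<dots> = norm (integral {\<eta>..\<xi>} (\<lambda>s. P0 s *v p s))"
        using \<xi> \<eta> by (subst AC_deriv_integral(2)[OF p]) auto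
      also have "\<dots> \<le> integral {\<eta>..\<xi>} (\<lambda>s. M * K * norm (p s))"
      proof (rule integral_norm_bound_integral)
        show "(\<lambda>s. P0 s *v p s) integrable_on {\<eta>..\<xi>}"
          using \<xi> \<eta> by (intro AC_deriv_integral(1)[OF p]) auto
        show "(\<lambda>s. M * K * norm (p s)) integrable_on {\<eta>..\<xi>}"
          using integrable_on_mult_right[OF i, of "M * K"] by simp
        fix s
        have "norm (P0 s) * norm (p s) * K \<le> M * norm (p s) * K"
          using K M by (intro mult_right_mono) auto
        then show "norm (P0 s *v p s) \<le> M * K * norm (p s)"
          using K(2)[of "P0 s" "p s"] by (simp add: mult_ac)
      qed
      finally show "norm (p \<eta>) \<le> M * K * integral {\<eta>..\<xi>} (\<lambda>s. norm (p s))" by simp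
    qed (use M0 K \<xi> in auto)
    then show "v = 0" by (simp add: p_def P)
  qed
  then show ?thesis by (simp add: invertible_left_inverse matrix_left_invertible_ker)
qed

text \<open>
  Pointwise inversion preserves continuity, but absolute continuity needs an argument. The
  integral \<open>R\<close> of the expected derivative is absolutely continuous, and \<open>R - P\<^sup>-\<^sup>1\<close> multiplied by \<open>P\<close>
  is the integral of a multiple of \<open>R - P\<^sup>-\<^sup>1\<close> itself, hence zero by Gronwall.
\<close>

lemma linear_ode_inverse_bounded:
  fixes P0 P :: "real \<Rightarrow> 'k::real_or_complex ^ 'n ^ 'n"
  assumes P: "P 0 = mat 1" "AC_deriv P (\<lambda>\<xi>. P0 \<xi> ** P \<xi>)"
    and M: "\<And>\<xi>. norm (P0 \<xi>) \<le> M" and P0[measurable]: "P0 \<in> borel_measurable (lebesgue_on {0..1})"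
  shows "AC_deriv (\<lambda>\<xi>. matrix_inv (P \<xi>)) (\<lambda>\<xi>. - (matrix_inv (P \<xi>) ** P0 \<xi>))"
proof -
  let ?M = "lebesgue_on {0..1::real}"
  interpret finite_measure ?M by (rule finite_measure_lebesgue_on) simp
  interpret mm: bounded_bilinear "(**) :: 'k ^ 'n ^ 'n \<Rightarrow> 'k ^ 'n ^ 'n \<Rightarrow> 'k ^ 'n ^ 'n"
    by (rule bounded_bilinear_matrix_matrix_mult)
  obtain K where K: "K > 0" "\<And>(A::'k^'n^'n) (B::'k^'n^'n). norm (A ** B) \<le> norm A * norm B * K"
    using mm.pos_bounded by blast
  have M0: "M \<ge> 0" using M[of 0] norm_ge_zero order_trans by blast
  define Q where "Q \<xi> = matrix_inv (P \<xi>)" for \<xi>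
  have inv: "invertible (P \<xi>)" if "\<xi> \<in> {0..1}" for \<xi>
    using linear_ode_invertible[OF P M that] .
  have QP: "Q \<xi> ** P \<xi> = mat 1" "P \<xi> ** Q \<xi> = mat 1" if "\<xi> \<in> {0..1}" for \<xi>
    using inv[OF that] by (simp_all add: Q_def matrix_inv_left matrix_inv_right)
  have cP: "continuous_on {0..1} P" by (rule AC_deriv_continuous[OF P(2)])
  have cQ: "continuous_on {0..1} Q"
    unfolding Q_def by (rule continuous_on_matrix_inv[OF cP inv])
  have bound: "\<exists>B\<ge>0. \<forall>x\<in>{0..1}. norm (h x) \<le> B" if "continuous_on {0..1} h" for h :: "real \<Rightarrow> 'k ^ 'n ^ 'n"
  proof -
    have "bounded (h ` {0..1})" using that by (intro compact_imp_bounded compact_continuous_image) auto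
    then obtain B where "\<forall>x\<in>h ` {0..1}. norm x \<le> B" unfolding bounded_iff by blast
    then show ?thesis by (intro exI[of _ "max B 0"]) (auto simp: max.coboundedI1)
  qed
  obtain BP BQ where BP: "BP \<ge> 0" "\<And>x. x \<in> {0..1} \<Longrightarrow> norm (P x) \<le> BP"
    and BQ: "BQ \<ge> 0" "\<And>x. x \<in> {0..1} \<Longrightarrow> norm (Q x) \<le> BQ"
    using bound[OF cP] bound[OF cQ] by blast
  have [measurable]: "Q \<in> borel_measurable ?M"
    using cQ by (intro continuous_imp_measurable_on_sets_lebesgue) auto
  have "(\<lambda>p. fst p ** snd p) \<in> borel_measurable (borel :: (('k ^ 'n ^ 'n) \<times> ('k ^ 'n ^ 'n)) measure)"
    by (intro borel_measurable_continuous_onI continuous_intros mm.continuous_on)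
  then have "(\<lambda>p. fst p ** snd p) \<circ> (\<lambda>x. (Q x, P0 x)) \<in> borel_measurable ?M"
    by (intro measurable_comp[where N=borel]) measurable
  then have [measurable]: "(\<lambda>x. Q x ** P0 x) \<in> borel_measurable ?M" by (simp add: o_def)
  have iQP0: "integrable ?M (\<lambda>x. Q x ** P0 x)"
  proof (rule integrable_const_bound[where B="BQ * M * K"])
    show "AE x in ?M. norm (Q x ** P0 x) \<le> BQ * M * K"
    proof (rule AE_I2)
      fix x assume x: "x \<in> space ?M"
      have "norm (Q x) * norm (P0 x) * K \<le> BQ * M * K"
        using x BQ M K M0 by (intro mult_right_mono mult_mono) auto
      then show "norm (Q x ** P0 x) \<le> BQ * M * K" using K(2)[of "Q x" "P0 x"] by linarith
    qed
  qed measurable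
  define R where "R \<xi> = mat 1 + (LINT s|?M. indicator {0..\<xi>} s *\<^sub>R (- (Q s ** P0 s)))" for \<xi>
  have R: "AC_deriv R (\<lambda>\<xi>. - (Q \<xi> ** P0 \<xi>))"
  proof -
    have "(LINT s|?M. indicator {0..0} s *\<^sub>R (- (Q s ** P0 s))) = (0 :: 'k ^ 'n ^ 'n)"
    proof (rule integral_eq_zero_AE)
      have "AE s in lebesgue. s \<noteq> (0::real)" by (metis AE_completion AE_lborel_singleton)
      then show "AE s in ?M. indicator {0..0} s *\<^sub>R (- (Q s ** P0 s)) = (0 :: 'k ^ 'n ^ 'n)"
        by (auto simp: AE_restrict_space_iff elim!: eventually_mono)
    qed
    then have "R 0 = mat 1" unfolding R_def by simp
    then show ?thesis unfolding AC_deriv_iff using iQP0 by (auto simp: R_def)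
  qed
  define S where "S \<xi> = R \<xi> - Q \<xi>" for \<xi>
  have cS: "continuous_on {0..1} S"
    unfolding S_def by (intro continuous_intros cQ AC_deriv_continuous[OF R])
  have RP: "AC_deriv (\<lambda>\<xi>. R \<xi> ** P \<xi>) (\<lambda>\<xi>. S \<xi> ** (P0 \<xi> ** P \<xi>))"
    using AC_deriv_product[OF bounded_bilinear_matrix_matrix_mult R P(2)]
    by (simp add: S_def mm.diff_left mm.minus_left matrix_mul_assoc)
  have "R 0 = mat 1"
  proof -
    have "(LINT s|?M. indicator {0..0} s *\<^sub>R (- (Q s ** P0 s))) = 0"
      using AC_deriv_eq[OF R, of 0] by simp
    then show ?thesis by (simp add: R_def)
  qed
  have S_le: "norm (S \<xi>) \<le> 0" if \<xi>: "\<xi> \<in> {0..1}" for \<xi>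
  proof (rule Gronwall_forward[of 1 "\<lambda>\<xi>. norm (S \<xi>)" "(M * BP * K) * K * BQ * K"])
    show "continuous_on {0..1} (\<lambda>\<xi>. norm (S \<xi>))" by (intro continuous_intros cS)
    fix x :: real assume x: "x \<in> {0..1}"
    have i: "(\<lambda>s. norm (S s)) integrable_on {0..x}"
      using x by (intro integrable_continuous_real continuous_intros continuous_on_subset[OF cS]) auto
    have "S x ** P x = R x ** P x - R 0 ** P 0"
      using x by (simp add: S_def mm.diff_left QP P \<open>R 0 = mat 1\<close>)
    also have "\<dots> = integral {0..x} (\<lambda>s. S s ** (P0 s ** P s))"
      using x by (intro AC_deriv_integral(2)[OF RP]) auto
    finally have SP: "S x ** P x = integral {0..x} (\<lambda>s. S s ** (P0 s ** P s))" .
    have le: "norm (S x ** P x) \<le> integral {0..x} (\<lambda>s. (M * BP * K) * K * norm (S s))"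
      unfolding SP
    proof (rule integral_norm_bound_integral)
      show "(\<lambda>s. S s ** (P0 s ** P s)) integrable_on {0..x}"
        using x by (intro AC_deriv_integral(1)[OF RP]) auto
      show "(\<lambda>s. (M * BP * K) * K * norm (S s)) integrable_on {0..x}"
        using integrable_on_mult_right[OF i, of "(M * BP * K) * K"] by simp
      fix s assume s: "s \<in> {0..x}"
      have "norm (P0 s) * norm (P s) * K \<le> M * BP * K"
        using s x BP M K M0 by (intro mult_right_mono mult_mono) auto
      then have "norm (P0 s ** P s) \<le> M * BP * K" using K(2)[of "P0 s" "P s"] by linarith
      then have "norm (S s) * norm (P0 s ** P s) * K \<le> norm (S s) * (M * BP * K) * K"
        using K by (intro mult_right_mono mult_left_mono) auto
      then show "norm (S s ** (P0 s ** P s)) \<le> (M * BP * K) * K * norm (S s)"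
        using K(2)[of "S s" "P0 s ** P s"] by (simp add: mult_ac)
    qed
    have "norm (S x) = norm ((S x ** P x) ** Q x)"
      using QP(2)[OF x] by (simp flip: matrix_mul_assoc)
    also have "\<dots> \<le> norm (S x ** P x) * norm (Q x) * K" by (rule K(2))
    also have "\<dots> \<le> norm (S x ** P x) * BQ * K"
      using x BQ K by (intro mult_right_mono mult_left_mono) auto
    also have "\<dots> \<le> ((M * BP * K) * K * integral {0..x} (\<lambda>s. norm (S s))) * BQ * K"
      using le BQ K by (intro mult_right_mono) auto
    finally show "norm (S x) \<le> (M * BP * K) * K * BQ * K * integral {0..x} (\<lambda>s. norm (S s))"
      by (simp add: mult_ac)
  qed (use \<xi> M0 BP BQ K in auto)
  have "AC_deriv Q (\<lambda>\<xi>. - (Q \<xi> ** P0 \<xi>))"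
    by (rule AC_deriv_cong[OF R]) (use S_le in \<open>auto simp: S_def\<close>)
  then show ?thesis by (simp add: Q_def[abs_def])
qed

text \<open>
  \<open>Q = P\<^sup>-\<^sup>1\<close> solves the adjoint equation \<open>Q' = - Q P0\<close>. This is what removes \<open>P0\<close> from the
  transport equation.
\<close>

lemma caratheodory_solution_inverse:
  fixes P0 P :: "real \<Rightarrow> 'k::real_or_complex ^ 'n ^ 'n"
  assumes P0: "Linf_on {0..1} P0" and P: "caratheodory_solution P0 P"
  shows "\<xi> \<in> {0..1} \<Longrightarrow> invertible (P \<xi>)"
    and "AC_deriv (\<lambda>\<xi>. matrix_inv (P \<xi>)) (\<lambda>\<xi>. - (matrix_inv (P \<xi>) ** P0 \<xi>))"
proof -
  let ?M = "lebesgue_on {0..1::real}"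
  obtain M where M: "AE s in ?M. norm (P0 s) \<le> M" and [measurable]: "P0 \<in> borel_measurable ?M"
    using P0 by (auto simp: Linf_on_def)
  (* The bound of P0 holds almost everywhere only. The truncation obeys it everywhere and
     satisfies the same equation. *)
  define P0' where "P0' s = (if norm (P0 s) \<le> M then P0 s else 0)" for s
  have [measurable]: "P0' \<in> borel_measurable ?M" unfolding P0'_def by measurable
  have ae: "AE s in ?M. P0 s = P0' s" using M by eventually_elim (simp add: P0'_def)
  have b: "norm (P0' s) \<le> max M 0" for s by (auto simp: P0'_def)
  have P1: "P 0 = mat 1" and P2: "AC_deriv P (\<lambda>\<xi>. P0 \<xi> ** P \<xi>)"
    using P by (auto simp: caratheodory_solution_def)
  have mult: "(\<lambda>x. X x ** Y x) \<in> borel_measurable ?M"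
    if [measurable]: "X \<in> borel_measurable ?M" "Y \<in> borel_measurable ?M"
    for X Y :: "real \<Rightarrow> 'k ^ 'n ^ 'n"
  proof -
    have "(\<lambda>p. fst p ** snd p) \<in> borel_measurable (borel :: (('k ^ 'n ^ 'n) \<times> ('k ^ 'n ^ 'n)) measure)"
      by (intro borel_measurable_continuous_onI continuous_intros
          bounded_bilinear.continuous_on[OF bounded_bilinear_matrix_matrix_mult])
    then have "(\<lambda>p. fst p ** snd p) \<circ> (\<lambda>x. (X x, Y x)) \<in> borel_measurable ?M"
      by (intro measurable_comp[where N=borel]) measurable
    then show ?thesis by (simp add: o_def)
  qed
  have mP: "P \<in> borel_measurable ?M"
    using AC_deriv_continuous[OF P2] by (intro continuous_imp_measurable_on_sets_lebesgue) auto
  have P3: "AC_deriv P (\<lambda>\<xi>. P0' \<xi> ** P \<xi>)"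
    by (rule AC_deriv_cong_AE[OF P2]) (use ae in \<open>auto intro!: mult mP elim!: eventually_mono\<close>)
  show "\<xi> \<in> {0..1} \<Longrightarrow> invertible (P \<xi>)" by (rule linear_ode_invertible[OF P1 P3 b])
  have Q: "AC_deriv (\<lambda>\<xi>. matrix_inv (P \<xi>)) (\<lambda>\<xi>. - (matrix_inv (P \<xi>) ** P0' \<xi>))"
    by (rule linear_ode_inverse_bounded[OF P1 P3 b]) measurable
  have mQ: "(\<lambda>\<xi>. matrix_inv (P \<xi>)) \<in> borel_measurable ?M"
    using AC_deriv_continuous[OF Q] by (intro continuous_imp_measurable_on_sets_lebesgue) auto
  show "AC_deriv (\<lambda>\<xi>. matrix_inv (P \<xi>)) (\<lambda>\<xi>. - (matrix_inv (P \<xi>) ** P0 \<xi>))"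
    by (rule AC_deriv_cong_AE[OF Q]) (use ae in \<open>auto intro!: borel_measurable_uminus mult mQ elim!: eventually_mono\<close>)
qed

section \<open>The travel time\<close>

text \<open>
  A disturbance of the transport equation with speed \<open>l0\<close> needs the time \<open>tau \<xi>\<close> to travel from the
  left end of the interval to \<open>\<xi>\<close>, and the time \<open>period\<close> to cross the whole interval.
\<close>

locale travel_time =
  fixes l0 :: "real \<Rightarrow> real"
  assumes Linf_l0: "Linf_on {0..1} l0"
    and Linf_inverse_l0: "Linf_on {0..1} (\<lambda>\<xi>. inverse (l0 \<xi>))"
    and l0_pos: "AE \<xi> in lebesgue_on {0..1}. 0 < l0 \<xi>"
begin

definition slowness :: "real \<Rightarrow> real" where
  "slowness \<xi> = inverse (l0 \<xi>)"

definition tau :: "real \<Rightarrow> real" where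
  "tau \<xi> = (LINT s|lebesgue_on {0..1}. indicator {0..\<xi>} s *\<^sub>R slowness s)"

definition period :: real where
  "period = tau 1"

lemma slowness_measurable[measurable]: "slowness \<in> borel_measurable (lebesgue_on {0..1})"
  using Linf_inverse_l0 by (simp add: Linf_on_def slowness_def[abs_def])

lemma slowness_bounds_exist:
  "\<exists>m M. 0 < m \<and> 0 < M \<and> (AE \<xi> in lebesgue_on {0..1}. m \<le> slowness \<xi> \<and> slowness \<xi> \<le> M)"
proof -
  obtain M N where M: "AE \<xi> in lebesgue_on {0..1}. norm (inverse (l0 \<xi>)) \<le> M"
    and N: "AE \<xi> in lebesgue_on {0..1}. norm (l0 \<xi>) \<le> N"
    using Linf_l0 Linf_inverse_l0 by (auto simp: Linf_on_def)
  have "AE \<xi> in lebesgue_on {0..1}. inverse (max N 1) \<le> slowness \<xi> \<and> slowness \<xi> \<le> max M 1"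
    using M N l0_pos
  proof eventually_elim
    case (elim \<xi>)
    then have "inverse (max N 1) \<le> inverse (l0 \<xi>)" by (intro le_imp_inverse_le) auto
    then show ?case using elim by (auto simp: slowness_def)
  qed
  then show ?thesis by (intro exI[of _ "inverse (max N 1)"] exI[of _ "max M 1"]) auto
qed

text \<open>
  One pair of essential bounds is fixed, so that the constants in the estimates do not
  depend on the functions to which the estimates are applied.
\<close>

definition slowness_bounds :: "real \<times> real" where
  "slowness_bounds = (SOME p. 0 < fst p \<and> 0 < snd p \<and>
     (AE \<xi> in lebesgue_on {0..1}. fst p \<le> slowness \<xi> \<and> slowness \<xi> \<le> snd p))"

abbreviation "slow_min \<equiv> fst slowness_bounds"
abbreviation "slow_max \<equiv> snd slowness_bounds"

lemma slowness_bounds: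
  shows slow_min_pos: "0 < slow_min" and slow_max_pos: "0 < slow_max"
    and slowness_le: "AE \<xi> in lebesgue_on {0..1}. slowness \<xi> \<le> slow_max"
    and slowness_ge: "AE \<xi> in lebesgue_on {0..1}. slow_min \<le> slowness \<xi>"
proof -
  have "\<exists>p. 0 < fst p \<and> 0 < snd p \<and>
     (AE \<xi> in lebesgue_on {0..1}. fst p \<le> slowness \<xi> \<and> slowness \<xi> \<le> snd p)"
    using slowness_bounds_exist by auto
  then have *: "0 < slow_min \<and> 0 < slow_max \<and>
     (AE \<xi> in lebesgue_on {0..1}. slow_min \<le> slowness \<xi> \<and> slowness \<xi> \<le> slow_max)"
    unfolding slowness_bounds_def by (rule someI_ex)
  then show "0 < slow_min" "0 < slow_max" by auto
  show "AE \<xi> in lebesgue_on {0..1}. slowness \<xi> \<le> slow_max" "AE \<xi> in lebesgue_on {0..1}. slow_min \<le> slowness \<xi>"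
    using * by (auto elim: eventually_mono)
qed

lemma slowness_nonneg: "AE \<xi> in lebesgue_on {0..1}. 0 \<le> slowness \<xi>"
  using slowness_ge by eventually_elim (use slow_min_pos in linarith)

lemma l0_slowness: "AE \<xi> in lebesgue_on {0..1}. l0 \<xi> * slowness \<xi> = 1"
  using l0_pos by eventually_elim (simp add: slowness_def)

lemma slowness_integrable: "integrable (lebesgue_on {0..1}) slowness"
proof -
  interpret finite_measure "lebesgue_on {0..1::real}" by (rule finite_measure_lebesgue_on) simp
  show ?thesis
    by (rule integrable_const_bound[where B=slow_max])
      (use slowness_le slowness_nonneg in \<open>auto elim: eventually_elim2\<close>)
qed

lemma tau_0: "tau 0 = 0"
proof -
  have "AE s in lebesgue. s \<noteq> (0::real)" by (metis AE_completion AE_lborel_singleton)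
  then have "AE s in lebesgue_on {0..1}. indicator {0..0} s *\<^sub>R slowness s = 0"
    by (auto simp: AE_restrict_space_iff elim!: eventually_mono)
  then show ?thesis unfolding tau_def by (rule integral_eq_zero_AE)
qed

lemma AC_deriv_tau: "AC_deriv tau slowness"
  unfolding AC_deriv_iff tau_0 by (simp add: slowness_integrable tau_def)

lemma continuous_on_tau: "continuous_on {0..1} tau"
  by (rule AC_deriv_continuous[OF AC_deriv_tau])

lemma tau_measurable[measurable]: "tau \<in> borel_measurable (lebesgue_on {0..1})"
  using continuous_on_tau by (intro continuous_imp_measurable_on_sets_lebesgue) auto

lemma indicator_slowness_integrable:
  "\<xi> \<le> 1 \<Longrightarrow> 0 \<le> \<eta> \<Longrightarrow> integrable (lebesgue_on {0..1}) (\<lambda>s. indicator {\<eta>..\<xi>} s *\<^sub>R slowness s)"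
  by (intro integrable_mult_indicator slowness_integrable) (auto simp: sets_restrict_space_iff)

lemma tau_diff:
  assumes "0 \<le> \<eta>" "\<eta> \<le> \<xi>" "\<xi> \<le> 1"
  shows "tau \<xi> - tau \<eta> = (LINT s|lebesgue_on {0..1}. indicator {\<eta>..\<xi>} s *\<^sub>R slowness s)"
proof -
  have "tau \<xi> - tau \<eta> = (LINT s|lebesgue_on {0..1}. indicator {0..\<xi>} s *\<^sub>R slowness s - indicator {0..\<eta>} s *\<^sub>R slowness s)"
    using assms by (simp add: tau_def indicator_slowness_integrable del: real_scaleR_def)
  also have "\<dots> = (LINT s|lebesgue_on {0..1}. indicator {\<eta>..\<xi>} s *\<^sub>R slowness s)"
  proof (rule integral_cong_AE)
    show "(\<lambda>s. indicator {0..\<xi>} s *\<^sub>R slowness s - indicator {0..\<eta>} s *\<^sub>R slowness s) \<in> borel_measurable (lebesgue_on {0..1})"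
      using indicator_slowness_integrable[of \<xi> 0] indicator_slowness_integrable[of \<eta> 0] assms
      by (intro borel_measurable_diff) auto
    show "(\<lambda>s. indicator {\<eta>..\<xi>} s *\<^sub>R slowness s) \<in> borel_measurable (lebesgue_on {0..1})"
      using indicator_slowness_integrable[of \<xi> \<eta>] assms by auto
    have "AE s in lebesgue. s \<noteq> \<eta>" by (metis AE_completion AE_lborel_singleton)
    then have "AE s in lebesgue_on {0..1}. s \<noteq> \<eta>"
      by (auto simp: AE_restrict_space_iff elim!: eventually_mono)
    then show "AE s in lebesgue_on {0..1}. indicator {0..\<xi>} s *\<^sub>R slowness s - indicator {0..\<eta>} s *\<^sub>R slowness s =
        indicator {\<eta>..\<xi>} s *\<^sub>R slowness s"
      by eventually_elim (use assms in \<open>auto simp: indicator_def\<close>)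
  qed
  finally show ?thesis .
qed

text \<open>
  The speed is essentially bounded, hence travel takes time. This makes \<open>tau\<close> an increasing
  homeomorphism of \<open>[0,1]\<close> onto \<open>[0,period]\<close>.
\<close>

lemma tau_increment:
  assumes "0 \<le> \<eta>" "\<eta> \<le> \<xi>" "\<xi> \<le> 1"
  shows "slow_min * (\<xi> - \<eta>) \<le> tau \<xi> - tau \<eta>"
proof -
  interpret finite_measure "lebesgue_on {0..1::real}" by (rule finite_measure_lebesgue_on) simp
  have s: "{\<eta>..\<xi>} \<in> sets (lebesgue_on {0..1})" using assms by (auto simp: sets_restrict_space_iff)
  have "slow_min * (\<xi> - \<eta>) = (LINT s|lebesgue_on {0..1}. indicator {\<eta>..\<xi>} s *\<^sub>R slow_min)"
    using assms s by (simp add: measure_restrict_space mult.commute)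
  also have "\<dots> \<le> (LINT s|lebesgue_on {0..1}. indicator {\<eta>..\<xi>} s *\<^sub>R slowness s)"
  proof (rule integral_mono_AE)
    show "integrable (lebesgue_on {0..1}) (\<lambda>s. indicator {\<eta>..\<xi>} s *\<^sub>R slow_min)"
      by (rule integrable_mult_indicator[OF s]) simp
    show "AE s in lebesgue_on {0..1}. indicator {\<eta>..\<xi>} s *\<^sub>R slow_min \<le> indicator {\<eta>..\<xi>} s *\<^sub>R slowness s"
      using slowness_ge by eventually_elim (auto simp: indicator_def)
  qed (use assms in \<open>auto intro: indicator_slowness_integrable simp del: real_scaleR_def\<close>)
  also have "\<dots> = tau \<xi> - tau \<eta>" using assms by (simp add: tau_diff)
  finally show ?thesis .
qed

lemma tau_strict_mono: "0 \<le> \<eta> \<Longrightarrow> \<eta> < \<xi> \<Longrightarrow> \<xi> \<le> 1 \<Longrightarrow> tau \<eta> < tau \<xi>"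
  using tau_increment[of \<eta> \<xi>] slow_min_pos by (smt (verit) mult_pos_pos)

lemma tau_less_iff: "\<eta> \<in> {0..1} \<Longrightarrow> \<xi> \<in> {0..1} \<Longrightarrow> tau \<eta> < tau \<xi> \<longleftrightarrow> \<eta> < \<xi>"
  using tau_strict_mono[of \<eta> \<xi>] tau_strict_mono[of \<xi> \<eta>] by (auto simp: not_less le_less)
   (metis less_irrefl less_trans linorder_neqE)

lemma tau_le_iff: "\<eta> \<in> {0..1} \<Longrightarrow> \<xi> \<in> {0..1} \<Longrightarrow> tau \<eta> \<le> tau \<xi> \<longleftrightarrow> \<eta> \<le> \<xi>"
  using tau_less_iff[of \<xi> \<eta>] by auto

lemma period_pos: "0 < period"
  using tau_strict_mono[of 0 1] by (simp add: period_def tau_0)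

lemma tau_range: "\<xi> \<in> {0..1} \<Longrightarrow> tau \<xi> \<in> {0..period}"
  using tau_le_iff[of 0 \<xi>] tau_le_iff[of \<xi> 1] by (simp add: tau_0 period_def)

lemma tau_surj:
  assumes "c \<in> {0..period}"
  obtains \<xi> where "\<xi> \<in> {0..1}" "tau \<xi> = c"
  using IVT'[of tau 0 c 1] assms continuous_on_tau by (auto simp: tau_0 period_def)

lemma tau_interior: "\<xi> \<in> {0<..<1} \<Longrightarrow> tau \<xi> \<in> {0<..<period}"
  using tau_less_iff[of 0 \<xi>] tau_less_iff[of \<xi> 1] by (simp add: tau_0 period_def)

lemma AE_interior: "AE \<xi> in lebesgue_on {0..1}. \<xi> \<in> {0<..<1::real}"
proof -
  have "AE s in lebesgue. s \<noteq> (0::real)" "AE s in lebesgue. s \<noteq> (1::real)"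
    by (metis AE_completion AE_lborel_singleton)+
  then have *: "AE s in lebesgue. s \<in> {0..1} \<longrightarrow> s \<in> {0<..<1::real}"
    by eventually_elim auto
  show ?thesis by (subst AE_restrict_space_iff) (simp, rule *)
qed

text \<open>
  The substitution rule \<open>d tau = slowness d\<xi>\<close>, stated for measures. As \<open>tau\<close> is only absolutely
  continuous, both sides are compared on the half-lines \<open>{c<..}\<close>, which generate the Borel sets; the
  preimage of such a half-line is an interval, on which the integral of \<open>slowness\<close> is an increment
  of \<open>tau\<close>.
\<close>

lemma distr_tau:
  "distr (density (lebesgue_on {0..1}) (\<lambda>\<xi>. ennreal (slowness \<xi>))) borel tau
    = density lborel (indicator {0..period})"
proof -
  let ?M = "lebesgue_on {0..1::real}"
  let ?N = "distr (density ?M (\<lambda>\<xi>. ennreal (slowness \<xi>))) borel tau"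
  have lhs: "emeasure ?N {c<..} = ennreal (LINT \<xi>|?M. indicator {c<..} (tau \<xi>) *\<^sub>R slowness \<xi>)" for c
  proof -
    have [measurable]: "(\<lambda>\<xi>. indicator {c<..} (tau \<xi>) :: real) \<in> borel_measurable ?M"
      by (rule measurable_compose[OF tau_measurable]) measurable
    have i: "integrable ?M (\<lambda>\<xi>. indicator {c<..} (tau \<xi>) *\<^sub>R slowness \<xi>)"
      by (rule Bochner_Integration.integrable_bound[OF slowness_integrable]) (measurable, auto simp: indicator_def)
    have "emeasure ?N {c<..} = emeasure (density ?M (\<lambda>\<xi>. ennreal (slowness \<xi>))) (tau -` {c<..} \<inter> space ?M)"
      by (subst emeasure_distr) auto
    also have "\<dots> = (\<integral>\<^sup>+\<xi>. ennreal (slowness \<xi>) * indicator (tau -` {c<..} \<inter> space ?M) \<xi> \<partial>?M)"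
      by (rule emeasure_density) (use measurable_sets[OF tau_measurable, of "{c<..}"] in auto)
    also have "\<dots> = (\<integral>\<^sup>+\<xi>. ennreal (indicator {c<..} (tau \<xi>) *\<^sub>R slowness \<xi>) \<partial>?M)"
      by (intro nn_integral_cong) (auto simp: indicator_def)
    also have "\<dots> = ennreal (LINT \<xi>|?M. indicator {c<..} (tau \<xi>) *\<^sub>R slowness \<xi>)"
      using i by (rule nn_integral_eq_integral) (use slowness_nonneg in \<open>eventually_elim, simp\<close>)
    finally show ?thesis .
  qed
  have rhs: "emeasure (density lborel (indicator {0..period})) {c<..} = emeasure lborel ({0..period} \<inter> {c<..})" for c
    by (subst emeasure_density) (auto simp: indicator_inter_arith[symmetric])
  show ?thesis
  proof (rule measure_eqI_lessThan)
    fix c :: real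
    show "emeasure ?N {c<..} < \<infinity>" by (simp add: lhs)
    show "emeasure ?N {c<..} = emeasure (density lborel (indicator {0..period})) {c<..}"
    proof (cases "c < 0")
      case True
      then have "(LINT \<xi>|?M. indicator {c<..} (tau \<xi>) *\<^sub>R slowness \<xi>) = (LINT \<xi>|?M. indicator {0..1} \<xi> *\<^sub>R slowness \<xi>)"
      proof (intro Bochner_Integration.integral_cong refl)
        fix \<xi> assume \<xi>: "\<xi> \<in> space ?M"
        then have "tau \<xi> \<in> {0..period}" by (intro tau_range) simp
        then show "indicator {c<..} (tau \<xi>) *\<^sub>R slowness \<xi> = indicator {0..1} \<xi> *\<^sub>R slowness \<xi>"
          using \<xi> True by (simp add: indicator_def)
      qed
      moreover have "(LINT \<xi>|?M. indicator {0..1} \<xi> *\<^sub>R slowness \<xi>) = period" by (simp add: period_def tau_def)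
      moreover have "{0..period} \<inter> {c<..} = {0..period}" using True by auto
      ultimately show ?thesis using period_pos by (simp add: lhs rhs)
    next
      case False
      show ?thesis
      proof (cases "c \<le> period")
        case True
        then obtain \<eta> where \<eta>: "\<eta> \<in> {0..1}" "tau \<eta> = c" using False tau_surj[of c] by (metis atLeastAtMost_iff linorder_not_less)
        have "(LINT \<xi>|?M. indicator {c<..} (tau \<xi>) *\<^sub>R slowness \<xi>) = (LINT \<xi>|?M. indicator {\<eta>..1} \<xi> *\<^sub>R slowness \<xi>)"
        proof (rule integral_cong_AE)
          have [measurable]: "(\<lambda>\<xi>. indicator {c<..} (tau \<xi>) :: real) \<in> borel_measurable ?M"
            by (rule measurable_compose[OF tau_measurable]) measurable
          show "(\<lambda>\<xi>. indicator {c<..} (tau \<xi>) *\<^sub>R slowness \<xi>) \<in> borel_measurable ?M" by measurable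
          show "(\<lambda>\<xi>. indicator {\<eta>..1} \<xi> *\<^sub>R slowness \<xi>) \<in> borel_measurable ?M"
            using indicator_slowness_integrable[of 1 \<eta>] \<eta> by auto
          have "AE s in lebesgue. s \<noteq> \<eta>" by (metis AE_completion AE_lborel_singleton)
          then have "AE s in lebesgue. s \<in> {0..1} \<longrightarrow>
              indicator {c<..} (tau s) *\<^sub>R slowness s = indicator {\<eta>..1} s *\<^sub>R slowness s"
            by eventually_elim (use \<eta> tau_less_iff[OF \<eta>(1)] in \<open>auto simp: indicator_def\<close>)
          then show "AE s in ?M. indicator {c<..} (tau s) *\<^sub>R slowness s = indicator {\<eta>..1} s *\<^sub>R slowness s"
            by (simp add: AE_restrict_space_iff)
        qed
        also have "\<dots> = period - c" using \<eta> tau_diff[of \<eta> 1] by (simp add: period_def)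
        moreover have "{0..period} \<inter> {c<..} = {c<..period}" using False by auto
        ultimately show ?thesis using True by (simp add: lhs rhs)
      next
        case c: False
        then have "(LINT \<xi>|?M. indicator {c<..} (tau \<xi>) *\<^sub>R slowness \<xi>) = (LINT \<xi>|?M. 0)"
        proof (intro Bochner_Integration.integral_cong refl)
          fix \<xi> assume "\<xi> \<in> space ?M"
          then have "tau \<xi> \<in> {0..period}" by (intro tau_range) simp
          then show "indicator {c<..} (tau \<xi>) *\<^sub>R slowness \<xi> = 0"
            using c by (simp add: indicator_def)
        qed
        moreover have "{0..period} \<inter> {c<..} = {}" using c by auto
        ultimately show ?thesis by (simp add: lhs rhs)
      qed
    qed
  qed auto
qed

lemma change_of_variables:
  fixes f :: "real \<Rightarrow> 'v::euclidean_space"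
  assumes [measurable]: "f \<in> borel_measurable borel"
  shows integrable_change_of_variables: "integrable (lebesgue_on {0..1}) (\<lambda>\<xi>. slowness \<xi> *\<^sub>R f (tau \<xi>)) \<longleftrightarrow>
      integrable lborel (\<lambda>s. indicator {0..period} s *\<^sub>R f s)"
    and integral_change_of_variables: "(LINT \<xi>|lebesgue_on {0..1}. slowness \<xi> *\<^sub>R f (tau \<xi>)) =
      (LINT s|lborel. indicator {0..period} s *\<^sub>R f s)"
proof -
  let ?M = "lebesgue_on {0..1::real}"
  let ?D = "density ?M (\<lambda>\<xi>. ennreal (slowness \<xi>))"
  have [measurable]: "(\<lambda>\<xi>. f (tau \<xi>)) \<in> borel_measurable ?M"
    by (rule measurable_compose[OF tau_measurable]) measurable
  have e: "(\<lambda>x. ennreal (indicator {0..period} x :: real)) = indicator {0..period}"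
    by (auto simp: indicator_def)
  have "integrable ?M (\<lambda>\<xi>. slowness \<xi> *\<^sub>R f (tau \<xi>)) \<longleftrightarrow> integrable ?D (\<lambda>\<xi>. f (tau \<xi>))"
    by (rule integrable_density[symmetric]) (measurable, use slowness_nonneg in auto)
  also have "\<dots> \<longleftrightarrow> integrable (distr ?D borel tau) f"
    by (rule integrable_distr_eq[symmetric]) auto
  also have "\<dots> \<longleftrightarrow> integrable lborel (\<lambda>s. indicator {0..period} s *\<^sub>R f s)"
    unfolding distr_tau using integrable_density[of f lborel "indicator {0..period} :: real \<Rightarrow> real"] by (simp add: e)
  finally show "integrable ?M (\<lambda>\<xi>. slowness \<xi> *\<^sub>R f (tau \<xi>)) \<longleftrightarrow>
      integrable lborel (\<lambda>s. indicator {0..period} s *\<^sub>R f s)" .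
  have "(LINT \<xi>|?M. slowness \<xi> *\<^sub>R f (tau \<xi>)) = (LINT \<xi>|?D. f (tau \<xi>))"
    by (rule integral_density[symmetric]) (measurable, use slowness_nonneg in auto)
  also have "\<dots> = (LINT s|distr ?D borel tau. f s)"
    by (rule integral_distr[symmetric]) auto
  also have "\<dots> = (LINT s|lborel. indicator {0..period} s *\<^sub>R f s)"
    unfolding distr_tau using integral_density[of f lborel "indicator {0..period} :: real \<Rightarrow> real"] by (simp add: e)
  finally show "(LINT \<xi>|?M. slowness \<xi> *\<^sub>R f (tau \<xi>)) = (LINT s|lborel. indicator {0..period} s *\<^sub>R f s)" .
qed

lemma change_of_variables_reflected:
  fixes f :: "real \<Rightarrow> 'v::euclidean_space"
  assumes [measurable]: "f \<in> borel_measurable borel"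
  shows integrable_change_of_variables_reflected: "integrable (lebesgue_on {0..1}) (\<lambda>\<xi>. slowness \<xi> *\<^sub>R f (t - tau \<xi>)) \<longleftrightarrow>
      integrable lborel (\<lambda>s. indicator {t - period..t} s *\<^sub>R f s)"
    and integral_change_of_variables_reflected: "(LINT \<xi>|lebesgue_on {0..1}. slowness \<xi> *\<^sub>R f (t - tau \<xi>)) =
      (LINT s|lborel. indicator {t - period..t} s *\<^sub>R f s)"
proof -
  have ind: "indicator {t - period..t} (t + - 1 * s) = (indicator {0..period} s :: real)" for s
    by (auto simp: indicator_def)
  have m: "(\<lambda>s. f (t - s)) \<in> borel_measurable borel" by measurable
  show "integrable (lebesgue_on {0..1}) (\<lambda>\<xi>. slowness \<xi> *\<^sub>R f (t - tau \<xi>)) \<longleftrightarrow>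
      integrable lborel (\<lambda>s. indicator {t - period..t} s *\<^sub>R f s)"
    unfolding integrable_change_of_variables[OF m]
    using lborel_integrable_real_affine_iff[of "-1" "\<lambda>s. indicator {t - period..t} s *\<^sub>R f s" t] ind by simp
  show "(LINT \<xi>|lebesgue_on {0..1}. slowness \<xi> *\<^sub>R f (t - tau \<xi>)) =
      (LINT s|lborel. indicator {t - period..t} s *\<^sub>R f s)"
    unfolding integral_change_of_variables[OF m]
    using lborel_integral_real_affine[of "-1" "\<lambda>s. indicator {t - period..t} s *\<^sub>R f s" t] ind by simp
qed

text \<open>
  The chain rule along \<open>tau\<close>, obtained from the fundamental theorem of calculus for \<open>\<psi>\<close> by
  the substitution rule. In the time variable the interval is run through backwards, hence the
  minus sign.
\<close>

lemma AC_deriv_travelling: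
  fixes \<psi> \<psi>' :: "real \<Rightarrow> 'v::euclidean_space"
  assumes d: "\<And>s. (\<psi> has_vector_derivative \<psi>' s) (at s)" and c: "continuous_on UNIV \<psi>'"
  shows "AC_deriv (\<lambda>\<xi>. \<psi> (t - tau \<xi>)) (\<lambda>\<xi>. - (slowness \<xi> *\<^sub>R \<psi>' (t - tau \<xi>)))"
proof -
  let ?M = "lebesgue_on {0..1::real}"
  have [measurable]: "\<psi>' \<in> borel_measurable borel" by (rule borel_measurable_continuous_onI[OF c])
  have int: "integrable ?M (\<lambda>\<xi>. slowness \<xi> *\<^sub>R \<psi>' (t - tau \<xi>))"
    unfolding integrable_change_of_variables_reflected[OF \<open>\<psi>' \<in> borel_measurable borel\<close>]
    using borel_integrable_atLeastAtMost'[of "t - period" t \<psi>'] c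
    by (simp add: set_integrable_def continuous_on_subset)
  have eq: "\<psi> (t - tau \<xi>) = \<psi> (t - tau 0) + (LINT s|?M. indicator {0..\<xi>} s *\<^sub>R - (slowness s *\<^sub>R \<psi>' (t - tau s)))"
    if \<xi>: "\<xi> \<in> {0..1}" for \<xi>
  proof -
    have m: "(\<lambda>s. indicator {t - tau \<xi>..} s *\<^sub>R \<psi>' s) \<in> borel_measurable borel" by measurable
    have "(LINT s|?M. indicator {0..\<xi>} s *\<^sub>R - (slowness s *\<^sub>R \<psi>' (t - tau s))) =
        (LINT s|?M. - (slowness s *\<^sub>R (indicator {t - tau \<xi>..} (t - tau s) *\<^sub>R \<psi>' (t - tau s))))"
      using \<xi> tau_le_iff[OF _ \<xi>] by (intro Bochner_Integration.integral_cong) (auto simp: indicator_def)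
    also have "\<dots> = - (LINT s|lborel. indicator {t - period..t} s *\<^sub>R (indicator {t - tau \<xi>..} s *\<^sub>R \<psi>' s))"
      unfolding integral_change_of_variables_reflected[OF m, symmetric]
      by (rule Bochner_Integration.integral_minus)
    also have "(LINT s|lborel. indicator {t - period..t} s *\<^sub>R (indicator {t - tau \<xi>..} s *\<^sub>R \<psi>' s)) =
        (LINT s|lborel. indicator {t - tau \<xi>..t} s *\<^sub>R \<psi>' s)"
      using tau_range[OF \<xi>] by (intro Bochner_Integration.integral_cong) (auto simp: indicator_def)
    also have "\<dots> = \<psi> t - \<psi> (t - tau \<xi>)"
      using tau_range[OF \<xi>] by (intro integral_FTC_Icc)
        (auto intro!: has_vector_derivative_at_within d continuous_on_subset[OF c])
    finally show ?thesis by (simp add: tau_0)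
  qed
  show ?thesis
    unfolding AC_deriv_iff by (intro conjI ballI Bochner_Integration.integrable_minus int eq)
qed

text \<open>
  Read at a fixed time, a travelling function shows its last \<open>period\<close> units of time. So its spatial
  \<open>L\<^sup>2\<close> norm is controlled by the temporal \<open>L\<^sup>2\<close> norm over this window.
\<close>

lemma L2_travelling:
  fixes f :: "real \<Rightarrow> 'v::euclidean_space"
  assumes [measurable]: "f \<in> borel_measurable borel"
    and i: "integrable lborel (\<lambda>s. indicator {t - period..t} s *\<^sub>R (norm (f s))\<^sup>2)"
  shows L2_on_travelling: "L2_on {0..1} (\<lambda>\<xi>. f (t - tau \<xi>))"
    and L2_norm_on_travelling: "(L2_norm_on {0..1} (\<lambda>\<xi>. f (t - tau \<xi>)))\<^sup>2 \<le>
      (LINT s|lborel. indicator {t - period..t} s *\<^sub>R (norm (f s))\<^sup>2) / slow_min"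
proof -
  let ?M = "lebesgue_on {0..1::real}"
  have mf[measurable]: "(\<lambda>\<xi>. f (t - tau \<xi>)) \<in> borel_measurable ?M"
    by (rule measurable_compose[of "\<lambda>\<xi>. t - tau \<xi>" _ borel]) measurable
  have m: "(\<lambda>s. (norm (f s))\<^sup>2) \<in> borel_measurable borel" by measurable
  have i': "integrable ?M (\<lambda>\<xi>. slowness \<xi> *\<^sub>R (norm (f (t - tau \<xi>)))\<^sup>2)"
    using i integrable_change_of_variables_reflected[OF m] by simp
  have le: "AE \<xi> in ?M. slow_min * (norm (f (t - tau \<xi>)))\<^sup>2 \<le> slowness \<xi> *\<^sub>R (norm (f (t - tau \<xi>)))\<^sup>2"
    using slowness_ge by eventually_elim (simp add: mult_right_mono)
  have i2: "integrable ?M (\<lambda>\<xi>. slow_min * (norm (f (t - tau \<xi>)))\<^sup>2)"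
  proof (rule Bochner_Integration.integrable_bound[OF i'])
    show "AE \<xi> in ?M. norm (slow_min * (norm (f (t - tau \<xi>)))\<^sup>2) \<le> norm (slowness \<xi> *\<^sub>R (norm (f (t - tau \<xi>)))\<^sup>2)"
      using le
    proof eventually_elim
      case (elim \<xi>)
      have "0 \<le> slow_min * (norm (f (t - tau \<xi>)))\<^sup>2" using slow_min_pos by simp
      then show ?case using elim unfolding real_norm_def by linarith
    qed
  qed measurable
  then have i3: "integrable ?M (\<lambda>\<xi>. (norm (f (t - tau \<xi>)))\<^sup>2)" using slow_min_pos by simp
  then show "L2_on {0..1} (\<lambda>\<xi>. f (t - tau \<xi>))" by (simp add: L2_on_def mf)
  have "slow_min * (LINT \<xi>|?M. (norm (f (t - tau \<xi>)))\<^sup>2) \<le> (LINT \<xi>|?M. slowness \<xi> *\<^sub>R (norm (f (t - tau \<xi>)))\<^sup>2)"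
    using integral_mono_AE[OF i2 i' le] by simp
  also have "\<dots> = (LINT s|lborel. indicator {t - period..t} s *\<^sub>R (norm (f s))\<^sup>2)"
    by (rule integral_change_of_variables_reflected[OF m])
  finally show "(L2_norm_on {0..1} (\<lambda>\<xi>. f (t - tau \<xi>)))\<^sup>2 \<le>
      (LINT s|lborel. indicator {t - period..t} s *\<^sub>R (norm (f s))\<^sup>2) / slow_min"
    using slow_min_pos by (simp add: L2_norm_on_power2 field_simps)
qed

end

section \<open>Flat functions and their density\<close>

text \<open>
  A smooth function together with all its derivatives, supported in \<open>[0,a]\<close> and flat at both ends.
  Shifted copies by multiples of \<open>a\<close> with arbitrary coefficients fit together smoothly. Carrying the
  derivatives along as a sequence avoids higher derivatives of vector-valued functions.
\<close>

definition flat_jet :: "real \<Rightarrow> (nat \<Rightarrow> real \<Rightarrow> 'w::real_normed_vector) \<Rightarrow> bool" where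
  "flat_jet a D \<longleftrightarrow> (\<forall>i t. (D i has_vector_derivative D (Suc i) t) (at t)) \<and>
     (\<forall>i t. t \<notin> {0<..<a} \<longrightarrow> D i t = 0)"

text \<open>
  The functions \<open>exp (- 1 / (s (a - s))) q(s)\<close> with a polynomial \<open>q\<close>, and their derivatives: each
  differentiation adds two powers of \<open>1 / (s (a - s))\<close> and changes the polynomial.
\<close>

definition flat :: "real \<Rightarrow> nat \<Rightarrow> (real \<Rightarrow> 'w::real_normed_vector) \<Rightarrow> real \<Rightarrow> 'w" where
  "flat a k q s = (if s \<in> {0<..<a}
     then (inverse (s * (a - s)) ^ (2 * k) * exp (- inverse (s * (a - s)))) *\<^sub>R q s else 0)"

lemma power_times_exp_minus_le:
  fixes y :: real
  assumes "y \<ge> 0" "n > 0"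
  shows "y ^ n * exp (- y) \<le> real n ^ n"
proof -
  have "y / n \<le> exp (y / n)" using exp_ge_add_one_self[of "y / n"] by linarith
  then have "(y / n) ^ n \<le> exp (y / n) ^ n" using assms by (intro power_mono) auto
  also have "\<dots> = exp y" using assms by (simp flip: exp_of_nat_mult)
  finally show ?thesis using assms by (simp add: power_divide exp_minus field_simps)
qed

text \<open>
  The exponential beats all powers of \<open>1 / (s (a - s))\<close>. A quadratic zero at the ends is what the
  differentiability there needs.
\<close>

lemma flat_quadratic_bound:
  fixes q :: "real \<Rightarrow> 'w::real_normed_vector"
  assumes "continuous_on {0..a} q"
  obtains C where "C \<ge> 0" "\<And>s. norm (flat a k q s) \<le> C * (s * (a - s))\<^sup>2"
proof -
  have "bounded (q ` {0..a})" using assms by (intro compact_imp_bounded compact_continuous_image) auto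
  then obtain B where "\<forall>x\<in>q ` {0..a}. norm x \<le> B" unfolding bounded_iff by blast
  then have B: "\<And>s. s \<in> {0..a} \<Longrightarrow> norm (q s) \<le> max B 0" by (auto simp: max.coboundedI1)
  define N where "N = real (2 * k + 2) ^ (2 * k + 2)"
  have "norm (flat a k q s) \<le> (N * max B 0) * (s * (a - s))\<^sup>2" for s
  proof (cases "s \<in> {0<..<a}")
    case True
    define r where "r = s * (a - s)"
    have r: "r > 0" using True by (simp add: r_def)
    have "inverse r ^ (2 * k) * exp (- inverse r) = (inverse r ^ (2 * k + 2) * exp (- inverse r)) * r\<^sup>2"
      using r by (simp add: power_add power2_eq_square field_simps)
    also have "\<dots> \<le> N * r\<^sup>2"
      using power_times_exp_minus_le[of "inverse r" "2 * k + 2"] r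
      by (intro mult_right_mono) (auto simp: N_def)
    finally have "inverse r ^ (2 * k) * exp (- inverse r) \<le> N * r\<^sup>2" .
    then have "(inverse r ^ (2 * k) * exp (- inverse r)) * norm (q s) \<le> (N * r\<^sup>2) * max B 0"
      by (rule mult_mono) (use B[of s] True in \<open>auto simp: N_def\<close>)
    moreover have "norm (flat a k q s) = (inverse r ^ (2 * k) * exp (- inverse r)) * norm (q s)"
      using True r by (simp add: flat_def r_def[symmetric] abs_mult power_abs del: greaterThanLessThan_iff)
    ultimately show ?thesis by (simp add: r_def mult_ac)
  qed (auto simp: flat_def N_def)
  then show ?thesis using that[of "N * max B 0"] by (simp add: N_def)
qed

lemma has_vector_derivative_flat:
  fixes q :: "real \<Rightarrow> 'w::euclidean_space"
  assumes q: "polynomial_function q" and q': "\<And>s. (q has_vector_derivative q' s) (at s)"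
  shows "(flat a k q has_vector_derivative flat a (Suc k)
    (\<lambda>s. ((a - 2 * s) * (1 - 2 * real k * (s * (a - s)))) *\<^sub>R q s + ((s * (a - s))\<^sup>2) *\<^sub>R q' s) s) (at s)"
proof -
  consider "s \<in> {0<..<a}" | "s < 0 \<or> s > a" | "s \<notin> {0<..<a}" "s = 0 \<or> s = a"
    by force
  then show ?thesis
  proof cases
    case 1
    define r where "r = (\<lambda>s. s * (a - s))"
    have r: "r s > 0" using 1 by (simp add: r_def)
    have dr: "(r has_real_derivative (a - 2 * s)) (at s)"
      unfolding r_def by (auto intro!: derivative_eq_intros)
    have dy: "((\<lambda>s. inverse (r s)) has_real_derivative - ((a - 2 * s) * (inverse (r s))\<^sup>2)) (at s)"
      using r by (auto intro!: derivative_eq_intros dr simp: power2_eq_square)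
    have dE: "((\<lambda>s. inverse (r s) ^ (2 * k) * exp (- inverse (r s))) has_real_derivative
        (inverse (r s) ^ (2 * Suc k) * exp (- inverse (r s))) * ((a - 2 * s) * (1 - 2 * real k * r s))) (at s)"
    proof -
      have aux: "((\<lambda>s. Y s ^ (2 * k) * exp (- Y s)) has_real_derivative
        (real (2 * k) * Y s ^ (2 * k - 1) * y') * exp (- Y s) + exp (- Y s) * (- y') * Y s ^ (2 * k)) (at s)"
        if "(Y has_real_derivative y') (at s)" for Y y'
        by (auto intro!: derivative_eq_intros that simp: algebra_simps)
      have *: "((\<lambda>s. inverse (r s) ^ (2 * k) * exp (- inverse (r s))) has_real_derivative
        (real (2 * k) * inverse (r s) ^ (2 * k - 1) * (- ((a - 2 * s) * (inverse (r s))\<^sup>2))) * exp (- inverse (r s))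
        + exp (- inverse (r s)) * ((a - 2 * s) * (inverse (r s))\<^sup>2) * inverse (r s) ^ (2 * k)) (at s)"
        using aux[OF dy] by simp
      have "(real (2 * k) * inverse (r s) ^ (2 * k - 1) * (- ((a - 2 * s) * (inverse (r s))\<^sup>2))) * exp (- inverse (r s))
        + exp (- inverse (r s)) * ((a - 2 * s) * (inverse (r s))\<^sup>2) * inverse (r s) ^ (2 * k)
        = (inverse (r s) ^ (2 * Suc k) * exp (- inverse (r s))) * ((a - 2 * s) * (1 - 2 * real k * r s))"
      proof -
        have e1: "real (2 * k) * inverse (r s) ^ (2 * k - 1) = real (2 * k) * (inverse (r s) ^ (2 * k) * r s)"
        proof (cases k)
          case (Suc l)
          have "inverse (r s) ^ (2 * k) = inverse (r s) ^ (2 * k - 1) * inverse (r s)"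
            using Suc by (simp flip: power_Suc2)
          then show ?thesis using r by simp
        qed simp
        show ?thesis unfolding e1 by (simp add: algebra_simps power2_eq_square)
      qed
      then show ?thesis using * by simp
    qed
    have "((\<lambda>s. (inverse (r s) ^ (2 * k) * exp (- inverse (r s))) *\<^sub>R q s) has_vector_derivative
        (inverse (r s) ^ (2 * k) * exp (- inverse (r s))) *\<^sub>R q' s +
        ((inverse (r s) ^ (2 * Suc k) * exp (- inverse (r s))) * ((a - 2 * s) * (1 - 2 * real k * r s))) *\<^sub>R q s) (at s)"
      by (rule has_vector_derivative_scaleR[OF dE q'])
    moreover have "(inverse (r s) ^ (2 * k) * exp (- inverse (r s))) *\<^sub>R q' s =
        (inverse (r s) ^ (2 * Suc k) * exp (- inverse (r s))) *\<^sub>R ((r s)\<^sup>2 *\<^sub>R q' s)"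
      using r by (simp add: power2_eq_square) (simp add: field_simps)
    ultimately have "((\<lambda>s. (inverse (r s) ^ (2 * k) * exp (- inverse (r s))) *\<^sub>R q s) has_vector_derivative
        (inverse (r s) ^ (2 * Suc k) * exp (- inverse (r s))) *\<^sub>R
        (((a - 2 * s) * (1 - 2 * real k * r s)) *\<^sub>R q s + (r s)\<^sup>2 *\<^sub>R q' s)) (at s)"
      by (simp add: scaleR_add_right add.commute)
    then have "((\<lambda>s. (inverse (r s) ^ (2 * k) * exp (- inverse (r s))) *\<^sub>R q s) has_vector_derivative
        flat a (Suc k) (\<lambda>s. ((a - 2 * s) * (1 - 2 * real k * (s * (a - s)))) *\<^sub>R q s + ((s * (a - s))\<^sup>2) *\<^sub>R q' s) s) (at s)"
      using 1 by (simp add: flat_def r_def)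
    then show ?thesis
      by (rule has_vector_derivative_transform_within_open[of _ _ _ "{0<..<a}"]) (use 1 in \<open>auto simp: flat_def r_def\<close>)
  next
    case 2
    have "((\<lambda>_. 0 :: 'w) has_vector_derivative 0) (at s)" by simp
    then have "(flat a k q has_vector_derivative 0) (at s)"
      by (rule has_vector_derivative_transform_within_open[of _ _ _ "- {0..a}"]) (use 2 in \<open>auto simp: flat_def\<close>)
    then show ?thesis using 2 by (auto simp: flat_def)
  next
    case 3
    have "continuous_on {0..a} q"
      using q' by (auto intro!: continuous_at_imp_continuous_on has_vector_derivative_continuous)
    then obtain C where C: "C \<ge> 0" "\<And>s. norm (flat a k q s) \<le> C * (s * (a - s))\<^sup>2"
      using flat_quadratic_bound by blast
    have "(flat a k q has_derivative (\<lambda>_. 0)) (at s)"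
    proof (rule has_derivativeI_sandwich[where e=1 and H="\<lambda>y. C * \<bar>y - s\<bar> * (a - y - s)\<^sup>2"])
      fix y assume y: "y \<noteq> s"
      have "y * (a - y) = (y - s) * (a - y - s)" using 3 by (auto simp: algebra_simps)
      then have "norm (flat a k q y) \<le> C * ((y - s) * (a - y - s))\<^sup>2" using C(2)[of y] by simp
      also have "\<dots> = C * \<bar>y - s\<bar> * (a - y - s)\<^sup>2 * \<bar>y - s\<bar>"
      proof -
        have "(y - s)\<^sup>2 = \<bar>y - s\<bar> * \<bar>y - s\<bar>" by (simp add: power2_eq_square)
        then show ?thesis unfolding power_mult_distrib by (simp only: mult_ac)
      qed
      finally have "norm (flat a k q y) / \<bar>y - s\<bar> \<le> C * \<bar>y - s\<bar> * (a - y - s)\<^sup>2"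
        using y by (simp add: divide_le_eq)
      moreover have "flat a k q s = 0" unfolding flat_def using 3(1) by (rule if_not_P)
      ultimately show "norm (flat a k q y - flat a k q s - 0) / norm (y - s) \<le> C * \<bar>y - s\<bar> * (a - y - s)\<^sup>2"
        by simp
    next
      have "((\<lambda>y. C * \<bar>y - s\<bar> * (a - y - s)\<^sup>2) \<longlongrightarrow> C * \<bar>s - s\<bar> * (a - s - s)\<^sup>2) (at s)"
        by (intro tendsto_intros)
      then show "((\<lambda>y. C * \<bar>y - s\<bar> * (a - y - s)\<^sup>2) \<longlongrightarrow> 0) (at s)" by simp
    qed auto
    then show ?thesis using 3 by (simp add: has_vector_derivative_def flat_def del: greaterThanLessThan_iff)
  qed
qed

text \<open>The polynomials of the successive derivatives are chosen one after the other.\<close>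

lemma flat_jet_exists:
  fixes q :: "real \<Rightarrow> 'w::euclidean_space"
  assumes "polynomial_function q"
  obtains D where "flat_jet a D" "D 0 = flat a 0 q"
proof -
  define good where "good k q q1 \<longleftrightarrow> polynomial_function q1 \<and>
    (\<forall>s. (flat a k q has_vector_derivative flat a (Suc k) q1 s) (at s))" for k and q q1 :: "real \<Rightarrow> 'w"
  have "\<exists>q1. good k q q1" if q: "polynomial_function q" for k and q :: "real \<Rightarrow> 'w"
  proof -
    obtain q' where q': "polynomial_function q'" "\<And>s. (q has_vector_derivative q' s) (at s)"
      using has_vector_derivative_polynomial_function[OF q] by blast
    define q1 where "q1 = (\<lambda>s. ((a - 2 * s) * (1 - 2 * real k * (s * (a - s)))) *\<^sub>R q s + ((s * (a - s))\<^sup>2) *\<^sub>R q' s)"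
    have "real_polynomial_function (\<lambda>s::real. (a - 2 * s) * (1 - 2 * real k * (s * (a - s))))"
      "real_polynomial_function (\<lambda>s::real. (s * (a - s))\<^sup>2)"
      by (intro real_polynomial_function.intros(2-4) real_polynomial_function_diff
          real_polynomial_function_power real_polynomial_function.intros(1) bounded_linear_ident)+
    then have "polynomial_function q1"
      unfolding q1_def using q q'(1)
      by (intro polynomial_function_add polynomial_function_mult) (auto simp flip: real_polynomial_function_eq)
    moreover have "\<forall>s. (flat a k q has_vector_derivative flat a (Suc k) q1 s) (at s)"
      unfolding q1_def by (intro allI has_vector_derivative_flat q q')
    ultimately show ?thesis unfolding good_def by blast
  qed
  then have n: "polynomial_function q \<Longrightarrow> good k q (SOME q1. good k q q1)" for k and q :: "real \<Rightarrow> 'w"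
    by (rule someI_ex)
  define n where "n k q = (SOME q1. good k q q1)" for k q
  note n = n[folded n_def]
  define Q where "Q = rec_nat q (\<lambda>k q. n k q)"
  have Q: "Q 0 = q" "Q (Suc k) = n k (Q k)" for k by (simp_all add: Q_def)
  have poly: "polynomial_function (Q k)" for k
    by (induction k) (use assms n in \<open>auto simp: Q good_def\<close>)
  have "flat_jet a (\<lambda>k. flat a k (Q k))"
    unfolding flat_jet_def using n[OF poly] by (auto simp: good_def Q flat_def)
  then show ?thesis using that[of "\<lambda>k. flat a k (Q k)"] by (simp add: Q)
qed

lemma flat_jet_continuous: "flat_jet a D \<Longrightarrow> continuous_on S (D i)"
  by (auto simp: flat_jet_def intro!: continuous_at_imp_continuous_on has_vector_derivative_continuous)

lemma flat_jet_measurable: "flat_jet a D \<Longrightarrow> D i \<in> borel_measurable borel"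
  by (intro borel_measurable_continuous_onI flat_jet_continuous)

text \<open>
  The free data of one period: a square integrable function vanishing outside \<open>(0,a)\<close>. The
  endpoints are excluded so that shifted copies never overlap; the Borel representative allows
  compositions.
\<close>

definition signal :: "real \<Rightarrow> (real \<Rightarrow> 'w::real_normed_vector) \<Rightarrow> bool" where
  "signal a h \<longleftrightarrow> h \<in> borel_measurable borel \<and> (\<forall>t. t \<notin> {0<..<a} \<longrightarrow> h t = 0) \<and>
     integrable lborel (\<lambda>t. (norm (h t))\<^sup>2)"

abbreviation energy :: "(real \<Rightarrow> 'w::real_normed_vector) \<Rightarrow> real" where
  "energy h \<equiv> (LINT t|lborel. (norm (h t))\<^sup>2)"

lemma integrable_const_on_Icc: "integrable lborel (\<lambda>t::real. c * indicator {0..a} t :: real)"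
  using emeasure_lborel_cbox_finite[of 0 a]
  by (intro integrable_mult_right integrable_real_indicator) (auto simp: cbox_interval)

lemma square_integrable_bounded_support:
  fixes f :: "real \<Rightarrow> 'w::real_normed_vector"
  assumes f[measurable]: "f \<in> borel_measurable borel" and b: "\<And>t. norm (f t) \<le> B" and z: "\<And>t. t \<notin> {0..a} \<Longrightarrow> f t = 0"
  shows "integrable lborel (\<lambda>t. (norm (f t))\<^sup>2)"
proof (rule Bochner_Integration.integrable_bound)
  show "integrable lborel (\<lambda>t. B\<^sup>2 * indicator {0..a} t :: real)"
    by (rule integrable_const_on_Icc)
  show "AE t in lborel. norm ((norm (f t))\<^sup>2) \<le> norm (B\<^sup>2 * indicator {0..a} t)"
  proof (rule AE_I2)
    fix t
    have "(norm (f t))\<^sup>2 \<le> B\<^sup>2" using b by (intro power_mono) auto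
    then show "norm ((norm (f t))\<^sup>2) \<le> norm (B\<^sup>2 * indicator {0..a} t)"
      using z[of t] by (auto simp: indicator_def)
  qed
qed measurable

lemma flat_jet_signal:
  fixes D :: "nat \<Rightarrow> real \<Rightarrow> 'w::real_normed_vector"
  assumes D: "flat_jet a D"
  shows "signal a (D i)"
proof -
  have "bounded (D i ` {0..a})"
    using flat_jet_continuous[OF D] by (intro compact_imp_bounded compact_continuous_image) auto
  then obtain B where "\<forall>x\<in>D i ` {0..a}. norm x \<le> B" unfolding bounded_iff by blast
  then have B: "\<And>s. s \<in> {0..a} \<Longrightarrow> norm (D i s) \<le> max B 0" by (auto simp: max.coboundedI1)
  have z: "\<And>t. t \<notin> {0<..<a} \<Longrightarrow> D i t = 0" using D by (simp add: flat_jet_def)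
  have "norm (D i t) \<le> max B 0" for t
    using B[of t] z[of t] by (cases "t \<in> {0<..<a}") auto
  then have "integrable lborel (\<lambda>t. (norm (D i t))\<^sup>2)"
    by (intro square_integrable_bounded_support[where B="max B 0" and a=a] flat_jet_measurable[OF D] z) auto
  then show ?thesis using flat_jet_measurable[OF D] z by (simp add: signal_def)
qed

lemma norm_add_power2_le: "(norm (x + y))\<^sup>2 \<le> 2 * (norm x)\<^sup>2 + 2 * (norm y)\<^sup>2"
proof -
  have "(norm (x + y))\<^sup>2 \<le> (norm x + norm y)\<^sup>2" by (intro power_mono norm_triangle_ineq) simp
  also have "\<dots> \<le> 2 * (norm x)\<^sup>2 + 2 * (norm y)\<^sup>2"
    using sum_squares_bound[of "norm x" "norm y"] by (simp add: power2_sum)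
  finally show ?thesis .
qed

lemma signal_diff:
  fixes f g :: "real \<Rightarrow> 'w::euclidean_space"
  assumes f: "signal a f" and g: "signal a g"
  shows "signal a (\<lambda>t. f t - g t)"
proof -
  have [measurable]: "f \<in> borel_measurable borel" "g \<in> borel_measurable borel"
    using f g by (auto simp: signal_def)
  have "integrable lborel (\<lambda>t. 2 * (norm (f t))\<^sup>2 + 2 * (norm (g t))\<^sup>2)"
    using f g by (auto simp: signal_def)
  then have "integrable lborel (\<lambda>t. (norm (f t - g t))\<^sup>2)"
    by (rule Bochner_Integration.integrable_bound)
      (measurable, use norm_add_power2_le[of "f _" "- g _"] in simp)
  then show ?thesis using f g by (auto simp: signal_def)
qed

lemma energy_diff_triangle:
  fixes f g h :: "real \<Rightarrow> 'w::euclidean_space"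
  assumes "signal a f" "signal a g" "signal a h"
  shows "energy (\<lambda>t. f t - h t) \<le> 2 * energy (\<lambda>t. f t - g t) + 2 * energy (\<lambda>t. g t - h t)"
proof -
  have i: "integrable lborel (\<lambda>t. (norm (f t - h t))\<^sup>2)" "integrable lborel (\<lambda>t. (norm (f t - g t))\<^sup>2)"
    "integrable lborel (\<lambda>t. (norm (g t - h t))\<^sup>2)"
    using assms signal_diff[of a] by (auto simp: signal_def)
  have "energy (\<lambda>t. f t - h t) \<le> (LINT t|lborel. 2 * (norm (f t - g t))\<^sup>2 + 2 * (norm (g t - h t))\<^sup>2)"
    by (rule integral_mono) (use i norm_add_power2_le[of "f t - g t" "g t - h t" for t] in auto)
  also have "\<dots> = 2 * energy (\<lambda>t. f t - g t) + 2 * energy (\<lambda>t. g t - h t)"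
    using i by simp
  finally show ?thesis .
qed

text \<open>
  A bounded measurable function is an almost everywhere limit of continuous functions; truncated
  to the same bound, they converge in \<open>L\<^sup>2\<close>. Continuous functions are approximated uniformly by
  polynomials.
\<close>

lemma polynomial_L2_dense:
  fixes F :: "real \<Rightarrow> 'w::euclidean_space"
  assumes F[measurable]: "F \<in> borel_measurable borel" and B: "\<And>t. norm (F t) \<le> B" and e: "e > 0" and a: "a > 0"
  obtains p where "polynomial_function p" "(LINT t|lborel. indicator {0..a} t * (norm (p t - F t))\<^sup>2) < e"
proof -
  have B0: "B \<ge> 0" using B[of 0] norm_ge_zero order_trans by blast
  have "F measurable_on UNIV"
    using F by (intro lebesgue_measurable_imp_measurable_on) (auto simp: measurable_completion)
  then obtain N g where N: "negligible N" and g: "\<And>n. continuous_on UNIV (g n)"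
    and lim: "\<And>x. x \<notin> N \<Longrightarrow> (\<lambda>n. g n x) \<longlonglongrightarrow> F x"
    unfolding measurable_on_def by auto
  define c where "c n t = closest_point (cball 0 B) (g n t)" for n t
  have cc: "continuous_on UNIV (c n)" for n
    unfolding c_def by (intro continuous_on_compose2[OF continuous_on_closest_point g]) (use B0 in auto)
  have cB: "norm (c n t) \<le> B" for n t
    using closest_point_in_set[of "cball (0::'w) B" "g n t"] B0 by (auto simp: c_def)
  have [measurable]: "c n \<in> borel_measurable borel" for n by (rule borel_measurable_continuous_onI[OF cc])
  have climit: "(\<lambda>n. c n t) \<longlonglongrightarrow> F t" if "t \<notin> N" for t
  proof -
    have "isCont (closest_point (cball 0 B)) (F t)"
      using continuous_on_closest_point[of "cball (0::'w) B" UNIV] B0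
      by (simp add: continuous_on_eq_continuous_at)
    then have "(\<lambda>n. c n t) \<longlonglongrightarrow> closest_point (cball 0 B) (F t)"
      unfolding c_def using lim[OF that] isCont_tendsto_compose by blast
    moreover have "closest_point (cball 0 B) (F t) = F t"
      using B by (intro closest_point_self) auto
    ultimately show ?thesis by simp
  qed
  have "AE t in lebesgue. t \<notin> N" using N by (simp add: AE_not_in negligible_iff_null_sets)
  then have "AE t in lebesgue. (\<lambda>n. c n t) \<longlonglongrightarrow> F t"
    by eventually_elim (rule climit)
  then have ae: "AE t in lborel. (\<lambda>n. c n t) \<longlonglongrightarrow> F t"
    by (subst (asm) AE_completion_iff) auto
  have "(\<lambda>n. LINT t|lborel. indicator {0..a} t * (norm (c n t - F t))\<^sup>2) \<longlonglongrightarrow> (LINT (t::real)|lborel. 0 :: real)"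
  proof (rule integral_dominated_convergence)
    show "integrable lborel (\<lambda>t. (2 * B)\<^sup>2 * indicator {0..a} t :: real)"
      by (rule integrable_const_on_Icc)
    show "AE t in lborel. (\<lambda>n. indicator {0..a} t * (norm (c n t - F t))\<^sup>2) \<longlonglongrightarrow> 0"
      using ae
    proof eventually_elim
      case (elim t)
      then have "(\<lambda>n. indicator {0..a} t * (norm (c n t - F t))\<^sup>2) \<longlonglongrightarrow> indicator {0..a} t * (norm (F t - F t))\<^sup>2"
        by (intro tendsto_intros)
      then show ?case by simp
    qed
    fix n
    show "AE t in lborel. norm (indicator {0..a} t * (norm (c n t - F t))\<^sup>2) \<le> (2 * B)\<^sup>2 * indicator {0..a} t"
    proof (rule AE_I2)
      fix t
      have "norm (c n t - F t) \<le> 2 * B"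
        using norm_triangle_ineq4[of "c n t" "F t"] cB[of n t] B[of t] by linarith
      then have "(norm (c n t - F t))\<^sup>2 \<le> (2 * B)\<^sup>2" by (intro power_mono) auto
      then show "norm (indicator {0..a} t * (norm (c n t - F t))\<^sup>2) \<le> (2 * B)\<^sup>2 * indicator {0..a} t"
        by (auto simp: indicator_def)
    qed
  qed auto
  then have "eventually (\<lambda>n. (LINT t|lborel. indicator {0..a} t * (norm (c n t - F t))\<^sup>2) < e / 4) sequentially"
    using e by (intro order_tendstoD) auto
  then obtain n where n: "(LINT t|lborel. indicator {0..a} t * (norm (c n t - F t))\<^sup>2) < e / 4"
    using eventually_happens by force
  (* A uniform error d on [0,a] contributes d^2 a = e / 4, which is doubled by the triangle inequality. *)
  define d where "d = sqrt (e / (4 * a))"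
  have d: "d > 0" "d\<^sup>2 = e / (4 * a)" using e a by (auto simp: d_def)
  obtain p where p: "polynomial_function p" "\<And>t. t \<in> {0..a} \<Longrightarrow> norm (c n t - p t) < d"
    using Stone_Weierstrass_polynomial_function[OF compact_Icc continuous_on_subset[OF cc subset_UNIV] d(1), of 0 a n] by blast
  have cp: "continuous_on UNIV p"
    using p(1) by (simp add: continuous_on_polymonial_function)
  have [measurable]: "p \<in> borel_measurable borel" by (rule borel_measurable_continuous_onI[OF cp])
  have le: "indicator {0..a} t * (norm (p t - F t))\<^sup>2 \<le>
      2 * (d\<^sup>2 * indicator {0..a} t) + 2 * (indicator {0..a} t * (norm (c n t - F t))\<^sup>2)" for t
  proof (cases "t \<in> {0..a}")
    case True
    have "(norm (p t - c n t))\<^sup>2 \<le> d\<^sup>2"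
      using p(2)[OF True] by (intro power_mono) (auto simp: norm_minus_commute)
    then show ?thesis using norm_add_power2_le[of "p t - c n t" "c n t - F t"] True by simp
  qed simp
  have i1: "integrable lborel (\<lambda>t. indicator {0..a} t * (norm (c n t - F t))\<^sup>2)"
  proof (rule Bochner_Integration.integrable_bound)
    show "integrable lborel (\<lambda>t. (2 * B)\<^sup>2 * indicator {0..a} t :: real)"
      by (rule integrable_const_on_Icc)
    show "AE t in lborel. norm (indicator {0..a} t * (norm (c n t - F t))\<^sup>2) \<le> norm ((2 * B)\<^sup>2 * indicator {0..a} t)"
    proof (rule AE_I2)
      fix t
      have "norm (c n t - F t) \<le> 2 * B"
        using norm_triangle_ineq4[of "c n t" "F t"] cB[of n t] B[of t] by linarith
      then have "(norm (c n t - F t))\<^sup>2 \<le> (2 * B)\<^sup>2" by (intro power_mono) auto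
      then show "norm (indicator {0..a} t * (norm (c n t - F t))\<^sup>2) \<le> norm ((2 * B)\<^sup>2 * indicator {0..a} t)"
        by (auto simp: indicator_def)
    qed
  qed measurable
  have i2: "integrable lborel (\<lambda>t. d\<^sup>2 * indicator {0..a} t :: real)"
    by (rule integrable_const_on_Icc)
  have i3: "integrable lborel (\<lambda>t. 2 * (d\<^sup>2 * indicator {0..a} t) + 2 * (indicator {0..a} t * (norm (c n t - F t))\<^sup>2))"
    by (intro Bochner_Integration.integrable_add integrable_mult_right[OF i1] integrable_mult_right[OF i2])
  have "integrable lborel (\<lambda>t. indicator {0..a} t * (norm (p t - F t))\<^sup>2)"
  proof (rule Bochner_Integration.integrable_bound[OF i3])
    show "AE t in lborel. norm (indicator {0..a} t * (norm (p t - F t))\<^sup>2) \<le>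
        norm (2 * (d\<^sup>2 * indicator {0..a} t) + 2 * (indicator {0..a} t * (norm (c n t - F t))\<^sup>2))"
    proof (rule AE_I2)
      fix t
      have "0 \<le> indicator {0..a} t * (norm (p t - F t))\<^sup>2" by simp
      then show "norm (indicator {0..a} t * (norm (p t - F t))\<^sup>2) \<le>
        norm (2 * (d\<^sup>2 * indicator {0..a} t) + 2 * (indicator {0..a} t * (norm (c n t - F t))\<^sup>2))"
        using le[of t] unfolding real_norm_def by linarith
    qed
  qed measurable
  then have "(LINT t|lborel. indicator {0..a} t * (norm (p t - F t))\<^sup>2) \<le>
      (LINT t|lborel. 2 * (d\<^sup>2 * indicator {0..a} t) + 2 * (indicator {0..a} t * (norm (c n t - F t))\<^sup>2))"
    by (rule integral_mono[OF _ i3 le])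
  also have "\<dots> = 2 * (d\<^sup>2 * a) + 2 * (LINT t|lborel. indicator {0..a} t * (norm (c n t - F t))\<^sup>2)"
  proof -
    have "(LINT t|lborel. 2 * (d\<^sup>2 * indicator {0..a} t) + 2 * (indicator {0..a} t * (norm (c n t - F t))\<^sup>2)) =
        (LINT t|lborel. 2 * (d\<^sup>2 * indicator {0..a} t)) + (LINT t|lborel. 2 * (indicator {0..a} t * (norm (c n t - F t))\<^sup>2))"
      by (intro Bochner_Integration.integral_add integrable_mult_right[OF i1] integrable_mult_right[OF i2])
    then show ?thesis using a by simp
  qed
  also have "\<dots> < e" using n d a by simp
  finally show ?thesis using that p(1) by blast
qed

text \<open>
  Multiplication by the flat weight \<open>E\<close> turns polynomials into flat functions. So \<open>h\<close> is
  first restricted to the sets where \<open>h / E\<close> is bounded, then \<open>h / E\<close> is approximated by a polynomial,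
  which is multiplied by \<open>E \<le> 1\<close> again.
\<close>

lemma flat_jets_dense:
  fixes h :: "real \<Rightarrow> 'w::euclidean_space"
  assumes h: "signal a h" and a: "a > 0" and e: "e > 0"
  obtains D where "flat_jet a D" "energy (\<lambda>t. D 0 t - h t) < e"
proof -
  have [measurable]: "h \<in> borel_measurable borel" and z: "\<And>t. t \<notin> {0<..<a} \<Longrightarrow> h t = 0"
    and ih: "integrable lborel (\<lambda>t. (norm (h t))\<^sup>2)" using h by (auto simp: signal_def)
  define E where "E t = exp (- inverse (t * (a - t)))" for t
  have [measurable]: "E \<in> borel_measurable borel" unfolding E_def[abs_def] by measurable
  define X where "X n = {t \<in> {0<..<a}. norm (h t) \<le> real n * E t}" for n
  have [measurable]: "X n \<in> sets borel" for n unfolding X_def by measurable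
  have EX: "eventually (\<lambda>n. t \<in> X n) sequentially" if "t \<in> {0<..<a}" for t
  proof -
    have Ep: "E t > 0" by (simp add: E_def)
    obtain n0 where n0: "norm (h t) / E t \<le> real n0" using real_arch_simple by blast
    have "t \<in> X n" if "n \<ge> n0" for n
    proof -
      have "norm (h t) / E t \<le> real n" using n0 that by linarith
      then show ?thesis using \<open>t \<in> {0<..<a}\<close> Ep by (simp add: X_def divide_le_eq mult.commute)
    qed
    then show ?thesis unfolding eventually_sequentially by blast
  qed
  have "(\<lambda>n. energy (\<lambda>t. indicator (X n) t *\<^sub>R h t - h t)) \<longlonglongrightarrow> (LINT (t::real)|lborel. 0 :: real)"
  proof (rule integral_dominated_convergence[where w="\<lambda>t. (norm (h t))\<^sup>2"])
    show "integrable lborel (\<lambda>t. (norm (h t))\<^sup>2)" by (rule ih)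
    show "AE t in lborel. (\<lambda>n. (norm (indicator (X n) t *\<^sub>R h t - h t))\<^sup>2) \<longlonglongrightarrow> 0"
    proof (rule AE_I2)
      fix t
      show "(\<lambda>n. (norm (indicator (X n) t *\<^sub>R h t - h t))\<^sup>2) \<longlonglongrightarrow> 0"
      proof (cases "t \<in> {0<..<a}")
        case True
        show ?thesis
          by (rule tendsto_eventually) (use EX[OF True] in \<open>eventually_elim, simp\<close>)
      qed (simp add: z)
    qed
    fix n
    show "AE t in lborel. norm ((norm (indicator (X n) t *\<^sub>R h t - h t))\<^sup>2) \<le> (norm (h t))\<^sup>2"
      by (rule AE_I2) (auto simp: indicator_def)
  qed measurable
  then have "eventually (\<lambda>n. energy (\<lambda>t. indicator (X n) t *\<^sub>R h t - h t) < e / 4) sequentially"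
    using e by (intro order_tendstoD) auto
  then obtain n where n: "energy (\<lambda>t. indicator (X n) t *\<^sub>R h t - h t) < e / 4"
    using eventually_happens by force
  define h1 where "h1 t = indicator (X n) t *\<^sub>R h t" for t
  define F where "F t = inverse (E t) *\<^sub>R h1 t" for t
  have [measurable]: "h1 \<in> borel_measurable borel" "F \<in> borel_measurable borel"
    unfolding F_def[abs_def] h1_def[abs_def] by measurable
  have Epos: "E t > 0" for t by (simp add: E_def)
  have FB: "norm (F t) \<le> real n" for t
    using Epos[of t] by (auto simp: F_def h1_def X_def indicator_def divide_simps)
  have h1F: "h1 t = E t *\<^sub>R F t" for t using Epos[of t] by (simp add: F_def)
  have E1: "E t \<le> 1" if "t \<in> {0<..<a}" for t using that by (simp add: E_def)
  have sh1: "signal a h1"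
    unfolding signal_def
  proof (intro conjI allI impI)
    show "integrable lborel (\<lambda>t. (norm (h1 t))\<^sup>2)"
      by (rule Bochner_Integration.integrable_bound[OF ih]) (auto simp: h1_def indicator_def)
  qed (auto simp: h1_def z)
  obtain p where p: "polynomial_function p" "(LINT t|lborel. indicator {0..a} t * (norm (p t - F t))\<^sup>2) < e / 4"
    using polynomial_L2_dense[of F "real n" "e / 4" a] FB e a by auto
  obtain D where D: "flat_jet a D" "D 0 = flat a 0 p" using flat_jet_exists[OF p(1)] by blast
  have [measurable]: "D 0 \<in> borel_measurable borel" by (rule flat_jet_measurable[OF D(1)])
  have [measurable]: "p \<in> borel_measurable borel"
    by (intro borel_measurable_continuous_onI) (simp add: continuous_on_polymonial_function p(1))
  have le: "(norm (D 0 t - h1 t))\<^sup>2 \<le> indicator {0..a} t * (norm (p t - F t))\<^sup>2" for t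
  proof (cases "t \<in> {0<..<a}")
    case True
    then have "D 0 t = E t *\<^sub>R p t" by (simp add: D(2) flat_def E_def)
    then have "D 0 t - h1 t = E t *\<^sub>R (p t - F t)" by (simp add: h1F scaleR_diff_right)
    then have "norm (D 0 t - h1 t) \<le> norm (p t - F t)"
      using E1[OF True] Epos[of t] by (simp add: mult_left_le_one_le)
    then have "(norm (D 0 t - h1 t))\<^sup>2 \<le> (norm (p t - F t))\<^sup>2" by (intro power_mono) auto
    then show ?thesis using True by simp
  qed (auto simp: D(2) flat_def h1_def z)
  have ip: "integrable lborel (\<lambda>t. indicator {0..a} t * (norm (p t - F t))\<^sup>2)"
  proof -
    have "integrable lborel (\<lambda>t. (norm (indicator {0..a} t *\<^sub>R (p t - F t)))\<^sup>2)"
    proof -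
      have "bounded (p ` {0..a})"
        using p(1) by (intro compact_imp_bounded compact_continuous_image) (auto simp: continuous_on_polymonial_function)
      then obtain Bp where "\<forall>x\<in>p ` {0..a}. norm x \<le> Bp" unfolding bounded_iff by blast
      then have Bp: "\<And>s. s \<in> {0..a} \<Longrightarrow> norm (p s) \<le> max Bp 0" by (auto simp: max.coboundedI1)
      have "norm (indicator {0..a} t *\<^sub>R (p t - F t)) \<le> max Bp 0 + real n" for t
      proof (cases "t \<in> {0..a}")
        case True
        then show ?thesis
          using norm_triangle_ineq4[of "p t" "F t"] FB[of t] Bp[OF True] by simp
      qed simp
      then show ?thesis
        by (intro square_integrable_bounded_support[where B="max Bp 0 + real n" and a=a]) auto
    qed
    moreover have "(norm (indicator {0..a} t *\<^sub>R (p t - F t)))\<^sup>2 = indicator {0..a} t * (norm (p t - F t))\<^sup>2" for t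
      by (auto simp: indicator_def)
    ultimately show ?thesis by simp
  qed
  have "energy (\<lambda>t. D 0 t - h1 t) \<le> (LINT t|lborel. indicator {0..a} t * (norm (p t - F t))\<^sup>2)"
    by (rule integral_mono[OF _ ip le])
      (use signal_diff[OF flat_jet_signal[OF D(1)] sh1] in \<open>simp add: signal_def\<close>)
  then have "energy (\<lambda>t. D 0 t - h1 t) < e / 4" using p(2) by linarith
  moreover have "energy (\<lambda>t. h1 t - h t) < e / 4" using n by (simp add: h1_def)
  ultimately have "energy (\<lambda>t. D 0 t - h t) < e"
    using energy_diff_triangle[OF flat_jet_signal[OF D(1), of 0] sh1 h] by linarith
  then show ?thesis using that D(1) by blast
qed

section \<open>Staircase functions\<close>

text \<open>
  A solution of the difference equation \<open>g(t + a) = A g(t) + B u(t)\<close> acts separately on each phase in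
  \<open>(0,a)\<close>. If the inputs depend linearly on finitely many data per phase, then so does the solution:
  in the \<open>k\<close>-th period, \<open>h\<close> being the data as a function of the phase, the value is \<open>G k\<close> applied to
  \<open>h\<close>. Inputs, states and outputs all have this form.
\<close>

definition stair :: "real \<Rightarrow> (nat \<Rightarrow> 'w \<Rightarrow> 'v) \<Rightarrow> (real \<Rightarrow> 'w) \<Rightarrow> real \<Rightarrow> 'v" where
  "stair a G h t = G (nat \<lfloor>t / a\<rfloor>) (h (t - a * of_int \<lfloor>t / a\<rfloor>))"

lemma floor_divide_bounds:
  fixes a t :: real
  assumes "a > 0"
  shows "0 \<le> t - a * of_int \<lfloor>t / a\<rfloor>" "t - a * of_int \<lfloor>t / a\<rfloor> < a"
proof -
  have "a * of_int \<lfloor>t / a\<rfloor> \<le> a * (t / a)" using assms by (intro mult_left_mono) auto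
  then show "0 \<le> t - a * of_int \<lfloor>t / a\<rfloor>" using assms by simp
  have "t / a < of_int \<lfloor>t / a\<rfloor> + 1" by linarith
  then show "t - a * of_int \<lfloor>t / a\<rfloor> < a" using assms by (simp add: field_simps)
qed

lemma floor_divide_eq:
  fixes a t :: real
  assumes "a > 0" "a * of_int m \<le> t" "t < a * of_int m + a"
  shows "\<lfloor>t / a\<rfloor> = m"
  using assms by (intro floor_unique) (auto simp: field_simps)

lemma stair_shift:
  assumes "a > 0" "t \<ge> 0"
  shows "stair a G h (t + a) = stair a (\<lambda>k. G (Suc k)) h t"
proof -
  have "\<lfloor>(t + a) / a\<rfloor> = \<lfloor>t / a\<rfloor> + 1" using assms by (simp add: add_divide_distrib)
  moreover have "nat (\<lfloor>t / a\<rfloor> + 1) = Suc (nat \<lfloor>t / a\<rfloor>)" using assms by (simp add: nat_add_distrib)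
  ultimately show ?thesis by (simp add: stair_def algebra_simps)
qed

lemma stair_on_step:
  assumes "a > 0" "a * real k \<le> t" "t < a * real k + a"
  shows "stair a G h t = G k (h (t - a * real k))"
  using floor_divide_eq[of a "int k" t] assms by (simp add: stair_def)

text \<open>
  Around the junction of two steps at most one of the two summands is nonzero. This writes the
  staircase locally as a sum of smooth functions.
\<close>

lemma stair_local:
  fixes G :: "nat \<Rightarrow> 'w::zero \<Rightarrow> 'v::monoid_add"
  assumes a: "a > 0" and G0: "\<And>k. G k 0 = 0" and h: "\<And>t. t \<notin> {0<..<a} \<Longrightarrow> h t = 0"
    and t: "a * of_int m - a < t" "t < a * of_int m + a"
  shows "stair a G h t = G (nat (m - 1)) (h (t - a * of_int (m - 1))) + G (nat m) (h (t - a * of_int m))"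
proof (cases "a * of_int m \<le> t")
  case True
  then have "\<lfloor>t / a\<rfloor> = m" using a t by (intro floor_divide_eq) auto
  moreover have "h (t - a * of_int (m - 1)) = 0" using True by (intro h) (auto simp: algebra_simps)
  ultimately show ?thesis by (simp add: stair_def G0)
next
  case False
  then have "\<lfloor>t / a\<rfloor> = m - 1" using a t by (intro floor_divide_eq) (auto simp: algebra_simps)
  moreover have "h (t - a * of_int m) = 0" using False by (intro h) auto
  ultimately show ?thesis by (simp add: stair_def G0)
qed

lemma stair_has_vector_derivative:
  fixes G :: "nat \<Rightarrow> 'w::euclidean_space \<Rightarrow> 'v::euclidean_space"
  assumes a: "a > 0" and G: "\<And>k. linear (G k)" and D: "flat_jet a D"
  shows "(stair a G (D i) has_vector_derivative stair a G (D (Suc i)) t) (at t)"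
proof -
  define m where "m = \<lfloor>t / a\<rfloor>"
  have G0: "G k 0 = 0" for k using G linear_0 by blast
  have z: "\<And>t. t \<notin> {0<..<a} \<Longrightarrow> D i t = 0" for i using D by (simp add: flat_jet_def)
  have bl: "bounded_linear (G k)" for k using G by (simp add: linear_conv_bounded_linear)
  have d: "((\<lambda>s. G k (D i (s - c))) has_vector_derivative G k (D (Suc i) (t - c))) (at t)" for k c
  proof -
    have "(D i has_vector_derivative D (Suc i) (t - c)) (at (t - c))" using D by (simp add: flat_jet_def)
    then have "((D i \<circ> (\<lambda>s. s - c)) has_vector_derivative 1 *\<^sub>R D (Suc i) (t - c)) (at t)"
      by (intro vector_diff_chain_at) (auto intro!: derivative_eq_intros)
    then have "((\<lambda>s. D i (s - c)) has_vector_derivative D (Suc i) (t - c)) (at t)" by (simp add: o_def)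
    then show ?thesis by (rule bounded_linear.has_vector_derivative[OF bl])
  qed
  have t: "a * of_int m - a < t" "t < a * of_int m + a"
    using floor_divide_bounds[OF a, of t] a unfolding m_def by linarith+
  have local: "stair a G (D j) s = G (nat (m - 1)) (D j (s - a * of_int (m - 1))) + G (nat m) (D j (s - a * of_int m))"
    if "a * of_int m - a < s" "s < a * of_int m + a" for j s
    by (rule stair_local[where G=G and h="D j", OF a _ _ that]) (auto simp: G0 z)
  have "((\<lambda>s. G (nat (m - 1)) (D i (s - a * of_int (m - 1))) + G (nat m) (D i (s - a * of_int m)))
      has_vector_derivative stair a G (D (Suc i)) t) (at t)"
    unfolding local[OF t] by (intro has_vector_derivative_add d)
  then show ?thesis
    by (rule has_vector_derivative_transform_within_open[where S="{a * of_int m - a<..<a * of_int m + a}"])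
      (use t local in auto)
qed

lemma stair_continuous:
  fixes G :: "nat \<Rightarrow> 'w::euclidean_space \<Rightarrow> 'v::euclidean_space"
  assumes "a > 0" "\<And>k. linear (G k)" "flat_jet a D"
  shows "continuous_on S (stair a G (D i))"
  using stair_has_vector_derivative[where G=G and D=D and i=i, OF assms]
  by (intro continuous_at_imp_continuous_on ballI has_vector_derivative_continuous) blast

lemma stair_measurable:
  fixes G :: "nat \<Rightarrow> 'w::euclidean_space \<Rightarrow> 'v::euclidean_space"
  assumes G: "\<And>k. linear (G k)" and [measurable]: "h \<in> borel_measurable borel"
  shows "stair a G h \<in> borel_measurable borel"
proof -
  have [measurable]: "G k \<in> borel_measurable borel" for k
    using G by (intro borel_measurable_continuous_onI linear_continuous_on) (simp add: linear_conv_bounded_linear)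
  have "(\<lambda>t. (\<lambda>n t. G (nat n) (h (t - a * of_int n))) \<lfloor>t / a\<rfloor> t) \<in> borel_measurable borel"
  proof (rule measurable_compose_countable)
    show "(\<lambda>t::real. \<lfloor>t / a\<rfloor>) \<in> measurable borel (count_space UNIV)" by measurable
    show "(\<lambda>t. G (nat n) (h (t - a * of_int n))) \<in> borel_measurable borel" for n
      by (rule measurable_compose[of _ _ borel]) measurable
  qed
  then show ?thesis by (simp add: stair_def[abs_def])
qed

lemma stair_diff:
  assumes "\<And>k. linear (G k)"
  shows "stair a G (\<lambda>t. f t - h t) t = stair a G f t - stair a G h t"
  using linear_diff[OF assms] by (simp add: stair_def)

text \<open>
  On a bounded interval only finitely many steps occur, and each is a bounded linear image of a
  shifted copy of \<open>h\<close>.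
\<close>

lemma stair_energy:
  fixes G :: "nat \<Rightarrow> 'w::euclidean_space \<Rightarrow> 'v::euclidean_space"
  assumes a: "a > 0" and G: "\<And>k. linear (G k)"
  obtains C where "C \<ge> 0"
    "\<And>h. signal a h \<Longrightarrow> integrable lborel (\<lambda>s. indicator {0..T} s * (norm (stair a G h s))\<^sup>2)"
    "\<And>h. signal a h \<Longrightarrow> (LINT s|lborel. indicator {0..T} s * (norm (stair a G h s))\<^sup>2) \<le> C * energy h"
proof -
  obtain M :: nat where M: "T < a * real M"
    using a ex_less_of_nat_mult[of a T] by (metis mult.commute)
  have "\<exists>c\<ge>0. \<forall>x. norm (G k x) \<le> c * norm x" for k
    using G[of k] bounded_linear.nonneg_bounded[of "G k"] by (simp add: linear_conv_bounded_linear mult.commute) 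
  then obtain c where c: "\<And>k. c k \<ge> 0" "\<And>k x. norm (G k x) \<le> c k * norm x" by metis
  (* Estimating by the sum over all steps avoids cutting the interval into pieces. *)
  have ptw: "indicator {0..T} s * (norm (stair a G h s))\<^sup>2 \<le> (\<Sum>k<M. (c k)\<^sup>2 * (norm (h (s - a * real k)))\<^sup>2)"
    for h :: "real \<Rightarrow> 'w" and s
  proof (cases "s \<in> {0..T}")
    case True
    define k where "k = nat \<lfloor>s / a\<rfloor>"
    have s: "s \<ge> 0" using True by simp
    have k: "real k = of_int \<lfloor>s / a\<rfloor>" using s a by (simp add: k_def)
    have ks: "a * real k \<le> s" "s < a * real k + a" using floor_divide_bounds[OF a, of s] unfolding k by linarith+
    have "a * real k < a * real M" using ks(1) True M by simp
    then have kM: "k < M" using a by simp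
    have "norm (stair a G h s) \<le> c k * norm (h (s - a * real k))"
      unfolding stair_on_step[OF a ks] by (rule c(2))
    then have "(norm (stair a G h s))\<^sup>2 \<le> (c k)\<^sup>2 * (norm (h (s - a * real k)))\<^sup>2"
      by (simp add: power_mono flip: power_mult_distrib)
    also have "\<dots> \<le> (\<Sum>k<M. (c k)\<^sup>2 * (norm (h (s - a * real k)))\<^sup>2)"
      using kM by (intro member_le_sum) auto
    finally show ?thesis using True by simp
  qed (auto intro: sum_nonneg)
  have i: "integrable lborel (\<lambda>s. \<Sum>k<M. (c k)\<^sup>2 * (norm (h (s - a * real k)))\<^sup>2)"
    and v: "(LINT s|lborel. (\<Sum>k<M. (c k)\<^sup>2 * (norm (h (s - a * real k)))\<^sup>2)) = (\<Sum>k<M. (c k)\<^sup>2) * energy h"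
    if h: "signal a h" for h :: "real \<Rightarrow> 'w"
  proof -
    have ih: "integrable lborel (\<lambda>s. (norm (h s))\<^sup>2)" using h by (simp add: signal_def)
    have ik: "integrable lborel (\<lambda>s. (norm (h (s - b)))\<^sup>2)" for b
      using lborel_integrable_real_affine[OF ih, of 1 "- b"] by (simp add: add.commute)
    have vk: "(LINT s|lborel. (norm (h (s - b)))\<^sup>2) = energy h" for b
      using lborel_integral_real_affine[of 1 "\<lambda>s. (norm (h s))\<^sup>2" "- b"] by (simp add: add.commute)
    show "integrable lborel (\<lambda>s. \<Sum>k<M. (c k)\<^sup>2 * (norm (h (s - a * real k)))\<^sup>2)"
      using ik by (intro Bochner_Integration.integrable_sum integrable_mult_right)
    have "(LINT s|lborel. (\<Sum>k<M. (c k)\<^sup>2 * (norm (h (s - a * real k)))\<^sup>2)) =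
        (\<Sum>k<M. (LINT s|lborel. (c k)\<^sup>2 * (norm (h (s - a * real k)))\<^sup>2))"
      using ik by (intro Bochner_Integration.integral_sum integrable_mult_right)
    then show "(LINT s|lborel. (\<Sum>k<M. (c k)\<^sup>2 * (norm (h (s - a * real k)))\<^sup>2)) = (\<Sum>k<M. (c k)\<^sup>2) * energy h"
      using vk by (simp add: sum_distrib_right)
  qed
  have j: "integrable lborel (\<lambda>s. indicator {0..T} s * (norm (stair a G h s))\<^sup>2)"
    if h: "signal a h" for h :: "real \<Rightarrow> 'w"
  proof (rule Bochner_Integration.integrable_bound[OF i[OF h]])
    have [measurable]: "stair a G h \<in> borel_measurable borel"
      using h by (intro stair_measurable G) (simp add: signal_def)
    show "(\<lambda>s. indicator {0..T} s * (norm (stair a G h s))\<^sup>2) \<in> borel_measurable lborel" by measurable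
    show "AE s in lborel. norm (indicator {0..T} s * (norm (stair a G h s))\<^sup>2)
        \<le> norm (\<Sum>k<M. (c k)\<^sup>2 * (norm (h (s - a * real k)))\<^sup>2)"
    proof (rule AE_I2)
      fix s
      have "0 \<le> indicator {0..T} s * (norm (stair a G h s))\<^sup>2" by simp
      then show "norm (indicator {0..T} s * (norm (stair a G h s))\<^sup>2)
        \<le> norm (\<Sum>k<M. (c k)\<^sup>2 * (norm (h (s - a * real k)))\<^sup>2)"
        using ptw[of s h] unfolding real_norm_def by linarith
    qed
  qed
  show ?thesis
  proof (rule that[of "\<Sum>k<M. (c k)\<^sup>2"])
    show "0 \<le> (\<Sum>k<M. (c k)\<^sup>2)" by (intro sum_nonneg) auto
    show "integrable lborel (\<lambda>s. indicator {0..T} s * (norm (stair a G h s))\<^sup>2)" if "signal a h" for h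
      by (rule j[OF that])
    show "(LINT s|lborel. indicator {0..T} s * (norm (stair a G h s))\<^sup>2) \<le> (\<Sum>k<M. (c k)\<^sup>2) * energy h"
      if "signal a h" for h
      using integral_mono[OF j[OF that] i[OF that] ptw] v[OF that] by simp
  qed
qed

text \<open>
  For Borel functions the completed measure may be replaced by \<open>lborel\<close>.
\<close>

lemma L2_on_borel:
  fixes f :: "real \<Rightarrow> 'v::euclidean_space"
  assumes [measurable]: "f \<in> borel_measurable borel"
  shows L2_on_borel_iff: "L2_on {s..t} f \<longleftrightarrow> integrable lborel (\<lambda>r. indicator {s..t} r * (norm (f r))\<^sup>2)"
    and L2_norm_on_borel: "(L2_norm_on {s..t} f)\<^sup>2 = (LINT r|lborel. indicator {s..t} r * (norm (f r))\<^sup>2)"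
proof -
  have [simp]: "f \<in> borel_measurable (lebesgue_on {s..t})"
    by (intro measurable_restrict_space1 measurable_completion) simp
  show "L2_on {s..t} f \<longleftrightarrow> integrable lborel (\<lambda>r. indicator {s..t} r * (norm (f r))\<^sup>2)"
    by (simp add: L2_on_def integrable_restrict_space integrable_completion)
  show "(L2_norm_on {s..t} f)\<^sup>2 = (LINT r|lborel. indicator {s..t} r * (norm (f r))\<^sup>2)"
    by (simp add: L2_norm_on_power2 integral_restrict_space integral_completion)
qed

lemma stair_L2:
  fixes G :: "nat \<Rightarrow> 'w::euclidean_space \<Rightarrow> 'v::euclidean_space"
  assumes a: "a > 0" and G: "\<And>k. linear (G k)"
  obtains C where "C \<ge> 0" "\<And>h. signal a h \<Longrightarrow> L2_on {0..T} (stair a G h)"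
    "\<And>h. signal a h \<Longrightarrow> L2_norm_on {0..T} (stair a G h) \<le> C * sqrt (energy h)"
proof -
  obtain C where C: "C \<ge> 0"
    "\<And>h. signal a h \<Longrightarrow> integrable lborel (\<lambda>s. indicator {0..T} s * (norm (stair a G h s))\<^sup>2)"
    "\<And>h. signal a h \<Longrightarrow> (LINT s|lborel. indicator {0..T} s * (norm (stair a G h s))\<^sup>2) \<le> C * energy h"
    by (rule stair_energy[where G=G and T=T, OF a G]) (rule that)
  have m: "stair a G h \<in> borel_measurable borel" if "signal a h" for h
    using that by (intro stair_measurable G) (simp add: signal_def)
  show ?thesis
  proof (rule that[of "sqrt C"])
    show "0 \<le> sqrt C" using C by simp
    fix h :: "real \<Rightarrow> 'w" assume h: "signal a h"
    show "L2_on {0..T} (stair a G h)" using C(2)[OF h] by (simp add: L2_on_borel_iff[OF m[OF h]])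
    have "(L2_norm_on {0..T} (stair a G h))\<^sup>2 \<le> C * energy h"
      using C(3)[OF h] by (simp add: L2_norm_on_borel[OF m[OF h]])
    then show "L2_norm_on {0..T} (stair a G h) \<le> sqrt C * sqrt (energy h)"
      unfolding real_sqrt_mult[symmetric] by (rule real_le_rsqrt)
  qed
qed

section \<open>Existence of solutions along characteristics\<close>

text \<open>
  The difference quotients of a \<open>C\<^sup>1\<close> function converge locally uniformly. This makes travelling waves
  differentiable in time with values in \<open>L\<^sup>2\<close>.
\<close>

lemma C1_shift_uniform:
  fixes g g' :: "real \<Rightarrow> 'v::euclidean_space"
  assumes d: "\<And>s. (g has_vector_derivative g' s) (at s)" and c: "continuous_on UNIV g'" and e: "e > 0"
  shows "eventually (\<lambda>s. \<forall>\<sigma>\<in>{0..a}. norm ((g (s - \<sigma>) - g (t - \<sigma>)) /\<^sub>R (s - t) - g' (t - \<sigma>)) \<le> e) (at t within S)"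
proof -
  have "uniformly_continuous_on {t - 1 - a..t + 1} g'"
    using c by (intro compact_uniformly_continuous continuous_on_subset[OF c]) auto
  then have "\<exists>\<delta>>0. \<forall>r\<in>{t - 1 - a..t + 1}. \<forall>r'\<in>{t - 1 - a..t + 1}. dist r' r < \<delta> \<longrightarrow> dist (g' r') (g' r) < e"
    using e unfolding uniformly_continuous_on_def by (elim allE[of _ e]) (rule mp)
  then obtain \<delta> where \<delta>: "\<delta> > 0" and close: "\<forall>r\<in>{t - 1 - a..t + 1}. \<forall>r'\<in>{t - 1 - a..t + 1}.
      dist r' r < \<delta> \<longrightarrow> dist (g' r') (g' r) < e" by (elim exE conjE)
  have "norm ((g (s - \<sigma>) - g (t - \<sigma>)) /\<^sub>R (s - t) - g' (t - \<sigma>)) \<le> e"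
    if s: "s \<noteq> t" "dist s t < min \<delta> 1" and \<sigma>: "\<sigma> \<in> {0..a}" for s \<sigma>
  proof -
    have "norm (g (s - \<sigma>) - g (t - \<sigma>) - ((s - \<sigma>) - (t - \<sigma>)) *\<^sub>R g' (t - \<sigma>)) \<le> norm ((s - \<sigma>) - (t - \<sigma>)) * e"
    proof (rule vector_differentiable_bound_linearization[where f=g and f'=g' and a="t - \<sigma>" and b="s - \<sigma>" and ?x0.0="t - \<sigma>" and S="closed_segment (t - \<sigma>) (s - \<sigma>)"])
      fix r assume r: "r \<in> closed_segment (t - \<sigma>) (s - \<sigma>)"
      show "(g has_vector_derivative g' r) (at r within closed_segment (t - \<sigma>) (s - \<sigma>))"
        by (rule has_vector_derivative_at_within[OF d])
      have "dist r (t - \<sigma>) \<le> dist (s - \<sigma>) (t - \<sigma>)"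
        using segment_bound(1)[OF r] by (simp add: dist_norm norm_minus_commute)
      then have dr: "dist r (t - \<sigma>) < min \<delta> 1" using s by (simp add: dist_real_def)
      then have "r \<in> {t - 1 - a..t + 1}" using \<sigma> by (auto simp: dist_real_def)
      moreover have "t - \<sigma> \<in> {t - 1 - a..t + 1}" using \<sigma> by auto
      ultimately have "dist (g' r) (g' (t - \<sigma>)) < e" using dr close by simp
      then show "norm (g' r - g' (t - \<sigma>)) \<le> e" by (simp add: dist_norm)
    qed auto
    then have *: "norm (g (s - \<sigma>) - g (t - \<sigma>) - (s - t) *\<^sub>R g' (t - \<sigma>)) \<le> \<bar>s - t\<bar> * e" by simp
    have "(g (s - \<sigma>) - g (t - \<sigma>)) /\<^sub>R (s - t) - g' (t - \<sigma>) =
        (g (s - \<sigma>) - g (t - \<sigma>) - (s - t) *\<^sub>R g' (t - \<sigma>)) /\<^sub>R (s - t)"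
      using s(1) by (simp add: scaleR_diff_right)
    then show ?thesis using * s(1) by (simp add: divide_simps mult.commute)
  qed
  then show ?thesis
    unfolding eventually_at using \<delta> by (intro exI[of _ "min \<delta> 1"]) auto
qed

lemma continuous_shift_uniform:
  fixes g :: "real \<Rightarrow> 'v::euclidean_space"
  assumes c: "continuous_on UNIV g" and e: "e > 0"
  shows "eventually (\<lambda>s. \<forall>\<sigma>\<in>{0..a}. norm (g (s - \<sigma>) - g (t - \<sigma>)) \<le> e) (at t within S)"
proof -
  have "uniformly_continuous_on {t - 1 - a..t + 1} g"
    using c by (intro compact_uniformly_continuous continuous_on_subset[OF c]) auto
  then have "\<exists>\<delta>>0. \<forall>r\<in>{t - 1 - a..t + 1}. \<forall>r'\<in>{t - 1 - a..t + 1}. dist r' r < \<delta> \<longrightarrow> dist (g r') (g r) < e"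
    using e unfolding uniformly_continuous_on_def by (elim allE[of _ e]) (rule mp)
  then obtain \<delta> where \<delta>: "\<delta> > 0" and close: "\<forall>r\<in>{t - 1 - a..t + 1}. \<forall>r'\<in>{t - 1 - a..t + 1}.
      dist r' r < \<delta> \<longrightarrow> dist (g r') (g r) < e" by (elim exE conjE)
  have "norm (g (s - \<sigma>) - g (t - \<sigma>)) \<le> e" if s: "dist s t < min \<delta> 1" and \<sigma>: "\<sigma> \<in> {0..a}" for s \<sigma>
  proof -
    have "dist (g (s - \<sigma>)) (g (t - \<sigma>)) < e"
      using s \<sigma> by (intro bspec[OF bspec[OF close], THEN mp]) (auto simp: dist_real_def)
    then show ?thesis by (simp add: dist_norm)
  qed
  then show ?thesis
    unfolding eventually_at using \<delta> by (intro exI[of _ "min \<delta> 1"]) auto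
qed

lemma measurable_matrix_vector_mult:
  fixes X :: "'z \<Rightarrow> 'k::real_or_complex ^ 'n ^ 'r"
  assumes [measurable]: "X \<in> borel_measurable N" "f \<in> borel_measurable N"
  shows "(\<lambda>x. X x *v f x) \<in> borel_measurable N"
proof -
  have "(\<lambda>p. fst p *v snd p) \<in> borel_measurable (borel :: (('k ^ 'n ^ 'r) \<times> ('k ^ 'n)) measure)"
    by (intro borel_measurable_continuous_onI continuous_intros
        bounded_bilinear.continuous_on[OF bounded_bilinear_matrix_vector_mult])
  then have "(\<lambda>p. fst p *v snd p) \<circ> (\<lambda>x. (X x, f x)) \<in> borel_measurable N"
    by (intro measurable_comp[where N=borel]) measurable
  then show ?thesis by (simp add: o_def)
qed

lemma bounded_linear_matrix_vector_mult:
  "bounded_linear (\<lambda>x. M *v x)" for M :: "'k::real_or_complex ^ 'n ^ 'r"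
  by (rule bounded_bilinear.bounded_linear_right[OF bounded_bilinear_matrix_vector_mult])

lemmas matrix_vector_mult_real_linear [simp] =
  bounded_bilinear.add_right[OF bounded_bilinear_matrix_vector_mult]
  bounded_bilinear.diff_right[OF bounded_bilinear_matrix_vector_mult]
  bounded_bilinear.minus_right[OF bounded_bilinear_matrix_vector_mult]
  bounded_bilinear.minus_left[OF bounded_bilinear_matrix_vector_mult]
  bounded_bilinear.scaleR_right[OF bounded_bilinear_matrix_vector_mult]
  bounded_bilinear.zero_right[OF bounded_bilinear_matrix_vector_mult]

lemma matrix_vector_mult_bounded_family:
  fixes X :: "real \<Rightarrow> 'k::real_or_complex ^ 'n ^ 'r"
  assumes "continuous_on {0..1} X"
  obtains c where "c > 0" "\<And>\<xi> v. \<xi> \<in> {0..1} \<Longrightarrow> norm (X \<xi> *v v) \<le> c * norm v"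
proof -
  obtain K where K: "K > 0" "\<And>(A::'k^'n^'r) v. norm (A *v v) \<le> norm A * norm v * K"
    using bounded_bilinear.pos_bounded[OF bounded_bilinear_matrix_vector_mult] by blast
  have "bounded (X ` {0..1})" using assms by (intro compact_imp_bounded compact_continuous_image) auto
  then obtain B where B: "\<forall>x\<in>X ` {0..1}. norm x \<le> B" unfolding bounded_iff by blast
  have "norm (X \<xi> *v v) \<le> (max B 1 * K) * norm v" if "\<xi> \<in> {0..1}" for \<xi> v
  proof -
    have "norm (X \<xi>) * norm v * K \<le> max B 1 * norm v * K"
      using B that K by (intro mult_right_mono) (auto simp: max.coboundedI1)
    then show ?thesis using K(2)[of "X \<xi>" v] by (simp add: mult_ac)
  qed
  then show ?thesis using that[of "max B 1 * K"] K by simp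
qed

text \<open>
  The matrices are those of the equation for the transported quantity \<open>w = P\<^sup>-\<^sup>1 l0 x\<close>.
\<close>

locale transport_system = travel_time l0 for l0 +
  fixes P0 P :: "real \<Rightarrow> 'k::real_or_complex ^ 'n ^ 'n"
    and E B :: "'k ^ 'm ^ 'n" and K L A :: "'k ^ 'n ^ 'n"
    and Ky Ly C :: "'k ^ 'n ^ 'p" and D :: "'k ^ 'm ^ 'p"
  assumes Linf_P0: "Linf_on {0..1} P0"
    and P_solution: "caratheodory_solution P0 P"
    and K_invertible: "invertible K"
    and A_eq: "A = - (matrix_inv K ** L ** P 1)"
    and B_eq: "B = - (matrix_inv K ** E)"
    and C_eq: "C = (Ky ** matrix_inv K ** L - Ly) ** P 1"
    and D_eq: "D = Ky ** matrix_inv K ** E"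
begin

definition Q :: "real \<Rightarrow> 'k ^ 'n ^ 'n" where "Q \<xi> = matrix_inv (P \<xi>)"

lemma P_0: "P 0 = mat 1" and AC_deriv_P: "AC_deriv P (\<lambda>\<xi>. P0 \<xi> ** P \<xi>)"
  using P_solution by (auto simp: caratheodory_solution_def)

lemma QP: "\<xi> \<in> {0..1} \<Longrightarrow> Q \<xi> ** P \<xi> = mat 1" and PQ: "\<xi> \<in> {0..1} \<Longrightarrow> P \<xi> ** Q \<xi> = mat 1"
  using caratheodory_solution_inverse(1)[OF Linf_P0 P_solution]
  by (simp_all add: Q_def matrix_inv_left matrix_inv_right)

lemma QP_vec: "\<xi> \<in> {0..1} \<Longrightarrow> Q \<xi> *v (P \<xi> *v v) = v" and PQ_vec: "\<xi> \<in> {0..1} \<Longrightarrow> P \<xi> *v (Q \<xi> *v v) = v"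
  by (simp_all add: matrix_vector_mul_assoc QP PQ)

lemma AC_deriv_Q: "AC_deriv Q (\<lambda>\<xi>. - (Q \<xi> ** P0 \<xi>))"
  using caratheodory_solution_inverse(2)[OF Linf_P0 P_solution] by (simp add: Q_def[abs_def])

lemma Q_0: "Q 0 = mat 1"
  using QP[of 0] by (simp add: P_0)

lemma continuous_on_P: "continuous_on {0..1} P" and continuous_on_Q: "continuous_on {0..1} Q"
  using AC_deriv_P AC_deriv_Q by (auto intro: AC_deriv_continuous)

lemma P_measurable[measurable]: "P \<in> borel_measurable (lebesgue_on {0..1})"
  and Q_measurable[measurable]: "Q \<in> borel_measurable (lebesgue_on {0..1})"
  and P0_measurable[measurable]: "P0 \<in> borel_measurable (lebesgue_on {0..1})"
  using continuous_on_P continuous_on_Q Linf_P0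
  by (auto intro: continuous_imp_measurable_on_sets_lebesgue simp: Linf_on_def)

lemma P0_bounded:
  obtains c where "c > 0" "AE \<xi> in lebesgue_on {0..1}. \<forall>v. norm (P0 \<xi> *v v) \<le> c * norm v"
proof -
  obtain k where k: "k > 0" "\<And>(A::'k^'n^'n) v. norm (A *v v) \<le> norm A * norm v * k"
    using bounded_bilinear.pos_bounded[OF bounded_bilinear_matrix_vector_mult] by blast
  obtain M where M: "AE s in lebesgue_on {0..1}. norm (P0 s) \<le> M" using Linf_P0 by (auto simp: Linf_on_def)
  have "AE \<xi> in lebesgue_on {0..1}. \<forall>v. norm (P0 \<xi> *v v) \<le> (max M 1 * k) * norm v"
    using M
  proof eventually_elim
    case (elim \<xi>)
    show ?case
    proof
      fix v :: "'k ^ 'n"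
      have "norm (P0 \<xi>) * norm v * k \<le> max M 1 * norm v * k"
        using elim k by (intro mult_right_mono) auto
      then show "norm (P0 \<xi> *v v) \<le> (max M 1 * k) * norm v" using k(2)[of "P0 \<xi>" v] by (simp add: mult_ac)
    qed
  qed
  then show ?thesis using that[of "max M 1 * k"] k by simp
qed

text \<open>
  With \<open>w0\<close> entering at the left and \<open>w1\<close> leaving at the right end, the boundary condition is the
  loop \<open>w0 = A w1 + B u\<close>, because \<open>K\<close> is invertible.
\<close>

lemma boundary_condition_iff:
  "E *v u = - (K *v w0) - L *v (P 1 *v w1) \<longleftrightarrow> w0 = A *v w1 + B *v u"
proof -
  have inv: "K *v (matrix_inv K *v v) = v" "matrix_inv K *v (K *v v) = v" for v
    using K_invertible by (simp_all add: matrix_vector_mul_assoc matrix_inv_left matrix_inv_right)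
  have AB: "A *v w1 + B *v u = - (matrix_inv K *v (L *v (P 1 *v w1) + E *v u))"
    by (simp add: A_eq B_eq matrix_vector_mul_assoc matrix_mul_assoc)
  have iff: "w0 = - (matrix_inv K *v v) \<longleftrightarrow> v = - (K *v w0)" for v
  proof
    assume "w0 = - (matrix_inv K *v v)"
    then show "v = - (K *v w0)" by (simp add: inv)
  next
    assume "v = - (K *v w0)"
    then show "w0 = - (matrix_inv K *v v)" by (simp add: inv)
  qed
  show ?thesis unfolding AB iff by (simp add: algebra_simps eq_diff_eq)
qed

lemma output_eq:
  assumes "w0 = A *v w1 + B *v u"
  shows "- (Ky *v w0) - Ly *v (P 1 *v w1) = C *v w1 + D *v u"
  by (simp add: assms A_eq B_eq C_eq D_eq matrix_vector_mul_assoc matrix_mul_assoc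
      matrix_vector_mult_diff_rdistrib bounded_bilinear.diff_left[OF bounded_bilinear_matrix_matrix_mult])

text \<open>
  The state \<open>x(\<cdot>,t)\<close> for which the transported quantity \<open>P\<^sup>-\<^sup>1 l0 x\<close> at the position \<open>\<xi>\<close> is \<open>g(t - tau \<xi>)\<close>:
  \<open>g\<close> is the signal that enters at the left end.
\<close>

definition profile :: "(real \<Rightarrow> 'k ^ 'n) \<Rightarrow> real \<Rightarrow> real \<Rightarrow> 'k ^ 'n" where
  "profile g t \<xi> = slowness \<xi> *\<^sub>R (P \<xi> *v g (t - tau \<xi>))"

text \<open>One constant for all signals \<open>g\<close> and times \<open>t\<close>.\<close>

lemma profile_L2_bound:
  obtains c where "c > 0"
    "\<And>g t. (\<lambda>\<xi>. g (t - tau \<xi>)) \<in> borel_measurable (lebesgue_on {0..1}) \<Longrightarrow>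
       profile g t \<in> borel_measurable (lebesgue_on {0..1})"
    "\<And>g t. AE \<xi> in lebesgue_on {0..1}. norm (profile g t \<xi>) \<le> c * norm (g (t - tau \<xi>))"
proof -
  obtain c where c: "c > 0" "\<And>\<xi> v. \<xi> \<in> {0..1} \<Longrightarrow> norm (P \<xi> *v v) \<le> c * norm v"
    using matrix_vector_mult_bounded_family[OF continuous_on_P] by blast
  have "AE \<xi> in lebesgue_on {0..1}. norm (profile g t \<xi>) \<le> (slow_max * c) * norm (g (t - tau \<xi>))" for g t
    using slowness_le slowness_nonneg AE_space
  proof eventually_elim
    case (elim \<xi>)
    have "slowness \<xi> * norm (P \<xi> *v g (t - tau \<xi>)) \<le> slow_max * (c * norm (g (t - tau \<xi>)))"
      using elim c(2)[of \<xi>] by (intro mult_mono) auto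
    then show ?case using elim by (simp add: profile_def mult_ac)
  qed
  moreover have "profile g t \<in> borel_measurable (lebesgue_on {0..1})"
    if [measurable]: "(\<lambda>\<xi>. g (t - tau \<xi>)) \<in> borel_measurable (lebesgue_on {0..1})" for g t
    unfolding profile_def[abs_def]
    by (intro borel_measurable_scaleR measurable_matrix_vector_mult) measurable
  ultimately show ?thesis using that[of "slow_max * c"] c slow_max_pos by simp
qed

lemma travelling_measurable:
  fixes g :: "real \<Rightarrow> 'v::topological_space"
  assumes "g \<in> borel_measurable borel"
  shows "(\<lambda>\<xi>. g (t - tau \<xi>)) \<in> borel_measurable (lebesgue_on {0..1})"
  by (rule measurable_compose[OF _ assms]) measurable

text \<open>
  Uniform convergence of the signals over one travel time, the form in which difference quotients
  converge, implies convergence of the states in \<open>L\<^sup>2\<close>.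
\<close>

lemma uniformly_small_profile:
  assumes small: "\<And>e. e > 0 \<Longrightarrow> eventually (\<lambda>s. \<forall>\<sigma>\<in>{0..period}. norm (G s (t - \<sigma>)) \<le> e) F"
    and m: "\<And>s. G s \<in> borel_measurable borel"
  shows "((\<lambda>s. L2_norm_on {0..1} (profile (G s) t)) \<longlongrightarrow> 0) F"
proof -
  obtain c where c: "c > 0"
    "\<And>g t. (\<lambda>\<xi>. g (t - tau \<xi>)) \<in> borel_measurable (lebesgue_on {0..1}) \<Longrightarrow>
       profile g t \<in> borel_measurable (lebesgue_on {0..1})"
    "\<And>g t. AE \<xi> in lebesgue_on {0..1}. norm (profile g t \<xi>) \<le> c * norm (g (t - tau \<xi>))"
    using profile_L2_bound by blast
  show ?thesis
  proof (rule tendstoI)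
    fix e :: real assume e: "e > 0"
    have "eventually (\<lambda>s. \<forall>\<sigma>\<in>{0..period}. norm (G s (t - \<sigma>)) \<le> e / (2 * c)) F"
      using e c by (intro small) simp
    then show "eventually (\<lambda>s. dist (L2_norm_on {0..1} (profile (G s) t)) 0 < e) F"
    proof eventually_elim
      case (elim s)
      have "L2_norm_on {0..1} (profile (G s) t) \<le> e / 2 * L2_norm_on {0..1} (\<lambda>_. 1::real)"
      proof (rule L2_norm_on_bound)
        show "L2_on {0..1} (\<lambda>_. 1::real)" by (rule L2_on_const) simp
        show "profile (G s) t \<in> borel_measurable (lebesgue_on {0..1})"
          by (intro c(2) travelling_measurable m)
        show "AE \<xi> in lebesgue_on {0..1}. norm (profile (G s) t \<xi>) \<le> e / 2 * norm (1::real)"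
          using c(3)[of "G s" t] AE_space
        proof eventually_elim
          case (elim \<xi>)
          have "norm (G s (t - tau \<xi>)) \<le> e / (2 * c)"
            using elim \<open>\<forall>\<sigma>\<in>{0..period}. norm (G s (t - \<sigma>)) \<le> e / (2 * c)\<close> tau_range[of \<xi>] by simp
          then have "c * norm (G s (t - tau \<xi>)) \<le> c * (e / (2 * c))" using c by (intro mult_left_mono) auto
          then show ?case using elim c by simp
        qed
      qed (use e in simp)
      then show ?case using e by (simp add: L2_norm_on_const L2_norm_on_nonneg)
    qed
  qed
qed

text \<open>
  A \<open>C\<^sup>1\<close> signal satisfying the loop equation travels as a classical solution. The product rule for
  \<open>P(\<xi>) g(t - tau \<xi>)\<close> yields the term with \<open>P0\<close> and, with the sign of the reflection, the time
  derivative.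
\<close>

lemma classical_solution_travelling:
  assumes d: "\<And>s. (g has_vector_derivative g' s) (at s)" and d': "continuous_on UNIV g'"
    and u: "smooth_on_nonneg u"
    and loop: "\<And>t. t \<ge> 0 \<Longrightarrow> g t = A *v g (t - period) + B *v u t"
  shows "classical_solution l0 P0 E K L Ky Ly u (profile g) (\<lambda>t. C *v g (t - period) + D *v u t)"
proof -
  have cg: "continuous_on UNIV g"
    using d by (auto intro!: continuous_at_imp_continuous_on has_vector_derivative_continuous)
  have mg: "g \<in> borel_measurable borel" "g' \<in> borel_measurable borel"
    using cg d' by (auto intro: borel_measurable_continuous_onI)
  obtain c where c: "c > 0"
    "\<And>g t. (\<lambda>\<xi>. g (t - tau \<xi>)) \<in> borel_measurable (lebesgue_on {0..1}) \<Longrightarrow>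
       profile g t \<in> borel_measurable (lebesgue_on {0..1})"
    "\<And>g t. AE \<xi> in lebesgue_on {0..1}. norm (profile g t \<xi>) \<le> c * norm (g (t - tau \<xi>))"
    using profile_L2_bound by blast
  have L2: "L2_on {0..1} (\<lambda>\<xi>. f (t - tau \<xi>))" if "continuous_on UNIV f" for f :: "real \<Rightarrow> 'k ^ 'n" and t
    by (intro continuous_imp_L2_on continuous_on_compose2[OF that] continuous_intros continuous_on_tau) auto
  have L2p: "L2_on {0..1} (profile f t)" if "continuous_on UNIV f" for f t
    by (rule L2_on_bound[OF L2[OF that, of t] c(2)[OF L2_on_measurable[OF L2[OF that, of t]]] c(3)[of f t]]) (use c in simp)
  define z where "z t \<xi> = P \<xi> *v g (t - tau \<xi>)" for t \<xi>
  have C1: "C1_L2 (profile g) (profile g')"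
    unfolding C1_L2_def
  proof (intro allI impI conjI)
    fix t :: real assume t: "t \<ge> 0"
    show "L2_on {0..1} (profile g t)" "L2_on {0..1} (profile g' t)" using L2p cg d' by auto
    have "((\<lambda>s. L2_norm_on {0..1} (profile (\<lambda>r. (g (s - t + r) - g r) /\<^sub>R (s - t) - g' r) t)) \<longlongrightarrow> 0) (at t within {0..})"
    proof (rule uniformly_small_profile)
      fix e :: real assume "e > 0"
      from C1_shift_uniform[OF d d' this]
      show "eventually (\<lambda>s. \<forall>\<sigma>\<in>{0..period}. norm ((g (s - t + (t - \<sigma>)) - g (t - \<sigma>)) /\<^sub>R (s - t) - g' (t - \<sigma>)) \<le> e) (at t within {0..})"
        by simp
    next
      show "(\<lambda>r. (g (s - t + r) - g r) /\<^sub>R (s - t) - g' r) \<in> borel_measurable borel" for s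
        using mg by measurable
    qed
    moreover have "profile (\<lambda>r. (g (s - t + r) - g r) /\<^sub>R (s - t) - g' r) t =
        (\<lambda>\<xi>. (profile g s \<xi> - profile g t \<xi>) /\<^sub>R (s - t) - profile g' t \<xi>)" for s
      by (simp add: fun_eq_iff profile_def algebra_simps)
    ultimately show "((\<lambda>s. L2_norm_on {0..1} (\<lambda>\<xi>. (profile g s \<xi> - profile g t \<xi>) /\<^sub>R (s - t) - profile g' t \<xi>)) \<longlongrightarrow> 0) (at t within {0..})"
      by simp
    have "((\<lambda>s. L2_norm_on {0..1} (profile (\<lambda>r. g' (s - t + r) - g' r) t)) \<longlongrightarrow> 0) (at t within {0..})"
    proof (rule uniformly_small_profile)
      fix e :: real assume "e > 0"
      from continuous_shift_uniform[OF d' this]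
      show "eventually (\<lambda>s. \<forall>\<sigma>\<in>{0..period}. norm (g' (s - t + (t - \<sigma>)) - g' (t - \<sigma>)) \<le> e) (at t within {0..})"
        by simp
    next
      show "(\<lambda>r. g' (s - t + r) - g' r) \<in> borel_measurable borel" for s
        using mg by measurable
    qed
    moreover have "profile (\<lambda>r. g' (s - t + r) - g' r) t = (\<lambda>\<xi>. profile g' s \<xi> - profile g' t \<xi>)" for s
      by (simp add: fun_eq_iff profile_def algebra_simps)
    ultimately show "((\<lambda>s. L2_norm_on {0..1} (\<lambda>\<xi>. profile g' s \<xi> - profile g' t \<xi>)) \<longlongrightarrow> 0) (at t within {0..})"
      by simp
  qed
  show ?thesis
    unfolding classical_solution_def
  proof (rule conjI[OF u], rule exI[of _ "profile g'"], rule exI[of _ z], intro conjI C1 allI impI)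
    fix t :: real assume t: "t \<ge> 0"
    define z' where "z' \<xi> = (P0 \<xi> ** P \<xi>) *v g (t - tau \<xi>) + P \<xi> *v (- (slowness \<xi> *\<^sub>R g' (t - tau \<xi>)))" for \<xi>
    show "AE \<xi> in lebesgue_on {0..1}. z t \<xi> = l0 \<xi> *\<^sub>R profile g t \<xi>"
      using l0_slowness by eventually_elim (simp add: profile_def z_def)
    have zt: "z t = (\<lambda>\<xi>. P \<xi> *v g (t - tau \<xi>))" by (simp add: z_def[abs_def])
    have "AC_deriv (z t) z'"
      unfolding zt z'_def[abs_def]
      by (intro AC_deriv_product[OF bounded_bilinear_matrix_vector_mult AC_deriv_P] AC_deriv_travelling d d')
    moreover have "L2_on {0..1} z'"
    proof -
      obtain c0 where c0: "c0 > 0" "AE \<xi> in lebesgue_on {0..1}. \<forall>v. norm (P0 \<xi> *v v) \<le> c0 * norm v"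
        using P0_bounded by blast
      have L2z: "L2_on {0..1} (z t)"
        unfolding zt by (intro continuous_imp_L2_on bounded_bilinear.continuous_on[OF bounded_bilinear_matrix_vector_mult]
          continuous_on_P continuous_on_compose2[OF cg] continuous_intros continuous_on_tau) auto
      have "L2_on {0..1} (\<lambda>\<xi>. P0 \<xi> *v z t \<xi>)"
        by (rule L2_on_bound[OF L2z, where c=c0])
          (use c0 in \<open>auto intro!: measurable_matrix_vector_mult L2_on_measurable[OF L2z] elim!: eventually_mono\<close>)
      moreover have "L2_on {0..1} (profile g' t)" by (rule L2p[OF d'])
      ultimately have "L2_on {0..1} (\<lambda>\<xi>. P0 \<xi> *v z t \<xi> - profile g' t \<xi>)" by (rule L2_on_diff)
      moreover have "z' = (\<lambda>\<xi>. P0 \<xi> *v z t \<xi> - profile g' t \<xi>)"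
        by (simp add: fun_eq_iff z'_def z_def profile_def matrix_vector_mul_assoc)
      ultimately show ?thesis by simp
    qed
    moreover have "AE \<xi> in lebesgue_on {0..1}. profile g' t \<xi> = - z' \<xi> + P0 \<xi> *v z t \<xi>"
      by (intro AE_I2) (simp add: z'_def z_def profile_def matrix_vector_mul_assoc)
    ultimately show "\<exists>z'. AC_deriv (z t) z' \<and> L2_on {0..1} z' \<and>
        (AE \<xi> in lebesgue_on {0..1}. profile g' t \<xi> = - z' \<xi> + P0 \<xi> *v z t \<xi>)" by blast
    have z0: "z t 0 = g t" and z1: "z t 1 = P 1 *v g (t - period)"
      by (simp_all add: z_def tau_0 P_0 period_def)
    show "E *v u t = - (K *v z t 0) - L *v z t 1"
      unfolding z0 z1 boundary_condition_iff by (rule loop[OF t])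
    show "C *v g (t - period) + D *v u t = - (Ky *v z t 0) - Ly *v z t 1"
      unfolding z0 z1 by (rule output_eq[OF loop[OF t], symmetric])
  qed
qed

text \<open>
  The state at time \<open>t\<close> depends on the signal in \<open>[t - period, t]\<close>, shifted by one period since the
  zeroth step of the staircase describes the initial state. The constant is uniform in \<open>t \<le> T\<close>, as
  uniform convergence in time requires.
\<close>

lemma profile_stair:
  fixes G :: "nat \<Rightarrow> 'w::euclidean_space \<Rightarrow> 'k::real_or_complex ^ 'n"
  assumes G: "\<And>k. linear (G k)" and T: "T \<ge> 0"
  obtains c where "c \<ge> 0"
    "\<And>h t. signal period h \<Longrightarrow> t \<in> {0..T} \<Longrightarrow> L2_on {0..1} (profile (\<lambda>s. stair period G h (s + period)) t)"
    "\<And>h t. signal period h \<Longrightarrow> t \<in> {0..T} \<Longrightarrow>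
       L2_norm_on {0..1} (profile (\<lambda>s. stair period G h (s + period)) t) \<le> c * sqrt (energy h)"
proof -
  obtain C1 where C1: "C1 \<ge> 0"
    "\<And>h. signal period h \<Longrightarrow> integrable lborel (\<lambda>s. indicator {0..T + period} s * (norm (stair period G h s))\<^sup>2)"
    "\<And>h. signal period h \<Longrightarrow> (LINT s|lborel. indicator {0..T + period} s * (norm (stair period G h s))\<^sup>2) \<le> C1 * energy h"
    by (rule stair_energy[where G=G and T="T + period", OF period_pos G]) (rule that)
  obtain c where c: "c > 0"
    "\<And>g t. (\<lambda>\<xi>. g (t - tau \<xi>)) \<in> borel_measurable (lebesgue_on {0..1}) \<Longrightarrow>
       profile g t \<in> borel_measurable (lebesgue_on {0..1})"
    "\<And>g t. AE \<xi> in lebesgue_on {0..1}. norm (profile g t \<xi>) \<le> c * norm (g (t - tau \<xi>))"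
    using profile_L2_bound by blast
  have key: "L2_on {0..1} (profile (\<lambda>s. stair period G h (s + period)) t) \<and>
      L2_norm_on {0..1} (profile (\<lambda>s. stair period G h (s + period)) t) \<le> (c * sqrt (C1 / slow_min)) * sqrt (energy h)"
    if h: "signal period h" and t: "t \<in> {0..T}" for h t
  proof -
    have m[measurable]: "stair period G h \<in> borel_measurable borel"
      using h by (intro stair_measurable G) (simp add: signal_def)
    define f where "f s = stair period G h (s + period)" for s
    have mf[measurable]: "f \<in> borel_measurable borel" unfolding f_def[abs_def] by measurable
    have le: "indicator {t..t + period} s *\<^sub>R (norm (stair period G h s))\<^sup>2 \<le>
        indicator {0..T + period} s * (norm (stair period G h s))\<^sup>2" for s
      using t by (auto simp: indicator_def)
    have i1: "integrable lborel (\<lambda>s. indicator {t..t + period} s *\<^sub>R (norm (stair period G h s))\<^sup>2)"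
      by (rule Bochner_Integration.integrable_bound[OF C1(2)[OF h]]) (measurable, use t in \<open>auto simp: indicator_def\<close>)
    have ind: "indicator {t..t + period} (period + 1 * s) = (indicator {t - period..t} s :: real)" for s
      by (auto simp: indicator_def)
    have i2: "integrable lborel (\<lambda>s. indicator {t - period..t} s *\<^sub>R (norm (f s))\<^sup>2)"
      using lborel_integrable_real_affine[OF i1, of 1 period] ind by (simp add: f_def add.commute)
    have "(LINT s|lborel. indicator {t - period..t} s *\<^sub>R (norm (f s))\<^sup>2) =
        (LINT s|lborel. indicator {t..t + period} s *\<^sub>R (norm (stair period G h s))\<^sup>2)"
      using lborel_integral_real_affine[of 1 "\<lambda>s. indicator {t..t + period} s *\<^sub>R (norm (stair period G h s))\<^sup>2" period] ind
      by (simp add: f_def add.commute)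
    also have "\<dots> \<le> C1 * energy h"
      using integral_mono[OF i1 C1(2)[OF h] le] C1(3)[OF h] by linarith
    finally have en: "(LINT s|lborel. indicator {t - period..t} s *\<^sub>R (norm (f s))\<^sup>2) \<le> C1 * energy h" .
    have L2f: "L2_on {0..1} (\<lambda>\<xi>. f (t - tau \<xi>))" by (rule L2_on_travelling[OF mf i2])
    have "(L2_norm_on {0..1} (\<lambda>\<xi>. f (t - tau \<xi>)))\<^sup>2 \<le> C1 * energy h / slow_min"
      using L2_norm_on_travelling[OF mf i2] en slow_min_pos
      by (smt (verit, best) divide_right_mono)
    then have "L2_norm_on {0..1} (\<lambda>\<xi>. f (t - tau \<xi>)) \<le> sqrt (C1 / slow_min) * sqrt (energy h)"
      unfolding real_sqrt_mult[symmetric] by (intro real_le_rsqrt) simp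
    then have "c * L2_norm_on {0..1} (\<lambda>\<xi>. f (t - tau \<xi>)) \<le> c * (sqrt (C1 / slow_min) * sqrt (energy h))"
      using c by (intro mult_left_mono) auto
    moreover have mp: "profile f t \<in> borel_measurable (lebesgue_on {0..1})"
      by (intro c(2) travelling_measurable mf)
    moreover have "L2_norm_on {0..1} (profile f t) \<le> c * L2_norm_on {0..1} (\<lambda>\<xi>. f (t - tau \<xi>))"
      by (rule L2_norm_on_bound[OF L2f mp c(3)]) (use c in simp)
    moreover have "L2_on {0..1} (profile f t)"
      by (rule L2_on_bound[OF L2f mp c(3)]) (use c in simp)
    ultimately show ?thesis by (simp add: f_def[abs_def] mult_ac)
  qed
  show ?thesis
    by (rule that[of "c * sqrt (C1 / slow_min)"]) (use key c C1 slow_min_pos in auto)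
qed

lemma profile_diff: "profile (\<lambda>s. f s - g s) t \<xi> = profile f t \<xi> - profile g t \<xi>"
  by (simp add: profile_def scaleR_diff_right)

lemma smooth_on_nonneg_stair:
  fixes U :: "nat \<Rightarrow> 'w::euclidean_space \<Rightarrow> 'u::euclidean_space"
  assumes "\<And>k. linear (U k)" "flat_jet a D'" "a > 0"
  shows "smooth_on_nonneg (stair a U (D' 0))"
  unfolding smooth_on_nonneg_def
  by (intro exI[of _ "\<lambda>i. stair a U (D' i)"] conjI refl allI impI has_vector_derivative_at_within[of "stair a U _" _ _ "{0..}"])
    (rule stair_has_vector_derivative[OF assms(3,1,2)])

text \<open>
  The recursion for \<open>G\<close> is the loop equation for the staircases; flat data make them smooth, and in
  particular compatible at the junctions and at time \<open>0\<close>.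
\<close>

lemma classical_solution_stair:
  fixes G :: "nat \<Rightarrow> 'w::euclidean_space \<Rightarrow> 'k::real_or_complex ^ 'n" and U :: "nat \<Rightarrow> 'w::euclidean_space \<Rightarrow> 'k::real_or_complex ^ 'm"
  assumes G: "\<And>k. linear (G k)" and U: "\<And>k. linear (U k)"
    and step: "\<And>k w. G (Suc k) w = A *v G k w + B *v U k w"
    and D': "flat_jet period D'"
  shows "classical_solution l0 P0 E K L Ky Ly (stair period U (D' 0))
    (profile (\<lambda>s. stair period G (D' 0) (s + period)))
    (\<lambda>t. C *v stair period G (D' 0) t + D *v stair period U (D' 0) t)"
proof -
  have d: "((\<lambda>s. stair period G (D' i) (s + period)) has_vector_derivative stair period G (D' (Suc i)) (s + period)) (at s)" for i s
  proof -
    have "(stair period G (D' i) has_vector_derivative stair period G (D' (Suc i)) (s + period)) (at (s + period))"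
      by (rule stair_has_vector_derivative[where G=G and D=D', OF period_pos G D'])
    then have "((stair period G (D' i) \<circ> (\<lambda>s. s + period)) has_vector_derivative 1 *\<^sub>R stair period G (D' (Suc i)) (s + period)) (at s)"
      by (intro vector_diff_chain_at) (auto intro!: derivative_eq_intros)
    then show ?thesis by (simp add: o_def)
  qed
  have "classical_solution l0 P0 E K L Ky Ly (stair period U (D' 0))
    (profile (\<lambda>s. stair period G (D' 0) (s + period)))
    (\<lambda>t. C *v stair period G (D' 0) (t - period + period) + D *v stair period U (D' 0) t)"
  proof (rule classical_solution_travelling[OF d])
    show "continuous_on UNIV (\<lambda>s. stair period G (D' (Suc 0)) (s + period))"
      by (rule continuous_on_compose2[OF stair_continuous[where G=G and D=D' and S=UNIV, OF period_pos G D']])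
        (auto intro!: continuous_intros)
    show "smooth_on_nonneg (stair period U (D' 0))"
      by (rule smooth_on_nonneg_stair[where U=U, OF U D' period_pos])
    fix t :: real assume t: "t \<ge> 0"
    show "stair period G (D' 0) (t + period) = A *v stair period G (D' 0) (t - period + period) + B *v stair period U (D' 0) t"
      using stair_shift[OF period_pos t, of G "D' 0"] by (simp add: stair_def step)
  qed
  then show ?thesis by simp
qed

text \<open>
  All staircases are continuous in their data \<open>h\<close> with respect to the \<open>L\<^sup>2\<close> norms, and flat data
  are dense. So staircases of square integrable data are limits of classical solutions.
\<close>

lemma mild_solution_stair:
  fixes G :: "nat \<Rightarrow> 'w::euclidean_space \<Rightarrow> 'k::real_or_complex ^ 'n" and U :: "nat \<Rightarrow> 'w::euclidean_space \<Rightarrow> 'k::real_or_complex ^ 'm"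
  assumes G: "\<And>k. linear (G k)" and U: "\<And>k. linear (U k)"
    and step: "\<And>k w. G (Suc k) w = A *v G k w + B *v U k w"
    and h: "signal period h" and u: "\<And>s. s \<ge> 0 \<Longrightarrow> u s = stair period U h s"
    and x0: "L2_on {0..1} x0" "AE \<xi> in lebesgue_on {0..1}. x0 \<xi> = profile (\<lambda>s. stair period G h (s + period)) 0 \<xi>"
  shows "mild_solution l0 P0 E K L Ky Ly x0 u (profile (\<lambda>s. stair period G h (s + period)))
    (\<lambda>t. C *v stair period G h t + D *v stair period U h t)"
proof -
  have "\<exists>D'. flat_jet period D' \<and> energy (\<lambda>t. D' 0 t - h t) < inverse (real (Suc j))" for j
    using flat_jets_dense[OF h period_pos, of "inverse (real (Suc j))"] by (metis inverse_positive_iff_positive of_nat_0_less_iff zero_less_Suc)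
  then obtain J where J: "\<And>j. flat_jet period (J j)" "\<And>j. energy (\<lambda>t. J j 0 t - h t) < inverse (real (Suc j))"
    by metis
  have sJ: "signal period (J j 0)" for j by (rule flat_jet_signal[OF J(1)])
  have sd: "signal period (\<lambda>t. J j 0 t - h t)" for j by (rule signal_diff[OF sJ h])
  have lim: "(\<lambda>j. c * sqrt (energy (\<lambda>t. J j 0 t - h t))) \<longlonglongrightarrow> 0" for c
  proof -
    have "(\<lambda>j. energy (\<lambda>t. J j 0 t - h t)) \<longlonglongrightarrow> 0"
      by (rule tendsto_sandwich[OF always_eventually always_eventually tendsto_const LIMSEQ_inverse_real_of_nat])
        (use less_imp_le[OF J(2)] in auto)
    then have "(\<lambda>j. c * sqrt (energy (\<lambda>t. J j 0 t - h t))) \<longlonglongrightarrow> c * sqrt 0" by (intro tendsto_intros)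
    then show ?thesis by simp
  qed
  (* The output is again a staircase, so that it is covered by the same estimate as the input. *)
  define Y where "Y k w = C *v G k w + D *v U k w" for k w
  have Y: "linear (Y k)" for k
    unfolding Y_def[abs_def]
    by (rule linearI) (simp_all add: linear_add[OF G] linear_add[OF U] linear_scale[OF G] linear_scale[OF U] scaleR_add_right)
  have sY: "C *v stair period G f t + D *v stair period U f t = stair period Y f t" for f t
    by (simp add: stair_def Y_def)
  have trace: "L2_on {0..T} (stair period V h)"
    "(\<lambda>j. L2_norm_on {0..T} (\<lambda>s. stair period V (J j 0) s - stair period V h s)) \<longlonglongrightarrow> 0"
    if V: "\<And>k. linear (V k)" for V :: "nat \<Rightarrow> 'w \<Rightarrow> 'z::euclidean_space" and T
  proof -
    obtain c where c: "c \<ge> 0" "\<And>h. signal period h \<Longrightarrow> L2_on {0..T} (stair period V h)"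
      "\<And>h. signal period h \<Longrightarrow> L2_norm_on {0..T} (stair period V h) \<le> c * sqrt (energy h)"
      by (rule stair_L2[where G=V and T=T, OF period_pos V]) (rule that)
    show "L2_on {0..T} (stair period V h)" by (rule c(2)[OF h])
    have eq: "(\<lambda>s. stair period V (J j 0) s - stair period V h s) = stair period V (\<lambda>t. J j 0 t - h t)" for j
      by (simp add: fun_eq_iff stair_diff[OF V])
    show "(\<lambda>j. L2_norm_on {0..T} (\<lambda>s. stair period V (J j 0) s - stair period V h s)) \<longlonglongrightarrow> 0"
      unfolding eq
      by (rule tendsto_sandwich[OF _ _ tendsto_const lim[of c]]) (use c(3)[OF sd] in \<open>auto simp: L2_norm_on_nonneg\<close>)
  qed
  define X where "X f = profile (\<lambda>s. stair period G f (s + period))" for f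
  have Xdiff: "(\<lambda>\<xi>. X (J j 0) t \<xi> - X h t \<xi>) = X (\<lambda>t. J j 0 t - h t) t" for j t
    by (simp add: X_def fun_eq_iff stair_diff[OF G] flip: profile_diff)
  have state: "L2_on {0..1} (X h t)" "uniform_limit {0..t} (\<lambda>j t. L2_norm_on {0..1} (\<lambda>\<xi>. X (J j 0) t \<xi> - X h t \<xi>)) (\<lambda>_. 0) sequentially"
    if t: "t \<ge> 0" for t
  proof -
    obtain c where "c \<ge> 0"
      and c2: "\<And>h s. signal period h \<Longrightarrow> s \<in> {0..t} \<Longrightarrow> L2_on {0..1} (profile (\<lambda>s. stair period G h (s + period)) s)"
      and c3: "\<And>h s. signal period h \<Longrightarrow> s \<in> {0..t} \<Longrightarrow>
        L2_norm_on {0..1} (profile (\<lambda>s. stair period G h (s + period)) s) \<le> c * sqrt (energy h)"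
      by (rule profile_stair[where G=G and T=t, OF G t]) (rule that)
    show "L2_on {0..1} (X h t)" using c2[OF h, of t] t by (simp add: X_def)
    show "uniform_limit {0..t} (\<lambda>j t. L2_norm_on {0..1} (\<lambda>\<xi>. X (J j 0) t \<xi> - X h t \<xi>)) (\<lambda>_. 0) sequentially"
    proof (rule uniform_limitI)
      fix e :: real assume "e > 0"
      then have "eventually (\<lambda>j. c * sqrt (energy (\<lambda>t. J j 0 t - h t)) < e) sequentially"
        using lim[of c] by (intro order_tendstoD)
      then show "eventually (\<lambda>j. \<forall>s\<in>{0..t}. dist (L2_norm_on {0..1} (\<lambda>\<xi>. X (J j 0) s \<xi> - X h s \<xi>)) 0 < e) sequentially"
      proof eventually_elim
        case (elim j)
        show ?case
        proof
          fix s assume "s \<in> {0..t}"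
          from c3[OF sd this, of j] show "dist (L2_norm_on {0..1} (\<lambda>\<xi>. X (J j 0) s \<xi> - X h s \<xi>)) 0 < e"
            using elim unfolding Xdiff by (simp add: L2_norm_on_nonneg X_def)
        qed
      qed
    qed
  qed
  have init: "(\<lambda>j. L2_norm_on {0..1} (\<lambda>\<xi>. X (J j 0) 0 \<xi> - x0 \<xi>)) \<longlonglongrightarrow> 0"
  proof -
    have "(\<lambda>j. L2_norm_on {0..1} (\<lambda>\<xi>. X (J j 0) 0 \<xi> - X h 0 \<xi>)) \<longlonglongrightarrow> 0"
      using tendsto_uniform_limitI[OF state(2)[of 0], of 0] by simp
    (* The initial state x0 is given almost everywhere only, hence a comparison of norms. *)
    moreover have "L2_norm_on {0..1} (\<lambda>\<xi>. X (J j 0) 0 \<xi> - X h 0 \<xi>) = L2_norm_on {0..1} (\<lambda>\<xi>. X (J j 0) 0 \<xi> - x0 \<xi>)" for j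
    proof (rule L2_norm_on_cong_AE)
      obtain c where c: "\<And>h. signal period h \<Longrightarrow> L2_on {0..1} (X h 0)"
        unfolding X_def using profile_stair[where G=G and T=0, OF G] by (metis atLeastAtMost_iff order_refl)
      note [measurable] = L2_on_measurable[OF c[OF sJ]] L2_on_measurable[OF c[OF h]] L2_on_measurable[OF x0(1)]
      show "(\<lambda>\<xi>. X (J j 0) 0 \<xi> - X h 0 \<xi>) \<in> borel_measurable (lebesgue_on {0..1})" by measurable
      show "(\<lambda>\<xi>. X (J j 0) 0 \<xi> - x0 \<xi>) \<in> borel_measurable (lebesgue_on {0..1})" by measurable
      show "AE \<xi> in lebesgue_on {0..1}. X (J j 0) 0 \<xi> - X h 0 \<xi> = X (J j 0) 0 \<xi> - x0 \<xi>"
        using x0(2) by eventually_elim (simp add: X_def)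
    qed
    ultimately show ?thesis by simp
  qed
  have u_norm: "L2_norm_on {0..T} (\<lambda>s. stair period U (J j 0) s - u s) =
      L2_norm_on {0..T} (\<lambda>s. stair period U (J j 0) s - stair period U h s)" for j T
    by (rule L2_norm_on_cong) (simp add: u)
  have u_L2: "L2_on {0..T} u" for T
    using trace(1)[OF U, of T] L2_on_cong[of "{0..T}" u "stair period U h"] u by simp
  show ?thesis
    unfolding mild_solution_def
  proof (intro conjI allI impI x0(1))
    show "L2_loc u" unfolding L2_loc_def using u_L2 by simp
    show "L2_on {0..1} (profile (\<lambda>s. stair period G h (s + period)) t)" if "t \<ge> 0" for t
      using state(1)[OF that] by (simp add: X_def)
    show "L2_loc (\<lambda>t. C *v stair period G h t + D *v stair period U h t)"
      unfolding L2_loc_def sY using trace(1)[OF Y] by simp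
    show "\<exists>uu xx yy. (\<forall>j::nat. classical_solution l0 P0 E K L Ky Ly (uu j) (xx j) (yy j)) \<and>
       (\<lambda>j. L2_norm_on {0..1} (\<lambda>\<xi>. xx j 0 \<xi> - x0 \<xi>)) \<longlonglongrightarrow> 0 \<and>
       (\<forall>T\<ge>0.
         (\<lambda>j. L2_norm_on {0..T} (\<lambda>s. uu j s - u s)) \<longlonglongrightarrow> 0 \<and>
         uniform_limit {0..T} (\<lambda>j t. L2_norm_on {0..1} (\<lambda>\<xi>. xx j t \<xi> - profile (\<lambda>s. stair period G h (s + period)) t \<xi>)) (\<lambda>_. 0)
           sequentially \<and>
         (\<lambda>j. L2_norm_on {0..T} (\<lambda>s. yy j s - (C *v stair period G h s + D *v stair period U h s))) \<longlonglongrightarrow> 0)"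
    proof (rule exI[of _ "\<lambda>j. stair period U (J j 0)"], rule exI[of _ "\<lambda>j. X (J j 0)"],
        rule exI[of _ "\<lambda>j t. C *v stair period G (J j 0) t + D *v stair period U (J j 0) t"], intro conjI allI impI)
      show "classical_solution l0 P0 E K L Ky Ly (stair period U (J j 0)) (X (J j 0))
          (\<lambda>t. C *v stair period G (J j 0) t + D *v stair period U (J j 0) t)" for j
        unfolding X_def by (rule classical_solution_stair[where G=G and U=U, OF G U step J(1)])
      show "(\<lambda>j. L2_norm_on {0..1} (\<lambda>\<xi>. X (J j 0) 0 \<xi> - x0 \<xi>)) \<longlonglongrightarrow> 0" by (rule init)
      fix T :: real assume T: "T \<ge> 0"
      show "(\<lambda>j. L2_norm_on {0..T} (\<lambda>s. stair period U (J j 0) s - u s)) \<longlonglongrightarrow> 0"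
        unfolding u_norm by (rule trace(2)[OF U])
      show "uniform_limit {0..T} (\<lambda>j t. L2_norm_on {0..1} (\<lambda>\<xi>. X (J j 0) t \<xi> - profile (\<lambda>s. stair period G h (s + period)) t \<xi>)) (\<lambda>_. 0) sequentially"
        using state(2)[OF T] by (simp add: X_def)
      show "(\<lambda>j. L2_norm_on {0..T} (\<lambda>s. C *v stair period G (J j 0) s + D *v stair period U (J j 0) s -
          (C *v stair period G h s + D *v stair period U h s))) \<longlonglongrightarrow> 0"
        unfolding sY by (rule trace(2)[OF Y])
    qed
  qed
qed

end

section \<open>The weak form of the equation\<close>

lemma C1_L2_D:
  assumes "C1_L2 x x'" "t \<ge> 0"
  shows "L2_on {0..1} (x t)" "L2_on {0..1} (x' t)"
    "((\<lambda>s. L2_norm_on {0..1} (\<lambda>\<xi>. (x s \<xi> - x t \<xi>) /\<^sub>R (s - t) - x' t \<xi>)) \<longlongrightarrow> 0) (at t within {0..})"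
    "((\<lambda>s. L2_norm_on {0..1} (\<lambda>\<xi>. x' s \<xi> - x' t \<xi>)) \<longlongrightarrow> 0) (at t within {0..})"
  using assms unfolding C1_L2_def by blast+

lemma eventually_at_within_nonneg:
  "eventually (\<lambda>s. s \<ge> 0 \<and> s \<noteq> t) (at t within {0..})" for t :: real
  by (simp add: eventually_at_filter)

lemma C1_L2_continuous:
  fixes x :: "real \<Rightarrow> real \<Rightarrow> 'v::euclidean_space"
  assumes x: "C1_L2 x x'" and t: "t \<ge> 0"
  shows "((\<lambda>s. L2_norm_on {0..1} (\<lambda>\<xi>. x s \<xi> - x t \<xi>)) \<longlongrightarrow> 0) (at t within {0..})"
proof -
  note c = C1_L2_D[OF x]
  define N where "N s = L2_norm_on {0..1} (\<lambda>\<xi>. (x s \<xi> - x t \<xi>) /\<^sub>R (s - t) - x' t \<xi>)" for s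
  have N: "(N \<longlongrightarrow> 0) (at t within {0..})" unfolding N_def by (rule c(3)[OF t])
  have le: "eventually (\<lambda>s. L2_norm_on {0..1} (\<lambda>\<xi>. x s \<xi> - x t \<xi>) \<le> \<bar>s - t\<bar> * (N s + L2_norm_on {0..1} (x' t))) (at t within {0..})"
    using eventually_at_within_nonneg
  proof eventually_elim
    case (elim s)
    have L2: "L2_on {0..1} (\<lambda>\<xi>. (x s \<xi> - x t \<xi>) /\<^sub>R (s - t) - x' t \<xi>)"
      using elim t by (intro L2_on_diff L2_on_scaleR c) auto
    have "L2_norm_on {0..1} (\<lambda>\<xi>. x s \<xi> - x t \<xi>) =
        L2_norm_on {0..1} (\<lambda>\<xi>. (s - t) *\<^sub>R (((x s \<xi> - x t \<xi>) /\<^sub>R (s - t) - x' t \<xi>) + x' t \<xi>))"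
      using elim by (simp add: scaleR_diff_right)
    also have "\<dots> = \<bar>s - t\<bar> * L2_norm_on {0..1} (\<lambda>\<xi>. ((x s \<xi> - x t \<xi>) /\<^sub>R (s - t) - x' t \<xi>) + x' t \<xi>)"
      by (rule L2_norm_on_scaleR[OF L2_on_add[OF L2 c(2)[OF t]]])
    also have "\<dots> \<le> \<bar>s - t\<bar> * (N s + L2_norm_on {0..1} (x' t))"
      unfolding N_def by (intro mult_left_mono L2_norm_on_triangle[OF L2 c(2)[OF t]]) simp
    finally show ?case .
  qed
  have "((\<lambda>s. \<bar>s - t\<bar> * (N s + L2_norm_on {0..1} (x' t))) \<longlongrightarrow> \<bar>t - t\<bar> * (0 + L2_norm_on {0..1} (x' t))) (at t within {0..})"
    by (intro tendsto_intros N)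
  then show ?thesis
    by (intro tendsto_sandwich[OF _ le tendsto_const]) (auto simp: L2_norm_on_nonneg)
qed

text \<open>
  The value at one point differs from the values elsewhere by at most the integral of the
  derivative; averaging over the interval gives the bound.
\<close>

lemma AC_deriv_pointwise_bound:
  fixes f :: "real \<Rightarrow> 'v::euclidean_space"
  assumes f: "AC_deriv f f'" and \<xi>: "\<xi> \<in> {0..1}"
  shows "norm (f \<xi>) \<le> (LINT s|lebesgue_on {0..1}. norm (f s)) + (LINT s|lebesgue_on {0..1}. norm (f' s))"
proof -
  let ?M = "lebesgue_on {0..1::real}"
  let ?V = "LINT s|?M. norm (f' s)"
  interpret finite_measure ?M by (rule finite_measure_lebesgue_on) simp
  have if': "integrable ?M f'" by (rule AC_deriv_integrable[OF f])
  have "L2_on {0..1} f" by (rule continuous_imp_L2_on[OF AC_deriv_continuous[OF f]])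
  then have i: "integrable ?M f" by (rule L2_imp_integrable) simp
  have inc: "norm (f y - f x) \<le> ?V" if "0 \<le> x" "x \<le> y" "y \<le> 1" for x y
  proof -
    have s: "{x..y} \<in> sets ?M" using that by (auto simp: sets_restrict_space_iff)
    have "integrable ?M (\<lambda>s. indicator {x..y} s *\<^sub>R f' s)" by (rule integrable_mult_indicator[OF s if'])
    then have "((\<lambda>s. indicator {x..y} s *\<^sub>R f' s) has_integral (LINT s|?M. indicator {x..y} s *\<^sub>R f' s)) {0..1}"
      by (rule has_integral_integral_lebesgue_on) simp
    then have "((\<lambda>s. if s \<in> {x..y} then f' s else 0) has_integral (LINT s|?M. indicator {x..y} s *\<^sub>R f' s)) {0..1}"
      by (simp add: indicator_scaleR_eq_if)
    then have "(f' has_integral (LINT s|?M. indicator {x..y} s *\<^sub>R f' s)) {x..y}"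
      using that by (subst (asm) has_integral_restrict) auto
    then have "f y - f x = (LINT s|?M. indicator {x..y} s *\<^sub>R f' s)"
      using AC_deriv_integral(2)[OF f that] by (simp add: integral_unique)
    also have "norm \<dots> \<le> (LINT s|?M. norm (indicator {x..y} s *\<^sub>R f' s))" by (rule integral_norm_bound)
    also have "\<dots> \<le> ?V"
      by (rule integral_mono[OF integrable_norm[OF integrable_mult_indicator[OF s if']] integrable_norm[OF if']])
        (auto simp: indicator_def)
    finally show ?thesis .
  qed
  have le: "norm (f \<xi>) \<le> norm (f s) + ?V" if "s \<in> space ?M" for s
  proof -
    have "norm (f \<xi> - f s) \<le> ?V"
      using inc[of s \<xi>] inc[of \<xi> s] that \<xi> by (cases "s \<le> \<xi>") (auto simp: norm_minus_commute)
    then show ?thesis using norm_triangle_sub[of "f \<xi>" "f s"] by linarith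
  qed
  have "norm (f \<xi>) = (LINT s|?M. norm (f \<xi>))" by (simp add: measure_restrict_space)
  also have "\<dots> \<le> (LINT s|?M. norm (f s) + ?V)"
    using le i by (intro integral_mono) auto
  also have "\<dots> = (LINT s|?M. norm (f s)) + ?V" using i by (simp add: measure_restrict_space)
  finally show ?thesis .
qed

context transport_system
begin

text \<open>
  The inner product of a test profile with \<open>Q x\<close>. Since \<open>Q x = slowness w\<close> for the transported quantity
  \<open>w\<close>, it is the integral of \<open>\<phi> \<bullet> w\<close> with respect to travel time.
\<close>

definition pairing :: "(real \<Rightarrow> 'k ^ 'n) \<Rightarrow> (real \<Rightarrow> 'k ^ 'n) \<Rightarrow> real" where
  "pairing \<phi> x = (LINT \<xi>|lebesgue_on {0..1}. \<phi> \<xi> \<bullet> (Q \<xi> *v x \<xi>))"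

lemma Q_bounded:
  obtains c where "c > 0" "\<And>x. L2_on {0..1} x \<Longrightarrow> L2_on {0..1} (\<lambda>\<xi>. Q \<xi> *v x \<xi>)"
    "\<And>x. L2_on {0..1} x \<Longrightarrow> L2_norm_on {0..1} (\<lambda>\<xi>. Q \<xi> *v x \<xi>) \<le> c * L2_norm_on {0..1} x"
proof -
  obtain c where c: "c > 0" "\<And>\<xi> v. \<xi> \<in> {0..1} \<Longrightarrow> norm (Q \<xi> *v v) \<le> c * norm v"
    using matrix_vector_mult_bounded_family[OF continuous_on_Q] by blast
  have "L2_on {0..1} (\<lambda>\<xi>. Q \<xi> *v x \<xi>) \<and> L2_norm_on {0..1} (\<lambda>\<xi>. Q \<xi> *v x \<xi>) \<le> c * L2_norm_on {0..1} x"
    if x: "L2_on {0..1} x" for x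
  proof -
    have m: "(\<lambda>\<xi>. Q \<xi> *v x \<xi>) \<in> borel_measurable (lebesgue_on {0..1})"
      by (intro measurable_matrix_vector_mult Q_measurable L2_on_measurable[OF x])
    have "AE \<xi> in lebesgue_on {0..1}. norm (Q \<xi> *v x \<xi>) \<le> c * norm (x \<xi>)"
      by (rule AE_I2) (simp add: c)
    from L2_bound[OF x m this] c show ?thesis by simp
  qed
  then show ?thesis using that[of c] c by blast
qed

lemma pairing_integrable:
  assumes \<phi>: "continuous_on {0..1} \<phi>" and x: "L2_on {0..1} x"
  shows "integrable (lebesgue_on {0..1}) (\<lambda>\<xi>. \<phi> \<xi> \<bullet> (Q \<xi> *v x \<xi>))"
proof -
  have "L2_on {0..1} (\<lambda>\<xi>. Q \<xi> *v x \<xi>)" by (rule Q_bounded) (use x in blast)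
  then show ?thesis by (rule L2_inner_integrable[OF continuous_imp_L2_on[OF \<phi>]])
qed

lemma pairing_bound:
  obtains c where "c > 0"
    "\<And>\<phi> x b. continuous_on {0..1} \<phi> \<Longrightarrow> L2_on {0..1} x \<Longrightarrow> b \<ge> 0 \<Longrightarrow>
       (\<And>\<xi>. \<xi> \<in> {0..1} \<Longrightarrow> norm (\<phi> \<xi>) \<le> b) \<Longrightarrow> \<bar>pairing \<phi> x\<bar> \<le> b * (c * L2_norm_on {0..1} x)"
proof -
  obtain c where c: "c > 0" "\<And>x. L2_on {0..1} x \<Longrightarrow> L2_on {0..1} (\<lambda>\<xi>. Q \<xi> *v x \<xi>)"
    "\<And>x. L2_on {0..1} x \<Longrightarrow> L2_norm_on {0..1} (\<lambda>\<xi>. Q \<xi> *v x \<xi>) \<le> c * L2_norm_on {0..1} x"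
    using Q_bounded by blast
  have "\<bar>pairing \<phi> x\<bar> \<le> b * (c * L2_norm_on {0..1} x)"
    if \<phi>: "continuous_on {0..1} \<phi>" and x: "L2_on {0..1} x" and b: "b \<ge> 0"
      "\<And>\<xi>. \<xi> \<in> {0..1} \<Longrightarrow> norm (\<phi> \<xi>) \<le> b" for \<phi> x b
  proof -
    have L2: "L2_on {0..1} \<phi>" by (rule continuous_imp_L2_on[OF \<phi>])
    have "L2_norm_on {0..1} \<phi> \<le> b * L2_norm_on {0..1} (\<lambda>_. 1::real)"
    proof (rule L2_norm_on_bound[OF _ L2_on_measurable[OF L2]])
      show "L2_on {0..1} (\<lambda>_. 1::real)" by (rule L2_on_const) simp
    qed (use b in \<open>auto intro!: AE_I2\<close>)
    then have "L2_norm_on {0..1} \<phi> \<le> b" by (simp add: L2_norm_on_const)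
    then have "L2_norm_on {0..1} \<phi> * L2_norm_on {0..1} (\<lambda>\<xi>. Q \<xi> *v x \<xi>) \<le> b * (c * L2_norm_on {0..1} x)"
      by (intro mult_mono c(3)[OF x] b L2_norm_on_nonneg)
    then show ?thesis
      using L2_Cauchy_Schwarz[OF L2 c(2)[OF x]] unfolding pairing_def by linarith
  qed
  then show ?thesis using that c(1) by blast
qed

lemma pairing_diff_right:
  assumes "continuous_on {0..1} \<phi>" "L2_on {0..1} x" "L2_on {0..1} y"
  shows "pairing \<phi> (\<lambda>\<xi>. x \<xi> - y \<xi>) = pairing \<phi> x - pairing \<phi> y"
  using pairing_integrable[OF assms(1,2)] pairing_integrable[OF assms(1,3)]
  by (simp add: pairing_def inner_diff_right)

lemma pairing_tendsto:
  assumes \<phi>: "continuous_on {0..1} \<phi>" and X: "\<And>j. L2_on {0..1} (X j)" and x: "L2_on {0..1} x"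
    and lim: "((\<lambda>j. L2_norm_on {0..1} (\<lambda>\<xi>. X j \<xi> - x \<xi>)) \<longlongrightarrow> 0) F"
  shows "((\<lambda>j. pairing \<phi> (X j)) \<longlongrightarrow> pairing \<phi> x) F"
proof -
  obtain c where c: "c > 0"
    "\<And>\<phi> x b. continuous_on {0..1} \<phi> \<Longrightarrow> L2_on {0..1} x \<Longrightarrow> b \<ge> 0 \<Longrightarrow>
       (\<And>\<xi>. \<xi> \<in> {0..1} \<Longrightarrow> norm (\<phi> \<xi>) \<le> b) \<Longrightarrow> \<bar>pairing \<phi> x\<bar> \<le> b * (c * L2_norm_on {0..1} x)"
    using pairing_bound by blast
  have "bounded (\<phi> ` {0..1})" using \<phi> by (intro compact_imp_bounded compact_continuous_image) auto
  then obtain b where "\<forall>x\<in>\<phi> ` {0..1}. norm x \<le> b" unfolding bounded_iff by blast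
  then have b: "\<And>\<xi>. \<xi> \<in> {0..1} \<Longrightarrow> norm (\<phi> \<xi>) \<le> max b 0" by (auto simp: max.coboundedI1)
  have le: "norm (pairing \<phi> (X j) - pairing \<phi> x) \<le> max b 0 * (c * L2_norm_on {0..1} (\<lambda>\<xi>. X j \<xi> - x \<xi>))" for j
    using c(2)[OF \<phi> L2_on_diff[OF X x] _ b] by (simp add: pairing_diff_right[OF \<phi> X x])
  have "((\<lambda>j. max b 0 * (c * L2_norm_on {0..1} (\<lambda>\<xi>. X j \<xi> - x \<xi>))) \<longlongrightarrow> max b 0 * (c * 0)) F"
    by (intro tendsto_intros lim)
  then have "((\<lambda>j. pairing \<phi> (X j) - pairing \<phi> x) \<longlongrightarrow> 0) F"
    using Lim_null_comparison[OF always_eventually[OF allI[OF le]]] by simp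
  then show ?thesis by (simp add: LIM_zero_iff)
qed

text \<open>The product rule for a test profile that travels along with the state.\<close>

lemma pairing_has_derivative:
  assumes x: "C1_L2 x x'" and d: "\<And>s. (\<psi> has_vector_derivative \<psi>' s) (at s)"
    and d': "continuous_on UNIV \<psi>'" and t: "t \<ge> 0"
  shows "((\<lambda>s. pairing (\<lambda>\<xi>. \<psi> (s - tau \<xi>)) (x s)) has_real_derivative
    (pairing (\<lambda>\<xi>. \<psi>' (t - tau \<xi>)) (x t) + pairing (\<lambda>\<xi>. \<psi> (t - tau \<xi>)) (x' t))) (at t within {0..})"
proof -
  let ?M = "lebesgue_on {0..1::real}"
  note cx = C1_L2_D[OF x]
  have c\<psi>: "continuous_on UNIV \<psi>"
    using d by (auto intro!: continuous_at_imp_continuous_on has_vector_derivative_continuous)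
  have cont: "continuous_on {0..1} (\<lambda>\<xi>. f (s - tau \<xi>))" if "continuous_on UNIV f" for f :: "real \<Rightarrow> 'k ^ 'n" and s
    by (intro continuous_on_compose2[OF that] continuous_intros continuous_on_tau) auto
  obtain c where c: "c > 0"
    "\<And>\<phi> x b. continuous_on {0..1} \<phi> \<Longrightarrow> L2_on {0..1} x \<Longrightarrow> b \<ge> 0 \<Longrightarrow>
       (\<And>\<xi>. \<xi> \<in> {0..1} \<Longrightarrow> norm (\<phi> \<xi>) \<le> b) \<Longrightarrow> \<bar>pairing \<phi> x\<bar> \<le> b * (c * L2_norm_on {0..1} x)"
    using pairing_bound by blast
  have small: "((\<lambda>s. pairing (\<lambda>\<xi>. \<Phi> s (t - tau \<xi>)) y) \<longlongrightarrow> 0) (at t within {0..})"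
    if y: "L2_on {0..1} y" and \<Phi>: "\<And>s. continuous_on UNIV (\<Phi> s)"
      and ev: "\<And>e. e > 0 \<Longrightarrow> eventually (\<lambda>s. \<forall>\<sigma>\<in>{0..period}. norm (\<Phi> s (t - \<sigma>)) \<le> e) (at t within {0..})"
    for \<Phi> :: "real \<Rightarrow> real \<Rightarrow> 'k ^ 'n" and y
  proof (rule tendstoI)
    fix e :: real assume e: "e > 0"
    define Y where "Y = c * L2_norm_on {0..1} y"
    have Y: "Y \<ge> 0" using c by (simp add: Y_def L2_norm_on_nonneg)
    have "eventually (\<lambda>s. \<forall>\<sigma>\<in>{0..period}. norm (\<Phi> s (t - \<sigma>)) \<le> e / (Y + 1)) (at t within {0..})"
      using e Y by (intro ev) simp
    then show "eventually (\<lambda>s. dist (pairing (\<lambda>\<xi>. \<Phi> s (t - tau \<xi>)) y) 0 < e) (at t within {0..})"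
    proof eventually_elim
      case (elim s)
      have "\<bar>pairing (\<lambda>\<xi>. \<Phi> s (t - tau \<xi>)) y\<bar> \<le> e / (Y + 1) * Y"
        unfolding Y_def by (rule c(2)[OF cont[OF \<Phi>] y]) (use elim tau_range e Y in \<open>auto simp: Y_def\<close>)
      also have "\<dots> < e" using e Y by (simp add: field_simps)
      finally show ?case by simp
    qed
  qed
  (* The error of the difference quotient: T1 from differentiating the profile, T2 from
     differentiating the state, T3 from evaluating the profile at s instead of t. *)
  define T1 T2 T3 where
    "T1 s = pairing (\<lambda>\<xi>. (\<psi> (s - tau \<xi>) - \<psi> (t - tau \<xi>)) /\<^sub>R (s - t) - \<psi>' (t - tau \<xi>)) (x t)" and
    "T2 s = pairing (\<lambda>\<xi>. \<psi> (s - tau \<xi>)) (\<lambda>\<xi>. (x s \<xi> - x t \<xi>) /\<^sub>R (s - t) - x' t \<xi>)" and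
    "T3 s = pairing (\<lambda>\<xi>. \<psi> (s - tau \<xi>) - \<psi> (t - tau \<xi>)) (x' t)" for s
  have T1: "(T1 \<longlongrightarrow> 0) (at t within {0..})"
  proof -
    have "((\<lambda>s. pairing (\<lambda>\<xi>. (\<lambda>r. (\<psi> (s - t + r) - \<psi> r) /\<^sub>R (s - t) - \<psi>' r) (t - tau \<xi>)) (x t)) \<longlongrightarrow> 0) (at t within {0..})"
    proof (rule small[OF cx(1)[OF t]])
      show "continuous_on UNIV (\<lambda>r. (\<psi> (s - t + r) - \<psi> r) /\<^sub>R (s - t) - \<psi>' r)" for s
        by (intro continuous_intros d' c\<psi> continuous_on_compose2[OF c\<psi>]) auto
      show "eventually (\<lambda>s. \<forall>\<sigma>\<in>{0..period}. norm ((\<psi> (s - t + (t - \<sigma>)) - \<psi> (t - \<sigma>)) /\<^sub>R (s - t) - \<psi>' (t - \<sigma>)) \<le> e) (at t within {0..})"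
        if "e > 0" for e using C1_shift_uniform[OF d d' that] by simp
    qed
    then show ?thesis by (simp add: T1_def[abs_def])
  qed
  have T3: "(T3 \<longlongrightarrow> 0) (at t within {0..})"
  proof -
    have "((\<lambda>s. pairing (\<lambda>\<xi>. (\<lambda>r. \<psi> (s - t + r) - \<psi> r) (t - tau \<xi>)) (x' t)) \<longlongrightarrow> 0) (at t within {0..})"
    proof (rule small[OF cx(2)[OF t]])
      show "continuous_on UNIV (\<lambda>r. \<psi> (s - t + r) - \<psi> r)" for s
        by (intro continuous_intros c\<psi> continuous_on_compose2[OF c\<psi>]) auto
      show "eventually (\<lambda>s. \<forall>\<sigma>\<in>{0..period}. norm (\<psi> (s - t + (t - \<sigma>)) - \<psi> (t - \<sigma>)) \<le> e) (at t within {0..})"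
        if "e > 0" for e using continuous_shift_uniform[OF c\<psi> that] by simp
    qed
    then show ?thesis by (simp add: T3_def[abs_def])
  qed
  have T2: "(T2 \<longlongrightarrow> 0) (at t within {0..})"
  proof -
    have "bounded (\<psi> ` {t - period - 1..t + 1})"
      using c\<psi> by (intro compact_imp_bounded compact_continuous_image continuous_on_subset[OF c\<psi>]) auto
    then obtain b where "\<forall>x\<in>\<psi> ` {t - period - 1..t + 1}. norm x \<le> b" unfolding bounded_iff by blast
    then have b: "\<And>r. r \<in> {t - period - 1..t + 1} \<Longrightarrow> norm (\<psi> r) \<le> max b 0" by (auto simp: max.coboundedI1)
    have near: "eventually (\<lambda>s. dist s t < 1) (at t within {0..})"
      unfolding eventually_at by (intro exI[of _ 1]) auto
    have evT2: "eventually (\<lambda>s. norm (T2 s) \<le> max b 0 * (c * L2_norm_on {0..1} (\<lambda>\<xi>. (x s \<xi> - x t \<xi>) /\<^sub>R (s - t) - x' t \<xi>))) (at t within {0..})"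
      using near eventually_at_within_nonneg
    proof eventually_elim
      case (elim s)
      have "L2_on {0..1} (\<lambda>\<xi>. (x s \<xi> - x t \<xi>) /\<^sub>R (s - t) - x' t \<xi>)"
        using elim t by (intro L2_on_diff L2_on_scaleR cx) auto
      moreover have "norm (\<psi> (s - tau \<xi>)) \<le> max b 0" if "\<xi> \<in> {0..1}" for \<xi>
        using tau_range[OF that] elim by (intro b) (auto simp: dist_real_def)
      ultimately show ?case unfolding T2_def real_norm_def by (intro c(2) cont[OF c\<psi>]) auto
    qed
    have "((\<lambda>s. max b 0 * (c * L2_norm_on {0..1} (\<lambda>\<xi>. (x s \<xi> - x t \<xi>) /\<^sub>R (s - t) - x' t \<xi>))) \<longlongrightarrow> max b 0 * (c * 0)) (at t within {0..})"
      by (intro tendsto_intros cx(3)[OF t])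
    then show ?thesis using Lim_null_comparison[OF evT2] by simp
  qed
  define F where "F s = pairing (\<lambda>\<xi>. \<psi> (s - tau \<xi>)) (x s)" for s
  define F' where "F' = pairing (\<lambda>\<xi>. \<psi>' (t - tau \<xi>)) (x t) + pairing (\<lambda>\<xi>. \<psi> (t - tau \<xi>)) (x' t)"
  have split: "eventually (\<lambda>s. T1 s + T2 s + T3 s = (F s - F t) / (s - t) - F') (at t within {0..})"
    using eventually_at_within_nonneg
  proof eventually_elim
    case (elim s)
    then have s: "s \<ge> 0" by simp
    have i: "integrable ?M (\<lambda>\<xi>. \<psi> (s - tau \<xi>) \<bullet> (Q \<xi> *v x s \<xi>))" "integrable ?M (\<lambda>\<xi>. \<psi> (t - tau \<xi>) \<bullet> (Q \<xi> *v x t \<xi>))"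
      "integrable ?M (\<lambda>\<xi>. \<psi>' (t - tau \<xi>) \<bullet> (Q \<xi> *v x t \<xi>))" "integrable ?M (\<lambda>\<xi>. \<psi> (t - tau \<xi>) \<bullet> (Q \<xi> *v x' t \<xi>))"
      "integrable ?M (\<lambda>\<xi>. \<psi> (s - tau \<xi>) \<bullet> (Q \<xi> *v x t \<xi>))" "integrable ?M (\<lambda>\<xi>. \<psi> (s - tau \<xi>) \<bullet> (Q \<xi> *v x' t \<xi>))"
      using s t by (auto intro!: pairing_integrable cont c\<psi> d' cx)
    show ?case
      using i by (simp add: T1_def T2_def T3_def F_def F'_def pairing_def inner_diff_left inner_diff_right
          inner_scaleR_left inner_scaleR_right divide_inverse algebra_simps)
  qed
  have "((\<lambda>s. T1 s + T2 s + T3 s) \<longlongrightarrow> 0 + 0 + 0) (at t within {0..})"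
    by (intro tendsto_intros T1 T2 T3)
  then have "((\<lambda>s. (F s - F t) / (s - t) - F') \<longlongrightarrow> 0) (at t within {0..})"
    using tendsto_cong[OF split] by simp
  then have "((\<lambda>s. (F s - F t) / (s - t)) \<longlongrightarrow> F') (at t within {0..})" by (simp add: LIM_zero_iff)
  then show ?thesis unfolding has_field_derivative_iff F_def F'_def .
qed

text \<open>
  The boundary value is dominated by the norms of the function and of its derivative, and the
  differential equation expresses the spatial derivative by the time derivative, which is
  continuous in \<open>L\<^sup>2\<close>.
\<close>

lemma trace_continuous:
  assumes x: "C1_L2 x x'"
    and z: "\<And>t. t \<ge> 0 \<Longrightarrow> AE \<xi> in lebesgue_on {0..1}. z t \<xi> = l0 \<xi> *\<^sub>R x t \<xi>"
    and z': "\<And>t. t \<ge> 0 \<Longrightarrow> AC_deriv (z t) (z' t)"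
    and eq: "\<And>t. t \<ge> 0 \<Longrightarrow> AE \<xi> in lebesgue_on {0..1}. x' t \<xi> = - z' t \<xi> + P0 \<xi> *v z t \<xi>"
  shows "continuous_on {0..} (\<lambda>t. z t 1)"
proof -
  let ?M = "lebesgue_on {0..1::real}"
  note cx = C1_L2_D[OF x]
  obtain b where b: "AE s in ?M. norm (l0 s) \<le> b" using Linf_l0 by (auto simp: Linf_on_def)
  obtain c0 where c0: "c0 > 0" "AE \<xi> in ?M. \<forall>v. norm (P0 \<xi> *v v) \<le> c0 * norm v" using P0_bounded by blast
  define b1 where "b1 = max b 0"
  have bound: "norm (z s 1 - z t 1) \<le> b1 * L2_norm_on {0..1} (\<lambda>\<xi>. x s \<xi> - x t \<xi>) +
      (L2_norm_on {0..1} (\<lambda>\<xi>. x' s \<xi> - x' t \<xi>) + c0 * (b1 * L2_norm_on {0..1} (\<lambda>\<xi>. x s \<xi> - x t \<xi>)))"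
    if s: "s \<ge> 0" and t: "t \<ge> 0" for s t
  proof -
    have AC: "AC_deriv (\<lambda>\<xi>. z s \<xi> - z t \<xi>) (\<lambda>\<xi>. z' s \<xi> - z' t \<xi>)" by (intro AC_deriv_diff z' s t)
    have L2x: "L2_on {0..1} (\<lambda>\<xi>. x s \<xi> - x t \<xi>)" and L2x': "L2_on {0..1} (\<lambda>\<xi>. x' s \<xi> - x' t \<xi>)"
      using s t by (auto intro: L2_on_diff cx)
    have L2z: "L2_on {0..1} (\<lambda>\<xi>. z s \<xi> - z t \<xi>)"
      by (rule continuous_imp_L2_on[OF AC_deriv_continuous[OF AC]])
    have nz: "L2_norm_on {0..1} (\<lambda>\<xi>. z s \<xi> - z t \<xi>) \<le> b1 * L2_norm_on {0..1} (\<lambda>\<xi>. x s \<xi> - x t \<xi>)"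
    proof (rule L2_norm_on_bound[OF L2x L2_on_measurable[OF L2z]])
      show "AE \<xi> in ?M. norm (z s \<xi> - z t \<xi>) \<le> b1 * norm (x s \<xi> - x t \<xi>)"
        using z[OF s] z[OF t] b
      proof eventually_elim
        case (elim \<xi>)
        have "norm (z s \<xi> - z t \<xi>) = \<bar>l0 \<xi>\<bar> * norm (x s \<xi> - x t \<xi>)"
          using elim by (simp flip: scaleR_diff_right)
        also have "\<dots> \<le> b1 * norm (x s \<xi> - x t \<xi>)" using elim by (intro mult_right_mono) (auto simp: b1_def)
        finally show ?case .
      qed
    qed (simp add: b1_def)
    have mP: "(\<lambda>\<xi>. P0 \<xi> *v (z s \<xi> - z t \<xi>)) \<in> borel_measurable ?M"
      by (intro measurable_matrix_vector_mult P0_measurable L2_on_measurable[OF L2z])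
    have leP: "AE \<xi> in ?M. norm (P0 \<xi> *v (z s \<xi> - z t \<xi>)) \<le> c0 * norm (z s \<xi> - z t \<xi>)"
      using c0(2) by eventually_elim blast
    have L2P: "L2_on {0..1} (\<lambda>\<xi>. P0 \<xi> *v (z s \<xi> - z t \<xi>))"
      by (rule L2_on_bound[OF L2z mP leP]) (use c0 in simp)
    have nP: "L2_norm_on {0..1} (\<lambda>\<xi>. P0 \<xi> *v (z s \<xi> - z t \<xi>)) \<le> c0 * L2_norm_on {0..1} (\<lambda>\<xi>. z s \<xi> - z t \<xi>)"
      by (rule L2_norm_on_bound[OF L2z mP leP]) (use c0 in simp)
    have mz': "(\<lambda>\<xi>. z' s \<xi> - z' t \<xi>) \<in> borel_measurable ?M"
      using AC_deriv_integrable[OF AC] by auto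
    have ez': "AE \<xi> in ?M. P0 \<xi> *v (z s \<xi> - z t \<xi>) - (x' s \<xi> - x' t \<xi>) = z' s \<xi> - z' t \<xi>"
      using eq[OF s] eq[OF t]
    proof eventually_elim
      case (elim \<xi>)
      show ?case unfolding elim by (simp add: algebra_simps)
    qed
    have L2d: "L2_on {0..1} (\<lambda>\<xi>. P0 \<xi> *v (z s \<xi> - z t \<xi>) - (x' s \<xi> - x' t \<xi>))"
      by (rule L2_on_diff[OF L2P L2x'])
    have L2z': "L2_on {0..1} (\<lambda>\<xi>. z' s \<xi> - z' t \<xi>)"
      by (rule L2_on_bound[OF L2d mz', where c=1]) (use ez' in \<open>auto elim!: eventually_mono\<close>)
    have "L2_norm_on {0..1} (\<lambda>\<xi>. z' s \<xi> - z' t \<xi>) =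
        L2_norm_on {0..1} (\<lambda>\<xi>. P0 \<xi> *v (z s \<xi> - z t \<xi>) - (x' s \<xi> - x' t \<xi>))"
      by (rule L2_norm_on_cong_AE[symmetric, OF L2_on_measurable[OF L2d] mz' ez'])
    also have "\<dots> \<le> L2_norm_on {0..1} (\<lambda>\<xi>. P0 \<xi> *v (z s \<xi> - z t \<xi>)) + L2_norm_on {0..1} (\<lambda>\<xi>. x' s \<xi> - x' t \<xi>)"
      by (rule L2_norm_on_triangle_diff[OF L2P L2x'])
    also have "\<dots> \<le> c0 * (b1 * L2_norm_on {0..1} (\<lambda>\<xi>. x s \<xi> - x t \<xi>)) + L2_norm_on {0..1} (\<lambda>\<xi>. x' s \<xi> - x' t \<xi>)"
      using nP mult_left_mono[OF nz, of c0] c0(1) by linarith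
    finally have nz': "L2_norm_on {0..1} (\<lambda>\<xi>. z' s \<xi> - z' t \<xi>) \<le>
        c0 * (b1 * L2_norm_on {0..1} (\<lambda>\<xi>. x s \<xi> - x t \<xi>)) + L2_norm_on {0..1} (\<lambda>\<xi>. x' s \<xi> - x' t \<xi>)" .
    show ?thesis
      using AC_deriv_pointwise_bound[OF AC, of 1] L1_le_L2[OF L2z] L1_le_L2[OF L2z'] nz nz' by simp
  qed
  show ?thesis
    unfolding continuous_on_def
  proof
    fix t :: real assume "t \<in> {0..}"
    then have t: "t \<ge> 0" by simp
    have "((\<lambda>s. b1 * L2_norm_on {0..1} (\<lambda>\<xi>. x s \<xi> - x t \<xi>) +
      (L2_norm_on {0..1} (\<lambda>\<xi>. x' s \<xi> - x' t \<xi>) + c0 * (b1 * L2_norm_on {0..1} (\<lambda>\<xi>. x s \<xi> - x t \<xi>))))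
      \<longlongrightarrow> b1 * 0 + (0 + c0 * (b1 * 0))) (at t within {0..})"
      by (intro tendsto_intros C1_L2_continuous[OF x t] cx(4)[OF t])
    then have "((\<lambda>s. z s 1 - z t 1) \<longlongrightarrow> 0) (at t within {0..})"
      using Lim_null_comparison[OF eventually_mono[OF eventually_at_within_nonneg[of t] bound[OF conjunct1 t]]] by simp
    then show "((\<lambda>t. z t 1) \<longlongrightarrow> z t 1) (at t within {0..})" by (simp add: LIM_zero_iff)
  qed
qed

text \<open>
  The change of the pairing with a travelling test profile is what enters at the left end, \<open>A w + B u\<close>,
  minus what leaves at the right end, \<open>w\<close>. Both are seen by the test function at the time at which
  its values pass the respective end.
\<close>

definition weak_identity ::
  "(real \<Rightarrow> 'k ^ 'm) \<Rightarrow> (real \<Rightarrow> real \<Rightarrow> 'k ^ 'n) \<Rightarrow> (real \<Rightarrow> 'k ^ 'n) \<Rightarrow> bool" where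
  "weak_identity u x w \<longleftrightarrow> (\<forall>\<psi> \<psi>' T. (\<forall>s. (\<psi> has_vector_derivative \<psi>' s) (at s)) \<longrightarrow>
      continuous_on UNIV \<psi>' \<longrightarrow> 0 \<le> T \<longrightarrow>
      ((\<lambda>t. \<psi> t \<bullet> (A *v w t + B *v u t) - \<psi> (t - period) \<bullet> w t) has_integral
        (pairing (\<lambda>\<xi>. \<psi> (T - tau \<xi>)) (x T) - pairing (\<lambda>\<xi>. \<psi> (0 - tau \<xi>)) (x 0))) {0..T})"

lemma weak_identityD:
  assumes "weak_identity u x w" and "\<And>s. (\<psi> has_vector_derivative \<psi>' s) (at s)"
    and "continuous_on UNIV \<psi>'" and "0 \<le> T"
  shows "((\<lambda>t. \<psi> t \<bullet> (A *v w t + B *v u t) - \<psi> (t - period) \<bullet> w t) has_integral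
        (pairing (\<lambda>\<xi>. \<psi> (T - tau \<xi>)) (x T) - pairing (\<lambda>\<xi>. \<psi> (0 - tau \<xi>)) (x 0))) {0..T}"
  using assms unfolding weak_identity_def by (elim allE[of _ \<psi>] allE[of _ \<psi>'] allE[of _ T]) blast

text \<open>
  Every classical solution, not only those constructed from staircases, satisfies the weak
  identity, where \<open>w\<close> is the outgoing boundary value of the transported quantity. Statements
  about arbitrary mild solutions are proved by passing to the limit in it; that mild
  solutions are determined by their data is not presupposed.
\<close>

lemma classical_solution_weak:
  assumes sol: "classical_solution l0 P0 E K L Ky Ly u x y"
  obtains w where "continuous_on {0..} w" "continuous_on {0..} u"
    "\<And>t. t \<ge> 0 \<Longrightarrow> L2_on {0..1} (x t)"
    "\<And>t. t \<ge> 0 \<Longrightarrow> y t = C *v w t + D *v u t"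
    "weak_identity u x w"
proof -
  let ?M = "lebesgue_on {0..1::real}"
  obtain x' z where x: "C1_L2 x x'" and u: "smooth_on_nonneg u"
    and sol': "\<And>t. t \<ge> 0 \<Longrightarrow> (AE \<xi> in ?M. z t \<xi> = l0 \<xi> *\<^sub>R x t \<xi>) \<and>
         (\<exists>z'. AC_deriv (z t) z' \<and> L2_on {0..1} z' \<and>
            (AE \<xi> in ?M. x' t \<xi> = - z' \<xi> + P0 \<xi> *v z t \<xi>)) \<and>
         E *v u t = - (K *v z t 0) - L *v z t 1 \<and>
         y t = - (Ky *v z t 0) - Ly *v z t 1"
    using sol unfolding classical_solution_def by blast
  have "\<forall>t\<in>{0..}. \<exists>z'. AC_deriv (z t) z' \<and> (AE \<xi> in ?M. x' t \<xi> = - z' \<xi> + P0 \<xi> *v z t \<xi>)"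
    using sol' by fastforce
  from bchoice[OF this] obtain z' where
    "\<forall>t\<in>{0..}. AC_deriv (z t) (z' t) \<and> (AE \<xi> in ?M. x' t \<xi> = - z' t \<xi> + P0 \<xi> *v z t \<xi>)" ..
  then have z': "\<And>t. t \<ge> 0 \<Longrightarrow> AC_deriv (z t) (z' t)"
    and eq: "\<And>t. t \<ge> 0 \<Longrightarrow> AE \<xi> in ?M. x' t \<xi> = - z' t \<xi> + P0 \<xi> *v z t \<xi>" by simp_all
  have z: "\<And>t. t \<ge> 0 \<Longrightarrow> AE \<xi> in ?M. z t \<xi> = l0 \<xi> *\<^sub>R x t \<xi>" using sol' by blast
  define w where "w t = Q 1 *v z t 1" for t
  have cw: "continuous_on {0..} w"
    unfolding w_def
    by (rule bounded_linear.continuous_on[OF bounded_linear_matrix_vector_mult trace_continuous[OF x z z' eq]])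
  have cu: "continuous_on {0..} u"
  proof -
    obtain U where U: "U (0::nat) = u" "\<And>i t. t \<ge> 0 \<Longrightarrow> (U i has_vector_derivative U (Suc i) t) (at t within {0..})"
      using u unfolding smooth_on_nonneg_def by blast
    show ?thesis
      unfolding continuous_on_eq_continuous_within
      using U(2)[of _ 0] by (auto simp: U(1) intro: has_vector_derivative_continuous)
  qed
  have z1: "z t 1 = P 1 *v w t" for t by (simp add: w_def PQ_vec)
  have z0: "z t 0 = A *v w t + B *v u t" if "t \<ge> 0" for t
    using sol'[OF that] boundary_condition_iff[of "u t" "z t 0" "w t"] by (simp add: z1)
  have y: "y t = C *v w t + D *v u t" if "t \<ge> 0" for t
    using sol'[OF that] output_eq[OF z0[OF that]] by (simp add: z1)
  have weak: "((\<lambda>t. \<psi> t \<bullet> (A *v w t + B *v u t) - \<psi> (t - period) \<bullet> w t) has_integral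
        (pairing (\<lambda>\<xi>. \<psi> (T - tau \<xi>)) (x T) - pairing (\<lambda>\<xi>. \<psi> (0 - tau \<xi>)) (x 0))) {0..T}"
    if d: "\<And>s. (\<psi> has_vector_derivative \<psi>' s) (at s)" and d': "continuous_on UNIV \<psi>'" and T: "T \<ge> 0" for \<psi> \<psi>' T
  proof (rule fundamental_theorem_of_calculus[OF T])
    fix t assume "t \<in> {0..T}"
    then have t: "t \<ge> 0" by simp
    have c\<psi>: "continuous_on UNIV \<psi>"
      using d by (auto intro!: continuous_at_imp_continuous_on has_vector_derivative_continuous)
    have cont: "continuous_on {0..1} (\<lambda>\<xi>. f (t - tau \<xi>))" if "continuous_on UNIV f" for f :: "real \<Rightarrow> 'k ^ 'n"
      by (intro continuous_on_compose2[OF that] continuous_intros continuous_on_tau) auto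
    note i = pairing_integrable[OF cont[OF d'] C1_L2_D(1)[OF x t]] pairing_integrable[OF cont[OF c\<psi>] C1_L2_D(2)[OF x t]]
    define W where "W \<xi> = Q \<xi> *v z t \<xi>" for \<xi>
    define W' where "W' \<xi> = (- (Q \<xi> ** P0 \<xi>)) *v z t \<xi> + Q \<xi> *v z' t \<xi>" for \<xi>
    have W: "AC_deriv W W'"
      unfolding W_def[abs_def] W'_def[abs_def]
      by (rule AC_deriv_product[OF bounded_bilinear_matrix_vector_mult AC_deriv_Q z'[OF t]])
    (* Transporting the test profile with the state cancels the transport terms: the spatial
       derivative of this product is minus the time derivative of the integrand of the pairing. *)
    have prod: "AC_deriv (\<lambda>\<xi>. \<psi> (t - tau \<xi>) \<bullet> W \<xi>)
        (\<lambda>\<xi>. (- (slowness \<xi> *\<^sub>R \<psi>' (t - tau \<xi>))) \<bullet> W \<xi> + \<psi> (t - tau \<xi>) \<bullet> W' \<xi>)"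
      by (rule AC_deriv_product[OF bounded_bilinear_inner AC_deriv_travelling[OF d d'] W])
    have ae: "AE \<xi> in ?M. (- (slowness \<xi> *\<^sub>R \<psi>' (t - tau \<xi>))) \<bullet> W \<xi> + \<psi> (t - tau \<xi>) \<bullet> W' \<xi> =
        - (\<psi>' (t - tau \<xi>) \<bullet> (Q \<xi> *v x t \<xi>)) - \<psi> (t - tau \<xi>) \<bullet> (Q \<xi> *v x' t \<xi>)"
      using z[OF t] eq[OF t] l0_slowness
    proof eventually_elim
      case (elim \<xi>)
      have "slowness \<xi> *\<^sub>R z t \<xi> = x t \<xi>" using elim by (simp add: mult.commute)
      then have Qx: "Q \<xi> *v x t \<xi> = slowness \<xi> *\<^sub>R W \<xi>"
        unfolding W_def by (simp flip: matrix_vector_mult_real_linear(5))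
      have W'x: "W' \<xi> = - (Q \<xi> *v x' t \<xi>)"
        using elim by (simp add: W'_def matrix_vector_mul_assoc)
      show ?case unfolding Qx W'x by simp
    qed
    have "\<psi> (t - tau 1) \<bullet> W 1 = \<psi> (t - tau 0) \<bullet> W 0 + (LINT s|?M. indicator {0..1} s *\<^sub>R
        ((- (slowness s *\<^sub>R \<psi>' (t - tau s))) \<bullet> W s + \<psi> (t - tau s) \<bullet> W' s))"
      by (rule AC_deriv_eq[OF prod]) simp
    also have "(LINT s|?M. indicator {0..1} s *\<^sub>R ((- (slowness s *\<^sub>R \<psi>' (t - tau s))) \<bullet> W s + \<psi> (t - tau s) \<bullet> W' s)) =
        (LINT s|?M. (- (slowness s *\<^sub>R \<psi>' (t - tau s))) \<bullet> W s + \<psi> (t - tau s) \<bullet> W' s)"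
      by (intro Bochner_Integration.integral_cong) auto
    also have "\<dots> = (LINT \<xi>|?M. - (\<psi>' (t - tau \<xi>) \<bullet> (Q \<xi> *v x t \<xi>)) - \<psi> (t - tau \<xi>) \<bullet> (Q \<xi> *v x' t \<xi>))"
      by (rule integral_cong_AE[OF _ _ ae]) (use AC_deriv_integrable[OF prod] i in auto)
    also have "\<dots> = - pairing (\<lambda>\<xi>. \<psi>' (t - tau \<xi>)) (x t) - pairing (\<lambda>\<xi>. \<psi> (t - tau \<xi>)) (x' t)"
      using i by (simp add: pairing_def)
    finally have "pairing (\<lambda>\<xi>. \<psi>' (t - tau \<xi>)) (x t) + pairing (\<lambda>\<xi>. \<psi> (t - tau \<xi>)) (x' t) =
        \<psi> t \<bullet> (A *v w t + B *v u t) - \<psi> (t - period) \<bullet> w t"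
      using z0[OF t] by (simp add: W_def Q_0 tau_0 period_def w_def)
    then have "((\<lambda>s. pairing (\<lambda>\<xi>. \<psi> (s - tau \<xi>)) (x s)) has_real_derivative
        (\<psi> t \<bullet> (A *v w t + B *v u t) - \<psi> (t - period) \<bullet> w t)) (at t within {0..})"
      using pairing_has_derivative[OF x d d' t] by simp
    then show "((\<lambda>s. pairing (\<lambda>\<xi>. \<psi> (s - tau \<xi>)) (x s)) has_vector_derivative
        (\<psi> t \<bullet> (A *v w t + B *v u t) - \<psi> (t - period) \<bullet> w t)) (at t within {0..T})"
      unfolding has_real_derivative_iff_has_vector_derivative
      by (rule has_vector_derivative_within_subset) auto
  qed
  have wi: "weak_identity u x w" unfolding weak_identity_def by (intro allI impI weak) auto
  show ?thesis by (rule that[OF cw cu C1_L2_D(1)[OF x] y wi])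
qed

end

section \<open>Limits of classical solutions and signals of states\<close>

lemma lebesgue_on_unit_not_null: "\<not> (AE \<xi> in lebesgue_on {0..1::real}. False)"
proof
  assume "AE \<xi> in lebesgue_on {0..1::real}. False"
  then obtain N where N: "{\<xi> \<in> space (lebesgue_on {0..1::real}). \<not> False} \<subseteq> N"
    "emeasure (lebesgue_on {0..1::real}) N = 0" "N \<in> sets (lebesgue_on {0..1::real})"
    by (rule AE_E)
  have "emeasure (lebesgue_on {0..1::real}) {0..1} \<le> emeasure (lebesgue_on {0..1::real}) N"
    using N by (intro emeasure_mono) auto
  then show False using N(2) by (simp add: emeasure_restrict_space)
qed

text \<open>A positive flat function, used as the profile of a single wave.\<close>

lemma bump_exists:
  obtains \<beta> :: "nat \<Rightarrow> real \<Rightarrow> real" where "flat_jet a \<beta>" "\<And>s. s \<in> {0<..<a} \<Longrightarrow> \<beta> 0 s > 0"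
proof -
  obtain \<beta> :: "nat \<Rightarrow> real \<Rightarrow> real" where "flat_jet a \<beta>" "\<beta> 0 = flat a 0 (\<lambda>_. 1)"
    using flat_jet_exists[OF polynomial_function_const] by blast
  then show ?thesis using that[of \<beta>] by (simp add: flat_def)
qed

text \<open>
  States are only Lebesgue measurable, which does not survive the composition with the
  inverse of \<open>tau\<close>.
\<close>

lemma borel_representative:
  fixes f :: "real \<Rightarrow> 'w::euclidean_space"
  assumes f: "f \<in> borel_measurable (lebesgue_on {a..b})"
  obtains f' where "f' \<in> borel_measurable borel" "AE s in lebesgue_on {a..b}. f' s = f s"
proof -
  have "f measurable_on {a..b}" using f by (simp add: measurable_on_iff_borel_measurable)
  then obtain N g where N: "negligible N" and g: "\<And>n. continuous_on UNIV (g n)"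
    and lim: "\<And>x. x \<notin> N \<Longrightarrow> (\<lambda>n. g n x) \<longlonglongrightarrow> (if x \<in> {a..b} then f x else 0)"
    unfolding measurable_on_def by blast
  have [measurable]: "g n \<in> borel_measurable borel" for n by (rule borel_measurable_continuous_onI[OF g])
  have "(\<lambda>x. lim (\<lambda>n. g n x)) \<in> borel_measurable borel" by (rule borel_measurable_lim_metric) measurable
  moreover have "AE s in lebesgue. s \<notin> N" using N by (simp add: AE_not_in negligible_iff_null_sets)
  then have "AE s in lebesgue. s \<in> {a..b} \<longrightarrow> lim (\<lambda>n. g n s) = f s"
    by eventually_elim (use limI[OF lim] in auto)
  then have "AE s in lebesgue_on {a..b}. lim (\<lambda>n. g n s) = f s"
    using AE_restrict_space_iff[of "{a..b}" lebesgue "\<lambda>s. lim (\<lambda>n. g n s) = f s"] by simp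
  ultimately show ?thesis using that by blast
qed

lemma signal_L2:
  fixes h :: "real \<Rightarrow> 'w::euclidean_space"
  assumes h: "signal a h"
  shows signal_L2_on: "L2_on {0..a} h" and L2_norm_on_signal: "L2_norm_on {0..a} h = sqrt (energy h)"
proof -
  have m: "h \<in> borel_measurable borel" and z: "\<And>t. t \<notin> {0<..<a} \<Longrightarrow> h t = 0"
    and i: "integrable lborel (\<lambda>t. (norm (h t))\<^sup>2)" using h by (auto simp: signal_def)
  have eq: "indicator {0..a} t * (norm (h t))\<^sup>2 = (norm (h t))\<^sup>2" for t
    using z[of t] by (cases "t \<in> {0<..<a}") auto
  show "L2_on {0..a} h" using i by (simp add: L2_on_borel_iff[OF m] eq)
  have "(L2_norm_on {0..a} h)\<^sup>2 = energy h" by (simp add: L2_norm_on_borel[OF m] eq)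
  then show "L2_norm_on {0..a} h = sqrt (energy h)"
    by (metis L2_norm_on_nonneg real_sqrt_unique)
qed

lemma L2_inner_tendsto:
  fixes f g :: "real \<Rightarrow> 'v::euclidean_space"
  assumes f: "L2_on S f" and X: "\<And>j::nat. L2_on S (X j)" and g: "L2_on S g"
    and lim: "(\<lambda>j. L2_norm_on S (\<lambda>s. X j s - g s)) \<longlonglongrightarrow> 0"
  shows "(\<lambda>j. LINT s|lebesgue_on S. f s \<bullet> X j s) \<longlonglongrightarrow> (LINT s|lebesgue_on S. f s \<bullet> g s)"
proof -
  have le: "norm ((LINT s|lebesgue_on S. f s \<bullet> X j s) - (LINT s|lebesgue_on S. f s \<bullet> g s)) \<le>
      L2_norm_on S f * L2_norm_on S (\<lambda>s. X j s - g s)" for j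
  proof -
    have "(LINT s|lebesgue_on S. f s \<bullet> X j s) - (LINT s|lebesgue_on S. f s \<bullet> g s) =
        (LINT s|lebesgue_on S. f s \<bullet> (X j s - g s))"
      using L2_inner_integrable[OF f X] L2_inner_integrable[OF f g] by (simp add: inner_diff_right)
    then show ?thesis using L2_Cauchy_Schwarz[OF f L2_on_diff[OF X g], of j] by simp
  qed
  have "(\<lambda>j. L2_norm_on S f * L2_norm_on S (\<lambda>s. X j s - g s)) \<longlonglongrightarrow> L2_norm_on S f * 0"
    by (intro tendsto_intros lim)
  then show ?thesis
    using Lim_null_comparison[OF always_eventually[OF allI[OF le]]] by (simp add: LIM_zero_iff)
qed

lemma null_sequence_le:
  fixes X Y :: "nat \<Rightarrow> real"
  assumes "\<And>j. 0 \<le> X j" and "\<And>j. X j \<le> Y j" and "Y \<longlonglongrightarrow> 0"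
  shows "X \<longlonglongrightarrow> 0"
  by (rule tendsto_sandwich[OF always_eventually[OF allI] always_eventually[OF allI] tendsto_const assms(3)])
    (rule assms)+

lemma L2_norm_on_eq_0:
  fixes f :: "real \<Rightarrow> 'v::euclidean_space"
  assumes f: "L2_on S f" and "L2_norm_on S f = 0"
  shows "AE s in lebesgue_on S. f s = 0"
proof -
  have "(LINT s|lebesgue_on S. (norm (f s))\<^sup>2) = 0" using assms(2) by (simp add: L2_norm_on_def)
  then have "AE s in lebesgue_on S. (norm (f s))\<^sup>2 = 0"
    using f by (subst (asm) integral_nonneg_eq_0_iff_AE) (auto simp: L2_on_def)
  then show ?thesis by simp
qed

text \<open>
  The approximating sequence of a mild solution, with pointwise convergence in time instead of
  locally uniform convergence.
\<close>

definition classical_approximation where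
  "classical_approximation l0 P0 E K L Ky Ly x0 u x y uu xx yy \<longleftrightarrow>
     (\<forall>j::nat. classical_solution l0 P0 E K L Ky Ly (uu j) (xx j) (yy j)) \<and>
     (\<lambda>j. L2_norm_on {0..1} (\<lambda>\<xi>. xx j 0 \<xi> - x0 \<xi>)) \<longlonglongrightarrow> 0 \<and>
     (\<forall>T\<ge>0. (\<lambda>j. L2_norm_on {0..T} (\<lambda>s. uu j s - u s)) \<longlonglongrightarrow> 0 \<and>
        (\<lambda>j. L2_norm_on {0..1} (\<lambda>\<xi>. xx j T \<xi> - x T \<xi>)) \<longlonglongrightarrow> 0 \<and>
        (\<lambda>j. L2_norm_on {0..T} (\<lambda>s. yy j s - y s)) \<longlonglongrightarrow> 0)"

lemma classical_approximationD:
  assumes "classical_approximation l0 P0 E K L Ky Ly x0 u x y uu xx yy"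
  shows "\<And>j. classical_solution l0 P0 E K L Ky Ly (uu j) (xx j) (yy j)"
    and "(\<lambda>j. L2_norm_on {0..1} (\<lambda>\<xi>. xx j 0 \<xi> - x0 \<xi>)) \<longlonglongrightarrow> 0"
    and "T \<ge> 0 \<Longrightarrow> (\<lambda>j. L2_norm_on {0..T} (\<lambda>s. uu j s - u s)) \<longlonglongrightarrow> 0"
    and "T \<ge> 0 \<Longrightarrow> (\<lambda>j. L2_norm_on {0..1} (\<lambda>\<xi>. xx j T \<xi> - x T \<xi>)) \<longlonglongrightarrow> 0"
    and "T \<ge> 0 \<Longrightarrow> (\<lambda>j. L2_norm_on {0..T} (\<lambda>s. yy j s - y s)) \<longlonglongrightarrow> 0"
  using assms unfolding classical_approximation_def by auto

lemma mild_solution_approximation: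
  fixes x :: "real \<Rightarrow> real \<Rightarrow> 'k::real_or_complex ^ 'n"
  assumes "mild_solution l0 P0 E K L Ky Ly x0 u x y"
  shows "\<exists>uu xx yy. classical_approximation l0 P0 E K L Ky Ly x0 u x y uu xx yy"
proof -
  obtain uu xx yy where a:
    "\<forall>j::nat. classical_solution l0 P0 E K L Ky Ly (uu j) (xx j) (yy j)"
    "(\<lambda>j. L2_norm_on {0..1} (\<lambda>\<xi>. xx j 0 \<xi> - x0 \<xi>)) \<longlonglongrightarrow> 0"
    "\<forall>T\<ge>0. (\<lambda>j. L2_norm_on {0..T} (\<lambda>s. uu j s - u s)) \<longlonglongrightarrow> 0 \<and>
         uniform_limit {0..T} (\<lambda>j t. L2_norm_on {0..1} (\<lambda>\<xi>. xx j t \<xi> - x t \<xi>)) (\<lambda>_. 0) sequentially \<and>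
         (\<lambda>j. L2_norm_on {0..T} (\<lambda>s. yy j s - y s)) \<longlonglongrightarrow> 0"
    using assms unfolding mild_solution_def by blast
  have "(\<lambda>j. L2_norm_on {0..1} (\<lambda>\<xi>. xx j T \<xi> - x T \<xi>)) \<longlonglongrightarrow> 0" if T: "T \<ge> 0" for T
  proof -
    have "uniform_limit {0..T} (\<lambda>j t. L2_norm_on {0..1} (\<lambda>\<xi>. xx j t \<xi> - x t \<xi>)) (\<lambda>_. 0) sequentially"
      using a(3) T by blast
    from tendsto_uniform_limitI[OF this, of T] T show ?thesis by simp
  qed
  then have "classical_approximation l0 P0 E K L Ky Ly x0 u x y uu xx yy"
    using a unfolding classical_approximation_def by blast
  then show ?thesis by blast
qed

context transport_system
begin

text \<open>
  The position whose value arrives at the right end after the time \<open>s\<close>. It is the inverse of the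
  reflected travel time \<open>period - tau\<close>.
\<close>

definition (in travel_time) tau_inv :: "real \<Rightarrow> real" where
  "tau_inv s = (if s \<in> {0<..<period} then the_inv_into {0..1} tau (period - s) else 0)"

lemma (in travel_time) tau_inv_measurable: "tau_inv \<in> borel_measurable borel"
proof -
  have inj: "inj_on tau {0..1}"
    by (rule linorder_inj_onI) (use tau_strict_mono in force)+
  have img: "tau ` {0..1} = {0..period}"
  proof
    show "tau ` {0..1} \<subseteq> {0..period}" using tau_range by blast
    show "{0..period} \<subseteq> tau ` {0..1}"
    proof
      fix c assume "c \<in> {0..period}"
      then obtain \<xi> where "\<xi> \<in> {0..1}" "tau \<xi> = c" by (rule tau_surj)
      then show "c \<in> tau ` {0..1}" by blast
    qed
  qed
  have "continuous_on {0..period} (the_inv_into {0..1} tau)"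
    unfolding img[symmetric]
    by (rule continuous_on_inv[OF continuous_on_tau]) (auto intro: the_inv_into_f_f[OF inj])
  then have "continuous_on {0<..<period} (\<lambda>s. the_inv_into {0..1} tau (period - s))"
    by (rule continuous_on_compose2) (auto intro!: continuous_intros)
  then show ?thesis
    unfolding tau_inv_def[abs_def]
    by (intro borel_measurable_continuous_on_if) (auto intro!: continuous_intros)
qed

lemma (in travel_time) tau_inv_tau: "\<xi> \<in> {0<..<1} \<Longrightarrow> tau_inv (period - tau \<xi>) = \<xi>"
proof -
  assume \<xi>: "\<xi> \<in> {0<..<1}"
  have inj: "inj_on tau {0..1}"
    by (rule linorder_inj_onI) (use tau_strict_mono in force)+
  show ?thesis using tau_interior[OF \<xi>] \<xi> the_inv_into_f_f[OF inj, of \<xi>] by (simp add: tau_inv_def)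
qed

text \<open>
  Every state is the snapshot of a signal, so states can be prescribed by choosing the data of a
  staircase.
\<close>

lemma (in travel_time) L2_as_travelling_signal:
  fixes f :: "real \<Rightarrow> 'w::euclidean_space"
  assumes f: "L2_on {0..1} f"
  obtains h where "signal period h" "AE \<xi> in lebesgue_on {0..1}. h (period - tau \<xi>) = f \<xi>"
proof -
  let ?M = "lebesgue_on {0..1::real}"
  obtain f' where f'[measurable]: "f' \<in> borel_measurable borel" and ae: "AE s in ?M. f' s = f s"
    using borel_representative[OF L2_on_measurable[OF f]] by blast
  note [measurable] = tau_inv_measurable L2_on_measurable[OF f]
  define h where "h s = indicator {0<..<period} s *\<^sub>R f' (tau_inv s)" for s
  have m[measurable]: "h \<in> borel_measurable borel" unfolding h_def[abs_def] by measurable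
  have hf: "AE \<xi> in ?M. h (period - tau \<xi>) = f \<xi>"
    using ae AE_interior by eventually_elim (use tau_interior tau_inv_tau in \<open>simp add: h_def\<close>)
  have m2: "(\<lambda>s. (norm (h s))\<^sup>2) \<in> borel_measurable borel" by measurable
  have "integrable ?M (\<lambda>\<xi>. slow_max * (norm (f \<xi>))\<^sup>2)" using f by (simp add: L2_on_def)
  then have "integrable ?M (\<lambda>\<xi>. slowness \<xi> *\<^sub>R (norm (h (period - tau \<xi>)))\<^sup>2)"
  proof (rule Bochner_Integration.integrable_bound)
    have [measurable]: "(\<lambda>\<xi>. (norm (h (period - tau \<xi>)))\<^sup>2) \<in> borel_measurable ?M"
      by (rule measurable_compose[OF _ m2]) measurable
    show "(\<lambda>\<xi>. slowness \<xi> *\<^sub>R (norm (h (period - tau \<xi>)))\<^sup>2) \<in> borel_measurable ?M" by measurable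
    show "AE \<xi> in ?M. norm (slowness \<xi> *\<^sub>R (norm (h (period - tau \<xi>)))\<^sup>2) \<le> norm (slow_max * (norm (f \<xi>))\<^sup>2)"
      using hf slowness_le slowness_nonneg
      by eventually_elim (simp add: abs_mult mult_right_mono)
  qed
  then have i: "integrable lborel (\<lambda>s. indicator {period - period..period} s *\<^sub>R (norm (h s))\<^sup>2)"
    using integrable_change_of_variables_reflected[OF m2, of period] by simp
  have ind: "indicator {period - period..period} s *\<^sub>R (norm (h s))\<^sup>2 = (norm (h s))\<^sup>2" for s
    by (auto simp: h_def indicator_def)
  have "integrable lborel (\<lambda>s. (norm (h s))\<^sup>2)" using i unfolding ind .
  then have "signal period h" by (auto simp: signal_def m h_def)
  then show ?thesis using that hf by blast
qed

text \<open>
  At the time \<open>k period\<close> the state consists of the \<open>k\<close>-th step alone.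
\<close>

lemma stair_interior:
  assumes "\<xi> \<in> {0<..<1}"
  shows "stair period G h (period * real k + period - tau \<xi>) = G k (h (period - tau \<xi>))"
  using stair_on_step[of period k "period * real k + period - tau \<xi>" G h] tau_interior[OF assms] period_pos
  by (simp add: algebra_simps)

text \<open>The transported quantity that belongs to the state \<open>x\<close>.\<close>

lemma rescaled_state_L2:
  assumes x: "L2_on {0..1} x"
  shows "L2_on {0..1} (\<lambda>\<xi>. l0 \<xi> *\<^sub>R (Q \<xi> *v x \<xi>))"
proof -
  obtain b where b: "AE s in lebesgue_on {0..1}. norm (l0 s) \<le> b" and [measurable]: "l0 \<in> borel_measurable (lebesgue_on {0..1})"
    using Linf_l0 by (auto simp: Linf_on_def)
  have Qx: "L2_on {0..1} (\<lambda>\<xi>. Q \<xi> *v x \<xi>)" by (rule Q_bounded) (use x in blast)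
  show ?thesis
  proof (rule L2_on_bound[OF Qx, where c="max b 0"])
    show "AE \<xi> in lebesgue_on {0..1}. norm (l0 \<xi> *\<^sub>R (Q \<xi> *v x \<xi>)) \<le> max b 0 * norm (Q \<xi> *v x \<xi>)"
      using b by eventually_elim (auto intro!: mult_right_mono)
    show "(\<lambda>\<xi>. l0 \<xi> *\<^sub>R (Q \<xi> *v x \<xi>)) \<in> borel_measurable (lebesgue_on {0..1})"
      by (rule borel_measurable_scaleR[OF _ L2_on_measurable[OF Qx]]) measurable
  qed simp
qed

lemma profile_of_rescaled:
  "\<xi> \<in> {0<..<1} \<Longrightarrow> l0 \<xi> * slowness \<xi> = 1 \<Longrightarrow> slowness \<xi> *\<^sub>R (P \<xi> *v (l0 \<xi> *\<^sub>R (Q \<xi> *v v))) = v"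
  by (simp add: PQ_vec mult.commute)

lemma linear_matrix_vector_mult: "linear ((*v) M)" for M :: "'k::real_or_complex ^ 'a ^ 'b"
  using bounded_linear_matrix_vector_mult[of M] by (rule bounded_linear.linear)

lemma mild_solution_L2:
  assumes "mild_solution l0 P0 E K L Ky Ly x0 u x y"
  shows "L2_on {0..1} x0" "t \<ge> 0 \<Longrightarrow> L2_on {0..1} (x t)" "T \<ge> 0 \<Longrightarrow> L2_on {0..T} y" "T \<ge> 0 \<Longrightarrow> L2_on {0..T} u"
  using assms unfolding mild_solution_def L2_loc_def by blast+

section \<open>Controllability\<close>

text \<open>
  Let \<open>v\<close> be orthogonal to all \<open>A\<^sup>i B u\<close>. A test function that solves the adjoint loop equation
  \<open>\<psi>(t - period) = A\<^sup>* \<psi>(t)\<close> and has values in the span of the \<open>(A\<^sup>*)\<^sup>i v\<close> does not see the input. It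
  annihilates the right-hand side of the weak identity, so solutions starting at zero stay
  orthogonal to its final profile. The state \<open>P v\<close> is not orthogonal to it, and thus has a
  positive distance from the reachable states.
\<close>

theorem approximately_controllable_imp:
  assumes ctr: "approximately_controllable l0 P0 E K L Ky Ly"
    and v: "\<And>i u. v \<bullet> (matrix_power A i *v (B *v u)) = 0"
  shows "v = 0"
proof (rule ccontr)
  assume v0: "v \<noteq> 0"
  let ?M = "lebesgue_on {0..1::real}"
  obtain T where T: "T \<ge> 0" and reach: "\<And>x0 x1 \<epsilon>. L2_on {0..1} x0 \<Longrightarrow> L2_on {0..1} x1 \<Longrightarrow> \<epsilon> > 0 \<Longrightarrow>
       \<exists>u. L2_on {0..T} u \<and> (\<exists>x y. mild_solution l0 P0 E K L Ky Ly x0 (zero_ext T u) x y \<and>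
            L2_norm_on {0..1} (\<lambda>\<xi>. x T \<xi> - x1 \<xi>) < \<epsilon>)"
    using ctr unfolding approximately_controllable_def by blast
  obtain N :: nat where N: "T \<le> period * real N"
    using ex_less_of_nat_mult[OF period_pos, of T] by (metis mult.commute less_imp_le)
  (* The staircase has its junctions at multiples of the period. The shift by c0 puts the final
     time T onto a junction, so that the final profile is a single step. *)
  define c0 where "c0 = period * real N - T"
  have c0: "c0 \<ge> 0" using N by (simp add: c0_def)
  obtain \<beta> where \<beta>: "flat_jet period \<beta>" "\<And>s. s \<in> {0<..<period} \<Longrightarrow> \<beta> 0 s > (0::real)"
    using bump_exists by blast
  define At where "At = adjoint ((*v) A)"
  have At: "w \<bullet> At v = (A *v w) \<bullet> v" for v w
    unfolding At_def by (rule adjoint_works[OF linear_matrix_vector_mult])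
  have AtS: "(At ^^ Suc i) v \<bullet> w = (At ^^ i) v \<bullet> (A *v w)" for i w
    using At[of w "(At ^^ i) v"] by (simp add: inner_commute)
  have AtB: "(At ^^ i) v \<bullet> w = v \<bullet> (matrix_power A i *v w)" for i w
  proof (induction i arbitrary: w)
    case (Suc i)
    have "(At ^^ Suc i) v \<bullet> w = (At ^^ i) v \<bullet> (A *v w)" by (rule AtS)
    also have "\<dots> = v \<bullet> (matrix_power A i *v (A *v w))" by (rule Suc)
    finally show ?case by (simp add: matrix_vector_mul_assoc matrix_power_commute)
  qed simp
  (* Backwards in time the test function picks up powers of the adjoint; the final step is a
     multiple of v itself. *)
  define G where "G k r = r *\<^sub>R (At ^^ (N - k)) v" for k and r :: real
  have G: "linear (G k)" for k unfolding G_def[abs_def] by (rule linearI) (simp_all add: scaleR_left_distrib)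
  define \<psi> where "\<psi> i s = stair period G (\<beta> i) (s + period + c0)" for i s
  have d: "(\<psi> i has_vector_derivative \<psi> (Suc i) s) (at s)" for i s
  proof -
    have "(stair period G (\<beta> i) has_vector_derivative stair period G (\<beta> (Suc i)) (s + period + c0)) (at (s + period + c0))"
      by (rule stair_has_vector_derivative[where G=G and D=\<beta>, OF period_pos G \<beta>(1)])
    then have "((stair period G (\<beta> i) \<circ> (\<lambda>s. s + period + c0)) has_vector_derivative 1 *\<^sub>R stair period G (\<beta> (Suc i)) (s + period + c0)) (at s)"
      by (intro vector_diff_chain_at) (auto intro!: derivative_eq_intros)
    then show ?thesis by (simp add: o_def \<psi>_def[abs_def])
  qed
  have c\<psi>: "continuous_on S (\<psi> i)" for S i
    using d by (auto intro!: continuous_at_imp_continuous_on has_vector_derivative_continuous)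
  have c\<psi>t: "continuous_on {0..1} (\<lambda>\<xi>. \<psi> 0 (t - tau \<xi>))" for t
    by (intro continuous_on_compose2[OF c\<psi>[of UNIV]] continuous_intros continuous_on_tau) auto
  have annihilates: "\<psi> 0 t \<bullet> (A *v w + B *v u) - \<psi> 0 (t - period) \<bullet> w = 0" if t: "t \<in> {0..T}" for t w u
  proof -
    define r where "r = t + c0"
    have r: "0 \<le> r" "r \<le> period * real N" using t c0 by (auto simp: r_def c0_def)
    define k where "k = nat \<lfloor>r / period\<rfloor>"
    have k: "real k = of_int \<lfloor>r / period\<rfloor>" using r period_pos by (simp add: k_def)
    define b where "b = \<beta> 0 (r - period * real k)"
    have kr: "period * real k \<le> r" "r < period * real k + period"
      using floor_divide_bounds[OF period_pos, of r] unfolding k by linarith+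
    have s1: "\<psi> 0 (t - period) = G k b"
      using stair_on_step[OF period_pos kr, of G "\<beta> 0"] by (simp add: \<psi>_def r_def b_def algebra_simps)
    have "\<psi> 0 t = stair period G (\<beta> 0) (r + period)" by (simp add: \<psi>_def r_def algebra_simps)
    also have "\<dots> = G (Suc k) b"
      unfolding stair_shift[OF period_pos r(1)] stair_on_step[OF period_pos kr] by (simp add: b_def)
    finally have s2: "\<psi> 0 t = G (Suc k) b" .
    show ?thesis
    proof (cases "k < N")
      case True
      then have Nk: "N - k = Suc (N - Suc k)" by simp
      have "G k b \<bullet> w = b * ((At ^^ (N - Suc k)) v \<bullet> (A *v w))"
        unfolding G_def Nk inner_scaleR_left AtS ..
      moreover have "G (Suc k) b \<bullet> (B *v u) = 0" by (simp add: G_def AtB v)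
      moreover have "G (Suc k) b \<bullet> (A *v w) = b * ((At ^^ (N - Suc k)) v \<bullet> (A *v w))" by (simp add: G_def)
      ultimately show ?thesis unfolding s1 s2 by (simp add: inner_add_right)
    next
      (* Only the final time T itself belongs to step N, and there the bump vanishes. *)
      case False
      then have le: "period * real N \<le> period * real k" using period_pos by simp
      have "r - period * real k = 0" using r(2) kr(1) le by linarith
      then have "b = 0" using \<beta>(1) by (simp add: b_def flat_jet_def)
      then show ?thesis unfolding s1 s2 by (simp add: G_def)
    qed
  qed
  define \<phi> where "\<phi> \<xi> = \<psi> 0 (T - tau \<xi>)" for \<xi>
  have c\<phi>: "continuous_on {0..1} \<phi>" unfolding \<phi>_def[abs_def] by (rule c\<psi>t)
  have \<phi>_int: "\<phi> \<xi> = \<beta> 0 (period - tau \<xi>) *\<^sub>R v" if "\<xi> \<in> {0<..<1}" for \<xi>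
  proof -
    have "\<phi> \<xi> = stair period G (\<beta> 0) (period * real N + period - tau \<xi>)"
      by (simp add: \<phi>_def \<psi>_def c0_def algebra_simps)
    then show ?thesis by (simp add: stair_interior[OF that] G_def)
  qed
  have classical: "pairing \<phi> (x T) = pairing (\<lambda>\<xi>. \<psi> 0 (0 - tau \<xi>)) (x 0) \<and> L2_on {0..1} (x T) \<and> L2_on {0..1} (x 0)"
    if sol: "classical_solution l0 P0 E K L Ky Ly u x y" for u x y
  proof -
    obtain w where "continuous_on {0..} w" and "continuous_on {0..} u"
      and L2: "\<And>t. t \<ge> 0 \<Longrightarrow> L2_on {0..1} (x t)"
      and "\<And>t. t \<ge> 0 \<Longrightarrow> y t = C *v w t + D *v u t"
      and weak: "weak_identity u x w"
      by (rule classical_solution_weak[OF sol]) (rule that)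
    have "((\<lambda>t. 0) has_integral (pairing (\<lambda>\<xi>. \<psi> 0 (T - tau \<xi>)) (x T) - pairing (\<lambda>\<xi>. \<psi> 0 (0 - tau \<xi>)) (x 0))) {0..T}"
      by (rule has_integral_eq[OF _ weak_identityD[OF weak d c\<psi> T]]) (use annihilates in blast)
    then have "pairing (\<lambda>\<xi>. \<psi> 0 (T - tau \<xi>)) (x T) - pairing (\<lambda>\<xi>. \<psi> 0 (0 - tau \<xi>)) (x 0) = 0"
      using has_integral_unique[OF _ has_integral_0[of "{0..T}"]] by simp
    then show ?thesis using L2 T by (simp add: \<phi>_def[abs_def])
  qed
  have mild: "pairing \<phi> (x T) = 0" if m: "mild_solution l0 P0 E K L Ky Ly (\<lambda>_. 0) u x y" for u x y
  proof -
    obtain uu xx yy where "classical_approximation l0 P0 E K L Ky Ly (\<lambda>_. 0) u x y uu xx yy"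
      using mild_solution_approximation[OF m] by blast
    note a = classical_approximationD[OF this]
    note xlim = a(4)
    have "(\<lambda>j. pairing \<phi> (xx j T)) \<longlonglongrightarrow> pairing \<phi> (x T)"
      by (rule pairing_tendsto[OF c\<phi> _ mild_solution_L2(2)[OF m T] xlim[OF T]]) (use classical[OF a(1)] in blast)
    moreover have "(\<lambda>j. pairing (\<lambda>\<xi>. \<psi> 0 (0 - tau \<xi>)) (xx j 0)) \<longlonglongrightarrow> pairing (\<lambda>\<xi>. \<psi> 0 (0 - tau \<xi>)) (\<lambda>_. 0)"
      by (rule pairing_tendsto[OF c\<psi>t _ L2_on_zero a(2)]) (use classical[OF a(1)] in blast)
    moreover have "pairing \<phi> (xx j T) = pairing (\<lambda>\<xi>. \<psi> 0 (0 - tau \<xi>)) (xx j 0)" for j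
      using classical[OF a(1)] by blast
    ultimately have "pairing \<phi> (x T) = pairing (\<lambda>\<xi>. \<psi> 0 (0 - tau \<xi>)) (\<lambda>_. 0)"
      using LIMSEQ_unique by simp
    then show ?thesis by (simp add: pairing_def)
  qed
  define x1 where "x1 \<xi> = P \<xi> *v v" for \<xi>
  have L2x1: "L2_on {0..1} x1"
    unfolding x1_def by (intro continuous_imp_L2_on bounded_bilinear.continuous_on[OF bounded_bilinear_matrix_vector_mult]
        continuous_on_P continuous_intros)
  have ae: "AE \<xi> in ?M. \<phi> \<xi> \<bullet> (Q \<xi> *v x1 \<xi>) = \<beta> 0 (period - tau \<xi>) * (v \<bullet> v) \<and> \<beta> 0 (period - tau \<xi>) > 0"
    using AE_interior
  proof eventually_elim
    case (elim \<xi>)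
    have "\<beta> 0 (period - tau \<xi>) > 0" using tau_interior[OF elim] by (intro \<beta>(2)) auto
    then show ?case using elim by (simp add: \<phi>_int x1_def QP_vec)
  qed
  have pos: "pairing \<phi> x1 > 0"
  proof (rule ccontr)
    assume neg: "\<not> pairing \<phi> x1 > 0"
    have nn: "AE \<xi> in ?M. 0 \<le> \<phi> \<xi> \<bullet> (Q \<xi> *v x1 \<xi>)" using ae by eventually_elim simp
    have "pairing \<phi> x1 \<ge> 0" unfolding pairing_def by (rule integral_nonneg_AE[OF nn])
    then have "pairing \<phi> x1 = 0" using neg by simp
    then have "AE \<xi> in ?M. \<phi> \<xi> \<bullet> (Q \<xi> *v x1 \<xi>) = 0"
      using integral_nonneg_eq_0_iff_AE[OF pairing_integrable[OF c\<phi> L2x1] nn] by (simp add: pairing_def)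
    then have "AE \<xi> in ?M. False" using ae by eventually_elim (use v0 in auto)
    then show False using lebesgue_on_unit_not_null by blast
  qed
  obtain c where c: "c > 0"
    "\<And>\<phi> x b. continuous_on {0..1} \<phi> \<Longrightarrow> L2_on {0..1} x \<Longrightarrow> b \<ge> 0 \<Longrightarrow>
       (\<And>\<xi>. \<xi> \<in> {0..1} \<Longrightarrow> norm (\<phi> \<xi>) \<le> b) \<Longrightarrow> \<bar>pairing \<phi> x\<bar> \<le> b * (c * L2_norm_on {0..1} x)"
    using pairing_bound by blast
  have "bounded (\<phi> ` {0..1})" using c\<phi> by (intro compact_imp_bounded compact_continuous_image) auto
  then obtain b where "\<forall>x\<in>\<phi> ` {0..1}. norm x \<le> b" unfolding bounded_iff by blast
  then have b: "\<And>\<xi>. \<xi> \<in> {0..1} \<Longrightarrow> norm (\<phi> \<xi>) \<le> max b 1" by (auto simp: max.coboundedI1)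
  (* An approximation of x1 by a reachable state with this error would contradict the bound of
     the pairing. The maximum with 1 keeps the denominator positive. *)
  define \<epsilon> where "\<epsilon> = pairing \<phi> x1 / (max b 1 * c)"
  have bc: "max b 1 * c > 0" using c by simp
  have "\<epsilon> > 0" using pos bc by (simp add: \<epsilon>_def)
  then obtain u x y where m: "mild_solution l0 P0 E K L Ky Ly (\<lambda>_. 0) (zero_ext T u) x y"
    and close: "L2_norm_on {0..1} (\<lambda>\<xi>. x T \<xi> - x1 \<xi>) < \<epsilon>"
    using reach[OF L2_on_zero L2x1] by blast
  have L2T: "L2_on {0..1} (x T)" by (rule mild_solution_L2(2)[OF m T])
  have "pairing \<phi> x1 = - pairing \<phi> (\<lambda>\<xi>. x T \<xi> - x1 \<xi>)"
    using pairing_diff_right[OF c\<phi> L2T L2x1] mild[OF m] by simp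
  also have "\<dots> \<le> \<bar>pairing \<phi> (\<lambda>\<xi>. x T \<xi> - x1 \<xi>)\<bar>" by simp
  also have "\<dots> \<le> max b 1 * (c * L2_norm_on {0..1} (\<lambda>\<xi>. x T \<xi> - x1 \<xi>))"
    by (rule c(2)[OF c\<phi> L2_on_diff[OF L2T L2x1] _ b]) simp
  also have "\<dots> = (max b 1 * c) * L2_norm_on {0..1} (\<lambda>\<xi>. x T \<xi> - x1 \<xi>)" by simp
  also have "\<dots> < (max b 1 * c) * \<epsilon>" using close bc by (rule mult_strict_left_mono)
  also have "\<dots> = pairing \<phi> x1"
    unfolding \<epsilon>_def times_divide_eq_right using bc by (intro nonzero_mult_div_cancel_left) linarith
  finally show False by simp
qed

text \<open>
  For every phase, \<open>N\<close> steps of the discrete system suffice to move the transported value from the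
  initial to the final one, with inputs that are linear in this pair of values. The staircase over
  the pairs \<open>(x0, x1)\<close> of rescaled states, therefore, is a solution from \<open>x0\<close> to \<open>x1\<close>.
\<close>

theorem exactly_controllable_if:
  assumes total: "\<And>v. (\<And>i u. v \<bullet> (matrix_power A i *v (B *v u)) = 0) \<Longrightarrow> v = 0"
  shows "exactly_controllable l0 P0 E K L Ky Ly"
proof -
  let ?M = "lebesgue_on {0..1::real}"
  have linf: "linear (\<lambda>u. matrix_power A i *v (B *v u))" for i
    unfolding matrix_vector_mul_assoc by (rule linear_matrix_vector_mult)
  obtain N H where H: "\<And>k. linear (H k :: 'k ^ 'n \<Rightarrow> 'k ^ 'm)"
    and inv: "\<And>v. (\<Sum>k<N. matrix_power A k *v (B *v H k v)) = v"
  proof (rule linear_right_inverse_of_family[where f="\<lambda>i u. matrix_power A i *v (B *v u)"])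
    show "linear (\<lambda>u. matrix_power A k *v (B *v u))" for k by (rule linf)
    show "v = 0" if "\<And>k u. v \<bullet> (matrix_power A k *v (B *v u)) = 0" for v using that by (rule total)
  qed (rule that)
  (* The input at step k still passes N - 1 - k loops, so it takes the contribution of the power
     N - 1 - k to the difference between the target and the free evolution. Afterwards it is zero,
     which makes the staircase agree with its truncation to [0,T]. *)
  define U :: "nat \<Rightarrow> ('k ^ 'n) \<times> ('k ^ 'n) \<Rightarrow> 'k ^ 'm" where
    "U k w = (if k < N then H (N - 1 - k) (snd w - matrix_power A N *v fst w) else 0)" for k w
  define G :: "nat \<Rightarrow> ('k ^ 'n) \<times> ('k ^ 'n) \<Rightarrow> 'k ^ 'n" where
    "G k w = rec_nat (fst w) (\<lambda>k g. A *v g + B *v U k w) k" for k w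
  have G0: "G 0 w = fst w" and GS: "G (Suc k) w = A *v G k w + B *v U k w" for k w by (simp_all add: G_def)
  have U: "linear (U k)" for k
    by (rule linearI) (simp_all add: U_def linear_add[OF H, symmetric] linear_scale[OF H, symmetric] algebra_simps)
  have G: "linear (G k)" for k
  proof (induction k)
    case 0
    have "G 0 = fst" using G0 by (simp add: fun_eq_iff)
    then show ?case by (simp add: linear_fst)
  next
    case (Suc k)
    show ?case
      by (rule linearI) (simp_all add: GS linear_add[OF Suc] linear_add[OF U] linear_scale[OF Suc] linear_scale[OF U] scaleR_add_right)
  qed
  have Gsum: "G k w = matrix_power A k *v fst w + (\<Sum>i<k. matrix_power A i *v (B *v U (k - 1 - i) w))" for k w
  proof (induction k)
    case (Suc k)
    have "(\<Sum>i<Suc k. matrix_power A i *v (B *v U (Suc k - 1 - i) w)) =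
        B *v U k w + (\<Sum>i<k. A *v (matrix_power A i *v (B *v U (k - 1 - i) w)))"
      by (subst sum.lessThan_Suc_shift) (simp add: matrix_vector_mul_assoc matrix_mul_assoc)
    then show ?case by (simp add: GS Suc matrix_vector_mul_assoc linear_sum[OF linear_matrix_vector_mult])
  qed (simp add: G0)
  have GN: "G N w = snd w" for w
  proof -
    have "(\<Sum>i<N. matrix_power A i *v (B *v U (N - 1 - i) w)) =
        (\<Sum>i<N. matrix_power A i *v (B *v H i (snd w - matrix_power A N *v fst w)))"
      by (intro sum.cong) (auto simp: U_def)
    then show ?thesis by (simp add: Gsum inv)
  qed
  define T where "T = period * real N"
  have T: "T \<ge> 0" using period_pos by (simp add: T_def)
  show ?thesis
    unfolding exactly_controllable_def
  proof (intro exI[of _ T] conjI T allI impI)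
    fix x0 x1 :: "real \<Rightarrow> 'k ^ 'n"
    assume x0: "L2_on {0..1} x0" and x1: "L2_on {0..1} x1"
    define f where "f \<xi> = (l0 \<xi> *\<^sub>R (Q \<xi> *v x0 \<xi>), l0 \<xi> *\<^sub>R (Q \<xi> *v x1 \<xi>))" for \<xi>
    have L2f: "L2_on {0..1} f"
    proof -
      note r0 = rescaled_state_L2[OF x0] and r1 = rescaled_state_L2[OF x1]
      have "L2_on {0..1} (\<lambda>\<xi>. (l0 \<xi> *\<^sub>R (Q \<xi> *v x0 \<xi>), 0 :: 'k ^ 'n))"
        by (rule L2_on_bound[OF r0, where c=1])
          (auto simp: norm_Pair intro!: borel_measurable_Pair L2_on_measurable[OF r0])
      moreover have "L2_on {0..1} (\<lambda>\<xi>. (0 :: 'k ^ 'n, l0 \<xi> *\<^sub>R (Q \<xi> *v x1 \<xi>)))"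
        by (rule L2_on_bound[OF r1, where c=1])
          (auto simp: norm_Pair intro!: borel_measurable_Pair L2_on_measurable[OF r1])
      ultimately have "L2_on {0..1} (\<lambda>\<xi>. (l0 \<xi> *\<^sub>R (Q \<xi> *v x0 \<xi>), 0) + (0, l0 \<xi> *\<^sub>R (Q \<xi> *v x1 \<xi>)))"
        by (rule L2_on_add)
      then show ?thesis by (simp add: f_def[abs_def])
    qed
    obtain h where h: "signal period h" and hf: "AE \<xi> in ?M. h (period - tau \<xi>) = f \<xi>"
      using L2_as_travelling_signal[OF L2f] by blast
    define x where "x = profile (\<lambda>s. stair period G h (s + period))"
    have slice: "AE \<xi> in ?M. x (period * real k) \<xi> = slowness \<xi> *\<^sub>R (P \<xi> *v G k (f \<xi>))" for k
      using hf AE_interior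
    proof eventually_elim
      case (elim \<xi>)
      have "x (period * real k) \<xi> = slowness \<xi> *\<^sub>R (P \<xi> *v stair period G h (period * real k + period - tau \<xi>))"
        by (simp add: x_def profile_def algebra_simps)
      then show ?case using stair_interior[OF elim(2), of G h k] elim(1) by simp
    qed
    have xT: "AE \<xi> in ?M. x T \<xi> = x1 \<xi>"
      using slice[of N] AE_interior l0_slowness unfolding T_def
      by eventually_elim (simp only: GN f_def snd_conv profile_of_rescaled)
    have init: "AE \<xi> in ?M. x0 \<xi> = x 0 \<xi>"
      using slice[of 0] AE_interior l0_slowness
      by eventually_elim (simp only: G0 f_def fst_conv profile_of_rescaled of_nat_0 mult_zero_right)
    have m: "mild_solution l0 P0 E K L Ky Ly x0 (zero_ext T (stair period U h)) x
        (\<lambda>t. C *v stair period G h t + D *v stair period U h t)"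
      unfolding x_def
    proof (rule mild_solution_stair[where G=G and U=U, OF G U GS h _ x0])
      fix s :: real assume s: "s \<ge> 0"
      show "zero_ext T (stair period U h) s = stair period U h s"
      proof (cases "s \<le> T")
        case False
        then have "real N \<le> s / period" using period_pos by (simp add: T_def field_simps)
        then have "N \<le> nat \<lfloor>s / period\<rfloor>" by (simp add: le_nat_floor)
        then show ?thesis using False by (simp add: zero_ext_def stair_def U_def)
      qed (use s in \<open>simp add: zero_ext_def\<close>)
    qed (use init in \<open>simp add: x_def\<close>)
    have "L2_on {0..T} (stair period U h)"
      by (rule stair_L2[where G=U and T=T, OF period_pos U]) (use h in blast)
    then show "\<exists>u. L2_on {0..T} u \<and> (\<exists>x y. mild_solution l0 P0 E K L Ky Ly x0 (zero_ext T u) x y \<and>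
            (AE \<xi> in ?M. x T \<xi> = x1 \<xi>))"
      using m xT by blast
  qed
qed

section \<open>Observability\<close>

text \<open>
  A wave in the direction of an undetected vector \<open>v\<close> stays undetected, since after \<open>k\<close> loops it is a
  multiple of \<open>A\<^sup>k v\<close>. The second solution is the zero solution, also with zero output.
\<close>

lemma unobservable_solutions:
  assumes v0: "v \<noteq> 0" and v: "\<And>i. C *v (matrix_power A i *v v) = 0"
  obtains x0 x x0' x' where "mild_solution l0 P0 E K L Ky Ly x0 (\<lambda>_. 0) x (\<lambda>_. 0)"
    "mild_solution l0 P0 E K L Ky Ly x0' (\<lambda>_. 0) x' (\<lambda>_. 0)"
    "\<not> (AE \<xi> in lebesgue_on {0..1}. x0 \<xi> = x0' \<xi>)"
proof -
  let ?M = "lebesgue_on {0..1::real}"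
  obtain \<beta> where \<beta>: "flat_jet period \<beta>" "\<And>s. s \<in> {0<..<period} \<Longrightarrow> \<beta> 0 s > (0::real)"
    using bump_exists by blast
  define G where "G k r = r *\<^sub>R (matrix_power A k *v v)" for k and r :: real
  define U :: "nat \<Rightarrow> real \<Rightarrow> 'k ^ 'm" where "U k r = 0" for k r
  have G: "linear (G k)" and U: "linear (U k)" for k
    unfolding G_def[abs_def] U_def[abs_def] by (rule linearI; simp add: scaleR_left_distrib)+
  have step: "G (Suc k) w = A *v G k w + B *v U k w" for k w
    by (simp add: G_def U_def matrix_vector_mul_assoc)
  define x where "x h = profile (\<lambda>s. stair period G h (s + period))" for h
  have mild: "mild_solution l0 P0 E K L Ky Ly (x h 0) (\<lambda>_. 0) (x h) (\<lambda>_. 0)" if h: "signal period h" for h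
  proof -
    have "mild_solution l0 P0 E K L Ky Ly (x h 0) (\<lambda>_. 0) (x h)
        (\<lambda>t. C *v stair period G h t + D *v stair period U h t)"
      unfolding x_def
    proof (rule mild_solution_stair[where G=G and U=U, OF G U step h])
      show "L2_on {0..1} (profile (\<lambda>s. stair period G h (s + period)) 0)"
        by (rule profile_stair[where G=G and T=0, OF G order_refl]) (use h in simp)
    qed (auto simp: stair_def U_def)
    moreover have "C *v stair period G h t + D *v stair period U h t = 0" for t
      by (simp add: stair_def G_def U_def v)
    ultimately show ?thesis by simp
  qed
  have s: "signal period (\<beta> 0)" "signal period (\<lambda>_. 0 :: real)"
    using flat_jet_signal[OF \<beta>(1)] by (auto simp: signal_def)
  have "\<not> (AE \<xi> in ?M. x (\<beta> 0) 0 \<xi> = x (\<lambda>_. 0) 0 \<xi>)"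
  proof
    assume "AE \<xi> in ?M. x (\<beta> 0) 0 \<xi> = x (\<lambda>_. 0) 0 \<xi>"
    then have "AE \<xi> in ?M. False"
      using AE_interior l0_slowness
    proof eventually_elim
      case (elim \<xi>)
      have "stair period G h (period - tau \<xi>) = G 0 (h (period - tau \<xi>))" for h
        using stair_interior[OF elim(2), of G h 0] by simp
      then have "slowness \<xi> *\<^sub>R (P \<xi> *v (\<beta> 0 (period - tau \<xi>) *\<^sub>R v)) = 0"
        using elim(1) by (simp add: x_def profile_def G_def)
      moreover have "slowness \<xi> \<noteq> 0" using elim(3) by auto
      moreover have "\<beta> 0 (period - tau \<xi>) > 0" using tau_interior[OF elim(2)] by (intro \<beta>(2)) auto
      ultimately have "P \<xi> *v v = 0" by simp
      then have "Q \<xi> *v (P \<xi> *v v) = 0" by simp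
      then show False using QP_vec[of \<xi> v] elim(2) v0 by simp
    qed
    then show False using lebesgue_on_unit_not_null by blast
  qed
  then show ?thesis by (rule that[OF mild[OF s(1)] mild[OF s(2)]])
qed

theorem approximately_observable_imp:
  assumes obs: "approximately_observable l0 P0 E K L Ky Ly"
    and v: "\<And>i. C *v (matrix_power A i *v v) = 0"
  shows "v = 0"
proof (rule ccontr)
  assume "v \<noteq> 0"
  then obtain x0 x x0' x' where m: "mild_solution l0 P0 E K L Ky Ly x0 (\<lambda>_. 0) x (\<lambda>_. 0)"
    "mild_solution l0 P0 E K L Ky Ly x0' (\<lambda>_. 0) x' (\<lambda>_. 0)"
    and ne: "\<not> (AE \<xi> in lebesgue_on {0..1}. x0 \<xi> = x0' \<xi>)"
    by (rule unobservable_solutions[OF _ v])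
  obtain t where "\<forall>x0 x y x0' x' y'.
       mild_solution l0 P0 E K L Ky Ly x0 (\<lambda>_. 0) x y \<longrightarrow>
       mild_solution l0 P0 E K L Ky Ly x0' (\<lambda>_. 0) x' y' \<longrightarrow>
       (AE s in lebesgue_on {0..t}. y s = y' s) \<longrightarrow>
       (AE \<xi> in lebesgue_on {0..1}. x0 \<xi> = x0' \<xi>)"
    using obs unfolding approximately_observable_def by (elim exE conjE)
  from this[rule_format, OF m] ne show False by simp
qed

text \<open>
  A sequence of weights for the discrete system: \<open>w = \<Sum>\<^sub>k (A\<^sup>*)\<^sup>k C\<^sup>* H\<^sub>k w\<close> recovers \<open>w\<close> from observed
  directions. The partial sums \<open>G\<^sub>k w = \<Sum>\<^sub>j\<^sub>\<ge>\<^sub>k (A\<^sup>*)\<^sup>j\<^sup>-\<^sup>k C\<^sup>* H\<^sub>j w\<close> run from \<open>w\<close> to \<open>0\<close> and satisfy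
  \<open>G\<^sub>k = A\<^sup>* G\<^sub>k\<^sub>+\<^sub>1 + C\<^sup>* H\<^sub>k\<close>, which is the last conclusion.
\<close>

lemma observability_staircase:
  assumes total: "\<And>v. (\<And>i. C *v (matrix_power A i *v v) = 0) \<Longrightarrow> v = 0"
  obtains N and G :: "nat \<Rightarrow> 'k ^ 'n \<Rightarrow> 'k::real_or_complex ^ 'n" and H :: "nat \<Rightarrow> 'k ^ 'n \<Rightarrow> 'k::real_or_complex ^ 'p"
  where "\<And>k. linear (G k)" "\<And>k. linear (H k)" "\<And>w. G 0 w = w" "\<forall>k w. N \<le> k \<longrightarrow> G k w = 0"
    "\<And>k w v. G (Suc k) w \<bullet> (A *v v) - G k w \<bullet> v = - (H k w \<bullet> (C *v v))"
proof -
  define At Ct where "At = adjoint ((*v) A)" and "Ct = adjoint ((*v) C)"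
  have At: "w \<bullet> At v = (A *v w) \<bullet> v" and Ct: "w \<bullet> Ct y = (C *v w) \<bullet> y" for v w y
    unfolding At_def Ct_def by (rule adjoint_works[OF linear_matrix_vector_mult])+
  have linAt: "linear At" and linCt: "linear Ct"
    unfolding At_def Ct_def by (rule adjoint_linear[OF linear_matrix_vector_mult])+
  have linpow: "linear (At ^^ k)" for k
  proof (induction k)
    case (Suc k)
    then show ?case using linear_compose[OF Suc linAt] by (simp add: o_def)
  qed (simp add: linear_id[unfolded id_def] id_def)
  have Atpow: "v \<bullet> (At ^^ i) w = (matrix_power A i *v v) \<bullet> w" for i v w
  proof (induction i arbitrary: v)
    case (Suc i)
    have "v \<bullet> (At ^^ Suc i) w = (A *v v) \<bullet> (At ^^ i) w" by (simp add: At)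
    also have "\<dots> = (matrix_power A i *v (A *v v)) \<bullet> w" by (rule Suc)
    finally show ?case by (simp add: matrix_vector_mul_assoc matrix_power_commute)
  qed simp
  obtain N H where H: "\<And>k. linear (H k :: 'k ^ 'n \<Rightarrow> 'k ^ 'p)"
    and inv: "\<And>v. (\<Sum>k<N. (At ^^ k) (Ct (H k v))) = v"
  proof (rule linear_right_inverse_of_family[where f="\<lambda>k y. (At ^^ k) (Ct y)"])
    show "linear (\<lambda>y. (At ^^ k) (Ct y))" for k
      using linear_compose[OF linCt linpow] by (simp add: o_def)
    show "v = 0" if h: "\<And>k y. v \<bullet> (At ^^ k) (Ct y) = 0" for v
    proof (rule total)
      fix i
      have "(C *v (matrix_power A i *v v)) \<bullet> (C *v (matrix_power A i *v v)) = 0"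
        using h[of i "C *v (matrix_power A i *v v)"] by (simp add: Atpow Ct)
      then show "C *v (matrix_power A i *v v) = 0" by simp
    qed
  qed (rule that)
  define H' where "H' k w = (if k < N then H k w else 0)" for k w
  define G where "G k w = (\<Sum>j\<in>{k..<N}. (At ^^ (j - k)) (Ct (H j w)))" for k w
  have H': "linear (H' k)" for k
    by (rule linearI) (simp_all add: H'_def linear_add[OF H] linear_scale[OF H])
  have G: "linear (G k)" for k
    by (rule linearI) (simp_all add: G_def linear_add[OF H] linear_scale[OF H] linear_add[OF linCt] linear_scale[OF linCt]
        linear_add[OF linpow] linear_scale[OF linpow] sum.distrib scaleR_sum_right)
  have G0: "G 0 w = w" for w using inv[of w] by (simp add: G_def atLeast0LessThan)
  have GN: "\<forall>k w. N \<le> k \<longrightarrow> G k w = 0" by (simp add: G_def)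
  have Gstep: "G k w = At (G (Suc k) w) + Ct (H' k w)" for k w
  proof (cases "k < N")
    case True
    have "At (G (Suc k) w) = (\<Sum>j\<in>{Suc k..<N}. (At ^^ Suc (j - Suc k)) (Ct (H j w)))"
      by (simp add: G_def linear_sum[OF linAt])
    also have "\<dots> = (\<Sum>j\<in>{Suc k..<N}. (At ^^ (j - k)) (Ct (H j w)))"
      by (intro sum.cong refl) (metis Suc_diff_Suc Suc_le_lessD atLeastLessThan_iff)
    finally show ?thesis using True by (simp add: G_def H'_def sum.atLeast_Suc_lessThan)
  qed (simp add: GN H'_def linear_0[OF linAt] linear_0[OF linCt])
  have "G (Suc k) w \<bullet> (A *v v) - G k w \<bullet> v = - (H' k w \<bullet> (C *v v))" for k w v
  proof -
    have "v \<bullet> G k w = v \<bullet> At (G (Suc k) w) + v \<bullet> Ct (H' k w)"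
      by (simp only: Gstep[of k] inner_add_right)
    also have "\<dots> = (A *v v) \<bullet> G (Suc k) w + (C *v v) \<bullet> H' k w" by (simp only: At Ct)
    finally show ?thesis
      by (simp add: inner_commute[of "G k w" v] inner_commute[of "G (Suc k) w"] inner_commute[of "H' k w"])
  qed
  then show ?thesis by (rule that[OF G H' G0 GN])
qed

text \<open>
  With the weights \<open>G\<close> as test function in the weak identity, what passes the ends at each time is minus
  the output tested with \<open>H\<close>, and the pairing with the final state vanishes. So the pairing of
  the initial state with an arbitrary flat profile is an integral over the output.
\<close>

lemma observability_identity:
  fixes G :: "nat \<Rightarrow> 'k ^ 'n \<Rightarrow> 'k::real_or_complex ^ 'n" and H :: "nat \<Rightarrow> 'k ^ 'n \<Rightarrow> 'k::real_or_complex ^ 'p"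
  assumes G: "\<And>k. linear (G k)" and H: "\<And>k. linear (H k)"
    and G0: "\<And>w. G 0 w = w" and GN: "\<forall>k w. N \<le> k \<longrightarrow> G k w = 0"
    and step: "\<And>k w v. G (Suc k) w \<bullet> (A *v v) - G k w \<bullet> v = - (H k w \<bullet> (C *v v))"
    and D': "flat_jet period D'"
    and m: "mild_solution l0 P0 E K L Ky Ly x0 (\<lambda>_. 0) x y"
  shows "pairing (\<lambda>\<xi>. stair period G (D' 0) (period - tau \<xi>)) x0 =
    (LINT s|lebesgue_on {0..period * real N}. stair period H (D' 0) s \<bullet> y s)"
proof -
  define T where "T = period * real N"
  have T: "T \<ge> 0" using period_pos by (simp add: T_def)
  define \<psi> where "\<psi> i s = stair period G (D' i) (s + period)" for i s
  define \<eta> where "\<eta> s = stair period H (D' 0) s" for s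
  have d: "(\<psi> i has_vector_derivative \<psi> (Suc i) s) (at s)" for i s
  proof -
    have "(stair period G (D' i) has_vector_derivative stair period G (D' (Suc i)) (s + period)) (at (s + period))"
      by (rule stair_has_vector_derivative[where G=G and D=D', OF period_pos G D'])
    then have "((stair period G (D' i) \<circ> (\<lambda>s. s + period)) has_vector_derivative 1 *\<^sub>R stair period G (D' (Suc i)) (s + period)) (at s)"
      by (intro vector_diff_chain_at) (auto intro!: derivative_eq_intros)
    then show ?thesis by (simp add: o_def \<psi>_def[abs_def])
  qed
  have c\<psi>: "continuous_on S (\<psi> i)" for S i
    using d by (auto intro!: continuous_at_imp_continuous_on has_vector_derivative_continuous)
  have c\<eta>: "continuous_on S \<eta>" for S
    unfolding \<eta>_def[abs_def] by (rule stair_continuous[where G=H and D=D', OF period_pos H D'])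
  have c\<psi>t: "continuous_on {0..1} (\<lambda>\<xi>. \<psi> 0 (t - tau \<xi>))" for t
    by (intro continuous_on_compose2[OF c\<psi>[of UNIV]] continuous_intros continuous_on_tau) auto
  have loop: "\<psi> 0 t \<bullet> (A *v w) - \<psi> 0 (t - period) \<bullet> w = - (\<eta> t \<bullet> (C *v w))" if t: "t \<ge> 0" for t w
  proof -
    define b where "b = D' 0 (t - period * of_int \<lfloor>t / period\<rfloor>)"
    have "\<psi> 0 t = stair period (\<lambda>k. G (Suc k)) (D' 0) t"
      by (simp only: \<psi>_def stair_shift[OF period_pos t])
    then have "\<psi> 0 t = G (Suc (nat \<lfloor>t / period\<rfloor>)) b" "\<psi> 0 (t - period) = G (nat \<lfloor>t / period\<rfloor>) b"
      "\<eta> t = H (nat \<lfloor>t / period\<rfloor>) b"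
      by (simp_all add: \<psi>_def[of _ "t - period"] \<eta>_def b_def stair_def)
    then show ?thesis by (simp only: step)
  qed
  have final: "\<psi> 0 (T - tau \<xi>) = 0" if "\<xi> \<in> {0..1}" for \<xi>
  proof -
    have "real N \<le> (T - tau \<xi> + period) / period"
      using tau_range[OF that] period_pos by (simp add: T_def field_simps)
    then have "N \<le> nat \<lfloor>(T - tau \<xi> + period) / period\<rfloor>" by (simp add: le_nat_floor)
    then show ?thesis by (simp add: \<psi>_def stair_def GN)
  qed
  (* A classical approximation of a solution without input may have an input. Its contribution
     is kept here and vanishes in the limit. *)
  have classical: "pairing (\<lambda>\<xi>. \<psi> 0 (0 - tau \<xi>)) (x 0) =
      (LINT s|lebesgue_on {0..T}. \<eta> s \<bullet> y s) - (LINT s|lebesgue_on {0..T}. (\<eta> s) \<bullet> (D *v u s)) - (LINT s|lebesgue_on {0..T}. \<psi> 0 s \<bullet> (B *v u s))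
      \<and> L2_on {0..1} (x 0) \<and> L2_on {0..T} u \<and> L2_on {0..T} y"
    if sol: "classical_solution l0 P0 E K L Ky Ly u x y" for u x y
  proof -
    obtain w where cw: "continuous_on {0..} w" and cu: "continuous_on {0..} u"
      and L2: "\<And>t. t \<ge> 0 \<Longrightarrow> L2_on {0..1} (x t)"
      and y: "\<And>t. t \<ge> 0 \<Longrightarrow> y t = C *v w t + D *v u t"
      and weak: "weak_identity u x w"
      by (rule classical_solution_weak[OF sol]) (rule that)
    have cu': "continuous_on {0..T} u" and cw': "continuous_on {0..T} w"
      using cu cw by (auto intro: continuous_on_subset)
    have "continuous_on {0..T} (\<lambda>t. C *v w t + D *v u t)"
      by (intro continuous_on_add bounded_linear.continuous_on[OF bounded_linear_matrix_vector_mult] cw' cu')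
    then have cy: "continuous_on {0..T} y"
      by (rule continuous_on_eq) (simp add: y)
    have L2y: "L2_on {0..T} y" and L2u: "L2_on {0..T} u" and L2\<eta>: "L2_on {0..T} \<eta>" and L2\<psi>: "L2_on {0..T} (\<psi> 0)"
      and L2Du: "L2_on {0..T} (\<lambda>s. D *v u s)" and L2Bu: "L2_on {0..T} (\<lambda>s. B *v u s)"
      by (intro continuous_imp_L2_on cy cu' c\<eta> c\<psi> bounded_linear.continuous_on[OF bounded_linear_matrix_vector_mult cu'])+
    note i = L2_inner_integrable[OF L2\<eta> L2y] L2_inner_integrable[OF L2\<eta> L2Du] L2_inner_integrable[OF L2\<psi> L2Bu]
    let ?I = "(LINT s|lebesgue_on {0..T}. \<eta> s \<bullet> (D *v u s)) + (LINT s|lebesgue_on {0..T}. \<psi> 0 s \<bullet> (B *v u s)) - (LINT s|lebesgue_on {0..T}. \<eta> s \<bullet> y s)"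
    have "((\<lambda>s. \<eta> s \<bullet> (D *v u s) + \<psi> 0 s \<bullet> (B *v u s) - \<eta> s \<bullet> y s) has_integral
        (LINT s|lebesgue_on {0..T}. \<eta> s \<bullet> (D *v u s) + \<psi> 0 s \<bullet> (B *v u s) - \<eta> s \<bullet> y s)) {0..T}"
      using i by (intro has_integral_integral_lebesgue_on) auto
    then have "((\<lambda>s. \<eta> s \<bullet> (D *v u s) + \<psi> 0 s \<bullet> (B *v u s) - \<eta> s \<bullet> y s) has_integral ?I) {0..T}"
      using i by simp
    moreover have "((\<lambda>s. \<eta> s \<bullet> (D *v u s) + \<psi> 0 s \<bullet> (B *v u s) - \<eta> s \<bullet> y s) has_integral
        (pairing (\<lambda>\<xi>. \<psi> 0 (T - tau \<xi>)) (x T) - pairing (\<lambda>\<xi>. \<psi> 0 (0 - tau \<xi>)) (x 0))) {0..T}"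
    proof (rule has_integral_eq[OF _ weak_identityD[OF weak d c\<psi> T]])
      fix s assume "s \<in> {0..T}"
      then have s: "s \<ge> 0" by simp
      show "\<psi> 0 s \<bullet> (A *v w s + B *v u s) - \<psi> 0 (s - period) \<bullet> w s =
          \<eta> s \<bullet> (D *v u s) + \<psi> 0 s \<bullet> (B *v u s) - \<eta> s \<bullet> y s"
        using loop[OF s, of "w s"] by (simp add: y[OF s] inner_add_right)
    qed
    ultimately have "pairing (\<lambda>\<xi>. \<psi> 0 (T - tau \<xi>)) (x T) - pairing (\<lambda>\<xi>. \<psi> 0 (0 - tau \<xi>)) (x 0) = ?I"
      by (rule has_integral_unique[rotated])
    moreover have "pairing (\<lambda>\<xi>. \<psi> 0 (T - tau \<xi>)) (x T) = 0"
    proof -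
      have "pairing (\<lambda>\<xi>. \<psi> 0 (T - tau \<xi>)) (x T) = (LINT (\<xi>::real)|lebesgue_on {0..1}. 0)"
        unfolding pairing_def by (rule Bochner_Integration.integral_cong[OF refl]) (simp add: final)
      then show ?thesis by simp
    qed
    ultimately show ?thesis using L2[of 0] L2u L2y by simp
  qed
  obtain uu xx yy where "classical_approximation l0 P0 E K L Ky Ly x0 (\<lambda>_. 0) x y uu xx yy"
    using mild_solution_approximation[OF m] by blast
  note a = classical_approximationD[OF this]
  note x0lim = a(2) and ulim = a(3) and ylim = a(5)
  note cl = classical[OF a(1)]
  have L2\<eta>: "L2_on {0..T} \<eta>" and L2\<psi>: "L2_on {0..T} (\<psi> 0)" by (intro continuous_imp_L2_on c\<eta> c\<psi>)+
  have zero: "(\<lambda>j. LINT s|lebesgue_on {0..T}. f s \<bullet> (M *v uu j s)) \<longlonglongrightarrow> 0"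
    if f: "L2_on {0..T} f" for f :: "real \<Rightarrow> 'k ^ 'q" and M :: "'k ^ 'm ^ 'q"
  proof -
    obtain c where c: "c \<ge> 0" "\<And>v. norm (M *v v) \<le> c * norm v"
      using bounded_linear.nonneg_bounded[OF bounded_linear_matrix_vector_mult[of M]] by (metis mult.commute)
    have mM: "(\<lambda>s. M *v uu j s) \<in> borel_measurable (lebesgue_on {0..T})" for j
      by (intro measurable_matrix_vector_mult borel_measurable_const L2_on_measurable) (use cl in blast)
    have leM: "AE s in lebesgue_on {0..T}. norm (M *v uu j s) \<le> c * norm (uu j s)" for j
      by (rule AE_I2) (rule c(2))
    have L2u: "L2_on {0..T} (uu j)" for j using cl by blast
    have L2M: "L2_on {0..T} (\<lambda>s. M *v uu j s)" for j by (rule L2_on_bound[OF L2u mM leM c(1)])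
    have "L2_norm_on {0..T} (\<lambda>s. M *v uu j s - 0) \<le> c * L2_norm_on {0..T} (\<lambda>s. uu j s - 0)" for j
      using L2_norm_on_bound[OF L2u mM leM c(1)] by simp
    note le = this
    have "(\<lambda>j. c * L2_norm_on {0..T} (\<lambda>s. uu j s - 0)) \<longlonglongrightarrow> 0"
      using tendsto_mult_right_zero[OF ulim[OF T], of c] .
    from null_sequence_le[OF L2_norm_on_nonneg le this]
    have "(\<lambda>j. L2_norm_on {0..T} (\<lambda>s. M *v uu j s - 0)) \<longlonglongrightarrow> 0" .
    from L2_inner_tendsto[OF f L2M L2_on_zero this] show ?thesis by simp
  qed
  have "(\<lambda>j. (LINT s|lebesgue_on {0..T}. \<eta> s \<bullet> yy j s) - (LINT s|lebesgue_on {0..T}. \<eta> s \<bullet> (D *v uu j s))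
      - (LINT s|lebesgue_on {0..T}. \<psi> 0 s \<bullet> (B *v uu j s))) \<longlonglongrightarrow>
      (LINT s|lebesgue_on {0..T}. \<eta> s \<bullet> y s) - 0 - 0"
  proof (rule tendsto_diff[OF tendsto_diff[OF _ zero[OF L2\<eta>]] zero[OF L2\<psi>]])
    have "\<And>j. L2_on {0..T} (yy j)" using cl by blast
    from L2_inner_tendsto[OF L2\<eta> this mild_solution_L2(3)[OF m T] ylim[OF T]]
    show "(\<lambda>j. LINT s|lebesgue_on {0..T}. \<eta> s \<bullet> yy j s) \<longlonglongrightarrow> (LINT s|lebesgue_on {0..T}. \<eta> s \<bullet> y s)" .
  qed
  then have "(\<lambda>j. pairing (\<lambda>\<xi>. \<psi> 0 (0 - tau \<xi>)) (xx j 0)) \<longlonglongrightarrow> (LINT s|lebesgue_on {0..T}. \<eta> s \<bullet> y s)"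
    using cl by simp
  moreover have "(\<lambda>j. pairing (\<lambda>\<xi>. \<psi> 0 (0 - tau \<xi>)) (xx j 0)) \<longlonglongrightarrow> pairing (\<lambda>\<xi>. \<psi> 0 (0 - tau \<xi>)) x0"
    by (rule pairing_tendsto[OF c\<psi>t _ mild_solution_L2(1)[OF m] x0lim]) (use cl in blast)
  ultimately have "pairing (\<lambda>\<xi>. \<psi> 0 (0 - tau \<xi>)) x0 = (LINT s|lebesgue_on {0..T}. \<eta> s \<bullet> y s)"
    by (rule LIMSEQ_unique[rotated])
  then show ?thesis by (simp add: \<psi>_def \<eta>_def T_def)
qed

text \<open>
  In \<open>observability_identity\<close> the flat profile may approximate the signal \<open>h\<close> of the initial state
  itself. Then the pairing tends to the energy of \<open>h\<close>, while the output integral is at most a multiple of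
  the norm of \<open>h\<close> times the norm of the output. The second estimate, for a pair of solutions,
  holds because the identity is linear; it avoids the question whether differences of
  solutions are solutions.
\<close>

lemma observability_estimate:
  assumes total: "\<And>v. (\<And>i. C *v (matrix_power A i *v v) = 0) \<Longrightarrow> v = 0"
  obtains T c where "T \<ge> 0" "c \<ge> 0"
    "\<And>x0 x y. mild_solution l0 P0 E K L Ky Ly x0 (\<lambda>_. 0) x y \<Longrightarrow>
      L2_norm_on {0..1} x0 \<le> c * L2_norm_on {0..T} y"
    "\<And>x0 x y x0' x' y'. mild_solution l0 P0 E K L Ky Ly x0 (\<lambda>_. 0) x y \<Longrightarrow>
      mild_solution l0 P0 E K L Ky Ly x0' (\<lambda>_. 0) x' y' \<Longrightarrow>
      L2_norm_on {0..1} (\<lambda>\<xi>. x0 \<xi> - x0' \<xi>) \<le> c * L2_norm_on {0..T} (\<lambda>s. y s - y' s)"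
proof -
  let ?M = "lebesgue_on {0..1::real}"
  obtain N and G :: "nat \<Rightarrow> 'k ^ 'n \<Rightarrow> 'k ^ 'n" and H :: "nat \<Rightarrow> 'k ^ 'n \<Rightarrow> 'k ^ 'p"
    where GH: "\<And>k. linear (G k)" "\<And>k. linear (H k)" "\<And>w. G 0 w = w" "\<forall>k w. N \<le> k \<longrightarrow> G k w = 0"
    "\<And>k w v. G (Suc k) w \<bullet> (A *v v) - G k w \<bullet> v = - (H k w \<bullet> (C *v v))"
    by (rule observability_staircase[OF total]) (blast+)
  define T where "T = period * real N"
  have T: "T \<ge> 0" using period_pos by (simp add: T_def)
  obtain c1 where c1: "c1 \<ge> 0" "\<And>h. signal period h \<Longrightarrow> L2_on {0..T} (stair period H h)"
    "\<And>h. signal period h \<Longrightarrow> L2_norm_on {0..T} (stair period H h) \<le> c1 * sqrt (energy h)"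
    by (rule stair_L2[where G=H and T=T, OF period_pos GH(2)]) (rule that)
  obtain c2 where c2: "c2 > 0"
    "\<And>g t. (\<lambda>\<xi>. g (t - tau \<xi>)) \<in> borel_measurable (lebesgue_on {0..1}) \<Longrightarrow>
       profile g t \<in> borel_measurable (lebesgue_on {0..1})"
    "\<And>g t. AE \<xi> in lebesgue_on {0..1}. norm (profile g t \<xi>) \<le> c2 * norm (g (t - tau \<xi>))"
    using profile_L2_bound by blast
  define c where "c = c2 * sqrt (1 / slow_min) * c1"
  have c: "c \<ge> 0" using c1 c2 slow_min_pos by (simp add: c_def)
  have key: "L2_norm_on {0..1} x0 \<le> c * L2_norm_on {0..T} y"
    if x0: "L2_on {0..1} x0" and y: "L2_on {0..T} y"
      and ident: "\<And>D'. flat_jet period D' \<Longrightarrow> pairing (\<lambda>\<xi>. stair period G (D' 0) (period - tau \<xi>)) x0 =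
        (LINT s|lebesgue_on {0..T}. stair period H (D' 0) s \<bullet> y s)" for x0 and y :: "real \<Rightarrow> 'k ^ 'p"
  proof -
    obtain h where h: "signal period h" and hf: "AE \<xi> in ?M. h (period - tau \<xi>) = l0 \<xi> *\<^sub>R (Q \<xi> *v x0 \<xi>)"
      using L2_as_travelling_signal[OF rescaled_state_L2[OF x0]] by blast
    have mh[measurable]: "h \<in> borel_measurable borel" using h by (simp add: signal_def)
    define Y where "Y = L2_norm_on {0..T} y"
    define e where "e = sqrt (energy h)"
    have e: "e \<ge> 0" by (simp add: e_def)
    have Y: "Y \<ge> 0" by (simp add: Y_def L2_norm_on_nonneg)
    (* The substitution s = period - tau \<xi> turns the pairing into an inner product of signals. *)
    have pair: "(LINT s|lebesgue_on {0..period}. D' 0 s \<bullet> h s) \<le> c1 * sqrt (energy (D' 0)) * Y"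
      if D': "flat_jet period D'" for D'
    proof -
      have mD[measurable]: "D' 0 \<in> borel_measurable borel" by (rule flat_jet_measurable[OF D'])
      have mp: "(\<lambda>s. D' 0 s \<bullet> h s) \<in> borel_measurable borel" by measurable
      have cstair: "continuous_on {0..1} (\<lambda>\<xi>. stair period G (D' 0) (period - tau \<xi>))"
        by (intro continuous_on_compose2[OF stair_continuous[where G=G and D=D' and S=UNIV and i=0, OF period_pos GH(1) D']]
            continuous_intros continuous_on_tau) auto
      have "(LINT s|lebesgue_on {0..period}. D' 0 s \<bullet> h s) = (LINT s|lborel. indicator {period - period..period} s *\<^sub>R (D' 0 s \<bullet> h s))"
        by (simp add: integral_restrict_space integral_completion)
      also have "\<dots> = (LINT \<xi>|?M. slowness \<xi> *\<^sub>R (D' 0 (period - tau \<xi>) \<bullet> h (period - tau \<xi>)))"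
        by (rule integral_change_of_variables_reflected[OF mp, symmetric])
      also have "\<dots> = pairing (\<lambda>\<xi>. stair period G (D' 0) (period - tau \<xi>)) x0"
        unfolding pairing_def
      proof (rule integral_cong_AE)
        have [measurable]: "(\<lambda>\<xi>. D' 0 (period - tau \<xi>) \<bullet> h (period - tau \<xi>)) \<in> borel_measurable ?M"
          by (rule measurable_compose[OF _ mp]) measurable
        show "(\<lambda>\<xi>. slowness \<xi> *\<^sub>R (D' 0 (period - tau \<xi>) \<bullet> h (period - tau \<xi>))) \<in> borel_measurable ?M"
          by measurable
        show "(\<lambda>\<xi>. stair period G (D' 0) (period - tau \<xi>) \<bullet> (Q \<xi> *v x0 \<xi>)) \<in> borel_measurable ?M"
          using pairing_integrable[OF cstair x0] by auto
        show "AE \<xi> in ?M. slowness \<xi> *\<^sub>R (D' 0 (period - tau \<xi>) \<bullet> h (period - tau \<xi>)) =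
            stair period G (D' 0) (period - tau \<xi>) \<bullet> (Q \<xi> *v x0 \<xi>)"
          using hf AE_interior l0_slowness
        proof eventually_elim
          case (elim \<xi>)
          have "stair period G (D' 0) (period - tau \<xi>) = D' 0 (period - tau \<xi>)"
            using stair_interior[OF elim(2), of G "D' 0" 0] by (simp add: GH(3))
          moreover have "slowness \<xi> *\<^sub>R h (period - tau \<xi>) = Q \<xi> *v x0 \<xi>"
            using elim(1,3) by (simp add: mult.commute)
          ultimately show ?case by (metis inner_scaleR_right real_scaleR_def)
        qed
      qed
      also have "\<dots> = (LINT s|lebesgue_on {0..T}. stair period H (D' 0) s \<bullet> y s)" by (rule ident[OF D'])
      also have "\<dots> \<le> L2_norm_on {0..T} (stair period H (D' 0)) * Y"
        using L2_Cauchy_Schwarz[OF c1(2)[OF flat_jet_signal[OF D']] y, of 0] unfolding Y_def by linarith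
      also have "\<dots> \<le> c1 * sqrt (energy (D' 0)) * Y"
        by (intro mult_right_mono c1(3) flat_jet_signal[OF D'] Y)
      finally show ?thesis .
    qed
    (* A flat profile within the distance \<delta> of h; the errors are linear in \<delta>. *)
    have approx: "e\<^sup>2 \<le> c1 * (e + \<delta>) * Y + \<delta> * e" if \<delta>: "\<delta> > 0" for \<delta>
    proof -
      obtain D' where D': "flat_jet period D'" and close: "energy (\<lambda>t. D' 0 t - h t) < \<delta>\<^sup>2"
        using flat_jets_dense[OF h period_pos, of "\<delta>\<^sup>2"] \<delta> by auto
      have sD: "signal period (D' 0)" and sd: "signal period (\<lambda>t. D' 0 t - h t)"
        using flat_jet_signal[OF D'] signal_diff[OF flat_jet_signal[OF D'] h] by auto
      have nd: "L2_norm_on {0..period} (\<lambda>t. D' 0 t - h t) \<le> \<delta>"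
        using close \<delta> L2_norm_on_signal[OF sd] by (simp add: real_le_lsqrt)
      have nh: "L2_norm_on {0..period} h = e" by (simp add: L2_norm_on_signal[OF h] e_def)
      have "sqrt (energy (D' 0)) = L2_norm_on {0..period} (\<lambda>t. (D' 0 t - h t) + h t)"
        by (simp add: L2_norm_on_signal[OF sD])
      also have "\<dots> \<le> \<delta> + e"
        using L2_norm_on_triangle[OF signal_L2_on[OF sd] signal_L2_on[OF h]] nd nh by linarith
      finally have nD: "sqrt (energy (D' 0)) \<le> e + \<delta>" by simp
      have "e\<^sup>2 = (LINT s|lebesgue_on {0..period}. h s \<bullet> h s)"
        using nh L2_norm_on_power2[of "{0..period}" h] by (simp add: power2_norm_eq_inner)
      also have "\<dots> = (LINT s|lebesgue_on {0..period}. D' 0 s \<bullet> h s) - (LINT s|lebesgue_on {0..period}. (D' 0 s - h s) \<bullet> h s)"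
        using L2_inner_integrable[OF signal_L2_on[OF sD] signal_L2_on[OF h]] L2_inner_integrable[OF signal_L2_on[OF h] signal_L2_on[OF h]]
        by (simp add: inner_diff_left)
      also have "\<dots> \<le> c1 * sqrt (energy (D' 0)) * Y + \<delta> * e"
      proof -
        have "\<bar>LINT s|lebesgue_on {0..period}. (D' 0 s - h s) \<bullet> h s\<bar> \<le> \<delta> * e"
          using L2_Cauchy_Schwarz[OF signal_L2_on[OF sd] signal_L2_on[OF h]] mult_right_mono[OF nd e] nh by simp
        then show ?thesis using pair[OF D'] by linarith
      qed
      also have "\<dots> \<le> c1 * (e + \<delta>) * Y + \<delta> * e"
        by (rule add_right_mono, rule mult_right_mono[OF mult_left_mono[OF nD c1(1)] Y])
      finally show ?thesis .
    qed
    have "((\<lambda>\<delta>. c1 * (e + \<delta>) * Y + \<delta> * e) \<longlongrightarrow> c1 * (e + 0) * Y + 0 * e) (at_right 0)"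
      by (intro tendsto_intros)
    then have "e\<^sup>2 \<le> c1 * (e + 0) * Y + 0 * e"
      by (rule tendsto_lowerbound) (use approx in \<open>auto simp: eventually_at_right_less intro!: eventually_at_rightI[of 0 1]\<close>)
    then have "e * e \<le> e * (c1 * Y)" by (simp add: power2_eq_square mult_ac)
    then have eY: "e \<le> c1 * Y" using e c1(1) Y by (cases "e = 0") auto
    have i: "integrable lborel (\<lambda>s. indicator {period - period..period} s *\<^sub>R (norm (h s))\<^sup>2)"
      using signal_L2_on[OF h] by (simp add: L2_on_borel_iff[OF mh])
    have en: "(LINT s|lborel. indicator {period - period..period} s *\<^sub>R (norm (h s))\<^sup>2) = e\<^sup>2"
      using L2_norm_on_borel[OF mh, of 0 period] L2_norm_on_signal[OF h] by (simp add: e_def)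
    have L2h: "L2_on {0..1} (\<lambda>\<xi>. h (period - tau \<xi>))" by (rule L2_on_travelling[OF mh i])
    have "(L2_norm_on {0..1} (\<lambda>\<xi>. h (period - tau \<xi>)))\<^sup>2 \<le> (1 / slow_min) * e\<^sup>2"
      using L2_norm_on_travelling[OF mh i] en by simp
    then have "L2_norm_on {0..1} (\<lambda>\<xi>. h (period - tau \<xi>)) \<le> sqrt ((1 / slow_min) * e\<^sup>2)"
      by (rule real_le_rsqrt)
    also have "\<dots> = sqrt (1 / slow_min) * e" unfolding real_sqrt_mult using e by simp
    finally have nh: "L2_norm_on {0..1} (\<lambda>\<xi>. h (period - tau \<xi>)) \<le> sqrt (1 / slow_min) * e" .
    have "L2_norm_on {0..1} x0 \<le> c2 * L2_norm_on {0..1} (\<lambda>\<xi>. h (period - tau \<xi>))"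
    proof (rule L2_norm_on_bound[OF L2h L2_on_measurable[OF x0]])
      show "AE \<xi> in ?M. norm (x0 \<xi>) \<le> c2 * norm (h (period - tau \<xi>))"
        using hf c2(3)[of h period] AE_interior l0_slowness
      proof eventually_elim
        case (elim \<xi>)
        have "profile h period \<xi> = x0 \<xi>"
          unfolding profile_def elim(1) by (rule profile_of_rescaled[OF elim(3,4)])
        then show ?case using elim(2) by simp
      qed
    qed (use c2 in simp)
    also have "\<dots> \<le> c2 * (sqrt (1 / slow_min) * (c1 * Y))"
    proof (rule mult_left_mono)
      have "sqrt (1 / slow_min) * e \<le> sqrt (1 / slow_min) * (c1 * Y)"
        using slow_min_pos by (intro mult_left_mono[OF eY]) simp
      with nh show "L2_norm_on {0..1} (\<lambda>\<xi>. h (period - tau \<xi>)) \<le> sqrt (1 / slow_min) * (c1 * Y)"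
        by (rule order_trans)
    qed (use c2(1) in simp)
    finally show ?thesis by (simp add: c_def Y_def mult_ac)
  qed
  have ident: "pairing (\<lambda>\<xi>. stair period G (D' 0) (period - tau \<xi>)) x0 =
      (LINT s|lebesgue_on {0..T}. stair period H (D' 0) s \<bullet> y s)"
    if "mild_solution l0 P0 E K L Ky Ly x0 (\<lambda>_. 0) x y" "flat_jet period D'" for x0 x y D'
    unfolding T_def by (rule observability_identity[where G=G and H=H, OF GH that(2,1)])
  show ?thesis
  proof (rule that[OF T c])
    fix x0 x y assume m: "mild_solution l0 P0 E K L Ky Ly x0 (\<lambda>_. 0) x y"
    show "L2_norm_on {0..1} x0 \<le> c * L2_norm_on {0..T} y"
      by (rule key[OF mild_solution_L2(1)[OF m] mild_solution_L2(3)[OF m T]]) (rule ident[OF m])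
  next
    fix x0 x y x0' x' y'
    assume m: "mild_solution l0 P0 E K L Ky Ly x0 (\<lambda>_. 0) x y" and m': "mild_solution l0 P0 E K L Ky Ly x0' (\<lambda>_. 0) x' y'"
    note L = mild_solution_L2(1)[OF m] mild_solution_L2(1)[OF m'] mild_solution_L2(3)[OF m T] mild_solution_L2(3)[OF m' T]
    show "L2_norm_on {0..1} (\<lambda>\<xi>. x0 \<xi> - x0' \<xi>) \<le> c * L2_norm_on {0..T} (\<lambda>s. y s - y' s)"
    proof (rule key[OF L2_on_diff[OF L(1,2)] L2_on_diff[OF L(3,4)]])
      fix D' :: "nat \<Rightarrow> real \<Rightarrow> 'k ^ 'n" assume D': "flat_jet period D'"
      have cstair: "continuous_on {0..1} (\<lambda>\<xi>. stair period G (D' 0) (period - tau \<xi>))"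
        by (intro continuous_on_compose2[OF stair_continuous[where G=G and D=D' and S=UNIV and i=0, OF period_pos GH(1) D']]
            continuous_intros continuous_on_tau) auto
      note s = c1(2)[OF flat_jet_signal[OF D']]
      show "pairing (\<lambda>\<xi>. stair period G (D' 0) (period - tau \<xi>)) (\<lambda>\<xi>. x0 \<xi> - x0' \<xi>) =
        (LINT s|lebesgue_on {0..T}. stair period H (D' 0) s \<bullet> (y s - y' s))"
        using L2_inner_integrable[OF s L(3)] L2_inner_integrable[OF s L(4)]
        by (simp add: pairing_diff_right[OF cstair L(1,2)] ident[OF m D'] ident[OF m' D'] inner_diff_right)
    qed
  qed
qed

theorem exactly_observable_if:
  assumes total: "\<And>v. (\<And>i. C *v (matrix_power A i *v v) = 0) \<Longrightarrow> v = 0"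
  shows "exactly_observable l0 P0 E K L Ky Ly" "approximately_observable l0 P0 E K L Ky Ly"
proof -
  obtain T c where T: "T \<ge> 0" and c: "c \<ge> 0"
    and est: "\<And>x0 x y. mild_solution l0 P0 E K L Ky Ly x0 (\<lambda>_. 0) x y \<Longrightarrow>
      L2_norm_on {0..1} x0 \<le> c * L2_norm_on {0..T} y"
    and diff: "\<And>x0 x y x0' x' y'. mild_solution l0 P0 E K L Ky Ly x0 (\<lambda>_. 0) x y \<Longrightarrow>
      mild_solution l0 P0 E K L Ky Ly x0' (\<lambda>_. 0) x' y' \<Longrightarrow>
      L2_norm_on {0..1} (\<lambda>\<xi>. x0 \<xi> - x0' \<xi>) \<le> c * L2_norm_on {0..T} (\<lambda>s. y s - y' s)"
    by (rule observability_estimate[OF total]) (blast+)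
  show "exactly_observable l0 P0 E K L Ky Ly"
    unfolding exactly_observable_def
  (* The constant c may be zero, c + 1 is not. *)
  proof (rule exI[of _ T], intro conjI T, rule exI[of _ "1 / (c + 1)\<^sup>2"], intro conjI allI impI)
    show "0 < 1 / (c + 1)\<^sup>2" using c by simp
    fix x0 x y assume m: "mild_solution l0 P0 E K L Ky Ly x0 (\<lambda>_. 0) x y"
    have "L2_norm_on {0..1} x0 \<le> (c + 1) * L2_norm_on {0..T} y"
      using est[OF m] L2_norm_on_nonneg[of "{0..T}" y] by (simp add: distrib_right)
    then have "(L2_norm_on {0..1} x0)\<^sup>2 \<le> ((c + 1) * L2_norm_on {0..T} y)\<^sup>2"
      by (rule power_mono) (rule L2_norm_on_nonneg)
    then have "(L2_norm_on {0..1} x0)\<^sup>2 \<le> (c + 1)\<^sup>2 * (L2_norm_on {0..T} y)\<^sup>2" by (simp add: power_mult_distrib)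
    then have "1 / (c + 1)\<^sup>2 * (L2_norm_on {0..1} x0)\<^sup>2 \<le> (L2_norm_on {0..T} y)\<^sup>2"
      using c by (simp add: divide_le_eq mult.commute)
    then show "1 / (c + 1)\<^sup>2 * (L2_norm_on {0..1} x0)\<^sup>2 \<le> (LINT s|lebesgue_on {0..T}. (norm (y s))\<^sup>2)"
      by (simp add: L2_norm_on_power2)
  qed
  show "approximately_observable l0 P0 E K L Ky Ly"
    unfolding approximately_observable_def
  proof (intro exI[of _ T] conjI T allI impI)
    fix x0 x y x0' x' y'
    assume m: "mild_solution l0 P0 E K L Ky Ly x0 (\<lambda>_. 0) x y" and m': "mild_solution l0 P0 E K L Ky Ly x0' (\<lambda>_. 0) x' y'"
      and ae: "AE s in lebesgue_on {0..T}. y s = y' s"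
    note L = mild_solution_L2(1)[OF m] mild_solution_L2(1)[OF m'] mild_solution_L2(3)[OF m T] mild_solution_L2(3)[OF m' T]
    have "L2_norm_on {0..T} (\<lambda>s. y s - y' s) = L2_norm_on {0..T} (\<lambda>_. 0 :: 'k ^ 'p)"
      by (rule L2_norm_on_cong_AE[OF L2_on_measurable[OF L2_on_diff[OF L(3,4)]]]) (use ae in auto)
    then have "L2_norm_on {0..1} (\<lambda>\<xi>. x0 \<xi> - x0' \<xi>) \<le> 0" using diff[OF m m'] by (simp add: L2_norm_on_zero)
    then have "L2_norm_on {0..1} (\<lambda>\<xi>. x0 \<xi> - x0' \<xi>) = 0"
      using L2_norm_on_nonneg[of "{0..1}" "\<lambda>\<xi>. x0 \<xi> - x0' \<xi>"] by linarith
    from L2_norm_on_eq_0[OF L2_on_diff[OF L(1,2)] this]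
    show "AE \<xi> in lebesgue_on {0..1}. x0 \<xi> = x0' \<xi>" by simp
  qed
qed

lemma exactly_controllable_imp_approximately:
  assumes "exactly_controllable l0 P0 E K L Ky Ly"
  shows "approximately_controllable l0 P0 E K L Ky Ly"
proof -
  obtain t where t: "t \<ge> 0" and ex: "\<And>x0 x1. L2_on {0..1} x0 \<Longrightarrow> L2_on {0..1} x1 \<Longrightarrow>
       (\<exists>u. L2_on {0..t} u \<and> (\<exists>x y. mild_solution l0 P0 E K L Ky Ly x0 (zero_ext t u) x y \<and>
            (AE \<xi> in lebesgue_on {0..1}. x t \<xi> = x1 \<xi>)))"
    using assms unfolding exactly_controllable_def by blast
  show ?thesis
    unfolding approximately_controllable_def
  proof (intro exI[of _ t] conjI t allI impI)
    fix x0 x1 :: "real \<Rightarrow> 'k ^ 'n" and \<epsilon> :: real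
    assume x0: "L2_on {0..1} x0" and x1: "L2_on {0..1} x1" and \<epsilon>: "\<epsilon> > 0"
    obtain u x y where u: "L2_on {0..t} u" and m: "mild_solution l0 P0 E K L Ky Ly x0 (zero_ext t u) x y"
      and ae: "AE \<xi> in lebesgue_on {0..1}. x t \<xi> = x1 \<xi>"
      using ex[OF x0 x1] by blast
    have "L2_norm_on {0..1} (\<lambda>\<xi>. x t \<xi> - x1 \<xi>) = L2_norm_on {0..1} (\<lambda>_. 0 :: 'k ^ 'n)"
      by (rule L2_norm_on_cong_AE[OF L2_on_measurable[OF L2_on_diff[OF mild_solution_L2(2)[OF m t] x1]]]) (use ae in auto)
    then have "L2_norm_on {0..1} (\<lambda>\<xi>. x t \<xi> - x1 \<xi>) < \<epsilon>" using \<epsilon> by (simp add: L2_norm_on_zero)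
    then show "\<exists>u. L2_on {0..t} u \<and> (\<exists>x y. mild_solution l0 P0 E K L Ky Ly x0 (zero_ext t u) x y \<and>
        L2_norm_on {0..1} (\<lambda>\<xi>. x t \<xi> - x1 \<xi>) < \<epsilon>)" using u m by blast
  qed
qed

lemma exactly_observable_imp:
  assumes obs: "exactly_observable l0 P0 E K L Ky Ly"
    and v: "\<And>i. C *v (matrix_power A i *v v) = 0"
  shows "v = 0"
proof (rule ccontr)
  assume "v \<noteq> 0"
  then obtain x0 x x0' x' where m: "mild_solution l0 P0 E K L Ky Ly x0 (\<lambda>_. 0) x (\<lambda>_. 0)"
    "mild_solution l0 P0 E K L Ky Ly x0' (\<lambda>_. 0) x' (\<lambda>_. 0)"
    and ne: "\<not> (AE \<xi> in lebesgue_on {0..1}. x0 \<xi> = x0' \<xi>)"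
    by (rule unobservable_solutions[OF _ v])
  obtain t c where c: "c > 0" and est: "\<forall>x0 x y. mild_solution l0 P0 E K L Ky Ly x0 (\<lambda>_. 0) x y \<longrightarrow>
       (LINT s|lebesgue_on {0..t}. (norm (y s))\<^sup>2) \<ge> c * (L2_norm_on {0..1} x0)\<^sup>2"
    using obs unfolding exactly_observable_def by (elim exE conjE)
  (* Zero output forces a zero initial state, for both solutions. *)
  have "AE \<xi> in lebesgue_on {0..1}. x \<xi> = 0"
    if "mild_solution l0 P0 E K L Ky Ly x (\<lambda>_. 0) x' (\<lambda>_. 0)" for x x'
  proof (rule L2_norm_on_eq_0[OF mild_solution_L2(1)[OF that]])
    have "c * (L2_norm_on {0..1} x)\<^sup>2 \<le> 0" using est[rule_format, OF that] by simp
    then show "L2_norm_on {0..1} x = 0" using c by (simp add: mult_le_0_iff)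
  qed
  from this[OF m(1)] this[OF m(2)] have "AE \<xi> in lebesgue_on {0..1}. x0 \<xi> = x0' \<xi>"
    by eventually_elim simp
  then show False using ne by simp
qed

end

section \<open>The equivalences\<close>

text \<open>
  The analytic results are expressed by the kernel conditions \<open>controllability_rank_iff_inner\<close> and
  \<open>observability_rank_iff\<close>; what remains between the rank conditions is linear algebra.
\<close>

theorem theorem6p4:
  fixes l0 :: "real \<Rightarrow> real"
    and P0 P :: "real \<Rightarrow> 'k::real_or_complex ^ 'n::{finite,linorder} ^ 'n::{finite,linorder}"
    and E B :: "'k ^ 'm::{finite,linorder} ^ 'n::{finite,linorder}"
    and K L A :: "'k ^ 'n::{finite,linorder} ^ 'n::{finite,linorder}"
    and Ky Ly C :: "'k ^ 'n::{finite,linorder} ^ 'p::finite"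
    and D :: "'k ^ 'm::{finite,linorder} ^ 'p::finite"
  assumes "CARD('m) \<le> CARD('n)"
    and "Linf_on {0..1} l0" and "Linf_on {0..1} (\<lambda>\<xi>. inverse (l0 \<xi>))"
    and "AE \<xi> in lebesgue_on {0..1}. 0 < l0 \<xi>"
    and "Linf_on {0..1} P0"
    and "invertible K"
    and "E = zero_over_id"
    and "caratheodory_solution P0 P"
    and "A = - (matrix_inv K ** L ** P 1)"
    and "B = - (matrix_inv K ** E)"
    and "C = (Ky ** matrix_inv K ** L - Ly) ** P 1"
    and "D = Ky ** matrix_inv K ** E"
  shows
    "(exactly_controllable l0 P0 E K L Ky Ly \<longleftrightarrow>
        approximately_controllable l0 P0 E K L Ky Ly) \<and>
     (approximately_controllable l0 P0 E K L Ky Ly \<longleftrightarrow>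
        rank (controllability_matrix A B) = CARD('n)) \<and>
     (rank (controllability_matrix A B) = CARD('n) \<longleftrightarrow>
        (\<forall>\<mu>::complex. rank (beside (mat \<mu> - complexify A) (complexify B)) = CARD('n))) \<and>
     ((\<forall>\<mu>::complex. rank (beside (mat \<mu> - complexify A) (complexify B)) = CARD('n)) \<longleftrightarrow>
        (\<forall>\<mu>\<in>eigenvalues (complexify A).
           rank (beside (mat \<mu> - complexify A) (complexify B)) = CARD('n))) \<and>
     (exactly_observable l0 P0 E K L Ky Ly \<longleftrightarrow>
        approximately_observable l0 P0 E K L Ky Ly) \<and>
     (approximately_observable l0 P0 E K L Ky Ly \<longleftrightarrow>
        rank (observability_matrix A C) = CARD('n)) \<and>
     (rank (observability_matrix A C) = CARD('n) \<longleftrightarrow>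
        (\<forall>\<mu>::complex. rank (stacked (mat \<mu> - complexify A) (complexify C)) = CARD('n))) \<and>
     ((\<forall>\<mu>::complex. rank (stacked (mat \<mu> - complexify A) (complexify C)) = CARD('n)) \<longleftrightarrow>
        (\<forall>\<mu>\<in>eigenvalues (complexify A).
           rank (stacked (mat \<mu> - complexify A) (complexify C)) = CARD('n)))"
proof -
  interpret transport_system l0 P0 P E B K L A Ky Ly C D
    by unfold_locales (use assms in auto)
  note ctr_rank = controllability_rank_iff_inner[of A B] and obs_rank = observability_rank_iff[of A C]
  have ctr2: "approximately_controllable l0 P0 E K L Ky Ly \<Longrightarrow> rank (controllability_matrix A B) = CARD('n)"
    unfolding ctr_rank using approximately_controllable_imp by blast
  have ctr3: "rank (controllability_matrix A B) = CARD('n) \<Longrightarrow> exactly_controllable l0 P0 E K L Ky Ly"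
    unfolding ctr_rank by (rule exactly_controllable_if) blast
  have obs2: "approximately_observable l0 P0 E K L Ky Ly \<Longrightarrow> rank (observability_matrix A C) = CARD('n)"
    unfolding obs_rank using approximately_observable_imp by blast
  have obs1: "exactly_observable l0 P0 E K L Ky Ly \<Longrightarrow> rank (observability_matrix A C) = CARD('n)"
    unfolding obs_rank using exactly_observable_imp by blast
  have obs3: "rank (observability_matrix A C) = CARD('n) \<Longrightarrow> exactly_observable l0 P0 E K L Ky Ly \<and> approximately_observable l0 P0 E K L Ky Ly"
    unfolding obs_rank using exactly_observable_if by blast
  show ?thesis
    using exactly_controllable_imp_approximately ctr2 ctr3 obs2 obs1 obs3 controllability_rank_tests[of A B]
      observability_rank_tests[of A C] Hautus_observability(2)[of "complexify A" "complexify C"]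
    by blast
qed

end
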